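(* Let $q\ge3$ be odd, $\ell=2\cos(\pi/q)$, and let $s\in\mathbb{C}\setminus\{\tfrac12\}$ with $\operatorname{Re}s>0$. Then, for each choice of sign, the spaces $\mathrm{SEF}_s^{\omega,\mathrm{as},\pm}$ and $\mathrm{FEF}_s^\pm$ are isomorphic as vector spaces. The isomorphism is given by $$\mathrm{FEF}_s^\pm\to\mathrm{SEF}_s^{\omega,\mathrm{as},\pm},\quad f=(f_0,f_{-1})^\top\mapsto\varphi,$$ where $$\varphi|_{D_0}:=f_0|_{D_0}\quad\text{and}\quad\varphi|_{D_{-1}}:=\big(1+\mathcal{L}_{-1,s}^{\mathrm{fast}}\big)f_{-1}|_{D_{-1}}.$$ The inverse isomorphism is $\mathrm{SEF}_s^{\omega,\mathrm{as},\pm}\to\mathrm{FEF}_s^\pm$, $\varphi\mapsto f=(f_0,f_{-1})^\top$, where $f$ is determined by $$f_0|_{D_0}:=\varphi|_{D_0}\quad\text{and}\quad f_{-1}|_{D_{-1}}:=\big(1-\alpha_s(g_{-1})\big)\varphi|_{D_{-1}}.$$ These isomorphisms induce isomorphisms between $\mathrm{SEF}_s^{\omega,\mathrm{dec},\pm}$ and $\mathrm{FEF}_s^{\mathrm{dec},\pm}$.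
   Context: **Group elements.** $q\ge3$ odd, $\ell=2\cos(\pi/q)$, $m=\frac{q-1}2$; $S=\begin{bmatrix}0&1\\-1&0\end{bmatrix}$, $T=\begin{bmatrix}1&\ell\\0&1\end{bmatrix}$, $Q=\begin{bmatrix}0&1\\1&0\end{bmatrix}$, $J=\begin{bmatrix}-1&0\\0&1\end{bmatrix}$ in $\mathrm{PGL}_2(\mathbb{R})$; $\Gamma=\langle S,T\rangle$, $\widetilde\Gamma=\langle\Gamma,Q\rangle$. $V$ is a finite-dimensional complex inner product space, $\chi\colon\widetilde\Gamma\to\mathrm U(V)$ a fixed unitary representation. With $\mathrm s(k)=\sin(k\pi/q)/\sin(\pi/q)$ put $g_k=((TS)^kS)^{-1}$, so $g_k^{-1}=\begin{bmatrix}\mathrm s(k)&\mathrm s(k+1)\\\mathrm s(k-1)&\mathrm s(k)\end{bmatrix}$; in particular $g_{-1}^{-1}=\begin{bmatrix}1&0\\\ell&1\end{bmatrix}$. Elements act on $P^1(\mathbb{C})$ by $\begin{bmatrix}a&b\\c&d\end{bmatrix}.z=\frac{az+b}{cz+d}$. **Action.** For $g=\begin{bmatrix}a&b\\c&d\end{bmatrix}\in\widetilde\Gamma$ and $V$-valued $f$: $\alpha_s(g^{-1})f(x)=|g'(x)|^s\chi(g^{-1})f(g.x)$ for real $x$, with $|g'(x)|=|ad-bc|(cx+d)^{-2}$. With the representative chosen so that $c\ge0$ ($d>0$ if $c=0$), it is extended to complex $z$ by replacing $|g'(x)|^s$ either by $(|ad-bc|(cz+d)^{-2})^s$ on $\{\operatorname{Re}z>-d/c\}$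 or by $|ad-bc|^s(cz+d)^{-2s}$ on $\mathbb{C}\setminus(-\infty,-d/c]$ (principal branches; they agree where both are defined; the result does not depend on the choice). Products $\alpha_s(Q)\alpha_s(h)$ are read as $\alpha_s(Qh)$. **Slow operators.** $\mathcal{L}_s^{\mathrm{slow},\pm}=\sum_{k=1}^m\big(\alpha_s(g_{-k})\pm\alpha_s(Qg_{-k})\big)$, acting on the space $C^\omega((0,1);V)$ of real-analytic functions; $\mathrm{SEF}_s^{\omega,\pm}=\{\varphi\in C^\omega((0,1);V):\varphi=\mathcal{L}_s^{\mathrm{slow},\pm}\varphi\}$. An open set $\mathcal U\subseteq\mathbb{C}$ containing $(0,1)$ is rounded at $0$ if $B_\varepsilon(\varepsilon)\subseteq\mathcal U$ for some $\varepsilon>0$ ($B_r(z)$ the open disc). $\mathrm{SEF}_s^{\omega,\mathrm{hol},\pm}$: those $\varphi\in\mathrm{SEF}_s^{\omega,\pm}$ having a holomorphic extension $\widetilde\varphi$ to some complex neighborhood $\mathcal U$ of $(0,1)$ rounded at $0$ with $\widetilde\varphi=\sum_{k=1}^m(\alpha_s(g_{-k})\pm\alpha_s(Qg_{-k}))\widetilde\varphi$ on $\mathcal U$. $\mathrm{SEF}_s^{\omega,\mathrm{as},\pm}$: those $\varphi\in\mathrm{SEF}_s^{\omega,\mathrm{hol},\pm}$ for which there is $c\in V$ with $\varphi(x)=\frac cx+O(1)$ as $x\to0^+$. $\mathrm{SEF}_s^{\omega,\mathrm{dec},\pm}$: those $\varphi\in\mathrm{SEF}_s^{\omega,\pm}$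 for which the map equal to $\varphi$ on $(0,\frac1\ell)$ and to $\mp\alpha_s(J)\varphi$ (that is, $x\mapsto\mp\chi(J)\varphi(-x)$) on $(-\frac1\ell,0)$ extends to a $C^\infty$ function on $(-\frac1\ell,\frac1\ell)$. **Fast operators.** $D_{-1}=(0,\frac1\ell)$, $D_0=(\frac1\ell,1)$; $\mathcal{L}_{0,s}^{\mathrm{fast}}=\sum_{k=2}^m\alpha_s(g_{-k})$; $\mathcal{L}_{-1,s}^{\mathrm{fast}}=\sum_{n=1}^\infty\alpha_s(g_{-1}^n)$ for $\operatorname{Re}s>\frac12$, i.e. $\mathcal{L}_{-1,s}^{\mathrm{fast}}f(x)=\sum_{n\ge1}(n\ell x+1)^{-2s}\chi(g_{-1}^n)f\big(\tfrac{x}{n\ell x+1}\big)$, and for other $s$ it denotes the meromorphic continuation in $s$ for fixed $f$ holomorphic near $0$ (poles are simple and contained in $\{\frac12-\frac k2:k\in\mathbb{N}_0\}$). Then $$\mathcal{L}_s^{\mathrm{fast},\pm}=\begin{pmatrix}(1\pm\alpha_s(Q))\mathcal{L}_{0,s}^{\mathrm{fast}}&(1\pm\alpha_s(Q))\mathcal{L}_{-1,s}^{\mathrm{fast}}\\(1\pm\alpha_s(Q))\mathcal{L}_{0,s}^{\mathrm{fast}}&\pm\alpha_s(Q)\mathcal{L}_{-1,s}^{\mathrm{fast}}\end{pmatrix}$$ acts on $\mathcal B=\mathcal B(D_0)\oplus\mathcal B(D_{-1})$. Here one fixes open connected complex neighborhoods $\mathcal E_0\supset\overline{D_0}$, $\mathcal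 E_{-1}\supset\overline{D_{-1}}$ such that whenever $\alpha_s(g)$ occurs in the entry of row $a$ and column $b$ one has $g^{-1}.\overline{\mathcal E_a}\subseteq\mathcal E_b$ ($a,b\in\{0,-1\}$); $\mathcal B(D_j)$ is the space of continuous functions $\overline{\mathcal E_j}\to V$ holomorphic on $\mathcal E_j$. (The results do not depend on this choice.) For $q=3$, $D_0$ is empty, there is no $f_0$-component, and $\mathcal{L}_s^{\mathrm{fast},\pm}=\pm\alpha_s(Q)\mathcal{L}_{-1,s}^{\mathrm{fast}}$. $\mathrm{FEF}_s^\pm=\{f\in\mathcal B:f=\mathcal{L}_s^{\mathrm{fast},\pm}f\}$. $\mathrm{FEF}_s^{\mathrm{dec},\pm}$: those $f=(f_0,f_{-1})^\top\in\mathrm{FEF}_s^\pm$ for which the map equal to $(1+\mathcal{L}_{-1,s}^{\mathrm{fast}})f_{-1}$ for $x>0$ and to $\mp\alpha_s(J)(1+\mathcal{L}_{-1,s}^{\mathrm{fast}})f_{-1}$ for $x<0$, on some punctured neighborhood of $0$ in $\mathbb{R}$, extends smoothly to $0$. *)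

theory Defs
  imports
    "HOL-Complex_Analysis.Complex_Analysis"
    "HOL-Algebra.Generated_Groups"
    "HOL-Library.Function_Algebras"
    "HOL-Library.Landau_Symbols"
begin

definition GL2 :: "(real^2^2) monoid" where
  "GL2 = \<lparr>carrier = {A. invertible A}, mult = (**), one = mat 1\<rparr>"

definition scalars :: "(real^2^2) set" where
  "scalars = {mat c | c. c \<noteq> 0}"

text \<open>Elements of PGL2 are cosets, i.e. sets of matrices that differ by nonzero scalars.\<close>

definition PGL2 :: "(real^2^2) set monoid" where
  "PGL2 = GL2 Mod scalars"

definition pgl :: "real \<Rightarrow> real \<Rightarrow> real \<Rightarrow> real \<Rightarrow> (real^2^2) set" where
  "pgl a b c d = scalars #>\<^bsub>GL2\<^esub> vector [vector [a, b], vector [c, d]]"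

definition ell :: "nat \<Rightarrow> real" where
  "ell q = 2 * cos (pi / real q)"

definition S_elt :: "(real^2^2) set" where "S_elt = pgl 0 1 (-1) 0"
definition T_elt :: "nat \<Rightarrow> (real^2^2) set" where "T_elt q = pgl 1 (ell q) 0 1"
definition Q_elt :: "(real^2^2) set" where "Q_elt = pgl 0 1 1 0"
definition J_elt :: "(real^2^2) set" where "J_elt = pgl (-1) 0 0 1"

definition Gamma :: "nat \<Rightarrow> (real^2^2) set set" where
  "Gamma q = generate PGL2 {S_elt, T_elt q}"

definition Gamma_tilde :: "nat \<Rightarrow> (real^2^2) set monoid" where
  "Gamma_tilde q = PGL2 \<lparr>carrier := generate PGL2 (Gamma q \<union> {Q_elt})\<rparr>"

definition g_elt :: "nat \<Rightarrow> int \<Rightarrow> (real^2^2) set" where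
  "g_elt q k = inv\<^bsub>PGL2\<^esub> (((T_elt q \<otimes>\<^bsub>PGL2\<^esub> S_elt) [^]\<^bsub>PGL2\<^esub> k) \<otimes>\<^bsub>PGL2\<^esub> S_elt)"

definition Qg_elt :: "nat \<Rightarrow> int \<Rightarrow> (real^2^2) set" where
  "Qg_elt q k = Q_elt \<otimes>\<^bsub>PGL2\<^esub> g_elt q k"

definition g_pow :: "nat \<Rightarrow> nat \<Rightarrow> (real^2^2) set" where
  "g_pow q n = g_elt q (-1) [^]\<^bsub>PGL2\<^esub> n"

definition Qg_pow :: "nat \<Rightarrow> nat \<Rightarrow> (real^2^2) set" where
  "Qg_pow q n = Q_elt \<otimes>\<^bsub>PGL2\<^esub> g_pow q n"

definition m_of :: "nat \<Rightarrow> nat" where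
  "m_of q = (q - 1) div 2"

text \<open>
  After the choice of an orthonormal basis, a finite-dimensional complex inner product space is
  \<^typ>\<open>complex^'n\<close> with its standard inner product, and its unitary group is the group of unitary
  matrices. A unitary representation is a homomorphism from \<open>Gamma_tilde q\<close> to this group.
\<close>

definition adjoint_matrix :: "complex^'n^'n \<Rightarrow> complex^'n^'n" where
  "adjoint_matrix U = (\<chi> i j. cnj (U $ j $ i))"

definition unitary_group :: "(complex^'n^'n) monoid" where
  "unitary_group =
     \<lparr>carrier = {U. U ** adjoint_matrix U = mat 1 \<and> adjoint_matrix U ** U = mat 1},
      mult = (**), one = mat 1\<rparr>"

text \<open>
  A representative with nonnegative lower left entry \<open>c\<close>, and positive lower right entry if
  \<open>c = 0\<close>. It is unique up to a positive factor, which does not affect anything below.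
\<close>

definition pgl_rep :: "(real^2^2) set \<Rightarrow> real^2^2" where
  "pgl_rep g = (SOME A. A \<in> g \<and> (A $ 2 $ 1 > 0 \<or> A $ 2 $ 1 = 0 \<and> A $ 2 $ 2 > 0))"

definition denom :: "(real^2^2) set \<Rightarrow> complex \<Rightarrow> complex" where
  "denom g z = of_real (pgl_rep g $ 2 $ 1) * z + of_real (pgl_rep g $ 2 $ 2)"

definition mobius :: "(real^2^2) set \<Rightarrow> complex \<Rightarrow> complex" where
  "mobius g z = (of_real (pgl_rep g $ 1 $ 1) * z + of_real (pgl_rep g $ 1 $ 2)) / denom g z"

definition denom_real :: "(real^2^2) set \<Rightarrow> real \<Rightarrow> real" where
  "denom_real g x = pgl_rep g $ 2 $ 1 * x + pgl_rep g $ 2 $ 2"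

definition mobius_real :: "(real^2^2) set \<Rightarrow> real \<Rightarrow> real" where
  "mobius_real g x = (pgl_rep g $ 1 $ 1 * x + pgl_rep g $ 1 $ 2) / denom_real g x"

text \<open>
  \<open>alpha_real \<rho> s h\<close> and \<open>alpha \<rho> s h\<close> are the operators attached to \<open>h\<close> itself, so the
  fractional linear transformation that enters is that of the inverse of \<open>h\<close>. The first one acts
  on functions of a real variable; the second one on functions of a complex variable, on the plane
  cut along the part of the real line where \<open>denom\<close> of the inverse is nonpositive. On this set its
  automorphy factor is the holomorphic extension of that of the first one.
\<close>

definition alpha_real ::
  "((real^2^2) set \<Rightarrow> complex^'n^'n) \<Rightarrow> complex \<Rightarrow> (real^2^2) set \<Rightarrow>
   (real \<Rightarrow> complex^'n) \<Rightarrow> real \<Rightarrow> complex^'n" where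
  "alpha_real \<rho> s h f x = (let g = inv\<^bsub>PGL2\<^esub> h in
     (of_real (\<bar>det (pgl_rep g)\<bar> / (denom_real g x)\<^sup>2) powr s) *s (\<rho> h *v f (mobius_real g x)))"

definition alpha ::
  "((real^2^2) set \<Rightarrow> complex^'n^'n) \<Rightarrow> complex \<Rightarrow> (real^2^2) set \<Rightarrow>
   (complex \<Rightarrow> complex^'n) \<Rightarrow> complex \<Rightarrow> complex^'n" where
  "alpha \<rho> s h f z = (let g = inv\<^bsub>PGL2\<^esub> h in
     (of_real \<bar>det (pgl_rep g)\<bar> powr s * denom g z powr (- 2 * s)) *s (\<rho> h *v f (mobius g z)))"

text \<open>
  \<open>acts_into h A B\<close>: on \<open>A\<close>, the operator \<open>alpha \<rho> s h\<close> is defined for functions that are given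
  on \<open>B\<close>.
\<close>

definition acts_into :: "(real^2^2) set \<Rightarrow> complex set \<Rightarrow> complex set \<Rightarrow> bool" where
  "acts_into h A B \<longleftrightarrow>
     (\<forall>z\<in>A. denom (inv\<^bsub>PGL2\<^esub> h) z \<notin> \<real>\<^sub>\<le>\<^sub>0 \<and> mobius (inv\<^bsub>PGL2\<^esub> h) z \<in> B)"

definition vholomorphic_on :: "(complex \<Rightarrow> complex^'n) \<Rightarrow> complex set \<Rightarrow> bool" where
  "vholomorphic_on f U \<longleftrightarrow> (\<forall>i. (\<lambda>z. f z $ i) holomorphic_on U)"

definition real_analytic_on :: "(real \<Rightarrow> complex^'n) \<Rightarrow> real set \<Rightarrow> bool" where
  "real_analytic_on f I \<longleftrightarrow>
     (\<forall>x\<in>I. \<exists>a r. r > 0 \<and> (\<forall>y. \<bar>y - x\<bar> < r \<longrightarrow> (\<lambda>n. (y - x) ^ n *\<^sub>R a n) sums f y))"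

definition smooth_on_open :: "(real \<Rightarrow> complex^'n) \<Rightarrow> real set \<Rightarrow> bool" where
  "smooth_on_open f I \<longleftrightarrow>
     (\<exists>D :: nat \<Rightarrow> real \<Rightarrow> complex^'n. (\<forall>x\<in>I. D 0 x = f x) \<and>
        (\<forall>n. \<forall>x\<in>I. (D n has_vector_derivative D (Suc n) x) (at x)))"

text \<open>
  Value at \<open>s\<close> of the meromorphic continuation of \<open>F\<close> from the half plane \<open>Re w > a\<close>. By the
  identity theorem the value does not depend on the half plane to which one continues. A function
  that is \<open>nicely_meromorphic_on\<close> a set has no removable singularities there, and is \<open>0\<close> at poles.
\<close>

definition mero_continuation ::
  "real \<Rightarrow> (complex \<Rightarrow> complex^'n) \<Rightarrow> complex \<Rightarrow> complex^'n" where
  "mero_continuation a F s =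
     (if Re s > a then F s
      else (THE v. \<exists>b G. b < Re s \<and>
              (\<forall>i. (\<lambda>w. G w $ i) nicely_meromorphic_on {w. Re w > b}) \<and>
              (\<forall>w. Re w > a \<longrightarrow> G w = F w) \<and> v = G s))"

text \<open>
  The sign \<open>\<plusminus>\<close> is a parameter \<open>\<sigma>\<close> with value \<open>1\<close> or \<open>-1\<close>. Functions on a set are total
  functions that vanish outside of that set, so that equality is equality on the set.
\<close>

definition C_omega :: "(real \<Rightarrow> complex^'n) set" where
  "C_omega = {\<phi>. real_analytic_on \<phi> {0<..<1} \<and> (\<forall>x. x \<notin> {0<..<1} \<longrightarrow> \<phi> x = 0)}"

definition slow_real ::
  "nat \<Rightarrow> ((real^2^2) set \<Rightarrow> complex^'n^'n) \<Rightarrow> complex \<Rightarrow> complex \<Rightarrow>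
   (real \<Rightarrow> complex^'n) \<Rightarrow> real \<Rightarrow> complex^'n" where
  "slow_real q \<rho> s \<sigma> \<phi> x = (\<Sum>k = 1..m_of q.
     alpha_real \<rho> s (g_elt q (- int k)) \<phi> x + \<sigma> *s alpha_real \<rho> s (Qg_elt q (- int k)) \<phi> x)"

definition slow ::
  "nat \<Rightarrow> ((real^2^2) set \<Rightarrow> complex^'n^'n) \<Rightarrow> complex \<Rightarrow> complex \<Rightarrow>
   (complex \<Rightarrow> complex^'n) \<Rightarrow> complex \<Rightarrow> complex^'n" where
  "slow q \<rho> s \<sigma> \<phi> z = (\<Sum>k = 1..m_of q.
     alpha \<rho> s (g_elt q (- int k)) \<phi> z + \<sigma> *s alpha \<rho> s (Qg_elt q (- int k)) \<phi> z)"

definition SEF ::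
  "nat \<Rightarrow> ((real^2^2) set \<Rightarrow> complex^'n^'n) \<Rightarrow> complex \<Rightarrow> complex \<Rightarrow> (real \<Rightarrow> complex^'n) set" where
  "SEF q \<rho> s \<sigma> = {\<phi> \<in> C_omega. \<forall>x\<in>{0<..<1}. \<phi> x = slow_real q \<rho> s \<sigma> \<phi> x}"

definition rounded_at_0 :: "complex set \<Rightarrow> bool" where
  "rounded_at_0 U \<longleftrightarrow> (\<exists>\<epsilon>>0. ball (of_real \<epsilon>) \<epsilon> \<subseteq> U)"

text \<open>
  The two \<open>acts_into\<close> conditions say that the right-hand side of the functional equation makes
  sense at every point of \<open>U\<close>.
\<close>

definition SEF_hol ::
  "nat \<Rightarrow> ((real^2^2) set \<Rightarrow> complex^'n^'n) \<Rightarrow> complex \<Rightarrow> complex \<Rightarrow> (real \<Rightarrow> complex^'n) set" where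
  "SEF_hol q \<rho> s \<sigma> = {\<phi> \<in> SEF q \<rho> s \<sigma>.
     \<exists>U \<psi>. open U \<and> of_real ` {0<..<1} \<subseteq> U \<and> rounded_at_0 U \<and>
       (\<forall>k\<in>{1..m_of q}. acts_into (g_elt q (- int k)) U U \<and> acts_into (Qg_elt q (- int k)) U U) \<and>
       vholomorphic_on \<psi> U \<and> (\<forall>x\<in>{0<..<1}. \<psi> (of_real x) = \<phi> x) \<and>
       (\<forall>z\<in>U. \<psi> z = slow q \<rho> s \<sigma> \<psi> z)}"

definition SEF_as ::
  "nat \<Rightarrow> ((real^2^2) set \<Rightarrow> complex^'n^'n) \<Rightarrow> complex \<Rightarrow> complex \<Rightarrow> (real \<Rightarrow> complex^'n) set" where
  "SEF_as q \<rho> s \<sigma> = {\<phi> \<in> SEF_hol q \<rho> s \<sigma>.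
     \<exists>c. (\<lambda>x. norm (\<phi> x - (1 / x) *\<^sub>R c)) \<in> O[at_right 0](\<lambda>_. 1)}"

definition SEF_dec ::
  "nat \<Rightarrow> ((real^2^2) set \<Rightarrow> complex^'n^'n) \<Rightarrow> complex \<Rightarrow> complex \<Rightarrow> (real \<Rightarrow> complex^'n) set" where
  "SEF_dec q \<rho> s \<sigma> = {\<phi> \<in> SEF q \<rho> s \<sigma>.
     \<exists>F. smooth_on_open F {- (1 / ell q)<..<1 / ell q} \<and>
       (\<forall>x\<in>{0<..<1 / ell q}. F x = \<phi> x) \<and>
       (\<forall>x\<in>{- (1 / ell q)<..<0}. F x = - \<sigma> *s alpha_real \<rho> s J_elt \<phi> x)}"

text \<open>The suffix \<open>m1\<close> stands for the index \<open>-1\<close>.\<close>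

definition D_m1 :: "nat \<Rightarrow> real set" where "D_m1 q = {0<..<1 / ell q}"
definition D_0 :: "nat \<Rightarrow> real set" where "D_0 q = {1 / ell q<..<1}"

definition fast_0 ::
  "nat \<Rightarrow> ((real^2^2) set \<Rightarrow> complex^'n^'n) \<Rightarrow> complex \<Rightarrow>
   (complex \<Rightarrow> complex^'n) \<Rightarrow> complex \<Rightarrow> complex^'n" where
  "fast_0 q \<rho> s f z = (\<Sum>k = 2..m_of q. alpha \<rho> s (g_elt q (- int k)) f z)"

definition Q_fast_0 ::
  "nat \<Rightarrow> ((real^2^2) set \<Rightarrow> complex^'n^'n) \<Rightarrow> complex \<Rightarrow>
   (complex \<Rightarrow> complex^'n) \<Rightarrow> complex \<Rightarrow> complex^'n" where
  "Q_fast_0 q \<rho> s f z = (\<Sum>k = 2..m_of q. alpha \<rho> s (Qg_elt q (- int k)) f z)"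

definition fast_m1 ::
  "nat \<Rightarrow> ((real^2^2) set \<Rightarrow> complex^'n^'n) \<Rightarrow> complex \<Rightarrow>
   (complex \<Rightarrow> complex^'n) \<Rightarrow> complex \<Rightarrow> complex^'n" where
  "fast_m1 q \<rho> s f z =
     mero_continuation (1/2) (\<lambda>w. \<Sum>n. alpha \<rho> w (g_pow q (Suc n)) f z) s"

text \<open>
  The composition of \<open>fast_m1\<close> with the operator of \<open>Q\<close>, where products of operators are read as
  the operator of the product; it is thus also defined at and to the left of \<open>0\<close>.
\<close>

definition Q_fast_m1 ::
  "nat \<Rightarrow> ((real^2^2) set \<Rightarrow> complex^'n^'n) \<Rightarrow> complex \<Rightarrow>
   (complex \<Rightarrow> complex^'n) \<Rightarrow> complex \<Rightarrow> complex^'n" where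
  "Q_fast_m1 q \<rho> s f z =
     mero_continuation (1/2) (\<lambda>w. \<Sum>n. alpha \<rho> w (Qg_pow q (Suc n)) f z) s"

text \<open>
  Admissible pairs of neighborhoods. For \<open>q = 3\<close> the interval \<open>D_0\<close> is empty and there is no
  component with index \<open>0\<close>, which is expressed by \<open>E0 = {}\<close>. The point \<open>0\<close> is kept away from
  \<open>E0\<close> because \<open>fast_m1\<close> occurs in the row with index \<open>0\<close>: its terms are defined outside of
  cuts that accumulate at \<open>0\<close>, and at \<open>0\<close> itself its terms have constant norm.
\<close>

definition fast_nbhds :: "nat \<Rightarrow> complex set \<Rightarrow> complex set \<Rightarrow> bool" where
  "fast_nbhds q E0 Em1 \<longleftrightarrow>
     open E0 \<and> connected E0 \<and> of_real ` closure (D_0 q) \<subseteq> E0 \<and> (q = 3 \<longrightarrow> E0 = {}) \<and>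
     0 \<notin> closure E0 \<and>
     open Em1 \<and> connected Em1 \<and> of_real ` closure (D_m1 q) \<subseteq> Em1 \<and>
     (\<forall>k\<in>{2..m_of q}.
        acts_into (g_elt q (- int k)) (closure E0) E0 \<and>
        acts_into (Qg_elt q (- int k)) (closure E0) E0 \<and>
        acts_into (g_elt q (- int k)) (closure Em1) E0 \<and>
        acts_into (Qg_elt q (- int k)) (closure Em1) E0) \<and>
     (\<forall>n\<ge>1.
        acts_into (g_pow q n) (closure E0) Em1 \<and>
        acts_into (Qg_pow q n) (closure E0) Em1 \<and>
        acts_into (Qg_pow q n) (closure Em1) Em1)"

definition B_space :: "complex set \<Rightarrow> (complex \<Rightarrow> complex^'n) set" where
  "B_space E = {f. continuous_on (closure E) f \<and> vholomorphic_on f E \<and>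
                   (\<forall>z. z \<notin> closure E \<longrightarrow> f z = 0)}"

definition FEF ::
  "nat \<Rightarrow> complex set \<Rightarrow> complex set \<Rightarrow> ((real^2^2) set \<Rightarrow> complex^'n^'n) \<Rightarrow> complex \<Rightarrow> complex \<Rightarrow>
   ((complex \<Rightarrow> complex^'n) \<times> (complex \<Rightarrow> complex^'n)) set" where
  "FEF q E0 Em1 \<rho> s \<sigma> = {(f0, fm1). f0 \<in> B_space E0 \<and> fm1 \<in> B_space Em1 \<and>
     (\<forall>z\<in>closure E0. f0 z =
        (fast_0 q \<rho> s f0 z + \<sigma> *s Q_fast_0 q \<rho> s f0 z) +
        (fast_m1 q \<rho> s fm1 z + \<sigma> *s Q_fast_m1 q \<rho> s fm1 z)) \<and>
     (\<forall>z\<in>closure Em1. fm1 z =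
        (fast_0 q \<rho> s f0 z + \<sigma> *s Q_fast_0 q \<rho> s f0 z) +
        \<sigma> *s Q_fast_m1 q \<rho> s fm1 z)}"

definition FEF_dec ::
  "nat \<Rightarrow> complex set \<Rightarrow> complex set \<Rightarrow> ((real^2^2) set \<Rightarrow> complex^'n^'n) \<Rightarrow> complex \<Rightarrow> complex \<Rightarrow>
   ((complex \<Rightarrow> complex^'n) \<times> (complex \<Rightarrow> complex^'n)) set" where
  "FEF_dec q E0 Em1 \<rho> s \<sigma> = {(f0, fm1) \<in> FEF q E0 Em1 \<rho> s \<sigma>.
     \<exists>F \<epsilon>. \<epsilon> > 0 \<and> smooth_on_open F {-\<epsilon><..<\<epsilon>} \<and>
       (\<forall>x\<in>{0<..<\<epsilon>}. F x = fm1 (of_real x) + fast_m1 q \<rho> s fm1 (of_real x)) \<and>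
       (\<forall>x\<in>{-\<epsilon><..<0}.
          F x = - \<sigma> *s alpha \<rho> s J_elt (\<lambda>z. fm1 z + fast_m1 q \<rho> s fm1 z) (of_real x))}"

definition fun_scale :: "complex \<Rightarrow> ('a \<Rightarrow> complex^'n) \<Rightarrow> 'a \<Rightarrow> complex^'n" where
  "fun_scale c f = (\<lambda>x. c *s f x)"

definition pair_scale ::
  "complex \<Rightarrow> ('a \<Rightarrow> complex^'n) \<times> ('b \<Rightarrow> complex^'n) \<Rightarrow>
   ('a \<Rightarrow> complex^'n) \<times> ('b \<Rightarrow> complex^'n)" where
  "pair_scale c p = (fun_scale c (fst p), fun_scale c (snd p))"

text \<open>
  \<open>\<Phi>\<close> restricts to an isomorphism from the complex vector space \<open>A\<close> to the complex vector space
  \<open>B\<close>, where the scalar multiplications of the ambient spaces are \<open>scA\<close> and \<open>scB\<close>. The ambient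
  additions are the pointwise and the componentwise ones.
\<close>

definition linear_iso_on ::
  "(complex \<Rightarrow> 'a \<Rightarrow> 'a) \<Rightarrow> (complex \<Rightarrow> 'b \<Rightarrow> 'b) \<Rightarrow>
   'a :: ab_group_add set \<Rightarrow> 'b :: ab_group_add set \<Rightarrow> ('a \<Rightarrow> 'b) \<Rightarrow> bool" where
  "linear_iso_on scA scB A B \<Phi> \<longleftrightarrow>
     module.subspace scA A \<and> module.subspace scB B \<and>
     (\<forall>x\<in>A. \<forall>y\<in>A. \<Phi> (x + y) = \<Phi> x + \<Phi> y) \<and>
     (\<forall>c. \<forall>x\<in>A. \<Phi> (scA c x) = scB c (\<Phi> x)) \<and>
     bij_betw \<Phi> A B"

end

theory Submission
  imports Defs "HOL-Real_Asymp.Real_Asymp"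
begin

text \<open>
  In the coordinate \<open>\<xi> = 1 / x\<close> the parabolic element acts as the translation by \<open>\<l> = ell q\<close>, so
  \<open>f\<^sub>-\<^sub>1 = (1 - \<alpha>\<^sub>s(g\<^sub>-\<^sub>1)) \<phi>\<close> is a difference equation along the ray \<open>\<xi> + \<nat> \<l>\<close>. It is solved
  by the sum \<open>(1 + L\<^sub>-\<^sub>1) f\<^sub>-\<^sub>1\<close>, which is continued to \<open>Re s > 0\<close>, \<open>s \<noteq> 1/2\<close>, by subtracting the
  coboundary of its leading terms. A solution of the homogeneous equation that tends to zero
  vanishes; hence the asymptotics \<open>\<phi>(x) = c / x + O(1)\<close> single out the same solution, and the two
  maps are inverse to each other.

  For \<open>f\<close> to be defined on the closures of \<open>\<E>\<^sub>0\<close> and \<open>\<E>\<^sub>-\<^sub>1\<close>, whatever their shape, \<open>\<phi>\<close> has to extend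
  to the plane slit along the nonpositive reals. The asymptotics extend it to a disc tangent to the
  imaginary axis at \<open>0\<close>. The maps \<open>g\<^sub>-\<^sub>k\<^sup>-\<^sup>1\<close> and \<open>(Q g\<^sub>-\<^sub>k)\<^sup>-\<^sup>1\<close> strictly increase
  \<open>Re z / \<bar>Im z\<bar>\<close>, so that iterating the slow equation carries the extension to the whole slit plane.
\<close>

text \<open>Among the maps of the slow equation only that of \<open>g_elt q (-1)\<close> fixes the
  cusp 0; every other one sends 0 to a point x with 0 < x \<le> 1. The slow equation turns
  \<open>(1 - \<alpha>(g_{-1})) \<phi>\<close> into the sum \<open>rest\<close> over these other
  maps, which is therefore regular at 0 although \<phi> is not; this is f_{-1}. The obstacle is that
  one of the images of 0 is the endpoint 1 itself, because
  \<open>sn q (Suc (m_of q)) = sn q (m_of q)\<close>: \<phi> must be continued across 1 before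
  anything can be said at 0.

  The matrix U of g_{-1} may have the eigenvalue 1, and this shapes the regularisation. The value
  f_{-1}(0) splits into a vector fixed by U and a vector b - U b. The fixed part produces the pole
  at s = 1/2 and the term c / x, the other part the bounded term b. Conversely, boundedness of
  \<phi>(x) - c / x leaves no room for a further fixed part. In the coordinate \<xi> a bounded
  remainder carries the weight \<xi> to the power -2 s, which tends to zero because Re s > 0; this
  gives uniqueness.\<close>

no_notation fps_nth (infixl \<open>$\<close> 75)

section \<open>Vector-valued holomorphic and real-analytic functions\<close>

lemma norm_vector_smult [simp]: "norm (c *s (v :: complex^'n)) = cmod c * norm v"
  by (simp add: norm_vec_def norm_mult L2_set_right_distrib)

lemma vector_smult_of_real: "of_real r *s (v :: complex^'n) = r *\<^sub>R v"
  by (simp add: vector_scalar_mult_def vec_eq_iff scaleR_conv_of_real[where 'a=complex])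

lemma matrix_vector_mult_smult: "A *v (c *s v) = c *s (A *v (v :: complex^'n))"
  by (simp add: matrix_vector_mult_def vec_eq_iff sum_distrib_left mult_ac)

lemma matrix_vector_mult_scaleR_complex: "A *v (r *\<^sub>R v) = r *\<^sub>R (A *v (v :: complex^'n))"
  by (metis matrix_vector_mult_smult vector_smult_of_real)

lemma linear_matrix_vector_complex: "linear (\<lambda>v :: complex^'n. A *v v)"
  by (rule linearI) (simp_all add: matrix_vector_right_distrib matrix_vector_mult_scaleR_complex)

lemma bounded_linear_matrix_vector_complex: "bounded_linear (\<lambda>v :: complex^'n. A *v v)"
  using linear_matrix_vector_complex by (simp add: linear_conv_bounded_linear)

lemma tendsto_vector_smult [tendsto_intros]:
  assumes "(f \<longlongrightarrow> c) F" "(g \<longlongrightarrow> (v :: complex^'n)) F"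
  shows "((\<lambda>x. f x *s g x) \<longlongrightarrow> c *s v) F"
  by (rule vec_tendstoI) (auto intro!: tendsto_intros tendsto_vec_nth assms)

lemma continuous_on_vector_smult [continuous_intros]:
  assumes "continuous_on S f" "continuous_on S (g :: 'a :: topological_space \<Rightarrow> complex^'n)"
  shows "continuous_on S (\<lambda>x. f x *s g x)"
  using assms unfolding continuous_on_def by (auto intro: tendsto_vector_smult)

lemma vholomorphic_onI: "(\<And>i. (\<lambda>z. f z $ i) holomorphic_on S) \<Longrightarrow> vholomorphic_on f S"
  by (simp add: vholomorphic_on_def)

lemma vholomorphic_onD: "vholomorphic_on f S \<Longrightarrow> (\<lambda>z. f z $ i) holomorphic_on S"
  by (simp add: vholomorphic_on_def)

lemma vholomorphic_on_subset: "vholomorphic_on f S \<Longrightarrow> T \<subseteq> S \<Longrightarrow> vholomorphic_on f T"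
  using holomorphic_on_subset unfolding vholomorphic_on_def by blast

lemma vholomorphic_on_cong:
  assumes "\<And>z. z \<in> S \<Longrightarrow> f z = g z"
  shows "vholomorphic_on f S \<longleftrightarrow> vholomorphic_on g S"
  unfolding vholomorphic_on_def using assms by (intro all_cong1 holomorphic_cong) auto

lemma vholomorphic_on_const: "vholomorphic_on (\<lambda>_. c) S"
  by (simp add: vholomorphic_on_def)

lemma vholomorphic_on_add:
  "vholomorphic_on f S \<Longrightarrow> vholomorphic_on g S \<Longrightarrow> vholomorphic_on (\<lambda>z. f z + g z) S"
  by (auto simp: vholomorphic_on_def intro!: holomorphic_intros)

lemma vholomorphic_on_diff:
  "vholomorphic_on f S \<Longrightarrow> vholomorphic_on g S \<Longrightarrow> vholomorphic_on (\<lambda>z. f z - g z) S"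
  by (auto simp: vholomorphic_on_def intro!: holomorphic_intros)

lemma vholomorphic_on_smult:
  "c holomorphic_on S \<Longrightarrow> vholomorphic_on f S \<Longrightarrow> vholomorphic_on (\<lambda>z. c z *s f z) S"
  by (auto simp: vholomorphic_on_def intro!: holomorphic_intros)

lemma vholomorphic_on_sum:
  "(\<And>x. x \<in> X \<Longrightarrow> vholomorphic_on (f x) S) \<Longrightarrow> vholomorphic_on (\<lambda>z. \<Sum>x\<in>X. f x z) S"
  by (auto simp: vholomorphic_on_def sum_component intro!: holomorphic_on_sum)

lemma vholomorphic_on_matrix:
  "vholomorphic_on f S \<Longrightarrow> vholomorphic_on (\<lambda>z. A *v f z) S"
  by (auto simp: vholomorphic_on_def matrix_vector_mult_def intro!: holomorphic_intros)

lemma vholomorphic_on_compose: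
  assumes "vholomorphic_on f T" "g holomorphic_on S" "\<And>z. z \<in> S \<Longrightarrow> g z \<in> T"
  shows "vholomorphic_on (\<lambda>z. f (g z)) S"
  using holomorphic_on_compose_gen[OF assms(2) vholomorphic_onD[OF assms(1)]] assms(3)
  by (auto simp: vholomorphic_on_def o_def)

lemmas vholomorphic_intros =
  vholomorphic_on_const vholomorphic_on_add vholomorphic_on_diff vholomorphic_on_smult
  vholomorphic_on_sum vholomorphic_on_matrix

lemma vholomorphic_on_imp_continuous_on:
  "vholomorphic_on f S \<Longrightarrow> continuous_on S f"
  unfolding vholomorphic_on_def
  using continuous_on_vec_lambda[of S "\<lambda>i z. f z $ i"] holomorphic_on_imp_continuous_on by fastforce

lemma vholomorphic_on_Union:
  "(\<And>S. S \<in> \<F> \<Longrightarrow> open S) \<Longrightarrow> (\<And>S. S \<in> \<F> \<Longrightarrow> vholomorphic_on f S) \<Longrightarrow> vholomorphic_on f (\<Union>\<F>)"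
  unfolding vholomorphic_on_def
  by (meson Union_iff holomorphic_on_open open_Union)

lemma vholomorphic_on_local:
  assumes "open S" "\<And>z. z \<in> S \<Longrightarrow> \<exists>T. open T \<and> z \<in> T \<and> vholomorphic_on f T"
  shows "vholomorphic_on f S"
proof -
  let ?F = "{T. open T \<and> vholomorphic_on f T}"
  have "vholomorphic_on f (\<Union>?F)" by (rule vholomorphic_on_Union) auto
  moreover have "S \<subseteq> \<Union>?F" using assms(2) by blast
  ultimately show ?thesis by (rule vholomorphic_on_subset)
qed

lemma vholomorphic_identity:
  assumes f: "vholomorphic_on f S" and g: "vholomorphic_on g S" and S: "open S" "connected S"
    and X: "X \<subseteq> S" "x islimpt X" "x \<in> S" and eq: "\<And>z. z \<in> X \<Longrightarrow> f z = g z" and z: "z \<in> S"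
  shows "f z = g z"
proof -
  have "f z $ i - g z $ i = 0" for i
    by (rule analytic_continuation[of "\<lambda>z. f z $ i - g z $ i", OF _ S X(1) X(3) X(2) _ z])
       (use f g eq in \<open>auto simp: vholomorphic_on_def intro!: holomorphic_intros\<close>)
  then show ?thesis by (simp add: vec_eq_iff)
qed

lemma of_real_image_islimpt:
  assumes "a < b" "x \<in> {a..b}"
  shows "(of_real x :: complex) islimpt (of_real ` {a<..<b})"
  unfolding islimpt_approachable
proof (intro allI impI)
  fix e :: real assume e: "e > 0"
  have "x islimpt {a<..<b}"
    using assms islimpt_greaterThanLessThan1[of a b] islimpt_greaterThanLessThan2[of a b]
      interior_limit_point[of x "{a<..<b}"] by (cases "x = a"; cases "x = b") (auto simp: interior_open)
  then obtain y where "y \<in> {a<..<b}" "y \<noteq> x" "dist y x < e"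
    using e unfolding islimpt_approachable by blast
  then show "\<exists>x'\<in>of_real ` {a<..<b}. x' \<noteq> complex_of_real x \<and> dist x' (of_real x) < e"
    by (intro bexI[of _ "of_real y"]) (auto simp: dist_of_real)
qed

text \<open>The form of the identity theorem used throughout: functional equations are known on a
  real interval and are transported to complex domains.\<close>

lemma vholomorphic_identity_real:
  assumes f: "vholomorphic_on f S" and g: "vholomorphic_on g S" and S: "open S" "connected S"
    and ab: "a < b" "of_real ` {a<..<b} \<subseteq> S"
    and eq: "\<And>x. a < x \<Longrightarrow> x < b \<Longrightarrow> f (of_real x) = g (of_real x)" and z: "z \<in> S"
  shows "f z = g z"
proof (rule vholomorphic_identity[OF f g S ab(2) _ _ _ z])
  show "of_real ((a+b)/2) islimpt (of_real ` {a<..<b} :: complex set)"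
    by (rule of_real_image_islimpt) (use ab in \<open>auto simp: field_simps\<close>)
  show "of_real ((a+b)/2) \<in> S"
    by (rule subsetD[OF ab(2) imageI]) (use ab in \<open>auto simp: field_simps\<close>)
qed (use eq in auto)

text \<open>The majorant may depend on the point and need only dominate a tail. This is what the
  estimates along an orbit provide, since the first few orbit points can be anywhere.\<close>

lemma vholomorphic_suminf:
  fixes f :: "nat \<Rightarrow> complex \<Rightarrow> complex^'n"
  assumes "open S" "\<And>n. vholomorphic_on (f n) S"
    and dom: "\<And>x. x \<in> S \<Longrightarrow> \<exists>d h. 0 < d \<and> summable (h :: nat \<Rightarrow> real) \<and>
       (\<forall>\<^sub>F n in sequentially. \<forall>y\<in>ball x d \<inter> S. norm (f n y) \<le> h n)"
  shows "vholomorphic_on (\<lambda>z. \<Sum>n. f n z) S"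
proof (rule vholomorphic_onI)
  fix i
  have summ: "summable (\<lambda>n. f n x)" if x: "x \<in> S" for x
  proof -
    obtain d h where d: "0 < d" "summable (h :: nat \<Rightarrow> real)"
      "\<forall>\<^sub>F n in sequentially. \<forall>y\<in>ball x d \<inter> S. norm (f n y) \<le> h n" using dom[OF x] by auto
    have "\<forall>\<^sub>F n in sequentially. norm (f n x) \<le> h n"
      using d(3) by eventually_elim (use d(1) x in auto)
    then show ?thesis using d(2) by (rule summable_comparison_test_ev)
  qed
  obtain g where g: "\<forall>x \<in> S. ((\<lambda>n. f n x $ i) sums g x) \<and> g field_differentiable (at x)"
  proof (rule series_differentiable_comparison_complex[OF assms(1), of "\<lambda>n x. f n x $ i"])
    fix n x assume "x \<in> S" then show "(\<lambda>x. f n x $ i) field_differentiable at x"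
      using holomorphic_on_imp_differentiable_at[OF vholomorphic_onD[OF assms(2)] assms(1)] by blast
  next
    fix x assume "x \<in> S"
    obtain d h where d: "0 < d" "summable (h :: nat \<Rightarrow> real)"
      "\<forall>\<^sub>F n in sequentially. \<forall>y\<in>ball x d \<inter> S. norm (f n y) \<le> h n" using dom[OF \<open>x \<in> S\<close>] by (elim exE conjE)
    have "\<forall>\<^sub>F n in sequentially. norm (f n x) \<le> h n"
      using d(3) by eventually_elim (use d(1) \<open>x \<in> S\<close> in auto)
    \<comment> \<open>The domination holds only from some index on and says nothing about the sign
      of earlier \<open>h n\<close>; absolute values give a majorant that is nonnegative
      throughout.\<close>
    then have "\<forall>\<^sub>F n in sequentially. norm \<bar>h n\<bar> \<le> h n"
    proof eventually_elim
      case (elim n) then show ?case using order_trans[OF norm_ge_zero] by fastforce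
    qed
    then have "summable (\<lambda>n. \<bar>h n\<bar>)" by (rule summable_comparison_test_ev) (fact d)
    then have "summable (\<lambda>n. complex_of_real \<bar>h n\<bar>)" by (simp add: summable_of_real)
    moreover have "\<forall>\<^sub>F n in sequentially. \<forall>y\<in>ball x d \<inter> S. cmod (f n y $ i) \<le> cmod (of_real \<bar>h n\<bar>)"
      using d(3)
    proof eventually_elim
      case (elim n)
      show ?case
      proof
        fix y assume "y \<in> ball x d \<inter> S"
        then have "cmod (f n y $ i) \<le> norm (f n y)" "norm (f n y) \<le> h n"
          using elim Finite_Cartesian_Product.norm_nth_le[of "f n y" i] by auto
        then show "cmod (f n y $ i) \<le> cmod (of_real \<bar>h n\<bar>)" by simp
      qed
    qed
    ultimately show "\<exists>d h. 0 < d \<and> summable h \<and> range h \<subseteq> \<real>\<^sub>\<ge>\<^sub>0 \<and>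
        (\<forall>\<^sub>F n in sequentially. \<forall>y\<in>ball x d \<inter> S. cmod (f n y $ i) \<le> cmod (h n))"
      using d(1) by (intro exI[of _ d] exI[of _ "\<lambda>n. complex_of_real \<bar>h n\<bar>"]) auto
  qed
  have "(\<Sum>n. f n x) $ i = g x" if "x \<in> S" for x
    using bounded_linear.suminf[OF bounded_linear_vec_nth summ[OF that], of i] g that
    by (metis sums_unique)
  moreover have "g holomorphic_on S"
    using g assms(1) field_differentiable_at_within holomorphic_on_def by blast
  ultimately show "(\<lambda>z. (\<Sum>n. f n z) $ i) holomorphic_on S"
    by (simp add: holomorphic_transform)
qed

lemma vholomorphic_ball_imp_power_series:
  assumes "vholomorphic_on g (ball (of_real x) r)" "\<bar>y - x\<bar> < r"
  shows "(\<lambda>n. (y - x) ^ n *\<^sub>R (\<chi> i. (deriv ^^ n) (\<lambda>z. g z $ i) (of_real x) / fact n))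
           sums g (of_real y)"
proof -
  have "(\<lambda>n. (deriv ^^ n) (\<lambda>z. g z $ i) (of_real x) / fact n * (of_real y - of_real x) ^ n)
      sums (g (of_real y) $ i)" for i
    by (rule holomorphic_power_series[OF vholomorphic_onD[OF assms(1)]])
       (use assms(2) in \<open>auto simp: dist_norm simp flip: of_real_diff\<close>)
  then have "\<forall>i. (\<lambda>N. (\<Sum>n<N. (y - x) ^ n *\<^sub>R (\<chi> i. (deriv ^^ n) (\<lambda>z. g z $ i) (of_real x) / fact n)) $ i)
       \<longlonglongrightarrow> g (of_real y) $ i"
    by (auto simp: sums_def sum_component scaleR_conv_of_real[where 'a=complex] mult.commute)
  then show ?thesis unfolding sums_def by (intro vec_tendstoI) auto
qed

lemma real_analytic_onI:
  assumes "\<And>x. x \<in> I \<Longrightarrow> \<exists>r g. r > 0 \<and> vholomorphic_on g (ball (of_real x) r) \<and>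
             (\<forall>y. \<bar>y - x\<bar> < r \<longrightarrow> \<phi> y = g (of_real y))"
  shows "real_analytic_on \<phi> I"
  unfolding real_analytic_on_def
proof
  fix x assume "x \<in> I"
  then obtain r g where "r > 0" "vholomorphic_on g (ball (of_real x) r)"
    "\<forall>y. \<bar>y - x\<bar> < r \<longrightarrow> \<phi> y = g (of_real y)" using assms by blast
  then show "\<exists>a r. r > 0 \<and> (\<forall>y. \<bar>y - x\<bar> < r \<longrightarrow> (\<lambda>n. (y - x) ^ n *\<^sub>R a n) sums \<phi> y)"
    using vholomorphic_ball_imp_power_series[of g x r]
    by (intro exI[of _ "\<lambda>n. \<chi> i. (deriv ^^ n) (\<lambda>z. g z $ i) (of_real x) / fact n"] exI[of _ r]) auto
qed

text \<open>A power series that converges on a real interval converges on the complex disc with the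
  same centre and radius, so a real-analytic function is locally the restriction of a holomorphic
  one.\<close>

lemma real_analytic_onD:
  assumes "real_analytic_on \<phi> I" "x \<in> I"
  obtains r g where "r > 0" "vholomorphic_on g (ball (of_real x) r)"
    "\<And>y. \<bar>y - x\<bar> < r \<Longrightarrow> \<phi> y = g (of_real y)"
proof -
  obtain a r where r: "r > 0" and s: "\<And>y. \<bar>y - x\<bar> < r \<Longrightarrow> (\<lambda>n. (y - x) ^ n *\<^sub>R a n) sums \<phi> y"
    using assms unfolding real_analytic_on_def by blast
  define g where "g = (\<lambda>z. \<chi> i. \<Sum>n. a n $ i * (z - of_real x) ^ n)"
  have s': "(\<lambda>n. a n $ i * (of_real y - of_real x) ^ n) sums (\<phi> y $ i)" if "\<bar>y - x\<bar> < r" for y i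
  proof -
    have "(\<lambda>n. ((y - x) ^ n *\<^sub>R a n) $ i) sums (\<phi> y $ i)"
      by (rule bounded_linear.sums[OF bounded_linear_vec_nth s[OF that]])
    then show ?thesis by (simp add: scaleR_conv_of_real[where 'a=complex] mult.commute)
  qed
  have "(\<lambda>z. g z $ i) holomorphic_on ball (of_real x) r" for i
  proof (rule power_series_holomorphic[where a = "\<lambda>n. a n $ i"])
    fix w assume w: "w \<in> ball (complex_of_real x) r"
    \<comment> \<open>An intermediate radius: convergence at the real point \<open>x + t\<close>
      gives convergence at every w with \<open>cmod (w - of_real x) < t\<close>.\<close>
    define t where "t = (cmod (w - of_real x) + r) / 2"
    have t: "cmod (w - of_real x) < t" "t < r" "t > 0"
      using w r norm_ge_zero[of "w - of_real x"] add_nonneg_pos[OF norm_ge_zero[of "w - of_real x"] r]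
      by (auto simp: t_def dist_norm norm_minus_commute)
    have "summable (\<lambda>n. a n $ i * of_real t ^ n)"
      using s'[of "x + t" i] t by (auto simp: sums_iff)
    then have "summable (\<lambda>n. a n $ i * (w - of_real x) ^ n)"
      by (rule powser_inside) (use t in auto)
    then show "(\<lambda>n. a n $ i * (w - of_real x) ^ n) sums (g w $ i)"
      by (simp add: g_def summable_sums)
  qed
  moreover have "\<phi> y = g (of_real y)" if "\<bar>y - x\<bar> < r" for y
    using s'[OF that] by (auto simp: vec_eq_iff g_def sums_iff)
  ultimately show ?thesis using r that[of r g] by (simp add: vholomorphic_on_def)
qed

section \<open>Complex powers on the slit plane\<close>

definition slit :: "complex set" where "slit = - \<real>\<^sub>\<le>\<^sub>0"

lemma slit_iff: "z \<in> slit \<longleftrightarrow> Im z \<noteq> 0 \<or> Re z > 0"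
  by (auto simp: slit_def complex_nonpos_Reals_iff)

lemma open_slit: "open slit"
  by (simp add: slit_def open_Compl)

lemma slit_not_nonpos: "z \<in> slit \<Longrightarrow> z \<notin> \<real>\<^sub>\<le>\<^sub>0"
  by (simp add: slit_def)

lemma slit_add: "z \<in> slit \<Longrightarrow> t \<ge> 0 \<Longrightarrow> z + of_real t \<in> slit"
  by (auto simp: slit_iff)

lemma slit_inverse: "z \<in> slit \<Longrightarrow> 1 / z \<in> slit"
  by (auto simp: slit_iff Re_divide Im_divide power2_eq_square sum_squares_gt_zero_iff)

lemma slit_nonzero: "z \<in> slit \<Longrightarrow> z \<noteq> 0"
  by (auto simp: slit_iff)

text \<open>With imaginary parts of opposite sign the two arguments have opposite sign too, so their
  sum stays strictly between -pi and pi and the principal logarithm is additive.\<close>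

lemma powr_mult_slit:
  assumes "X \<in> slit" "Y \<in> slit" "Im X * Im Y \<le> 0"
  shows "(X * Y) powr w = X powr w * Y powr w"
proof -
  have nz: "X \<noteq> 0" "Y \<noteq> 0" using assms slit_nonzero by auto
  have b: "Im (Ln z) < pi" "- pi < Im (Ln z)" if "z \<in> slit" for z
    using that Im_Ln_less_pi[of z] mpi_less_Im_Ln[of z] slit_nonzero slit_not_nonpos by auto
  have neg: "Im (Ln z) \<le> 0" if "Im z \<le> 0" "z \<in> slit" for z
    using Im_Ln_pos_lt[of z] b[of z] that by (cases "z = 0") (auto simp: slit_iff)
  have pos: "Im (Ln z) \<ge> 0" if "Im z \<ge> 0" "z \<in> slit" for z
    using Im_Ln_pos_le[of z] that slit_nonzero[of z] by auto
  have "(Im X \<ge> 0 \<and> Im Y \<le> 0) \<or> (Im X \<le> 0 \<and> Im Y \<ge> 0)"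
    using assms(3) by (auto simp: mult_le_0_iff)
  then have "Ln (X * Y) = Ln X + Ln Y"
    using neg[of X] neg[of Y] pos[of X] pos[of Y] b[of X] b[of Y] assms nz
    by (intro Ln_times_simple) auto
  then show ?thesis using nz by (simp add: powr_def distrib_left exp_add)
qed

text \<open>For t \<ge> 0 the imaginary part of \<open>of_real t / X\<close> has the sign opposite
  to that of X, so the factors X and \<open>1 + of_real t / X\<close> multiply without a jump of the
  branch.\<close>

lemma powr_add_slit:
  assumes "X \<in> slit" "t \<ge> 0"
  shows "(X + of_real t) powr w = X powr w * (1 + of_real t / X) powr w"
proof -
  have nz: "X \<noteq> 0" using assms slit_nonzero by auto
  have im: "Im (1 + of_real t / X) = - t * Im X / (cmod X)\<^sup>2"
    by (simp add: Im_divide cmod_power2)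
  have "X + of_real t \<in> slit" using slit_add assms by blast
  have "1 + of_real t / X \<in> slit"
  proof (cases "Im X = 0 \<or> t = 0")
    case True
    then have "Re X > 0 \<or> t = 0" using assms(1) by (auto simp: slit_iff)
    then show ?thesis using True assms(2) by (auto simp: slit_iff Re_divide add_pos_nonneg)
  next
    case False
    then show ?thesis using im nz by (auto simp: slit_iff)
  qed
  moreover have "Im X * Im (1 + of_real t / X) \<le> 0"
  proof -
    have "Im X * Im (1 + of_real t / X) = - (t * (Im X)\<^sup>2 / (cmod X)\<^sup>2)"
      unfolding im by (simp add: power2_eq_square)
    then show ?thesis using assms(2) by simp
  qed
  ultimately have "(X * (1 + of_real t / X)) powr w = X powr w * (1 + of_real t / X) powr w"
    using powr_mult_slit assms(1) by blast
  then show ?thesis using nz by (simp add: distrib_left)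
qed

lemma cmod_powr_le:
  assumes "z \<noteq> 0"
  shows "cmod (z powr w) \<le> cmod z powr Re w * exp (pi * \<bar>Im w\<bar>)"
proof -
  have "- Im w * Arg z \<le> \<bar>Im w\<bar> * pi"
  proof -
    have "\<bar>Im w * Arg z\<bar> \<le> \<bar>Im w\<bar> * pi"
      unfolding abs_mult using Arg_bounded[of z] by (intro mult_left_mono) auto
    then show ?thesis by linarith
  qed
  then show ?thesis
    unfolding norm_powr_complex by (intro mult_left_mono) (auto simp: mult.commute)
qed

text \<open>One constant serves all exponents of bounded size, as the continuation in the exponent
  needs locally uniform estimates. The second-order bound is there because it will be multiplied by
  the large quantity X.\<close>

lemma powr_binomial_bounds:
  assumes "A \<ge> 0"
  obtains C where "C > 0"
    "\<And>\<alpha> v. cmod \<alpha> \<le> A \<Longrightarrow> cmod v \<le> 1/2 \<Longrightarrow> cmod ((1 + v) powr \<alpha> - 1) \<le> C * cmod v"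
    "\<And>\<alpha> v. cmod \<alpha> \<le> A \<Longrightarrow> cmod v \<le> 1/2 \<Longrightarrow>
       cmod ((1 + v) powr \<alpha> - 1 - \<alpha> * v) \<le> C * (cmod v)\<^sup>2"
proof -
  have sl: "1 + v \<in> slit" if "cmod v \<le> 1/2" for v
  proof -
    have "Re v \<ge> - 1/2" using abs_Re_le_cmod[of v] that by linarith
    then show ?thesis by (auto simp: slit_iff)
  qed
  have "continuous_on (cball 0 (1/2)) (\<lambda>v. Ln (1 + v))"
    using sl by (intro continuous_intros) (auto dest: slit_not_nonpos)
  then have "compact ((\<lambda>v. Ln (1 + v)) ` cball 0 (1/2))"
    by (rule compact_continuous_image) simp
  then have "bounded ((\<lambda>v. Ln (1 + v)) ` cball 0 (1/2))" by (rule compact_imp_bounded)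
  then obtain B where "\<forall>x\<in>(\<lambda>v. Ln (1 + v)) ` cball 0 (1/2). cmod x \<le> B"
    unfolding bounded_iff by (elim exE)
  then have B: "\<And>v. cmod v \<le> 1/2 \<Longrightarrow> cmod (Ln (1 + v)) \<le> B" by auto
  define K where "K = exp ((A + 1) * B)"
  have B0: "B \<ge> 0" using B[of 0] by simp
  have K1: "K \<ge> 1" unfolding K_def using assms B0 by simp
  have K: "cmod ((1 + v) powr \<beta>) \<le> K" if "cmod \<beta> \<le> A + 1" "cmod v \<le> 1/2" for \<beta> v
  proof -
    have "1 + v \<noteq> 0" using slit_nonzero[OF sl] that by blast
    then have "cmod ((1 + v) powr \<beta>) = exp (Re (\<beta> * Ln (1 + v)))"
      by (simp add: powr_def)
    also have "Re (\<beta> * Ln (1 + v)) \<le> cmod \<beta> * cmod (Ln (1 + v))"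
      using complex_Re_le_cmod norm_mult by metis
    also have "\<dots> \<le> (A + 1) * B" using that B assms by (intro mult_mono) auto
    finally show ?thesis by (simp add: K_def)
  qed
  have der: "((\<lambda>u. (1 + u) powr \<alpha>) has_field_derivative \<alpha> * (1 + u) powr (\<alpha> - 1)) (at u within S)"
    if "cmod u \<le> 1/2" for u \<alpha> S
    using slit_not_nonpos[OF sl[OF that]] by (auto intro!: derivative_eq_intros)
  have K': "cmod ((1 + v) powr (\<beta> - 1)) \<le> K * K" if "cmod \<beta> \<le> A + 1" "cmod v \<le> 1/2" for \<beta> v
  proof -
    have nz: "1 + v \<noteq> 0" using slit_nonzero[OF sl] that by blast
    have "(1 + v) powr (\<beta> - 1) = (1 + v) powr \<beta> * (1 + v) powr (-1)"
      by (simp flip: powr_add)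
    then have "cmod ((1 + v) powr (\<beta> - 1)) = cmod ((1 + v) powr \<beta>) * cmod ((1 + v) powr (-1))"
      by (simp add: norm_mult)
    also have "\<dots> \<le> K * K" using K[of \<beta> v] K[of "-1" v] that assms K1 by (intro mult_mono) auto
    finally show ?thesis .
  qed
  \<comment> \<open>Proved for exponents up to A + 1, since the second-order bound will apply it to
    \<alpha> - 1.\<close>
  have 1: "cmod ((1 + v) powr \<alpha> - 1) \<le> ((A + 1) * (K * K)) * cmod v"
    if "cmod \<alpha> \<le> A + 1" "cmod v \<le> 1/2" for \<alpha> v
  proof -
    have "norm ((1 + v) powr \<alpha> - (1 + 0) powr \<alpha>) \<le> ((A + 1) * (K * K)) * norm (v - 0)"
      by (rule field_differentiable_bound[OF convex_cball[of 0 "1/2"] der[where S="cball 0 (1/2)"]])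
         (use that assms K' K1 in \<open>auto simp: norm_mult intro!: mult_mono\<close>)
    then show ?thesis by simp
  qed
  define C where "C = (A + 1) * ((A + 1) * (K * K))"
  have AC: "(A + 1) * (K * K) \<le> C"
  proof -
    have "1 * ((A + 1) * (K * K)) \<le> (A + 1) * ((A + 1) * (K * K))"
      using assms K1 by (intro mult_right_mono) auto
    then show ?thesis by (simp add: C_def)
  qed
  have 2: "cmod ((1 + v) powr \<alpha> - 1 - \<alpha> * v) \<le> C * (cmod v)\<^sup>2"
    if "cmod \<alpha> \<le> A" "cmod v \<le> 1/2" for \<alpha> v
  proof -
    \<comment> \<open>Mean value inequality for \<open>(1 + u) powr \<alpha> - \<alpha> * u\<close>
      on the disc of radius |v|: its derivative is \<alpha> times a first-order difference for the
      exponent \<alpha> - 1, hence of size |v|.\<close>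
    have "norm (((1 + v) powr \<alpha> - \<alpha> * v) - ((1 + 0) powr \<alpha> - \<alpha> * 0)) \<le> (C * cmod v) * norm (v - 0)"
    proof (rule field_differentiable_bound[OF convex_cball[of 0 "cmod v"],
          where f' = "\<lambda>u. \<alpha> * (1 + u) powr (\<alpha> - 1) - \<alpha>"])
      fix u :: complex assume u: "u \<in> cball 0 (cmod v)"
      then have u2: "cmod u \<le> 1/2" using that by auto
      show "((\<lambda>u. (1 + u) powr \<alpha> - \<alpha> * u) has_field_derivative \<alpha> * (1 + u) powr (\<alpha> - 1) - \<alpha>)
          (at u within cball 0 (cmod v))"
        by (rule DERIV_diff[OF der[OF u2]]) (auto intro!: derivative_eq_intros)
      have "cmod (\<alpha> * (1 + u) powr (\<alpha> - 1) - \<alpha>) = cmod \<alpha> * cmod ((1 + u) powr (\<alpha> - 1) - 1)"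
        by (simp add: right_diff_distrib flip: norm_mult)
      also have "\<dots> \<le> (A + 1) * (((A + 1) * (K * K)) * cmod u)"
      proof (intro mult_mono)
        have "cmod (\<alpha> - 1) \<le> A + 1" using that norm_triangle_ineq4[of \<alpha> 1] by simp
        then show "cmod ((1 + u) powr (\<alpha> - 1) - 1) \<le> ((A + 1) * (K * K)) * cmod u"
          using 1[of "\<alpha> - 1" u] u2 by blast
      qed (use that assms in auto)
      also have "\<dots> \<le> C * cmod v"
        unfolding C_def mult.assoc using u assms K1 by (intro mult_left_mono) auto
      finally show "cmod (\<alpha> * (1 + u) powr (\<alpha> - 1) - \<alpha>) \<le> C * cmod v" .
    qed auto
    then show ?thesis by (simp add: power2_eq_square algebra_simps)
  qed
  show ?thesis
  proof
    show "C > 0" unfolding C_def using assms K1 by simp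
  next
    fix \<alpha> v assume a: "cmod \<alpha> \<le> A" "cmod v \<le> 1/2"
    then have "cmod ((1 + v) powr \<alpha> - 1) \<le> ((A + 1) * (K * K)) * cmod v" using 1 by simp
    also have "\<dots> \<le> C * cmod v" using AC by (intro mult_right_mono) auto
    finally show "cmod ((1 + v) powr \<alpha> - 1) \<le> C * cmod v" .
  qed (use 2 in auto)
qed

section \<open>The regularised sum over the orbit of the parabolic element\<close>

primrec matpow :: "complex^'n^'n \<Rightarrow> nat \<Rightarrow> complex^'n^'n" where
  "matpow U 0 = mat 1"
| "matpow U (Suc n) = U ** matpow U n"

lemma matpow_commute: "U ** matpow U n = matpow U n ** U"
  by (induction n) (simp_all add: matrix_mul_assoc)

lemma matpow_Suc_mult: "matpow U (Suc n) *v v = matpow U n *v (U *v v)"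
  by (simp add: matpow_commute matrix_vector_mul_assoc)

text \<open>Later U is the matrix of \<open>g_elt q (-1)\<close>, and \<open>\<l>\<close> the length
  of its translation in the coordinate 1 / z.\<close>

locale parabolic_sum =
  fixes \<l> :: real and U :: "complex^'n^'n"
  assumes ell_pos: "\<l> > 0" and isometry: "norm (U *v v) = norm v"
begin

lemma norm_matpow [simp]: "norm (matpow U n *v v) = norm v"
  by (induction n arbitrary: v) (simp_all add: isometry flip: matrix_vector_mul_assoc)

text \<open>
  Formally \<open>p / (2 * w - 1) * X + b\<close>, read in the coordinate \<open>X = 1 / z\<close>, solves the cohomological
  equation with right-hand side \<open>f\<close> up to terms that vanish at \<open>z = 0\<close>. Subtracting its coboundary
  is what makes the sum converge for \<open>Re w > 0\<close>. Everything is multiplied by \<open>2 * w - 1\<close>, so that it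
  is holomorphic also at \<open>w = 1/2\<close>.
\<close>

definition admissible :: "(complex \<Rightarrow> complex^'n) \<Rightarrow> complex^'n \<Rightarrow> complex^'n \<Rightarrow> bool" where
  "admissible f p b \<longleftrightarrow> U *v p = p \<and> f 0 = \<l> *\<^sub>R p + (b - U *v b) \<and>
     (\<exists>C r. r > 0 \<and> (\<forall>v. cmod v < r \<longrightarrow> norm (f v - f 0) \<le> C * cmod v))"

text \<open>The formal solution multiplied by \<open>(2 * w - 1) * X powr (- 2 * w)\<close>, the
  weight under which the twisted difference equation has constant coefficients.\<close>

definition hs :: "complex^'n \<Rightarrow> complex^'n \<Rightarrow> complex \<Rightarrow> complex \<Rightarrow> complex^'n" where
  "hs p b w X = X powr (- 2 * w) *s (X *s p + (2 * w - 1) *s b)"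

text \<open>What remains of the weighted f once the coboundary of \<open>hs\<close> is
  subtracted.\<close>

definition Rs :: "(complex \<Rightarrow> complex^'n) \<Rightarrow> complex^'n \<Rightarrow> complex^'n \<Rightarrow> complex \<Rightarrow> complex \<Rightarrow> complex^'n" where
  "Rs f p b w X = ((2 * w - 1) * X powr (- 2 * w)) *s f (1 / X) - hs p b w X + U *v hs p b w (X + of_real \<l>)"

text \<open>The weighted solution of the difference equation at z = 1 / \<eta>. In the sum of the
  \<open>Rs\<close> terms the coboundary telescopes to \<open>- hs\<close> at \<eta>, which the
  leading summand restores.\<close>

definition Ks :: "(complex \<Rightarrow> complex^'n) \<Rightarrow> complex^'n \<Rightarrow> complex^'n \<Rightarrow> complex \<Rightarrow> complex \<Rightarrow> complex^'n" where
  "Ks f p b w \<eta> = hs p b w \<eta> + (\<Sum>n. matpow U n *v Rs f p b w (\<eta> + of_real (real n * \<l>)))"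

text \<open>Expand the translated \<open>hs\<close> in v = l / X. The terms of order X^(1 - 2 w)
  cancel because U p = p, those of order X^(-2 w) because of the value of f at 0 prescribed by
  \<open>admissible\<close>. The rest gains a factor 1 / X, which makes it summable along the orbit
  as soon as Re w > 0.\<close>

lemma Rs_bound:
  assumes adm: "admissible f p b" and A: "A \<ge> 0"
  obtains C X0 where "C > 0" "X0 > 0"
    "\<And>w X. cmod w \<le> A \<Longrightarrow> X \<in> slit \<Longrightarrow> cmod X \<ge> X0 \<Longrightarrow>
       norm (Rs f p b w X) \<le> C * cmod X powr (- 2 * Re w - 1)"
proof -
  obtain Cf r where r: "r > 0" "\<And>v. cmod v < r \<Longrightarrow> norm (f v - f 0) \<le> Cf * cmod v"
    and p: "U *v p = p" and f0: "f 0 = \<l> *\<^sub>R p + (b - U *v b)"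
    using adm unfolding admissible_def by blast
  have A2: "2 * A + 1 \<ge> 0" using A by simp
  obtain Cb where Cb: "Cb > 0"
    "\<And>\<alpha> v. cmod \<alpha> \<le> 2 * A + 1 \<Longrightarrow> cmod v \<le> 1/2 \<Longrightarrow> cmod ((1 + v) powr \<alpha> - 1) \<le> Cb * cmod v"
    "\<And>\<alpha> v. cmod \<alpha> \<le> 2 * A + 1 \<Longrightarrow> cmod v \<le> 1/2 \<Longrightarrow>
       cmod ((1 + v) powr \<alpha> - 1 - \<alpha> * v) \<le> Cb * (cmod v)\<^sup>2"
    using powr_binomial_bounds[OF A2] by blast
  \<comment> \<open>The three summands come from the Lipschitz bound for f at 0, from the
    second-order remainder multiplying p, and from the first-order remainder multiplying b.\<close>
  define D where "D = (2 * A + 1) * \<bar>Cf\<bar> + Cb * \<l>\<^sup>2 * norm p + (2 * A + 1) * (Cb * \<l>) * norm b"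
  define C where "C = exp (2 * pi * A) * (D + 1)"
  \<comment> \<open>Ensures |v| \<le> 1/2, so that the binomial bounds apply, and |1 / X| < r, so
    that the Lipschitz bound does.\<close>
  define X0 where "X0 = max (2 * \<l>) (2 / r)"
  have D0: "D \<ge> 0" unfolding D_def using A Cb(1) ell_pos by (intro add_nonneg_nonneg mult_nonneg_nonneg) auto
  have "norm (Rs f p b w X) \<le> C * cmod X powr (- 2 * Re w - 1)"
    if w: "cmod w \<le> A" and X: "X \<in> slit" "cmod X \<ge> X0" for w X
  proof -
    define v where "v = of_real \<l> / X"
    have nz: "X \<noteq> 0" using X slit_nonzero by auto
    have Xpos: "cmod X > 0" using nz by simp
    have v: "cmod v = \<l> / cmod X" "cmod v \<le> 1/2"
      using X(2) ell_pos Xpos unfolding v_def X0_def by (auto simp: norm_divide field_simps)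
    have v1: "cmod (1 / X) < r"
    proof -
      have "2 / r \<le> cmod X" using X(2) by (simp add: X0_def)
      then show ?thesis using r(1) Xpos by (auto simp: norm_divide field_simps)
    qed
    have cw: "cmod (2 * w - 1) \<le> 2 * A + 1" "cmod (1 - 2 * w) \<le> 2 * A + 1" "cmod (- 2 * w) \<le> 2 * A + 1"
      using w norm_triangle_ineq4[of "2 * w" 1] by (auto simp: norm_mult norm_minus_commute)
    define B where "B = (2 * w - 1) *s (f (1 / X) - f 0)
        + (X * ((1 + v) powr (1 - 2 * w) - 1 - (1 - 2 * w) * v)) *s p
        + ((2 * w - 1) * ((1 + v) powr (- 2 * w) - 1)) *s (U *v b)"
    have 1: "(X + of_real \<l>) powr (- 2 * w) = X powr (- 2 * w) * (1 + v) powr (- 2 * w)"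
      unfolding v_def using powr_add_slit[OF X(1)] ell_pos by simp
    have nz1: "1 + v \<noteq> 0"
    proof
      assume "1 + v = 0" then have "v = -1" by (simp add: eq_neg_iff_add_eq_0 add.commute)
      then show False using v(2) by simp
    qed
    have 2: "(1 + v) powr (1 - 2 * w) = (1 + v) * (1 + v) powr (- 2 * w)"
      using nz1 powr_add[of "1 + v" 1 "- 2 * w"] by (simp add: powr_to_1)
    have Xv: "X * v = of_real \<l>" using nz by (simp add: v_def)
    have "Rs f p b w X = X powr (- 2 * w) *s B"
    proof -
      define E where "E = X powr (- 2 * w)"
      define F where "F = (1 + v) powr (- 2 * w)"
      have hsX: "hs p b w X = E *s (X *s p + (2 * w - 1) *s b)" by (simp add: hs_def E_def)
      have hsX': "U *v hs p b w (X + of_real \<l>) =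
           (E * F) *s ((X + of_real \<l>) *s p + (2 * w - 1) *s (U *v b))"
        unfolding hs_def 1 E_def[symmetric] F_def[symmetric]
        by (simp only: matrix_vector_mult_smult matrix_vector_right_distrib p)
      have Bc: "B $ i = (2 * w - 1) * (f (1 / X) $ i - (of_real \<l> * p $ i + (b $ i - (U *v b) $ i)))
        + (X * ((1 + v) * F - 1 - (1 - 2 * w) * v)) * p $ i
        + ((2 * w - 1) * (F - 1)) * (U *v b) $ i" for i
        unfolding B_def f0 2 F_def[symmetric]
        by (simp only: vector_smult_component vector_add_component vector_minus_component
            vector_scaleR_component scaleR_conv_of_real[where 'a=complex])
      have "Rs f p b w X $ i = (E *s B) $ i" for i
        unfolding Rs_def hsX hsX' E_def[symmetric] vector_smult_component Bc
          vector_add_component vector_minus_component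
        \<comment> \<open>With \<open>\<l>\<close> written as \<open>X * v\<close> the claim becomes
          a polynomial identity.\<close>
        unfolding Xv[symmetric] by algebra
      then show ?thesis by (simp add: vec_eq_iff E_def)
    qed
    then have "norm (Rs f p b w X) = cmod (X powr (- 2 * w)) * norm B" by simp
    also have "\<dots> \<le> (cmod X powr (- 2 * Re w) * exp (2 * pi * A)) * (D / cmod X)"
    proof (intro mult_mono)
      have "cmod (X powr (- 2 * w)) \<le> cmod X powr (- 2 * Re w) * exp (pi * \<bar>Im (- 2 * w)\<bar>)"
        using cmod_powr_le[OF nz, of "- 2 * w"] by simp
      also have "\<dots> \<le> cmod X powr (- 2 * Re w) * exp (2 * pi * A)"
        using abs_Im_le_cmod[of w] w by (intro mult_left_mono) (auto simp: abs_mult)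
      finally show "cmod (X powr (- 2 * w)) \<le> cmod X powr (- 2 * Re w) * exp (2 * pi * A)" .
    next
      have "norm B \<le> norm ((2 * w - 1) *s (f (1 / X) - f 0))
        + norm ((X * ((1 + v) powr (1 - 2 * w) - 1 - (1 - 2 * w) * v)) *s p)
        + norm (((2 * w - 1) * ((1 + v) powr (- 2 * w) - 1)) *s (U *v b))"
        unfolding B_def by (intro norm_triangle_le add_mono order.refl norm_triangle_ineq)
      also have "\<dots> \<le> (2 * A + 1) * (\<bar>Cf\<bar> * (1 / cmod X))
          + (cmod X * (Cb * (cmod v)\<^sup>2)) * norm p + ((2 * A + 1) * (Cb * cmod v)) * norm b"
        unfolding norm_vector_smult norm_mult isometry
      proof (intro add_mono mult_mono cw Cb(2) Cb(3) v)
        have "norm (f (1 / X) - f 0) \<le> Cf * cmod (1 / X)" using r(2) v1 by blast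
        also have "\<dots> \<le> \<bar>Cf\<bar> * (1 / cmod X)" by (simp add: norm_divide divide_right_mono)
        finally show "norm (f (1 / X) - f 0) \<le> \<bar>Cf\<bar> * (1 / cmod X)" .
      qed (use A Cb(1) in auto)
      also have "\<dots> = D / cmod X"
        unfolding D_def v(1) using Xpos by (simp add: field_simps power2_eq_square)
      finally show "norm B \<le> D / cmod X" .
    qed (use Xpos D0 in auto)
    also have "\<dots> = exp (2 * pi * A) * D * cmod X powr (- 2 * Re w - 1)"
      using Xpos by (simp add: powr_diff)
    also have "\<dots> \<le> C * cmod X powr (- 2 * Re w - 1)"
      unfolding C_def by (intro mult_right_mono mult_left_mono) auto
    finally show ?thesis .
  qed
  moreover have "C > 0" unfolding C_def using D0 by simp
  moreover have "X0 > 0" unfolding X0_def using ell_pos by simp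
  ultimately show ?thesis using that by blast
qed

text \<open>The majorant is uniform in the exponent and in the point at once, so that it yields
  holomorphy of \<open>Ks\<close> in either variable.\<close>

lemma Rs_locally_dominated:
  assumes adm: "admissible f p b" and w0: "Re w0 > 0" and \<eta>0: "\<eta>0 \<in> slit"
  shows "\<exists>d h. d > 0 \<and> summable (h :: nat \<Rightarrow> real) \<and>
    (\<forall>\<^sub>F n in sequentially. \<forall>w\<in>ball w0 d. \<forall>\<eta>\<in>ball \<eta>0 d.
       norm (matpow U n *v Rs f p b w (\<eta> + of_real (real n * \<l>))) \<le> h n)"
proof -
  obtain d0 where d0: "d0 > 0" "ball \<eta>0 d0 \<subseteq> slit"
    using open_slit \<eta>0 open_contains_ball by blast
  \<comment> \<open>On a ball of radius at most a about w0 the real part of w stays \<ge> a, so the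
    exponent -2 a - 1 < -1 of a convergent series serves everywhere.\<close>
  define a where "a = Re w0 / 2"
  define d where "d = min (min 1 a) d0"
  define A where "A = cmod w0 + 1"
  have A: "A \<ge> 0" by (simp add: A_def)
  obtain C X0 where C: "C > 0" "X0 > 0" "\<And>w X. cmod w \<le> A \<Longrightarrow> X \<in> slit \<Longrightarrow> cmod X \<ge> X0 \<Longrightarrow>
       norm (Rs f p b w X) \<le> C * cmod X powr (- 2 * Re w - 1)"
    using Rs_bound[OF adm A] by blast
  define h where "h = (\<lambda>n. C * (\<l> / 2) powr (- 2 * a - 1) * real n powr (- 2 * a - 1))"
  have a: "a > 0" using w0 by (simp add: a_def)
  have "summable (\<lambda>n. real n powr (- 2 * a - 1))"
    using a by (simp add: summable_real_powr_iff)
  then have sh: "summable h" unfolding h_def by (rule summable_mult)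
  have Rew: "Re w \<ge> a" "cmod w \<le> A" if "w \<in> ball w0 d" for w
  proof -
    have *: "cmod (w - w0) < d" using that by (simp add: dist_norm norm_minus_commute)
    show "Re w \<ge> a" using * abs_Re_le_cmod[of "w - w0"] by (auto simp: d_def a_def)
    show "cmod w \<le> A" using * norm_triangle_sub[of w w0] by (auto simp: d_def A_def)
  qed
  have "filterlim (\<lambda>n. real n * (\<l> / 2)) at_top sequentially"
    using ell_pos by real_asymp
  then have "\<forall>\<^sub>F n in sequentially. real n * (\<l> / 2) \<ge> max (max 1 X0) (cmod \<eta>0 + 1)"
    by (simp add: filterlim_at_top)
  then have ev: "\<forall>\<^sub>F n in sequentially. \<forall>w\<in>ball w0 d. \<forall>\<eta>\<in>ball \<eta>0 d.
       norm (matpow U n *v Rs f p b w (\<eta> + of_real (real n * \<l>))) \<le> h n"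
  proof eventually_elim
    case (elim n)
    show ?case
    proof (intro ballI)
      fix w \<eta> assume w: "w \<in> ball w0 d" and \<eta>: "\<eta> \<in> ball \<eta>0 d"
      define X where "X = \<eta> + of_real (real n * \<l>)"
      have "\<eta> \<in> slit" using \<eta> d0 by (auto simp: d_def)
      then have X: "X \<in> slit" unfolding X_def using ell_pos by (intro slit_add) auto
      have "cmod (\<eta> - \<eta>0) < 1" using \<eta> by (simp add: dist_norm norm_minus_commute d_def)
      then have "cmod \<eta> \<le> cmod \<eta>0 + 1" using norm_triangle_sub[of \<eta> \<eta>0] by linarith
      moreover have "real n * \<l> \<le> cmod X + cmod \<eta>"
        using norm_triangle_ineq4[of X \<eta>] ell_pos by (simp add: X_def norm_mult)
      moreover have "real n * \<l> = 2 * (real n * (\<l> / 2))" by simp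
      ultimately have Xn: "cmod X \<ge> real n * (\<l> / 2)" using elim by linarith
      have X1: "cmod X \<ge> 1" "cmod X \<ge> X0" using Xn elim by linarith+
      have npos: "real n * (\<l> / 2) > 0" using elim by linarith
      have "norm (matpow U n *v Rs f p b w X) \<le> C * cmod X powr (- 2 * Re w - 1)"
        using C(3)[OF Rew(2)[OF w] X X1(2)] by simp
      also have "\<dots> \<le> C * cmod X powr (- 2 * a - 1)"
        using Rew(1)[OF w] X1(1) C(1) by (intro mult_left_mono powr_mono) auto
      also have "\<dots> \<le> C * (real n * (\<l> / 2)) powr (- 2 * a - 1)"
        using Xn npos a C(1) by (intro mult_left_mono powr_mono2') auto
      also have "\<dots> = h n" 
        unfolding h_def using ell_pos powr_mult[of "real n" "\<l> / 2" "- 2 * a - 1"] by simp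
      finally show "norm (matpow U n *v Rs f p b w (\<eta> + of_real (real n * \<l>))) \<le> h n"
        by (simp add: X_def)
    qed
  qed
  have "d > 0" using a d0 by (simp add: d_def)
  then show ?thesis using sh ev by blast
qed

lemma summable_Rs:
  assumes "admissible f p b" "Re w > 0" "\<eta> \<in> slit"
  shows "summable (\<lambda>n. matpow U n *v Rs f p b w (\<eta> + of_real (real n * \<l>)))"
proof -
  obtain d h where d: "d > 0" "summable (h :: nat \<Rightarrow> real)"
    and ev: "\<forall>\<^sub>F n in sequentially. \<forall>w\<in>ball w d. \<forall>\<eta>\<in>ball \<eta> d.
       norm (matpow U n *v Rs f p b w (\<eta> + of_real (real n * \<l>))) \<le> h n"
    using Rs_locally_dominated[OF assms] by (elim exE conjE)
  show ?thesis
  proof (rule summable_comparison_test_ev[OF _ d(2)])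
    show "\<forall>\<^sub>F n in sequentially. norm (matpow U n *v Rs f p b w (\<eta> + of_real (real n * \<l>))) \<le> h n"
      using ev
    proof eventually_elim
      case (elim n) then show ?case using d(1) by simp
    qed
  qed
qed

text \<open>The analytic continuation itself: \<open>Ks\<close> is holomorphic across the line Re w
  = 1/2 and also at w = 1/2, where only the later division by 2 w - 1 can create a pole.\<close>

lemma Ks_holomorphic_exponent:
  assumes "admissible f p b" "\<eta> \<in> slit"
  shows "vholomorphic_on (\<lambda>w. Ks f p b w \<eta>) {w. Re w > 0}"
proof -
  have nz: "\<eta> + of_real (real n * \<l>) \<noteq> 0" for n
    using slit_add[OF assms(2), of "real n * \<l>"] ell_pos by (intro slit_nonzero) auto
  have hs: "vholomorphic_on (\<lambda>w. hs p b w X) S" if "X \<noteq> 0" for X S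
    unfolding hs_def using that by (auto intro!: vholomorphic_intros holomorphic_intros)
  show ?thesis unfolding Ks_def
  proof (intro vholomorphic_on_add hs vholomorphic_suminf)
    show "open {w. Re w > 0}" by (simp add: open_halfspace_Re_gt)
  next
    fix n
    have "\<eta> + of_real (real n * \<l>) + of_real \<l> \<noteq> 0" using nz[of "Suc n"] by (simp add: algebra_simps)
    then show "vholomorphic_on (\<lambda>w. matpow U n *v Rs f p b w (\<eta> + of_real (real n * \<l>))) {w. Re w > 0}"
      unfolding Rs_def using nz[of n]
      by (intro vholomorphic_intros holomorphic_intros hs) auto
  next
    fix w assume "w \<in> {w. Re w > 0}"
    then have w: "Re w > 0" by simp
    obtain d h where "d > 0" "summable (h :: nat \<Rightarrow> real)"
      and ev: "\<forall>\<^sub>F n in sequentially. \<forall>w\<in>ball w d. \<forall>\<eta>\<in>ball \<eta> d.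
       norm (matpow U n *v Rs f p b w (\<eta> + of_real (real n * \<l>))) \<le> h n"
      using Rs_locally_dominated[OF assms(1) w assms(2)] by (elim exE conjE)
    then show "\<exists>d h. 0 < d \<and> summable (h :: nat \<Rightarrow> real) \<and>
      (\<forall>\<^sub>F n in sequentially. \<forall>y\<in>ball w d \<inter> {w. Re w > 0}.
         norm (matpow U n *v Rs f p b y (\<eta> + of_real (real n * \<l>))) \<le> h n)"
      by (intro exI[of _ d] exI[of _ h]) (auto elim!: eventually_mono)
  qed (use nz[of 0] in simp)
qed

section \<open>Holomorphy of the regularised sum in the space variable\<close>

definition orbit_domain :: "complex set \<Rightarrow> complex set" where
  "orbit_domain G = {\<eta> \<in> slit. \<forall>n. 1 / (\<eta> + of_real (real n * \<l>)) \<in> G}"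

text \<open>Infinitely many open conditions, but those for large n hold automatically near a given
  point: 1 / (\<eta> + n l) then lies in a disc about 0 inside G. Only finitely many remain to be
  intersected.\<close>

lemma open_orbit_domain:
  assumes "open G" "0 \<in> G"
  shows "open (orbit_domain G)"
  unfolding open_contains_ball
proof
  fix \<eta> assume "\<eta> \<in> orbit_domain G"
  then have \<eta>: "\<eta> \<in> slit" "\<And>n. 1 / (\<eta> + of_real (real n * \<l>)) \<in> G" by (auto simp: orbit_domain_def)
  obtain r where r: "r > 0" "ball 0 r \<subseteq> G" using assms open_contains_ball by blast
  obtain d0 where d0: "d0 > 0" "ball \<eta> d0 \<subseteq> slit"
    using open_slit \<eta> open_contains_ball by blast
  have "filterlim (\<lambda>n. real n * \<l>) at_top sequentially" using ell_pos by real_asymp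
  then have "\<forall>\<^sub>F n in sequentially. real n * \<l> \<ge> cmod \<eta> + 1 + 2 / r" by (simp add: filterlim_at_top)
  then obtain N where N: "\<And>n. n \<ge> N \<Longrightarrow> real n * \<l> \<ge> cmod \<eta> + 1 + 2 / r"
    by (auto simp: eventually_sequentially)
  have "open (\<Inter>n\<in>{..<N}. slit \<inter> (\<lambda>\<eta>. 1 / (\<eta> + of_real (real n * \<l>))) -` G)"
  proof (intro open_INT ballI)
    fix n
    have "\<eta> + of_real (real n * \<l>) \<noteq> 0" if "\<eta> \<in> slit" for \<eta>
      using slit_add[OF that, of "real n * \<l>"] ell_pos by (intro slit_nonzero) auto
    then show "open (slit \<inter> (\<lambda>\<eta>. 1 / (\<eta> + of_real (real n * \<l>))) -` G)"
      by (intro continuous_open_preimage[OF _ open_slit assms(1)] continuous_intros) auto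
  qed auto
  moreover have "\<eta> \<in> (\<Inter>n\<in>{..<N}. slit \<inter> (\<lambda>\<eta>. 1 / (\<eta> + of_real (real n * \<l>))) -` G)"
    using \<eta> by auto
  ultimately obtain d1 where d1: "d1 > 0"
    "ball \<eta> d1 \<subseteq> (\<Inter>n\<in>{..<N}. slit \<inter> (\<lambda>\<eta>. 1 / (\<eta> + of_real (real n * \<l>))) -` G)"
    by (rule openE)
  define d where "d = min 1 (min d0 d1)"
  have "\<zeta> \<in> orbit_domain G" if "\<zeta> \<in> ball \<eta> d" for \<zeta>
    unfolding orbit_domain_def mem_Collect_eq
  proof (intro conjI allI)
    show "\<zeta> \<in> slit" using that d0 by (auto simp: d_def)
    fix n
    show "1 / (\<zeta> + of_real (real n * \<l>)) \<in> G"
    proof (cases "n < N")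
      case True
      have "\<zeta> \<in> ball \<eta> d1" using that by (simp add: d_def)
      then show ?thesis using d1(2) True by blast
    next
      case False
      have "cmod (\<zeta> - \<eta>) < 1" using that by (simp add: dist_norm norm_minus_commute d_def)
      then have "cmod \<zeta> \<le> cmod \<eta> + 1" using norm_triangle_sub[of \<zeta> \<eta>] by linarith
      moreover have "real n * \<l> \<le> cmod (\<zeta> + of_real (real n * \<l>)) + cmod \<zeta>"
        using norm_triangle_ineq4[of "\<zeta> + of_real (real n * \<l>)" \<zeta>] ell_pos by (simp add: norm_mult)
      ultimately have "cmod (\<zeta> + of_real (real n * \<l>)) \<ge> 2 / r" using N[of n] False by linarith
      moreover have "2 / r > 0" "1 / r < 2 / r" using r by (auto simp: field_simps)
      ultimately have "cmod (\<zeta> + of_real (real n * \<l>)) > 1 / r" "cmod (\<zeta> + of_real (real n * \<l>)) > 0"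
        by linarith+
      then have "1 / cmod (\<zeta> + of_real (real n * \<l>)) < r"
        using r by (simp add: field_simps)
      then have "cmod (1 / (\<zeta> + of_real (real n * \<l>))) < r"
        by (simp add: norm_divide)
      then show ?thesis using r by auto
    qed
  qed
  then show "\<exists>e>0. ball \<eta> e \<subseteq> orbit_domain G"
    using d0 d1 by (intro exI[of _ d]) (auto simp: d_def)
qed

lemma Ks_holomorphic:
  assumes adm: "admissible f p b" and w: "Re w > 0"
    and G: "open G" "0 \<in> G" "vholomorphic_on f G"
  shows "vholomorphic_on (Ks f p b w) (orbit_domain G)"
proof -
  have sl: "\<eta> + of_real t \<in> slit" if "\<eta> \<in> orbit_domain G" "t \<ge> 0" for \<eta> t
    using slit_add that by (auto simp: orbit_domain_def)
  have hs: "vholomorphic_on (\<lambda>\<eta>. hs p b w (\<eta> + of_real t)) (orbit_domain G)" if "t \<ge> 0" for t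
    unfolding hs_def using sl that
    by (intro vholomorphic_intros holomorphic_intros) (auto dest: slit_nonzero slit_not_nonpos)
  have "vholomorphic_on (\<lambda>\<eta>. Ks f p b w \<eta>) (orbit_domain G)" unfolding Ks_def
  proof (intro vholomorphic_on_add vholomorphic_suminf)
    show "open (orbit_domain G)" using open_orbit_domain G by blast
  next
    fix n
    have f: "vholomorphic_on (\<lambda>\<eta>. f (1 / (\<eta> + of_real (real n * \<l>)))) (orbit_domain G)"
    proof (rule vholomorphic_on_compose[OF G(3)])
      show "(\<lambda>\<eta>. 1 / (\<eta> + of_real (real n * \<l>))) holomorphic_on orbit_domain G"
        using slit_nonzero[OF sl[of _ "real n * \<l>"]] ell_pos by (intro holomorphic_intros) auto
    qed (simp add: orbit_domain_def)
    have "vholomorphic_on (\<lambda>\<eta>. hs p b w (\<eta> + of_real (real n * \<l>) + of_real \<l>)) (orbit_domain G)"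
      using hs[of "real n * \<l> + \<l>"] ell_pos by (simp add: add.assoc)
    then show "vholomorphic_on (\<lambda>\<eta>. matpow U n *v Rs f p b w (\<eta> + of_real (real n * \<l>))) (orbit_domain G)"
      unfolding Rs_def using sl[of _ "real n * \<l>"] ell_pos hs[of "real n * \<l>"] f
      by (intro vholomorphic_intros holomorphic_intros) (auto dest: slit_nonzero slit_not_nonpos)
  next
    fix \<eta> assume "\<eta> \<in> orbit_domain G"
    then have "\<eta> \<in> slit" by (auto simp: orbit_domain_def)
    obtain d h where d: "d > 0" "summable (h :: nat \<Rightarrow> real)"
      and ev: "\<forall>\<^sub>F n in sequentially. \<forall>w\<in>ball w d. \<forall>\<eta>\<in>ball \<eta> d.
       norm (matpow U n *v Rs f p b w (\<eta> + of_real (real n * \<l>))) \<le> h n"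
      using Rs_locally_dominated[OF adm w \<open>\<eta> \<in> slit\<close>] by (elim exE conjE)
    then show "\<exists>d h. 0 < d \<and> summable (h :: nat \<Rightarrow> real) \<and>
      (\<forall>\<^sub>F n in sequentially. \<forall>y\<in>ball \<eta> d \<inter> orbit_domain G.
         norm (matpow U n *v Rs f p b w (y + of_real (real n * \<l>))) \<le> h n)"
      by (intro exI[of _ d] exI[of _ h]) (auto elim!: eventually_mono)
  qed (use hs[of 0] in simp)
  then show ?thesis .
qed

text \<open>The coboundary telescopes. The boundary term at N is what compensates the possible
  divergence of the plain partial sums.\<close>

lemma sum_Rs:
  "(\<Sum>n<N. matpow U n *v Rs f p b w (\<eta> + of_real (real n * \<l>))) =
     (\<Sum>n<N. matpow U n *v (((2 * w - 1) * (\<eta> + of_real (real n * \<l>)) powr (- 2 * w)) *s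
        f (1 / (\<eta> + of_real (real n * \<l>)))))
     - hs p b w \<eta> + matpow U N *v hs p b w (\<eta> + of_real (real N * \<l>))"
proof (induction N)
  case (Suc N)
  have X: "\<eta> + of_real (real N * \<l>) + of_real \<l> = \<eta> + of_real (real (Suc N) * \<l>)"
    by (simp add: algebra_simps)
  have "matpow U N *v Rs f p b w (\<eta> + of_real (real N * \<l>)) =
     matpow U N *v (((2 * w - 1) * (\<eta> + of_real (real N * \<l>)) powr (- 2 * w)) *s
        f (1 / (\<eta> + of_real (real N * \<l>))))
     - matpow U N *v hs p b w (\<eta> + of_real (real N * \<l>))
     + matpow U (Suc N) *v hs p b w (\<eta> + of_real (real (Suc N) * \<l>))"
    unfolding Rs_def matpow_Suc_mult X
    by (simp only: matrix_vector_right_distrib matrix_vector_mult_diff_distrib)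
  then show ?case using Suc by simp
qed simp

lemma Ks_limit:
  assumes "admissible f p b" "Re w > 0" "\<eta> \<in> slit"
  shows "(\<lambda>N. (\<Sum>n<N. matpow U n *v (((2 * w - 1) * (\<eta> + of_real (real n * \<l>)) powr (- 2 * w)) *s
        f (1 / (\<eta> + of_real (real n * \<l>)))))
     + matpow U N *v hs p b w (\<eta> + of_real (real N * \<l>))) \<longlonglongrightarrow> Ks f p b w \<eta>"
proof -
  have "(\<lambda>N. hs p b w \<eta> + (\<Sum>n<N. matpow U n *v Rs f p b w (\<eta> + of_real (real n * \<l>)))) \<longlonglongrightarrow> Ks f p b w \<eta>"
    unfolding Ks_def by (intro tendsto_intros summable_LIMSEQ summable_Rs assms)
  then show ?thesis unfolding sum_Rs by simp
qed

lemma norm_powr_orbit: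
  assumes "Re \<beta> < 0"
  shows "(\<lambda>N. cmod ((\<eta> + of_real (real N * \<l>)) powr \<beta>)) \<longlonglongrightarrow> 0"
proof (rule tendsto_sandwich[OF _ _ tendsto_const])
  have lim: "filterlim (\<lambda>n. real n * (\<l> / 2)) at_top sequentially"
    using ell_pos by real_asymp
  then have "\<forall>\<^sub>F n in sequentially. real n * (\<l> / 2) \<ge> cmod \<eta> + 1"
    unfolding filterlim_at_top by blast
  then show "\<forall>\<^sub>F n in sequentially. cmod ((\<eta> + of_real (real n * \<l>)) powr \<beta>)
      \<le> (real n * (\<l> / 2)) powr Re \<beta> * exp (pi * \<bar>Im \<beta>\<bar>)"
  proof eventually_elim
    case (elim n)
    have "real n * \<l> \<le> cmod (\<eta> + of_real (real n * \<l>)) + cmod \<eta>"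
      using norm_triangle_ineq4[of "\<eta> + of_real (real n * \<l>)" \<eta>] ell_pos by (simp add: norm_mult)
    then have ge: "real n * (\<l> / 2) \<le> cmod (\<eta> + of_real (real n * \<l>))" using elim by simp
    have pos: "real n * (\<l> / 2) > 0" using elim norm_ge_zero[of \<eta>] by linarith
    have nz: "\<eta> + of_real (real n * \<l>) \<noteq> 0" using ge pos by auto
    have "cmod ((\<eta> + of_real (real n * \<l>)) powr \<beta>)
      \<le> cmod (\<eta> + of_real (real n * \<l>)) powr Re \<beta> * exp (pi * \<bar>Im \<beta>\<bar>)"
      using cmod_powr_le[OF nz] .
    also have "\<dots> \<le> (real n * (\<l> / 2)) powr Re \<beta> * exp (pi * \<bar>Im \<beta>\<bar>)"
      using ge pos assms by (intro mult_right_mono powr_mono2') auto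
    finally show ?case .
  qed
  have "((\<lambda>x::real. x powr Re \<beta>) \<longlongrightarrow> 0) at_top" using assms by (rule tendsto_neg_powr[OF _ filterlim_ident])
  then have "(\<lambda>n. (real n * (\<l> / 2)) powr Re \<beta>) \<longlonglongrightarrow> 0"
    by (rule filterlim_compose[OF _ lim])
  then show "(\<lambda>n. (real n * (\<l> / 2)) powr Re \<beta> * exp (pi * \<bar>Im \<beta>\<bar>)) \<longlonglongrightarrow> 0"
    by (rule tendsto_mult_left_zero)
qed auto

text \<open>For Re w > 1/2 both parts of the boundary term, of orders X^(1 - 2 w) and X^(-2 w), tend
  to zero, so the plain series converges to the regularised one.\<close>

lemma Ks_sums:
  assumes "admissible f p b" "Re w > 1/2" "\<eta> \<in> slit"
  shows "(\<lambda>n. matpow U n *v ((\<eta> + of_real (real n * \<l>)) powr (- 2 * w) *s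
        f (1 / (\<eta> + of_real (real n * \<l>))))) sums ((1 / (2 * w - 1)) *s Ks f p b w \<eta>)"
proof -
  let ?X = "\<lambda>n. \<eta> + of_real (real n * \<l>)"
  have nz: "2 * w - 1 \<noteq> 0"
  proof
    assume "2 * w - 1 = 0"
    then have "Re (2 * w - 1) = 0" by simp
    then show False using assms(2) by simp
  qed
  have Xnz: "?X n \<noteq> 0" for n
    using slit_add[OF assms(3), of "real n * \<l>"] ell_pos by (intro slit_nonzero) auto
  have "(\<lambda>N. norm (matpow U N *v hs p b w (?X N))) \<longlonglongrightarrow> 0"
  proof (rule tendsto_sandwich[OF _ _ tendsto_const])
    show "\<forall>\<^sub>F N in sequentially. norm (matpow U N *v hs p b w (?X N)) \<le>
      cmod (?X N powr (1 - 2 * w)) * norm p + cmod (?X N powr (- 2 * w)) * norm ((2 * w - 1) *s b)"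
    proof (intro always_eventually allI)
      fix N
      have "hs p b w (?X N) = (?X N powr (1 - 2 * w)) *s p + (?X N powr (- 2 * w)) *s ((2 * w - 1) *s b)"
        using Xnz[of N] powr_add[of "?X N" 1 "- 2 * w"]
        by (simp add: hs_def vec_eq_iff algebra_simps powr_to_1)
      then show "norm (matpow U N *v hs p b w (?X N)) \<le>
         cmod (?X N powr (1 - 2 * w)) * norm p + cmod (?X N powr (- 2 * w)) * norm ((2 * w - 1) *s b)"
        by (simp only: norm_matpow) (metis norm_triangle_ineq norm_vector_smult)
    qed
    show "(\<lambda>N. cmod (?X N powr (1 - 2 * w)) * norm p + cmod (?X N powr (- 2 * w)) * norm ((2 * w - 1) *s b)) \<longlonglongrightarrow> 0"
      by (intro tendsto_add_zero tendsto_mult_left_zero norm_powr_orbit) (use assms(2) in auto)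
  qed auto
  then have "(\<lambda>N. matpow U N *v hs p b w (?X N)) \<longlonglongrightarrow> 0" by (rule tendsto_norm_zero_cancel)
  then have "(\<lambda>N. \<Sum>n<N. matpow U n *v (((2 * w - 1) * ?X n powr (- 2 * w)) *s f (1 / ?X n)))
    \<longlonglongrightarrow> Ks f p b w \<eta>"
    using tendsto_diff[OF Ks_limit[OF assms(1) _ assms(3), of w]] assms(2) by fastforce
  then have "(\<lambda>N. (1 / (2 * w - 1)) *s (\<Sum>n<N. matpow U n *v (((2 * w - 1) * ?X n powr (- 2 * w)) *s f (1 / ?X n))))
    \<longlonglongrightarrow> (1 / (2 * w - 1)) *s Ks f p b w \<eta>" by (intro tendsto_intros)
  moreover have "(1 / (2 * w - 1)) *s (\<Sum>n<N. matpow U n *v (((2 * w - 1) * ?X n powr (- 2 * w)) *s f (1 / ?X n)))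
     = (\<Sum>n<N. matpow U n *v (?X n powr (- 2 * w) *s f (1 / ?X n)))" for N
    using nz by (simp add: vec_eq_iff matrix_vector_mult_smult sum_component sum_distrib_left)
  ultimately show ?thesis unfolding sums_def by simp
qed

text \<open>The uniqueness principle. Any solution \<Phi> of the difference equation telescopes in
  the same way, and the powers of U, being isometric, do not enlarge the difference of the boundary
  terms.\<close>

lemma Ks_eqI:
  assumes adm: "admissible f p b" and w: "Re w > 0" and \<eta>: "\<eta> \<in> slit"
    and tele: "\<And>n. \<Phi> (\<eta> + of_real (real n * \<l>)) - U *v \<Phi> (\<eta> + of_real (real (Suc n) * \<l>)) =
       ((2 * w - 1) * (\<eta> + of_real (real n * \<l>)) powr (- 2 * w)) *s f (1 / (\<eta> + of_real (real n * \<l>)))"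
    and lim: "(\<lambda>n. norm (hs p b w (\<eta> + of_real (real n * \<l>)) - \<Phi> (\<eta> + of_real (real n * \<l>)))) \<longlonglongrightarrow> 0"
  shows "Ks f p b w \<eta> = \<Phi> \<eta>"
proof -
  let ?X = "\<lambda>n. \<eta> + of_real (real n * \<l>)"
  have "(\<Sum>n<N. matpow U n *v (((2 * w - 1) * ?X n powr (- 2 * w)) *s f (1 / ?X n)))
     = \<Phi> \<eta> - matpow U N *v \<Phi> (?X N)" for N
  proof (induction N)
    case (Suc N)
    have "matpow U N *v (((2 * w - 1) * ?X N powr (- 2 * w)) *s f (1 / ?X N))
       = matpow U N *v \<Phi> (?X N) - matpow U (Suc N) *v \<Phi> (?X (Suc N))"
      unfolding tele[symmetric] matpow_Suc_mult by (simp add: matrix_vector_mult_diff_distrib)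
    then show ?case using Suc by simp
  qed simp
  then have 1: "(\<lambda>N. \<Phi> \<eta> - matpow U N *v \<Phi> (?X N) + matpow U N *v hs p b w (?X N)) \<longlonglongrightarrow> Ks f p b w \<eta>"
    using Ks_limit[OF adm w \<eta>] by (simp only:)
  have "(\<lambda>N. norm (matpow U N *v (hs p b w (?X N) - \<Phi> (?X N)))) \<longlonglongrightarrow> 0"
    using lim by (simp only: norm_matpow)
  then have "(\<lambda>N. \<Phi> \<eta> + matpow U N *v (hs p b w (?X N) - \<Phi> (?X N))) \<longlonglongrightarrow> \<Phi> \<eta> + 0"
    by (rule tendsto_add[OF tendsto_const tendsto_norm_zero_cancel])
  moreover have "\<Phi> \<eta> + matpow U N *v (hs p b w (?X N) - \<Phi> (?X N)) =
     \<Phi> \<eta> - matpow U N *v \<Phi> (?X N) + matpow U N *v hs p b w (?X N)" for N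
    by (simp add: matrix_vector_mult_diff_distrib)
  ultimately have "(\<lambda>N. \<Phi> \<eta> - matpow U N *v \<Phi> (?X N) + matpow U N *v hs p b w (?X N)) \<longlonglongrightarrow> \<Phi> \<eta>"
    by (simp only: add_0_right)
  with 1 show ?thesis by (rule LIMSEQ_unique)
qed

text \<open>Split off the term with n = 0. Its \<open>- hs\<close> cancels the leading
  \<open>hs\<close>, and its translated \<open>hs\<close> starts the sum at \<eta> + l.\<close>

lemma Ks_shift:
  assumes adm: "admissible f p b" and w: "Re w > 0" and \<eta>: "\<eta> \<in> slit"
  shows "Ks f p b w \<eta> = ((2 * w - 1) * \<eta> powr (- 2 * w)) *s f (1 / \<eta>) + U *v Ks f p b w (\<eta> + of_real \<l>)"
proof -
  let ?X = "\<lambda>n. \<eta> + of_real (real n * \<l>)"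
  let ?g = "\<lambda>n. matpow U n *v Rs f p b w (?X n)"
  have \<eta>': "\<eta> + of_real \<l> \<in> slit" using slit_add[OF \<eta>] ell_pos by simp
  have X: "\<eta> + of_real \<l> + of_real (real n * \<l>) = ?X (Suc n)" for n by (simp add: algebra_simps)
  have s: "summable (\<lambda>n. matpow U n *v Rs f p b w (?X (Suc n)))"
    using summable_Rs[OF adm w \<eta>'] unfolding X .
  have "(\<Sum>n. ?g n) = ?g 0 + (\<Sum>n. ?g (Suc n))"
    using suminf_split_head[OF summable_Rs[OF adm w \<eta>]] by simp
  also have "(\<Sum>n. ?g (Suc n)) = (\<Sum>n. U *v (matpow U n *v Rs f p b w (?X (Suc n))))"
    by (simp only: matpow.simps matrix_vector_mul_assoc)
  also have "\<dots> = U *v (\<Sum>n. matpow U n *v Rs f p b w (?X (Suc n)))"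
    by (rule bounded_linear.suminf[OF bounded_linear_matrix_vector_complex s, symmetric])
  finally show ?thesis
    unfolding Ks_def X by (simp add: Rs_def[where X = \<eta>] matrix_vector_right_distrib)
qed

text \<open>By the mean value theorem each term y^(-2a-1) is at most a constant times (y - l)^(-2a)
  - y^(-2a), and these differences telescope. The tail thus has the order of the term b in
  \<open>hs\<close>, that is, O(1) once the weight is removed.\<close>

lemma Ks_real_asymptotics:
  assumes adm: "admissible f p b" and w: "Re w > 0"
  obtains C B where "B > 0" "\<And>x. x \<ge> B \<Longrightarrow> norm (Ks f p b w (of_real x) - hs p b w (of_real x)) \<le> C * x powr (- 2 * Re w)"
proof -
  define a where "a = Re w"
  obtain C X0 where C: "C > 0" "X0 > 0" "\<And>X. X \<in> slit \<Longrightarrow> cmod X \<ge> X0 \<Longrightarrow>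
       norm (Rs f p b w X) \<le> C * cmod X powr (- 2 * Re w - 1)"
    using Rs_bound[OF adm norm_ge_zero[of w]] by (metis order_refl)
  \<comment> \<open>The bound B \<ge> 2 l gives x - l \<ge> x / 2, which absorbs the shift by l into
    a constant.\<close>
  define B where "B = max X0 (2 * \<l>)"
  have B: "B > 0" "B \<ge> X0" "B \<ge> 2 * \<l>" using ell_pos by (auto simp: B_def)
  have tele: "y powr (- 2 * a - 1) \<le> ((y - \<l>) powr (- 2 * a) - y powr (- 2 * a)) / (2 * a * \<l>)" if y: "y > \<l>" for y
  proof -
    have d: "((\<lambda>y. y powr (- 2 * a)) has_real_derivative (- 2 * a) * t powr (- 2 * a - 1)) (at t)" if "t \<ge> y - \<l>" for t
      using that y by (auto intro!: derivative_eq_intros simp: powr_diff)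
    obtain t where t: "y - \<l> < t" "t < y"
      "y powr (- 2 * a) - (y - \<l>) powr (- 2 * a) = (y - (y - \<l>)) * ((- 2 * a) * t powr (- 2 * a - 1))"
      using MVT2[of "y - \<l>" y "\<lambda>y. y powr (- 2 * a)" "\<lambda>t. (- 2 * a) * t powr (- 2 * a - 1)"] d ell_pos by auto
    have "y powr (- 2 * a - 1) \<le> t powr (- 2 * a - 1)"
      using t y w by (intro powr_mono2') (auto simp: a_def)
    then have "(2 * a * \<l>) * y powr (- 2 * a - 1) \<le> (2 * a * \<l>) * t powr (- 2 * a - 1)"
      using w ell_pos by (intro mult_left_mono) (auto simp: a_def)
    also have "\<dots> = (y - \<l>) powr (- 2 * a) - y powr (- 2 * a)" using t(3) by (simp add: algebra_simps)
    finally show ?thesis using w ell_pos by (simp add: pos_le_divide_eq a_def mult_ac)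
  qed
  have "norm (Ks f p b w (of_real x) - hs p b w (of_real x)) \<le> (C / (2 * a * \<l>) * (1/2) powr (- 2 * a)) * x powr (- 2 * Re w)" if x: "x \<ge> B" for x
  proof -
    let ?g = "\<lambda>n. matpow U n *v Rs f p b w (of_real x + of_real (real n * \<l>))"
    define u where "u = (\<lambda>n. (x + real n * \<l> - \<l>) powr (- 2 * a))"
    have le: "norm (?g n) \<le> C / (2 * a * \<l>) * (u n - u (Suc n))" for n
    proof -
      have y: "x + real n * \<l> \<ge> X0" "x + real n * \<l> > \<l>" "x + real n * \<l> > 0"
        using x B ell_pos by (smt (verit) mult_nonneg_nonneg of_nat_0_le_iff)+
      have sl: "of_real (x + real n * \<l>) \<in> slit" using y by (simp add: slit_iff del: of_real_add)
      have "norm (?g n) = norm (Rs f p b w (of_real (x + real n * \<l>)))" by simp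
      also have "\<dots> \<le> C * cmod (of_real (x + real n * \<l>)) powr (- 2 * Re w - 1)"
        by (rule C(3)[OF sl]) (use y in \<open>simp del: of_real_add\<close>)
      also have "\<dots> = C * (x + real n * \<l>) powr (- 2 * a - 1)"
        using y by (simp add: a_def del: of_real_add)
      also have "\<dots> \<le> C * ((((x + real n * \<l>) - \<l>) powr (- 2 * a) - (x + real n * \<l>) powr (- 2 * a)) / (2 * a * \<l>))"
        using tele[OF y(2)] C(1) by (intro mult_left_mono) auto
      also have "\<dots> = C / (2 * a * \<l>) * (u n - u (Suc n))"
        by (simp add: u_def algebra_simps diff_divide_distrib)
      finally show ?thesis .
    qed
    have "(\<lambda>n. u n) \<longlonglongrightarrow> 0"
    proof -
      have "filterlim (\<lambda>n. x + real n * \<l> - \<l>) at_top sequentially" using ell_pos by real_asymp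
      then show ?thesis unfolding u_def
        using w by (intro tendsto_neg_powr) (auto simp: a_def)
    qed
    then have "(\<lambda>n. u n - u (Suc n)) sums (u 0 - 0)" by (rule telescope_sums')
    then have s: "(\<lambda>n. C / (2 * a * \<l>) * (u n - u (Suc n))) sums (C / (2 * a * \<l>) * u 0)"
      using sums_mult by fastforce
    have "norm (suminf ?g) \<le> (\<Sum>n. C / (2 * a * \<l>) * (u n - u (Suc n)))"
      by (rule norm_suminf_le[OF le]) (use s in \<open>simp add: sums_iff\<close>)
    also have "\<dots> = C / (2 * a * \<l>) * u 0" using s by (simp add: sums_iff)
    also have "\<dots> \<le> C / (2 * a * \<l>) * ((1/2) powr (- 2 * a) * x powr (- 2 * Re w))"
    proof (intro mult_left_mono)
      have "u 0 \<le> (x * (1/2)) powr (- 2 * a)"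
        unfolding u_def using x B ell_pos w by (intro powr_mono2') (auto simp: a_def)
      also have "(x * (1/2)) powr (- 2 * a) = (1/2) powr (- 2 * a) * x powr (- 2 * Re w)"
        using x B powr_mult[of x "1/2" "- 2 * a"] by (simp add: a_def mult.commute)
      finally show "u 0 \<le> (1/2) powr (- 2 * a) * x powr (- 2 * Re w)" .
    qed (use C(1) w ell_pos in \<open>simp add: a_def\<close>)
    finally have "norm (suminf ?g) \<le> C / (2 * a * \<l>) * ((1/2) powr (- 2 * a) * x powr (- 2 * Re w))" .
    moreover have "Ks f p b w (of_real x) - hs p b w (of_real x) = suminf ?g"
      unfolding Ks_def by (rule add_diff_cancel_left')
    ultimately show ?thesis by (simp only: mult.assoc)
  qed
  then show ?thesis using that B(1) by blast
qed

text \<open>The orthogonal complement of the range of \<open>1 - U\<close> consists of fixed vectors, as \<open>U\<close> is isometric.\<close>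

lemma fixed_decomposition:
  obtains p b where "U *v p = p" "a = p + (b - U *v b)" "\<And>x. inner p (U *v x) = inner p x"
proof -
  define R where "R = range (\<lambda>b. b - U *v b)"
  have lin: "linear (\<lambda>b. b - U *v b)"
    using linear_compose_sub[OF linear_id linear_matrix_vector_complex[of U]] by (simp add: id_def)
  \<comment> \<open>Orthogonality refers to the real inner product of the underlying Euclidean
    space, for which the isometry U preserves lengths as well.\<close>
  have "subspace R" unfolding R_def by (rule linear_subspace_image[OF lin subspace_UNIV])
  then have sp: "span R = R" by (simp add: span_eq_iff)
  obtain y z where y: "y \<in> span R" and z: "\<And>w. w \<in> span R \<Longrightarrow> orthogonal z w" and a: "a = y + z"
    by (rule orthogonal_subspace_decomp_exists[of R a]) blast
  obtain b where b: "y = b - U *v b" using y unfolding sp by (auto simp: R_def)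
  have orth: "inner z (U *v x) = inner z x" for x
  proof -
    have "x - U *v x \<in> span R" unfolding sp by (auto simp: R_def)
    then have "orthogonal z (x - U *v x)" by (rule z)
    then show ?thesis by (simp add: orthogonal_def inner_diff_right)
  qed
  have "(norm (U *v z - z))\<^sup>2 = (norm (U *v z))\<^sup>2 + (norm z)\<^sup>2 - 2 * inner z (U *v z)"
    by (simp add: power2_norm_eq_inner inner_diff inner_commute algebra_simps)
  also have "\<dots> = 0" by (simp add: isometry orth power2_norm_eq_inner)
  finally have "U *v z = z" by simp
  then show ?thesis using that[of z b] a b orth by (simp add: add.commute)
qed

lemma vholomorphic_linear_bound:
  assumes "open G" "0 \<in> G" "vholomorphic_on f G"
  shows "\<exists>C r. r > 0 \<and> (\<forall>v. cmod v < r \<longrightarrow> norm (f v - f 0) \<le> C * cmod v)"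
proof -
  obtain e where e: "e > 0" "cball 0 e \<subseteq> G" using assms open_contains_cball by blast
  have "\<exists>B. \<forall>v. cmod v \<le> e \<longrightarrow> cmod (f v $ i - f 0 $ i) \<le> B * cmod v" for i
  proof -
    have hol: "(\<lambda>z. f z $ i) holomorphic_on G" using assms(3) by (rule vholomorphic_onD)
    then have "deriv (\<lambda>z. f z $ i) holomorphic_on G" using assms(1) holomorphic_deriv by blast
    then have "continuous_on (cball 0 e) (deriv (\<lambda>z. f z $ i))"
      using continuous_on_subset[OF holomorphic_on_imp_continuous_on e(2)] by simp
    then have "compact (deriv (\<lambda>z. f z $ i) ` cball 0 e)"
      by (intro compact_continuous_image) auto
    then have "bounded (deriv (\<lambda>z. f z $ i) ` cball 0 e)" by (rule compact_imp_bounded)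
    then obtain B where "\<forall>x\<in>deriv (\<lambda>z. f z $ i) ` cball 0 e. cmod x \<le> B"
      unfolding bounded_iff by (elim exE)
    then have B: "\<And>v. cmod v \<le> e \<Longrightarrow> cmod (deriv (\<lambda>z. f z $ i) v) \<le> B" by auto
    have "cmod (f v $ i - f 0 $ i) \<le> B * cmod (v - 0)" if "cmod v \<le> e" for v
    proof (rule field_differentiable_bound[OF convex_cball[of 0 e]])
      fix z assume "z \<in> cball (0::complex) e"
      then show "((\<lambda>z. f z $ i) has_field_derivative deriv (\<lambda>z. f z $ i) z) (at z within cball 0 e)"
        using holomorphic_derivI[OF hol assms(1)] e(2) by blast
    qed (use that B e in auto)
    then show ?thesis by auto
  qed
  then obtain B where B: "\<And>i v. cmod v \<le> e \<Longrightarrow> cmod (f v $ i - f 0 $ i) \<le> B i * cmod v" by metis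
  have "norm (f v - f 0) \<le> (\<Sum>i\<in>UNIV. B i) * cmod v" if "cmod v < e" for v
  proof -
    have "norm (f v - f 0) \<le> (\<Sum>i\<in>UNIV. cmod ((f v - f 0) $ i))" 
      unfolding norm_vec_def by (rule L2_set_le_sum) simp
    also have "\<dots> \<le> (\<Sum>i\<in>UNIV. B i * cmod v)" using B that by (intro sum_mono) auto
    finally show ?thesis by (simp add: sum_distrib_right)
  qed
  then show ?thesis using e(1) by blast
qed

text \<open>The decomposition of f(0) supplies p and b, with p rescaled because one translation step
  of p X contributes l p; the Lipschitz clause follows from holomorphy.\<close>

lemma admissible_exists:
  assumes "open G" "0 \<in> G" "vholomorphic_on f G"
  obtains p b where "admissible f p b"
proof -
  obtain p b where p: "U *v p = p" "f 0 = p + (b - U *v b)" using fixed_decomposition by metis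
  have "admissible f ((1 / \<l>) *\<^sub>R p) b"
    unfolding admissible_def using p ell_pos vholomorphic_linear_bound[OF assms]
    by (simp add: matrix_vector_mult_scaleR_complex)
  then show ?thesis using that by blast
qed

end

section \<open>Meromorphic continuation in the exponent\<close>

text \<open>The difference vanishes on a half plane, hence near every point of the connected domain
  except possibly at the point itself. At s the normalisation decides: both functions are 0 at a
  common pole, and both equal their limit otherwise.\<close>

lemma nicely_meromorphic_identity:
  fixes f g :: "complex \<Rightarrow> complex"
  assumes f: "f nicely_meromorphic_on {w. Re w > c}" and g: "g nicely_meromorphic_on {w. Re w > c}"
    and eq: "\<And>w. Re w > a \<Longrightarrow> f w = g w" and s: "Re s > c"
  shows "f s = g s"
proof -
  let ?A = "{w. Re w > c}"
  have opA: "open ?A" by (simp add: open_halfspace_Re_gt)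
  have conA: "connected ?A" by (intro convex_connected convex_halfspace_Re_gt)
  have fm: "f meromorphic_on ?A" and gm: "g meromorphic_on ?A"
    using f g by (auto simp: nicely_meromorphic_on_def)
  have "(\<lambda>w. f w - g w) meromorphic_on ?A" by (intro meromorphic_intros fm gm)
  from meromorphic_imp_constant_or_avoid[OF this opA conA, of 0]
  have ev: "eventually (\<lambda>w. f w - g w = 0) (cosparse ?A)"
  proof
    assume *: "eventually (\<lambda>w. f w - g w \<noteq> 0) (cosparse ?A)"
    define a0 :: complex where "a0 = of_real (max a c + 1)"
    have a0: "a0 \<in> ?A" "a0 \<in> {w. Re w > a}" by (auto simp: a0_def)
    have "\<forall>\<^sub>F z in at a0. f z - g z \<noteq> 0"
      using * a0(1) by (simp add: eventually_cosparse_open_eq opA)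
    moreover have "\<forall>\<^sub>F z in at a0. z \<in> {w. Re w > a}"
      using a0(2) by (intro eventually_at_in_open') (simp_all add: open_halfspace_Re_gt)
    ultimately have "\<forall>\<^sub>F z in at a0. False" by eventually_elim (use eq in auto)
    then show ?thesis by simp
  qed
  have eqs: "\<forall>\<^sub>F z in at s. f z = g z"
    using ev s by (simp add: eventually_cosparse_open_eq opA)
  have no: False if "is_pole h s" "h \<midarrow>s\<rightarrow> c" for h :: "complex \<Rightarrow> complex" and c
    using that not_tendsto_and_filterlim_at_infinity[of "at s" h c] by (simp add: is_pole_def)
  have pole: "is_pole f s \<longleftrightarrow> is_pole g s" by (rule is_pole_cong[OF eqs refl])
  have fs: "(is_pole f s \<and> f s = 0) \<or> f \<midarrow>s\<rightarrow> f s" and gs: "(is_pole g s \<and> g s = 0) \<or> g \<midarrow>s\<rightarrow> g s"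
    using f g s by (auto simp: nicely_meromorphic_on_def)
  show ?thesis
  proof (cases "is_pole f s")
    case True
    then show ?thesis using fs gs pole no by metis
  next
    case False
    then have "f \<midarrow>s\<rightarrow> f s" "g \<midarrow>s\<rightarrow> g s" using fs gs pole by auto
    moreover have "f \<midarrow>s\<rightarrow> g s" using \<open>g \<midarrow>s\<rightarrow> g s\<close> tendsto_cong[OF eqs] by simp
    ultimately show ?thesis using LIM_unique by blast
  qed
qed

text \<open>Reduces each evaluation of a fast operator to exhibiting one function K, holomorphic for
  Re w > 0. The description in \<open>mero_continuation\<close> is met by K / (2 w - 1), and
  uniquely so by the identity theorem.\<close>

lemma mero_continuation_eq:
  fixes F K :: "complex \<Rightarrow> complex^'n"
  assumes K: "vholomorphic_on K {w. Re w > 0}"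
    and F: "\<And>w. Re w > 1/2 \<Longrightarrow> F w = (1 / (2 * w - 1)) *s K w"
    and s: "Re s > 0" "s \<noteq> 1/2"
  shows "mero_continuation (1/2) F s = (1 / (2 * s - 1)) *s K s"
proof (cases "Re s > 1/2")
  case True
  then show ?thesis using F by (simp add: mero_continuation_def)
next
  case False
  let ?A = "{w. Re w > 0} :: complex set"
  let ?H = "\<lambda>i w. (1 / (2 * w - 1)) * K w $ i"
  \<comment> \<open>At w = 1/2 the quotient as written is 0 by the convention for division by zero,
    yet a component of K that vanishes there has a removable singularity;
    \<open>remove_sings\<close> supplies the limit.\<close>
  define G where "G = (\<lambda>w. \<chi> i. remove_sings (?H i) w)"
  have opA: "open ?A" by (simp add: open_halfspace_Re_gt)
  have Kan: "(\<lambda>w. K w $ i) analytic_on ?A" for i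
    using vholomorphic_onD[OF K] opA by (simp add: analytic_on_open)
  have an: "?H i analytic_on {w}" if "Re w > 0" "w \<noteq> 1/2" for i w
  proof -
    have "2 * w - 1 \<noteq> 0" using that(2) by (auto simp: field_simps)
    then show ?thesis
      using that analytic_on_subset[OF Kan, of "{w}"] by (intro analytic_intros) auto
  qed
  have mero: "?H i meromorphic_on ?A" for i
    by (intro meromorphic_intros analytic_on_imp_meromorphic_on[OF Kan])
  have Gv: "G w = (1 / (2 * w - 1)) *s K w" if "Re w > 0" "w \<noteq> 1/2" for w
    using an[OF that] by (simp add: G_def vec_eq_iff)
  have Gnice: "(\<lambda>w. G w $ i) nicely_meromorphic_on ?A" for i
    unfolding G_def using remove_sings_nicely_meromorphic[OF mero] by simp
  have GF: "G w = F w" if "Re w > 1/2" for w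
  proof -
    have "w \<noteq> 1/2"
    proof
      assume "w = 1/2"
      then have "Re w = Re (1/2)" by (rule arg_cong)
      then show False using that by simp
    qed
    then show ?thesis using Gv[of w] F[OF that] that by simp
  qed
  have "(THE v. \<exists>b G. b < Re s \<and> (\<forall>i. (\<lambda>w. G w $ i) nicely_meromorphic_on {w. Re w > b}) \<and>
              (\<forall>w. Re w > 1/2 \<longrightarrow> G w = F w) \<and> v = G s) = G s"
  proof (rule the_equality)
    show "\<exists>b G'. b < Re s \<and> (\<forall>i. (\<lambda>w. G' w $ i) nicely_meromorphic_on {w. Re w > b}) \<and>
              (\<forall>w. Re w > 1/2 \<longrightarrow> G' w = F w) \<and> G s = G' s"
      using Gnice GF s(1) by blast
  next
    fix v assume "\<exists>b G. b < Re s \<and> (\<forall>i. (\<lambda>w. G w $ i) nicely_meromorphic_on {w. Re w > b}) \<and>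
              (\<forall>w. Re w > 1/2 \<longrightarrow> G w = F w) \<and> v = G s"
    then obtain b G' where b: "b < Re s" "\<And>i. (\<lambda>w. G' w $ i) nicely_meromorphic_on {w. Re w > b}"
      "\<And>w. Re w > 1/2 \<Longrightarrow> G' w = F w" "v = G' s" by blast
    have "G' s $ i = G s $ i" for i
    \<comment> \<open>The competing continuation lives on Re w > b for some b of either sign, so the
      comparison takes place on the smaller of the two half planes.\<close>
    proof (rule nicely_meromorphic_identity[where c = "max b 0" and a = "1/2" and s = s
          and f = "\<lambda>w. G' w $ i" and g = "\<lambda>w. G w $ i"])
      show "(\<lambda>w. G' w $ i) nicely_meromorphic_on {w. Re w > max b 0}"
        by (rule nicely_meromorphic_on_subset[OF b(2)]) auto
      show "(\<lambda>w. G w $ i) nicely_meromorphic_on {w. Re w > max b 0}"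
        by (rule nicely_meromorphic_on_subset[OF Gnice]) auto
    qed (use b GF s in auto)
    then show "v = G s" using b(4) by (simp add: vec_eq_iff)
  qed
  then show ?thesis using False Gv[OF s] by (simp add: mero_continuation_def)
qed

section \<open>The group elements\<close>

lemma matrix_2_eqI:
  fixes A B :: "real^2^2"
  assumes "A $ 1 $ 1 = B $ 1 $ 1" "A $ 1 $ 2 = B $ 1 $ 2" "A $ 2 $ 1 = B $ 2 $ 1" "A $ 2 $ 2 = B $ 2 $ 2"
  shows "A = B"
  using assms by (simp add: vec_eq_iff forall_2)

abbreviation mat2 :: "real \<Rightarrow> real \<Rightarrow> real \<Rightarrow> real \<Rightarrow> real^2^2" where
  "mat2 a b c d \<equiv> vector [vector [a, b], vector [c, d]]"

lemma mat2_mult: "mat2 a b c d ** mat2 a' b' c' d' =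
    mat2 (a * a' + b * c') (a * b' + b * d') (c * a' + d * c') (c * b' + d * d')"
  by (intro matrix_2_eqI) (simp_all add: matrix_matrix_mult_def sum_2)

lemma det_mat2: "det (mat2 a b c d) = a * d - b * c"
  by (simp add: det_2)

lemma mat_eq_mat2: "mat x = mat2 x 0 0 x"
  by (intro matrix_2_eqI) (simp_all add: mat_def)

lemma group_GL2: "group GL2"
proof (rule groupI)
  fix A assume "A \<in> carrier GL2"
  then show "\<exists>B\<in>carrier GL2. B \<otimes>\<^bsub>GL2\<^esub> A = \<one>\<^bsub>GL2\<^esub>"
    unfolding GL2_def invertible_def by auto
qed (auto simp: GL2_def matrix_mul_assoc invertible_det_nz det_mul)

lemma subgroup_scalars: "subgroup scalars GL2"
proof (rule group.subgroupI[OF group_GL2])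
  have inv: "invertible (mat c :: real^2^2)" if "c \<noteq> 0" for c
    using that by (simp add: invertible_det_nz mat_eq_mat2 det_mat2)
  then show "scalars \<subseteq> carrier GL2" by (auto simp: scalars_def GL2_def)
  show "scalars \<noteq> {}" by (auto simp: scalars_def intro: exI[of _ 1])
next
  fix A assume "A \<in> scalars"
  then obtain c where c: "c \<noteq> 0" "A = mat c" by (auto simp: scalars_def)
  have "inv\<^bsub>GL2\<^esub> A = mat (1 / c)"
    by (rule group.inv_equality[OF group_GL2])
       (use c in \<open>auto simp: GL2_def invertible_det_nz mat_eq_mat2 det_mat2 mat2_mult\<close>)
  then show "inv\<^bsub>GL2\<^esub> A \<in> scalars" using c by (auto simp: scalars_def)
next
  fix A B assume "A \<in> scalars" "B \<in> scalars"
  then obtain c d where "c \<noteq> 0" "A = mat c" "d \<noteq> 0" "B = mat d" by (auto simp: scalars_def)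
  then have "A \<otimes>\<^bsub>GL2\<^esub> B = mat (c * d)" "c * d \<noteq> 0" by (simp_all add: GL2_def mat_eq_mat2 mat2_mult)
  then show "A \<otimes>\<^bsub>GL2\<^esub> B \<in> scalars" unfolding scalars_def by blast
qed

lemma scalar_commutes: "mat c ** A = A ** mat c" for A :: "real^2^2"
  by (intro matrix_2_eqI) (simp_all add: matrix_matrix_mult_def sum_2 mat_def mult.commute)

lemma normal_scalars: "scalars \<lhd> GL2"
proof (rule group.normalI[OF group_GL2 subgroup_scalars], intro ballI)
  fix A show "scalars #>\<^bsub>GL2\<^esub> A = A <#\<^bsub>GL2\<^esub> scalars"
    unfolding r_coset_def l_coset_def by (auto simp: scalars_def GL2_def scalar_commutes)
qed

lemma group_PGL2: "group PGL2"
  unfolding PGL2_def using normal.factorgroup_is_group[OF normal_scalars] .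

lemma mat2_in_GL2: "a * d - b * c \<noteq> 0 \<Longrightarrow> mat2 a b c d \<in> carrier GL2"
  by (simp add: GL2_def invertible_det_nz det_mat2)

lemma pgl_in_PGL2: "a * d - b * c \<noteq> 0 \<Longrightarrow> pgl a b c d \<in> carrier PGL2"
  unfolding PGL2_def FactGroup_def pgl_def RCOSETS_def using mat2_in_GL2 by auto

lemma pgl_mult:
  assumes "a * d - b * c \<noteq> 0" "a' * d' - b' * c' \<noteq> 0"
  shows "pgl a b c d \<otimes>\<^bsub>PGL2\<^esub> pgl a' b' c' d' =
    pgl (a * a' + b * c') (a * b' + b * d') (c * a' + d * c') (c * b' + d * d')"
  using normal.rcos_sum[OF normal_scalars mat2_in_GL2[OF assms(1)] mat2_in_GL2[OF assms(2)]]
  by (simp add: PGL2_def FactGroup_def pgl_def mat2_mult GL2_def)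

lemma mem_pgl: "A \<in> pgl a b c d \<longleftrightarrow> (\<exists>t. t \<noteq> 0 \<and> A = mat2 (t * a) (t * b) (t * c) (t * d))"
  unfolding pgl_def r_coset_def scalars_def GL2_def by (auto simp: mat_eq_mat2 mat2_mult)

lemma pgl_scale:
  assumes "t \<noteq> 0"
  shows "pgl (t * a) (t * b) (t * c) (t * d) = pgl a b c d"
proof (intro Set.set_eqI iffI)
  fix A assume "A \<in> pgl (t * a) (t * b) (t * c) (t * d)"
  then obtain u where u: "u \<noteq> 0" "A = mat2 (u * (t * a)) (u * (t * b)) (u * (t * c)) (u * (t * d))"
    by (auto simp: mem_pgl)
  show "A \<in> pgl a b c d" unfolding mem_pgl by (rule exI[of _ "u * t"]) (use u assms in \<open>simp add: mult.assoc\<close>)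
next
  fix A assume "A \<in> pgl a b c d"
  then obtain u where u: "u \<noteq> 0" "A = mat2 (u * a) (u * b) (u * c) (u * d)" by (auto simp: mem_pgl)
  show "A \<in> pgl (t * a) (t * b) (t * c) (t * d)"
    unfolding mem_pgl by (rule exI[of _ "u / t"]) (use u assms in simp)
qed

lemma pgl_one: "\<one>\<^bsub>PGL2\<^esub> = pgl 1 0 0 1"
proof -
  have "\<one>\<^bsub>PGL2\<^esub> = scalars" by (simp add: PGL2_def FactGroup_def)
  also have "\<dots> = pgl 1 0 0 1"
    by (auto simp: mem_pgl scalars_def mat_eq_mat2)
  finally show ?thesis .
qed

lemma pgl_inv:
  assumes "a * d - b * c \<noteq> 0"
  shows "inv\<^bsub>PGL2\<^esub> (pgl a b c d) = pgl d (- b) (- c) a"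
proof (rule group.inv_equality[OF group_PGL2])
  have nz: "d * a - (- b) * (- c) \<noteq> 0" using assms by (simp add: mult.commute)
  have "pgl d (- b) (- c) a \<otimes>\<^bsub>PGL2\<^esub> pgl a b c d = pgl ((a * d - b * c) * 1) ((a * d - b * c) * 0) ((a * d - b * c) * 0) ((a * d - b * c) * 1)"
    unfolding pgl_mult[OF nz assms] by (simp add: algebra_simps)
  also have "\<dots> = \<one>\<^bsub>PGL2\<^esub>" unfolding pgl_one by (rule pgl_scale[OF assms])
  finally show "pgl d (- b) (- c) a \<otimes>\<^bsub>PGL2\<^esub> pgl a b c d = \<one>\<^bsub>PGL2\<^esub>" .
qed (use assms in \<open>auto intro!: pgl_in_PGL2 simp: mult.commute\<close>)

section \<open>Explicit formulas for the operators from a normalised representative\<close>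

lemma pgl_rep_pgl:
  assumes "c > 0 \<or> c = 0 \<and> d > 0"
  obtains t where "t > 0" "pgl_rep (pgl a b c d) = mat2 (t * a) (t * b) (t * c) (t * d)"
proof -
  let ?P = "\<lambda>A. A \<in> pgl a b c d \<and> (A $ 2 $ 1 > 0 \<or> A $ 2 $ 1 = 0 \<and> A $ 2 $ 2 > 0)"
  have "?P (mat2 a b c d)" using assms by (auto simp: mem_pgl intro: exI[of _ 1])
  then have P: "?P (pgl_rep (pgl a b c d))" unfolding pgl_rep_def by (rule someI)
  then obtain t where t: "t \<noteq> 0" "pgl_rep (pgl a b c d) = mat2 (t * a) (t * b) (t * c) (t * d)"
    by (auto simp: mem_pgl)
  have "t > 0" using P assms unfolding t(2) by (auto simp: zero_less_mult_iff)
  then show ?thesis using t(2) that by blast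
qed

text \<open>The chosen representative is known only up to a factor t > 0. The determinant
  contributes t^(2 s), the denominator t^(-2 s), and positivity of t keeps the branches fixed, so
  any matrix of determinant 1 or -1 with a suitable lower row computes the operator.\<close>

lemma alpha_pgl:
  assumes inv: "inv\<^bsub>PGL2\<^esub> h = pgl a b c d" and c: "c > 0 \<or> c = 0 \<and> d > 0" and det: "\<bar>a * d - b * c\<bar> = 1"
  shows "alpha \<rho> s h f z = (of_real c * z + of_real d) powr (- 2 * s) *s
     (\<rho> h *v f ((of_real a * z + of_real b) / (of_real c * z + of_real d)))"
proof -
  obtain t where t: "t > 0" "pgl_rep (pgl a b c d) = mat2 (t * a) (t * b) (t * c) (t * d)"
    using pgl_rep_pgl[OF c] by blast
  have den: "denom (pgl a b c d) z = of_real t * (of_real c * z + of_real d)"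
    by (simp add: denom_def t(2) algebra_simps)
  have mob: "mobius (pgl a b c d) z = (of_real a * z + of_real b) / (of_real c * z + of_real d)"
  proof -
    have "of_real (t * a) * z + of_real (t * b) = of_real t * (of_real a * z + of_real b)"
      by (simp add: algebra_simps)
    then show ?thesis using t(1) by (simp add: mobius_def den) (simp add: t(2))
  qed
  have "\<bar>det (pgl_rep (pgl a b c d))\<bar> = t\<^sup>2 * \<bar>a * d - b * c\<bar>"
  proof -
    have "det (pgl_rep (pgl a b c d)) = t\<^sup>2 * (a * d - b * c)"
      unfolding t(2) det_mat2 by (simp add: algebra_simps power2_eq_square)
    then show ?thesis by (simp add: abs_mult)
  qed
  then have "of_real \<bar>det (pgl_rep (pgl a b c d))\<bar> powr s * denom (pgl a b c d) z powr (- 2 * s) =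
     complex_of_real (t\<^sup>2) powr s * (of_real t * (of_real c * z + of_real d)) powr (- 2 * s)"
    using det by (simp add: den)
  also have "\<dots> = complex_of_real (t\<^sup>2) powr s * (of_real t powr (- 2 * s) * (of_real c * z + of_real d) powr (- 2 * s))"
    using t(1) by (subst powr_times_real_left) auto
  also have "complex_of_real (t\<^sup>2) powr s = of_real t powr (2 * s)"
  proof -
    have "Ln (complex_of_real (t\<^sup>2)) = 2 * Ln (of_real t)"
      using t(1) ln_realpow[of t 2] by (simp add: Ln_of_real del: of_real_power)
    then show ?thesis using t(1) by (simp add: powr_def mult_ac)
  qed
  also have "of_real t powr (2 * s) * (of_real t powr (- 2 * s) * (of_real c * z + of_real d) powr (- 2 * s)) =
     (of_real c * z + of_real d) powr (- 2 * s)"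
    using t(1) by (simp flip: powr_add mult.assoc)
  finally show ?thesis unfolding alpha_def Let_def inv mob by simp
qed

text \<open>For a positive denominator all logarithms are real, so the power s of the inverse square
  is the power -2 s of the denominator. This brings \<open>alpha_real\<close> to the form of
  \<open>alpha\<close>.\<close>

lemma alpha_real_pgl:
  assumes inv: "inv\<^bsub>PGL2\<^esub> h = pgl a b c d" and c: "c > 0 \<or> c = 0 \<and> d > 0" and det: "\<bar>a * d - b * c\<bar> = 1"
    and pos: "c * x + d > 0"
  shows "alpha_real \<rho> s h f x = of_real (c * x + d) powr (- 2 * s) *s
     (\<rho> h *v f ((a * x + b) / (c * x + d)))"
proof -
  obtain t where t: "t > 0" "pgl_rep (pgl a b c d) = mat2 (t * a) (t * b) (t * c) (t * d)"
    using pgl_rep_pgl[OF c] by blast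
  have den: "denom_real (pgl a b c d) x = t * (c * x + d)"
    by (simp add: denom_real_def t(2) algebra_simps)
  have mob: "mobius_real (pgl a b c d) x = (a * x + b) / (c * x + d)"
  proof -
    have "t * a * x + t * b = t * (a * x + b)" by (simp add: algebra_simps)
    then show ?thesis using t(1) by (simp add: mobius_real_def den) (simp add: t(2))
  qed
  have "det (pgl_rep (pgl a b c d)) = t\<^sup>2 * (a * d - b * c)"
    unfolding t(2) det_mat2 by (simp add: algebra_simps power2_eq_square)
  then have "\<bar>det (pgl_rep (pgl a b c d))\<bar> / (denom_real (pgl a b c d) x)\<^sup>2 = (1 / (c * x + d))\<^sup>2"
    using det t(1) by (simp add: den abs_mult power_mult_distrib power_divide)
  moreover have "complex_of_real ((1 / (c * x + d))\<^sup>2) powr s = of_real (c * x + d) powr (- 2 * s)"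
  proof -
    have "ln ((1 / (c * x + d))\<^sup>2) = - 2 * ln (c * x + d)"
      using pos by (simp add: ln_div ln_realpow)
    then have "Ln (complex_of_real ((1 / (c * x + d))\<^sup>2)) = of_real (- 2 * ln (c * x + d))"
      using pos by (subst Ln_of_real) auto
    then have "complex_of_real ((1 / (c * x + d))\<^sup>2) powr s = exp (s * of_real (- 2 * ln (c * x + d)))"
      using pos by (simp add: powr_def del: of_real_add of_real_mult of_real_power of_real_divide)
    also have "\<dots> = exp (- 2 * s * Ln (of_real (c * x + d)))"
      using pos by (subst Ln_of_real) (simp_all add: mult_ac)
    also have "\<dots> = of_real (c * x + d) powr (- 2 * s)"
      using pos by (simp add: powr_def del: of_real_add of_real_mult)
    finally show ?thesis .
  qed
  ultimately show ?thesis unfolding alpha_real_def Let_def inv mob by (simp del: of_real_add of_real_mult)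
qed

lemma acts_into_pgl:
  assumes inv: "inv\<^bsub>PGL2\<^esub> h = pgl a b c d" and c: "c > 0 \<or> c = 0 \<and> d > 0"
  shows "acts_into h A B \<longleftrightarrow> (\<forall>z\<in>A. of_real c * z + of_real d \<in> slit \<and>
     (of_real a * z + of_real b) / (of_real c * z + of_real d) \<in> B)"
proof -
  obtain t where t: "t > 0" "pgl_rep (pgl a b c d) = mat2 (t * a) (t * b) (t * c) (t * d)"
    using pgl_rep_pgl[OF c] by blast
  have den: "denom (pgl a b c d) z = of_real t * (of_real c * z + of_real d)" for z
    by (simp add: denom_def t(2) algebra_simps)
  have mob: "mobius (pgl a b c d) z = (of_real a * z + of_real b) / (of_real c * z + of_real d)" for z
  proof -
    have "of_real (t * a) * z + of_real (t * b) = of_real t * (of_real a * z + of_real b)"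
      by (simp add: algebra_simps)
    then show ?thesis using t(1) by (simp add: mobius_def den) (simp add: t(2))
  qed
  have "of_real t * X \<notin> \<real>\<^sub>\<le>\<^sub>0 \<longleftrightarrow> X \<in> slit" for X
    using t(1) by (auto simp: slit_iff complex_nonpos_Reals_iff mult_le_0_iff)
  then show ?thesis unfolding acts_into_def inv mob den by simp
qed

text \<open>For k \<ge> 1 the value at cos(pi / q) of the Chebyshev polynomial of the second kind of
  degree k - 1, whence the three-term recursion \<open>sn_rec\<close>.\<close>

definition sn :: "nat \<Rightarrow> nat \<Rightarrow> real" where
  "sn q k = sin (real k * pi / real q) / sin (pi / real q)"

section \<open>The numbers \<open>sn\<close> and the elements of the Hecke triangle group\<close>

context
  fixes q :: nat
  assumes q3: "q \<ge> 3" and q_odd: "odd q"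
begin

lemma sin_pi_q_pos: "sin (pi / real q) > 0"
  using q3 by (intro sin_gt_zero) (auto simp: field_simps)

lemma sn_0 [simp]: "sn q 0 = 0"
  by (simp add: sn_def)

lemma sn_1 [simp]: "sn q (Suc 0) = 1"
  using sin_pi_q_pos by (simp add: sn_def)

lemma sn_rec: "sn q (Suc (Suc k)) = ell q * sn q (Suc k) - sn q k"
proof -
  have *: "sin (x + 2 * t) = 2 * cos t * sin (x + t) - sin x" for x t :: real
  proof -
    have "sin ((x + t) + t) + sin ((x + t) - t) = 2 * cos t * sin (x + t)"
      by (simp only: sin_add sin_diff) (simp add: algebra_simps)
    then show ?thesis by (simp add: algebra_simps)
  qed
  have "sin (real (Suc (Suc k)) * pi / real q) = sin (real k * pi / real q + 2 * (pi / real q))"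
    by (simp add: algebra_simps add_divide_distrib)
  also have "\<dots> = 2 * cos (pi / real q) * sin (real k * pi / real q + pi / real q) - sin (real k * pi / real q)"
    by (rule *)
  also have "real k * pi / real q + pi / real q = real (Suc k) * pi / real q"
    by (simp add: algebra_simps add_divide_distrib)
  finally show ?thesis by (simp add: sn_def ell_def diff_divide_distrib)
qed

lemma sn_2: "sn q 2 = ell q"
  using sn_rec[of 0] by (simp add: numeral_2_eq_2)

text \<open>A Cassini identity: the recursion leaves the left-hand side invariant. It is the
  determinant of the matrices computed below.\<close>

lemma sn_det: "sn q (Suc k) * sn q (Suc k) - sn q k * sn q (Suc (Suc k)) = 1"
proof (induction k)
  case (Suc k)
  have "sn q (Suc (Suc k)) * sn q (Suc (Suc k)) - sn q (Suc k) * sn q (Suc (Suc (Suc k))) =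
      sn q (Suc k) * sn q (Suc k) - sn q k * sn q (Suc (Suc k))"
    unfolding sn_rec[of "Suc k"] using sn_rec[of k] by algebra
  then show ?case using Suc by simp
qed (simp add: sn_rec)

lemma q_eq: "q = Suc (2 * m_of q)" and m_pos: "m_of q \<ge> 1"
  using q3 q_odd unfolding m_of_def by (auto elim!: oddE)

text \<open>The sine increases up to pi / 2, and k < m with q = 2 m + 1 keeps both angles in that
  range.\<close>

lemma sn_strict: "k < m_of q \<Longrightarrow> sn q k < sn q (Suc k)"
proof -
  assume k: "k < m_of q"
  have "real q = 2 * real (m_of q) + 1" using q_eq by (metis of_nat_1 of_nat_add of_nat_mult of_nat_numeral Suc_eq_plus1)
  moreover have "2 * (real k + 1) \<le> 2 * real (m_of q)" using k by (intro mult_left_mono) linarith+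
  ultimately have "2 * (real k + 1) \<le> real q" by (metis add_increasing2 zero_le_one)
  then have "real (Suc k) * pi / real q \<le> pi / 2"
    using q3 mult_left_mono[of "2 * (real k + 1)" "real q" pi] by (simp add: field_simps)
  moreover have "real k * pi / real q < real (Suc k) * pi / real q"
    using q3 by (intro divide_strict_right_mono mult_strict_right_mono) auto
  moreover have "- (pi / 2) \<le> real k * pi / real q"
    by (rule order_trans[of _ 0]) auto
  ultimately have "sin (real k * pi / real q) < sin (real (Suc k) * pi / real q)"
    by (intro sin_monotone_2pi) auto
  then show ?thesis unfolding sn_def using sin_pi_q_pos by (rule divide_strict_right_mono)
qed

text \<open>Oddness of q enters: the indices m and m + 1 are symmetric about q / 2. As a consequence
  the map belonging to \<open>Qg_elt q (- m)\<close> sends 0 exactly to 1.\<close>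

lemma sn_m: "sn q (Suc (m_of q)) = sn q (m_of q)"
proof -
  have "real q = 2 * real (m_of q) + 1" using q_eq by (metis of_nat_1 of_nat_add of_nat_mult of_nat_numeral Suc_eq_plus1)
  then have "real (Suc (m_of q)) * pi / real q = pi - real (m_of q) * pi / real q"
    using q3 by (simp add: field_simps)
  then show ?thesis by (simp add: sn_def)
qed

lemma sn_mono: "k \<le> m_of q \<Longrightarrow> sn q k \<le> sn q (Suc k)"
  using sn_strict[of k] sn_m by (cases "k = m_of q") auto

lemma sn_ge_1: "1 \<le> k \<Longrightarrow> k \<le> Suc (m_of q) \<Longrightarrow> sn q k \<ge> 1"
proof (induction k)
  case (Suc k)
  then show ?case using sn_mono[of k] by (cases "k = 0") auto
qed simp

lemma sn_nonneg: "k \<le> Suc (m_of q) \<Longrightarrow> sn q k \<ge> 0"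
  using sn_ge_1[of k] by (cases "k = 0") auto

lemma ell_ge_1: "ell q \<ge> 1"
  using sn_ge_1[of 2] m_pos by (simp add: sn_2)

lemma ell_3: "ell 3 = 1"
  by (simp add: ell_def cos_60)

lemma ell_gt_1: "q \<noteq> 3 \<Longrightarrow> ell q > 1"
proof -
  assume "q \<noteq> 3"
  then have "1 < m_of q" using q3 q_odd q_eq by presburger
  then show ?thesis using sn_strict[of 1] sn_2 by (simp add: numeral_2_eq_2)
qed

lemma S_in: "S_elt \<in> carrier PGL2" and T_in: "T_elt q \<in> carrier PGL2" and Q_in: "Q_elt \<in> carrier PGL2"
  unfolding S_elt_def T_elt_def Q_elt_def by (auto intro!: pgl_in_PGL2)

abbreviation TS where "TS \<equiv> T_elt q \<otimes>\<^bsub>PGL2\<^esub> S_elt"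

lemma TS_in: "TS \<in> carrier PGL2"
  using S_in T_in group.is_monoid[OF group_PGL2] by (simp add: monoid.m_closed)

lemma inv_TS: "inv\<^bsub>PGL2\<^esub> TS = pgl 0 (-1) 1 (- ell q)"
proof -
  have "TS = pgl (- ell q) 1 (-1) 0"
    unfolding T_elt_def S_elt_def by (subst pgl_mult) auto
  then show ?thesis by (simp add: pgl_inv)
qed

text \<open>Left multiplication by the inverse of TS advances the entries by \<open>sn_rec\<close>
  up to the sign -1, a scalar. The index Suc j keeps all arguments of \<open>sn\<close>
  natural.\<close>

lemma TS_pow_S: "TS [^]\<^bsub>PGL2\<^esub> (- int (Suc j)) \<otimes>\<^bsub>PGL2\<^esub> S_elt =
    pgl (sn q (Suc j)) (sn q j) (sn q (Suc (Suc j))) (sn q (Suc j))"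
proof -
  interpret group PGL2 by (rule group_PGL2)
  have nz: "sn q (Suc j) * sn q (Suc j) - sn q j * sn q (Suc (Suc j)) \<noteq> 0" for j
    using sn_det[of j] by simp
  have "inv\<^bsub>PGL2\<^esub> TS [^]\<^bsub>PGL2\<^esub> (Suc j) \<otimes>\<^bsub>PGL2\<^esub> S_elt =
    pgl (sn q (Suc j)) (sn q j) (sn q (Suc (Suc j))) (sn q (Suc j))"
  proof (induction j)
    case 0
    have "inv\<^bsub>PGL2\<^esub> TS [^]\<^bsub>PGL2\<^esub> (Suc 0) \<otimes>\<^bsub>PGL2\<^esub> S_elt = inv\<^bsub>PGL2\<^esub> TS \<otimes>\<^bsub>PGL2\<^esub> S_elt"
      using TS_in by simp
    also have "\<dots> = pgl 1 0 (ell q) 1"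
      unfolding inv_TS unfolding S_elt_def by (subst pgl_mult) auto
    finally show ?case by (simp add: sn_rec)
  next
    case (Suc j)
    have "inv\<^bsub>PGL2\<^esub> TS [^]\<^bsub>PGL2\<^esub> (Suc (Suc j)) \<otimes>\<^bsub>PGL2\<^esub> S_elt =
      inv\<^bsub>PGL2\<^esub> TS \<otimes>\<^bsub>PGL2\<^esub> (inv\<^bsub>PGL2\<^esub> TS [^]\<^bsub>PGL2\<^esub> (Suc j) \<otimes>\<^bsub>PGL2\<^esub> S_elt)"
      using TS_in S_in by (subst nat_pow_Suc2) (auto simp del: nat_pow_Suc simp: m_assoc)
    also have "\<dots> = pgl (- sn q (Suc (Suc j))) (- sn q (Suc j))
        (sn q (Suc j) - ell q * sn q (Suc (Suc j))) (sn q j - ell q * sn q (Suc j))"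
      unfolding Suc unfolding inv_TS by (subst pgl_mult) (use nz in auto)
    also have "\<dots> = pgl ((-1) * sn q (Suc (Suc j))) ((-1) * sn q (Suc j))
        ((-1) * sn q (Suc (Suc (Suc j)))) ((-1) * sn q (Suc (Suc j)))"
      using sn_rec[of j] sn_rec[of "Suc j"] by simp
    also have "\<dots> = pgl (sn q (Suc (Suc j))) (sn q (Suc j)) (sn q (Suc (Suc (Suc j)))) (sn q (Suc (Suc j)))"
      by (rule pgl_scale) simp
    finally show ?case .
  qed
  then show ?thesis using TS_in by (simp only: int_pow_neg_int nat_pow_inv)
qed

lemma g_in: "g_elt q k \<in> carrier PGL2"
proof -
  interpret group PGL2 by (rule group_PGL2)
  show ?thesis unfolding g_elt_def using TS_in S_in by (intro inv_closed m_closed[OF int_pow_closed])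
qed

lemma inv_g: "inv\<^bsub>PGL2\<^esub> (g_elt q (- int (Suc j))) =
    pgl (sn q (Suc j)) (sn q j) (sn q (Suc (Suc j))) (sn q (Suc j))"
proof -
  interpret group PGL2 by (rule group_PGL2)
  show ?thesis unfolding g_elt_def TS_pow_S[symmetric]
    using TS_in S_in by (intro inv_inv m_closed[OF int_pow_closed])
qed

text \<open>Q is its own inverse up to the scalar -1, and multiplying by it on the right swaps the
  columns.\<close>

lemma inv_Q_mult:
  assumes "g \<in> carrier PGL2" "inv\<^bsub>PGL2\<^esub> g = pgl a b c d" "a * d - b * c \<noteq> 0"
  shows "inv\<^bsub>PGL2\<^esub> (Q_elt \<otimes>\<^bsub>PGL2\<^esub> g) = pgl b a d c"
proof -
  interpret group PGL2 by (rule group_PGL2)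
  have "inv\<^bsub>PGL2\<^esub> Q_elt = pgl ((-1) * 0) ((-1) * 1) ((-1) * 1) ((-1) * 0)"
    unfolding Q_elt_def by (simp add: pgl_inv)
  also have "\<dots> = pgl 0 1 1 0" by (rule pgl_scale) simp
  finally have "inv\<^bsub>PGL2\<^esub> (Q_elt \<otimes>\<^bsub>PGL2\<^esub> g) = pgl a b c d \<otimes>\<^bsub>PGL2\<^esub> pgl 0 1 1 0"
    using assms Q_in by (simp add: inv_mult_group)
  also have "\<dots> = pgl b a d c" using assms(3) by (subst pgl_mult) auto
  finally show ?thesis .
qed

lemma inv_Qg: "inv\<^bsub>PGL2\<^esub> (Qg_elt q (- int (Suc j))) =
    pgl (sn q j) (sn q (Suc j)) (sn q (Suc j)) (sn q (Suc (Suc j)))"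
  unfolding Qg_elt_def by (rule inv_Q_mult[OF g_in inv_g]) (use sn_det[of j] in simp)

lemma inv_g_m1: "inv\<^bsub>PGL2\<^esub> (g_elt q (-1)) = pgl 1 0 (ell q) 1"
  using inv_g[of 0] by (simp add: sn_rec)

lemma g_pow_in: "g_pow q n \<in> carrier PGL2"
  unfolding g_pow_def using g_in group.is_monoid[OF group_PGL2] by (rule monoid.nat_pow_closed[rotated])

lemma inv_g_pow: "inv\<^bsub>PGL2\<^esub> (g_pow q n) = pgl 1 0 (real n * ell q) 1"
proof -
  interpret group PGL2 by (rule group_PGL2)
  have "(inv\<^bsub>PGL2\<^esub> (g_elt q (-1))) [^]\<^bsub>PGL2\<^esub> n = pgl 1 0 (real n * ell q) 1"
  proof (induction n)
    case 0 show ?case by (simp add: pgl_one)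
  next
    case (Suc n)
    have "(inv\<^bsub>PGL2\<^esub> (g_elt q (-1))) [^]\<^bsub>PGL2\<^esub> (Suc n) = pgl 1 0 (real n * ell q) 1 \<otimes>\<^bsub>PGL2\<^esub> pgl 1 0 (ell q) 1"
      unfolding nat_pow_Suc Suc unfolding inv_g_m1 ..
    then show ?case by (subst (asm) pgl_mult) (auto simp: algebra_simps)
  qed
  then show ?thesis unfolding g_pow_def using g_in by (simp add: nat_pow_inv)
qed

lemma inv_Qg_pow: "inv\<^bsub>PGL2\<^esub> (Qg_pow q n) = pgl 0 1 1 (real n * ell q)"
  unfolding Qg_pow_def by (rule inv_Q_mult[OF g_pow_in inv_g_pow]) simp

lemma inv_J: "inv\<^bsub>PGL2\<^esub> J_elt = pgl (-1) 0 0 1"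
proof -
  have "inv\<^bsub>PGL2\<^esub> J_elt = pgl ((-1) * (-1)) ((-1) * 0) ((-1) * 0) ((-1) * 1)"
    unfolding J_elt_def by (simp add: pgl_inv)
  also have "\<dots> = pgl (-1) 0 0 1" by (rule pgl_scale) simp
  finally show ?thesis .
qed

section \<open>The unitary representation\<close>

context
  fixes \<rho> :: "(real^2^2) set \<Rightarrow> complex^'n^'n"
  assumes hom: "\<rho> \<in> hom (Gamma_tilde q) unitary_group"
begin

lemma Gamma_tilde_subgroup: "subgroup (carrier (Gamma_tilde q)) PGL2"
proof -
  interpret group PGL2 by (rule group_PGL2)
  have 1: "{S_elt, T_elt q} \<subseteq> carrier PGL2" using S_in T_in by simp
  have "Gamma q \<union> {Q_elt} \<subseteq> carrier PGL2" unfolding Gamma_def using generate_incl[OF 1] Q_in by simp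
  then show ?thesis unfolding Gamma_tilde_def by (simp add: generate_is_subgroup)
qed

lemma in_Gamma_tilde:
  shows "g_elt q k \<in> carrier (Gamma_tilde q)" and "Q_elt \<in> carrier (Gamma_tilde q)"
    and "g_pow q n \<in> carrier (Gamma_tilde q)"
proof -
  interpret group PGL2 by (rule group_PGL2)
  note sub = Gamma_tilde_subgroup
  have S: "S_elt \<in> carrier (Gamma_tilde q)" and T: "T_elt q \<in> carrier (Gamma_tilde q)"
    and Q: "Q_elt \<in> carrier (Gamma_tilde q)"
    unfolding Gamma_tilde_def by (auto intro!: generate.incl simp: Gamma_def)
  have TS: "TS \<in> carrier (Gamma_tilde q)" using subgroup.m_closed[OF sub T S] .
  show g: "g_elt q k \<in> carrier (Gamma_tilde q)" for k
    unfolding g_elt_def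
    by (intro subgroup.m_inv_closed[OF sub] subgroup.m_closed[OF sub] subgroup_int_pow_closed[OF sub] TS S)
  show "Q_elt \<in> carrier (Gamma_tilde q)" by (fact Q)
  show "g_pow q n \<in> carrier (Gamma_tilde q)"
    unfolding g_pow_def by (induction n) (auto intro!: subgroup.m_closed[OF sub] subgroup.one_closed[OF sub] g)
qed

lemma rho_mult:
  "x \<in> carrier (Gamma_tilde q) \<Longrightarrow> y \<in> carrier (Gamma_tilde q) \<Longrightarrow> \<rho> (x \<otimes>\<^bsub>PGL2\<^esub> y) = \<rho> x ** \<rho> y"
  using hom_mult[OF hom] by (simp add: Gamma_tilde_def unitary_group_def)

lemma rho_unitary:
  assumes "x \<in> carrier (Gamma_tilde q)"
  shows "\<rho> x ** adjoint_matrix (\<rho> x) = mat 1" "adjoint_matrix (\<rho> x) ** \<rho> x = mat 1"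
  using hom_carrier[OF hom] assms by (auto simp: unitary_group_def image_subset_iff)

lemma rho_isometry:
  assumes "x \<in> carrier (Gamma_tilde q)"
  shows "norm (\<rho> x *v v) = norm v"
proof -
  define A where "A = \<rho> x"
  have sq: "of_real ((norm v)\<^sup>2) = (\<Sum>i\<in>UNIV. cnj (v $ i) * v $ i)" for v :: "complex^'n"
    by (simp add: norm_vec_def L2_set_def sum_nonneg complex_norm_square mult.commute del: of_real_power)
  have AA: "(adjoint_matrix A ** A) = mat 1" unfolding A_def by (rule rho_unitary[OF assms])
  have "(\<Sum>i\<in>UNIV. cnj ((A *v v) $ i) * (A *v v) $ i)
      = (\<Sum>i\<in>UNIV. \<Sum>j\<in>UNIV. cnj (v $ j) * (cnj (A $ i $ j) * (A *v v) $ i))"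
    by (simp add: matrix_vector_mult_def[of A v] sum_distrib_right sum_distrib_left mult_ac)
  also have "\<dots> = (\<Sum>j\<in>UNIV. \<Sum>i\<in>UNIV. cnj (v $ j) * (cnj (A $ i $ j) * (A *v v) $ i))"
    by (rule sum.swap)
  also have "\<dots> = (\<Sum>j\<in>UNIV. cnj (v $ j) * (adjoint_matrix A *v (A *v v)) $ j)"
    by (simp add: adjoint_matrix_def matrix_vector_mult_def[of "\<chi> i j. cnj (A $ j $ i)"] sum_distrib_left)
  also have "adjoint_matrix A *v (A *v v) = v" by (simp add: matrix_vector_mul_assoc AA)
  finally have "complex_of_real ((norm (A *v v))\<^sup>2) = of_real ((norm v)\<^sup>2)" unfolding sq .
  then have "(norm (A *v v))\<^sup>2 = (norm v)\<^sup>2" by (simp only: of_real_eq_iff)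
  then show ?thesis unfolding A_def by simp
qed

text \<open>The homomorphism law makes this matrix idempotent; cancelling it against its adjoint
  leaves the identity.\<close>

lemma rho_one: "\<rho> \<one>\<^bsub>PGL2\<^esub> = mat 1"
proof -
  interpret group PGL2 by (rule group_PGL2)
  have 1: "\<one>\<^bsub>PGL2\<^esub> \<in> carrier (Gamma_tilde q)" using subgroup.one_closed[OF Gamma_tilde_subgroup] .
  have "\<rho> \<one>\<^bsub>PGL2\<^esub> ** \<rho> \<one>\<^bsub>PGL2\<^esub> = \<rho> \<one>\<^bsub>PGL2\<^esub>" using rho_mult[OF 1 1] by simp
  then have "\<rho> \<one>\<^bsub>PGL2\<^esub> ** (\<rho> \<one>\<^bsub>PGL2\<^esub> ** adjoint_matrix (\<rho> \<one>\<^bsub>PGL2\<^esub>)) = \<rho> \<one>\<^bsub>PGL2\<^esub> ** adjoint_matrix (\<rho> \<one>\<^bsub>PGL2\<^esub>)"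
    by (simp add: matrix_mul_assoc)
  then show ?thesis by (simp add: rho_unitary[OF 1])
qed

lemma rho_g_pow: "\<rho> (g_pow q n) = matpow (\<rho> (g_elt q (-1))) n"
proof (induction n)
  case 0 then show ?case by (simp add: g_pow_def rho_one)
next
  case (Suc n)
  have "g_pow q (Suc n) = g_pow q n \<otimes>\<^bsub>PGL2\<^esub> g_elt q (-1)" by (simp add: g_pow_def)
  then show ?case using Suc in_Gamma_tilde by (simp add: rho_mult matpow_commute)
qed

lemma rho_Qg_pow: "\<rho> (Qg_pow q n) = \<rho> Q_elt ** matpow (\<rho> (g_elt q (-1))) n"
  unfolding Qg_pow_def using in_Gamma_tilde by (simp add: rho_mult rho_g_pow)

lemma rho_Qg: "\<rho> (Qg_elt q (-1)) = \<rho> Q_elt ** \<rho> (g_elt q (-1))"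
  unfolding Qg_elt_def using in_Gamma_tilde by (simp add: rho_mult)

end

end

section \<open>Extending solutions of the slow equation to the slit plane\<close>

lemma cmod_affine_square:
  "(cmod (of_real u * z + of_real v))\<^sup>2 = u\<^sup>2 * (cmod z)\<^sup>2 + 2 * (u * v) * Re z + v\<^sup>2"
  by (simp only: cmod_power2) (simp add: power2_eq_square algebra_simps)

text \<open>This form of the condition says that Re(1 / z) > 1 / (2 \<epsilon>): in the coordinate 1
  / z the disc is a half plane, visibly stable under translation to the right.\<close>

lemma mem_tangent_ball:
  assumes "\<epsilon> > 0"
  shows "z \<in> ball (of_real \<epsilon>) \<epsilon> \<longleftrightarrow> (cmod z)\<^sup>2 < 2 * \<epsilon> * Re z"
proof -
  have "cmod (z - of_real \<epsilon>) < \<epsilon> \<longleftrightarrow> (cmod (z - of_real \<epsilon>))\<^sup>2 < \<epsilon>\<^sup>2"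
    using assms power_strict_mono[of "cmod (z - of_real \<epsilon>)" \<epsilon> 2]
      power2_less_imp_less[of "cmod (z - of_real \<epsilon>)" \<epsilon>] by auto
  also have "(cmod (z - of_real \<epsilon>))\<^sup>2 = (cmod z)\<^sup>2 - 2 * \<epsilon> * Re z + \<epsilon>\<^sup>2"
    using cmod_affine_square[of 1 z "- \<epsilon>"] by simp
  finally show ?thesis by (simp add: dist_norm norm_minus_commute)
qed

text \<open>What the geometry uses of the Hecke matrices. The inequalities \<open>le\<close> send
  the right half plane into the unit disc. Both signs of the determinant occur because Q reverses
  orientation. The index j0 is the parabolic map fixing 0; by \<open>generic\<close> all other maps
  move 0 away from itself.\<close>

locale slow_system =
  fixes J :: "'j set" and j0 :: 'j and a b c d :: "'j \<Rightarrow> real" and A :: "'j \<Rightarrow> complex^'n^'n"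
    and \<l> :: real and s :: complex
  assumes fin: "finite J" and j0: "j0 \<in> J" and l_pos: "\<l> > 0"
    and ge0: "j \<in> J \<Longrightarrow> a j \<ge> 0" "j \<in> J \<Longrightarrow> b j \<ge> 0"
    and gt0: "j \<in> J \<Longrightarrow> c j > 0" "j \<in> J \<Longrightarrow> d j > 0"
    and le: "j \<in> J \<Longrightarrow> a j \<le> c j" "j \<in> J \<Longrightarrow> b j \<le> d j" "j \<in> J \<Longrightarrow> a j + b j < c j + d j"
    and det: "j \<in> J \<Longrightarrow> \<bar>a j * d j - b j * c j\<bar> = 1"
    and special: "a j0 = 1" "b j0 = 0" "c j0 = \<l>" "d j0 = 1"
    and generic: "j \<in> J \<Longrightarrow> j \<noteq> j0 \<Longrightarrow> b j \<ge> 1" "j \<in> J \<Longrightarrow> j \<noteq> j0 \<Longrightarrow> d j \<ge> 1"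
begin

definition den :: "'j \<Rightarrow> complex \<Rightarrow> complex" where
  "den j z = of_real (c j) * z + of_real (d j)"

definition num :: "'j \<Rightarrow> complex \<Rightarrow> complex" where
  "num j z = of_real (a j) * z + of_real (b j)"

definition mob :: "'j \<Rightarrow> complex \<Rightarrow> complex" where
  "mob j z = num j z / den j z"

definition opr :: "'j \<Rightarrow> (complex \<Rightarrow> complex^'n) \<Rightarrow> complex \<Rightarrow> complex^'n" where
  "opr j \<psi> z = den j z powr (- 2 * s) *s (A j *v \<psi> (mob j z))"

definition slw :: "(complex \<Rightarrow> complex^'n) \<Rightarrow> complex \<Rightarrow> complex^'n" where
  "slw \<psi> z = (\<Sum>j\<in>J. opr j \<psi> z)"

section \<open>The fractional linear maps on the right half plane and on the slit plane\<close>

lemma Im_mob: "Im (mob j z) = (a j * d j - b j * c j) * Im z / (cmod (den j z))\<^sup>2"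
  unfolding mob_def Im_divide cmod_power2 by (simp add: num_def den_def algebra_simps)

lemma Re_mob: "Re (mob j z) =
    (a j * c j * (cmod z)\<^sup>2 + (a j * d j + b j * c j) * Re z + b j * d j) / (cmod (den j z))\<^sup>2"
  unfolding mob_def Re_divide cmod_power2 by (simp add: num_def den_def algebra_simps power2_eq_square)

lemma abs_Im_mob: "j \<in> J \<Longrightarrow> \<bar>Im (mob j z)\<bar> = \<bar>Im z\<bar> / (cmod (den j z))\<^sup>2"
  unfolding Im_mob by (simp add: abs_mult det)

lemma cmod_mob: "(cmod (mob j z))\<^sup>2 = (cmod (num j z))\<^sup>2 / (cmod (den j z))\<^sup>2"
  by (simp add: mob_def norm_divide power_divide)

lemma den_slit: "j \<in> J \<Longrightarrow> z \<in> slit \<Longrightarrow> den j z \<in> slit"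
  using gt0[of j] by (auto simp: slit_iff den_def intro!: add_pos_pos)

lemma den_nz: "j \<in> J \<Longrightarrow> z \<in> slit \<Longrightarrow> den j z \<noteq> 0"
  using den_slit slit_nonzero by blast

lemma sum_ad_bc_pos: "j \<in> J \<Longrightarrow> a j * d j + b j * c j > 0"
  using det[of j] ge0[of j] gt0[of j] by (smt (verit) mult_nonneg_nonneg)

lemma Re_mob_pos:
  assumes "j \<in> J" "Re z > 0"
  shows "Re (mob j z) > 0"
proof -
  have "z \<in> slit" using assms by (simp add: slit_iff)
  then have "(cmod (den j z))\<^sup>2 > 0" using den_nz assms by simp
  moreover have "(a j * d j + b j * c j) * Re z > 0" using sum_ad_bc_pos assms by simp
  moreover have "a j * c j * (cmod z)\<^sup>2 \<ge> 0" "b j * d j \<ge> 0"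
    using ge0[of j] gt0[of j] assms by (auto intro!: mult_nonneg_nonneg)
  ultimately show ?thesis unfolding Re_mob by (intro divide_pos_pos) linarith+
qed

lemma mob_slit:
  assumes "j \<in> J" "z \<in> slit"
  shows "mob j z \<in> slit"
proof (cases "Im z = 0")
  case True
  then have "Re (mob j z) > 0" using Re_mob_pos assms by (simp add: slit_iff)
  then show ?thesis by (simp add: slit_iff)
next
  case False
  then have "\<bar>Im (mob j z)\<bar> > 0" using den_nz[OF assms] abs_Im_mob[OF assms(1)] by simp
  then show ?thesis by (auto simp: slit_iff)
qed

text \<open>In \<open>cmod_affine_square\<close> each coefficient of the denominator is at least
  that of the numerator, with one strict inequality, and Re z > 0.\<close>

lemma cmod_mob_less_1:
  assumes "j \<in> J" "Re z > 0"
  shows "cmod (mob j z) < 1"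
proof -
  have z: "z \<in> slit" using assms by (simp add: slit_iff)
  have "(cmod (num j z))\<^sup>2 < (cmod (den j z))\<^sup>2"
  proof -
    have "a j * b j \<le> c j * d j" "(a j)\<^sup>2 \<le> (c j)\<^sup>2" "(b j)\<^sup>2 \<le> (d j)\<^sup>2"
      using ge0[of j] gt0[of j] le[of j] assms(1) by (auto intro!: mult_mono power_mono)
    moreover have "a j < c j \<or> b j < d j" using le[of j] assms(1) by linarith
    then have "(a j)\<^sup>2 < (c j)\<^sup>2 \<or> (b j)\<^sup>2 < (d j)\<^sup>2"
      using ge0[of j] assms(1) by (auto intro!: power_strict_mono)
    moreover have "(cmod z)\<^sup>2 > 0" using slit_nonzero[OF z] by simp
    ultimately show ?thesis unfolding num_def den_def cmod_affine_square
      by (smt (verit) assms(2) mult_right_mono mult_strict_right_mono zero_less_mult_iff)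
  qed
  then have "cmod (num j z) < cmod (den j z)" by (rule power2_less_imp_less) simp
  then show ?thesis using den_nz[OF assms(1) z] by (simp add: mob_def norm_divide)
qed

text \<open>Imaginary and real part of the image share the denominator |den|^2. The numerator of the
  former is |Im z|, that of the latter is at least Re z because ad + bc \<ge> |ad - bc| = 1.\<close>

lemma cone_mob:
  assumes "j \<in> J" "Re z > 0" "\<bar>Im z\<bar> < t * Re z"
  shows "\<bar>Im (mob j z)\<bar> < t * Re (mob j z)"
proof -
  have z: "z \<in> slit" using assms by (simp add: slit_iff)
  have den: "(cmod (den j z))\<^sup>2 > 0" using den_nz assms(1) z by simp
  have t: "t > 0" using assms(2,3) by (smt (verit) mult_nonpos_nonneg)
  have "1 \<le> a j * d j + b j * c j"
    using det[OF assms(1)] mult_nonneg_nonneg[OF ge0(1) less_imp_le[OF gt0(2)], OF assms(1) assms(1)]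
      mult_nonneg_nonneg[OF ge0(2) less_imp_le[OF gt0(1)], OF assms(1) assms(1)] by linarith
  then have "1 * (t * Re z) \<le> (a j * d j + b j * c j) * (t * Re z)"
    using t assms(2) by (intro mult_right_mono) auto
  moreover have "t * (a j * c j * (cmod z)\<^sup>2) \<ge> 0" "t * (b j * d j) \<ge> 0"
    using ge0[of j] gt0[of j] assms t by (auto intro!: mult_nonneg_nonneg)
  ultimately have "\<bar>Im z\<bar> < t * (a j * c j * (cmod z)\<^sup>2 + (a j * d j + b j * c j) * Re z + b j * d j)"
    using assms(3) by (simp add: algebra_simps)
  then have "\<bar>Im z\<bar> / (cmod (den j z))\<^sup>2 < (t * (a j * c j * (cmod z)\<^sup>2 + (a j * d j + b j * c j) * Re z + b j * d j)) / (cmod (den j z))\<^sup>2"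
    using den by (rule divide_strict_right_mono)
  then show ?thesis by (simp add: abs_Im_mob assms(1) Re_mob)
qed

lemma opr_cong: "\<psi> (mob j z) = \<psi>' (mob j z) \<Longrightarrow> opr j \<psi> z = opr j \<psi>' z"
  by (simp add: opr_def)

lemma slw_cong: "(\<And>j. j \<in> J \<Longrightarrow> \<psi> (mob j z) = \<psi>' (mob j z)) \<Longrightarrow> slw \<psi> z = slw \<psi>' z"
  unfolding slw_def by (intro sum.cong refl opr_cong) auto

lemma vholomorphic_opr:
  assumes "vholomorphic_on \<psi> D" "\<And>z. z \<in> S \<Longrightarrow> den j z \<in> slit \<and> mob j z \<in> D"
  shows "vholomorphic_on (opr j \<psi>) S"
proof -
  have "(\<lambda>z. den j z powr (- 2 * s)) holomorphic_on S"
    unfolding den_def using assms(2)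
    by (intro holomorphic_intros) (auto simp: den_def dest!: slit_not_nonpos)
  moreover have "mob j holomorphic_on S"
    unfolding mob_def[abs_def] num_def den_def using assms(2) slit_nonzero
    by (intro holomorphic_intros) (auto simp: den_def)
  then have "vholomorphic_on (\<lambda>z. \<psi> (mob j z)) S"
    by (rule vholomorphic_on_compose[OF assms(1)]) (use assms(2) in auto)
  ultimately show ?thesis unfolding opr_def[abs_def] by (intro vholomorphic_intros)
qed

lemma vholomorphic_slw:
  assumes "vholomorphic_on \<psi> D" "\<And>z j. z \<in> S \<Longrightarrow> j \<in> J \<Longrightarrow> den j z \<in> slit \<and> mob j z \<in> D"
  shows "vholomorphic_on (slw \<psi>) S"
  unfolding slw_def[abs_def] by (intro vholomorphic_on_sum vholomorphic_opr[OF assms(1)]) (use assms(2) in blast)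

lemma open_mob_preimage:
  assumes "open D" "j \<in> J"
  shows "open {z \<in> slit. mob j z \<in> D}"
proof -
  have "continuous_on slit (mob j)"
    unfolding mob_def[abs_def] num_def den_def
    using den_nz[OF assms(2)] by (intro continuous_intros) (auto simp: den_def)
  then have "open (slit \<inter> mob j -` D)"
    by (rule continuous_open_preimage[OF _ open_slit assms(1)])
  then show ?thesis by (simp add: Int_def vimage_def)
qed

text \<open>
  This makes the preimages of a sector around the positive axis exhaust the slit plane.
\<close>

lemma cot_mob_increases:
  assumes j: "j \<in> J" and z: "Im z \<noteq> 0"
  shows "Im (mob j z) \<noteq> 0" "Re (mob j z) / \<bar>Im (mob j z)\<bar> > Re z / \<bar>Im z\<bar>"
proof -
  have sl: "z \<in> slit" using z by (simp add: slit_iff)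
  have den: "(cmod (den j z))\<^sup>2 > 0" using den_nz j sl by simp
  have I: "\<bar>Im (mob j z)\<bar> > 0" unfolding abs_Im_mob[OF j] using z den by simp
  then show "Im (mob j z) \<noteq> 0" by simp
  define r where "r = cmod z"
  have r: "r > 0" "Re z \<ge> - r" using z abs_Re_le_cmod[of z] by (auto simp: r_def)
  define P Q where "P = a j * c j" and "Q = b j * d j"
  \<comment> \<open>The products ad and bc are nonnegative and differ by 1. With u the smaller one,
    ad + bc - 1 = 2 u and P Q = u (u + 1), so P r^2 - 2 u r + Q has reduced discriminant u^2 - P Q =
    -u. If u = 0, the linear term is absent.\<close>
  have key: "P * r\<^sup>2 + 2 * u * Re z + Q > 0" if u: "u \<ge> 0" "P * Q = u * (u + 1)" "u = 0 \<Longrightarrow> P > 0 \<or> Q > 0" "P \<ge> 0" "Q \<ge> 0" for u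
  proof (cases "u = 0")
    case True
    then show ?thesis using u r by (auto intro: add_pos_nonneg add_nonneg_pos)
  next
    case False
    then have "u > 0" using u by simp
    then have "P * Q > 0" using u(2) by simp
    then have P: "P > 0" using u(4) by (auto simp: zero_less_mult_iff)
    have "P * (P * r\<^sup>2 - 2 * u * r + Q) = (P * r - u)\<^sup>2 + u"
      using u(2) by (simp add: power2_eq_square algebra_simps)
    also have "\<dots> > 0" using \<open>u > 0\<close> by (intro add_nonneg_pos) auto
    finally have "P * r\<^sup>2 - 2 * u * r + Q > 0" using P by (simp add: zero_less_mult_iff)
    moreover have "2 * u * Re z \<ge> - (2 * u * r)" using mult_left_mono[OF r(2), of "2 * u"] u(1) by simp
    ultimately show ?thesis by linarith
  qed
  have PQ: "P \<ge> 0" "Q \<ge> 0" using ge0[of j] gt0[of j] j by (auto simp: P_def Q_def)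
  have nn: "a j * d j \<ge> 0" "b j * c j \<ge> 0" using ge0[of j] gt0[of j] j by auto
  have PQe: "P * Q = (a j * d j) * (b j * c j)" by (simp add: P_def Q_def)
  have "P * r\<^sup>2 + (a j * d j + b j * c j - 1) * Re z + Q > 0"
  proof (cases "a j * d j - b j * c j = 1")
    case True
    then have ad: "a j * d j = b j * c j + 1" by simp
    have "P * r\<^sup>2 + 2 * (b j * c j) * Re z + Q > 0"
    proof (rule key[OF nn(2) _ _ PQ])
      show "P * Q = b j * c j * (b j * c j + 1)" unfolding PQe ad by simp
      assume "b j * c j = 0"
      then have "a j \<noteq> 0" using ad by auto
      then show "P > 0 \<or> Q > 0" using ge0(1)[OF j] gt0(1)[OF j] by (simp add: P_def)
    qed
    then show ?thesis unfolding ad by (simp add: algebra_simps)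
  next
    case False
    then have bc: "b j * c j = a j * d j + 1" using det[OF j] by linarith
    have "P * r\<^sup>2 + 2 * (a j * d j) * Re z + Q > 0"
    proof (rule key[OF nn(1) _ _ PQ])
      show "P * Q = a j * d j * (a j * d j + 1)" unfolding PQe bc by simp
      assume "a j * d j = 0"
      then have "b j \<noteq> 0" using bc by auto
      then show "P > 0 \<or> Q > 0" using ge0(2)[OF j] gt0(2)[OF j] by (simp add: Q_def)
    qed
    then show ?thesis unfolding bc by (simp add: algebra_simps)
  qed
  then have "Re z < a j * c j * (cmod z)\<^sup>2 + (a j * d j + b j * c j) * Re z + b j * d j"
    by (simp add: P_def Q_def r_def algebra_simps)
  then have "Re z / \<bar>Im z\<bar> < (a j * c j * (cmod z)\<^sup>2 + (a j * d j + b j * c j) * Re z + b j * d j) / \<bar>Im z\<bar>"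
    using z by (intro divide_strict_right_mono) auto
  also have "\<dots> = Re (mob j z) / \<bar>Im (mob j z)\<bar>"
    unfolding Re_mob abs_Im_mob[OF j] using den z by simp
  finally show "Re (mob j z) / \<bar>Im (mob j z)\<bar> > Re z / \<bar>Im z\<bar>" .
qed

text \<open>The cross term 2 u v Re z is at worst -\<mu> times 2 u v |z|, hence at worst -\<mu>
  times the sum of the squares. Away from the negative axis no cancellation can make a denominator
  small.\<close>

lemma affine_lower_bound:
  assumes "Re z \<ge> - (\<mu> * cmod z)" "0 \<le> \<mu>" "\<mu> < 1" "u \<ge> 0" "v \<ge> 0"
  shows "(cmod (of_real u * z + of_real v))\<^sup>2 \<ge> (1 - \<mu>) * (u\<^sup>2 * (cmod z)\<^sup>2 + v\<^sup>2)"
proof -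
  define r where "r = cmod z"
  have "2 * (u * v) * Re z \<ge> 2 * (u * v) * (- (\<mu> * r))"
    using assms by (intro mult_left_mono) (auto simp: r_def)
  moreover have "\<mu> * (2 * (u * r) * v) \<le> \<mu> * ((u * r)\<^sup>2 + v\<^sup>2)"
    using sum_squares_bound[of "u * r" v] assms(2) by (intro mult_left_mono) auto
  ultimately show ?thesis unfolding cmod_affine_square r_def[symmetric]
    by (simp add: algebra_simps power_mult_distrib)
qed

lemma affine_upper_bound:
  assumes "u \<ge> 0" "v \<ge> 0"
  shows "(cmod (of_real u * z + of_real v))\<^sup>2 \<le> 2 * (u\<^sup>2 * (cmod z)\<^sup>2 + v\<^sup>2)"
proof -
  have "cmod (of_real u * z + of_real v) \<le> u * cmod z + v"
    using norm_triangle_ineq[of "of_real u * z" "of_real v"] assms by (simp add: norm_mult)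
  then have "(cmod (of_real u * z + of_real v))\<^sup>2 \<le> (u * cmod z + v)\<^sup>2" by (intro power_mono) auto
  also have "\<dots> \<le> 2 * (u\<^sup>2 * (cmod z)\<^sup>2 + v\<^sup>2)"
    using sum_squares_bound[of "u * cmod z" v] by (simp add: power2_sum power_mult_distrib)
  finally show ?thesis .
qed

text \<open>A lower bound c0 for the cotangent of the angle becomes a lower bound for its cosine,
  with the constant |c0| / sqrt(1 + c0^2) < 1.\<close>

lemma cone_lower_bound:
  assumes "Re z \<ge> c0 * \<bar>Im z\<bar>"
  shows "Re z \<ge> - (sqrt (c0\<^sup>2 / (1 + c0\<^sup>2)) * cmod z)"
proof (cases "Re z \<ge> 0")
  case True
  have "sqrt (c0\<^sup>2 / (1 + c0\<^sup>2)) * cmod z \<ge> 0" by simp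
  then show ?thesis using True by linarith
next
  case False
  have "\<bar>Re z\<bar> \<le> \<bar>c0\<bar> * \<bar>Im z\<bar>"
    using False assms by (smt (verit) abs_ge_zero mult_minus_left mult_nonneg_nonneg)
  then have "(Re z)\<^sup>2 \<le> c0\<^sup>2 * (Im z)\<^sup>2"
    using abs_le_square_iff[of "Re z" "\<bar>c0\<bar> * \<bar>Im z\<bar>"] by (simp add: abs_mult power_mult_distrib)
  then have "(Re z)\<^sup>2 * (1 + c0\<^sup>2) \<le> c0\<^sup>2 * (cmod z)\<^sup>2"
    by (simp add: cmod_power2 algebra_simps)
  moreover have "1 + c0\<^sup>2 > 0" by (simp add: add_pos_nonneg)
  ultimately have "(Re z)\<^sup>2 \<le> (c0\<^sup>2 / (1 + c0\<^sup>2)) * (cmod z)\<^sup>2" by (simp add: field_simps)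
  then have "\<bar>Re z\<bar> \<le> sqrt (c0\<^sup>2 / (1 + c0\<^sup>2)) * cmod z"
    by (metis real_sqrt_abs real_sqrt_le_mono real_sqrt_mult abs_norm_cancel)
  then show ?thesis by linarith
qed

text \<open>The constraints below are stable under the maps as long as the orbit avoids the tangent disc.\<close>

definition trap :: "real \<Rightarrow> real \<Rightarrow> real \<Rightarrow> real \<Rightarrow> complex set" where
  "trap \<epsilon> c0 R Y = {z. Re z \<ge> c0 * \<bar>Im z\<bar> \<and> cmod z \<le> R \<and> \<bar>Im z\<bar> \<le> Y * (cmod z)\<^sup>2 \<and>
     2 * \<epsilon> * Re z \<le> (cmod z)\<^sup>2 \<and> 1 \<le> (Y + 1 / (2 * \<epsilon>) + \<bar>c0\<bar> * Y) * cmod z}"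

text \<open>For z \<noteq> 0 the last clause follows from the others: they bound |Re z| and |Im z|
  by multiples of |z|^2, and |z| \<le> |Re z| + |Im z|. Its presence in the definition keeps the set
  closed and yet free of 0.\<close>

lemma trapI:
  assumes "\<epsilon> > 0" "Y \<ge> 0" "z \<noteq> 0" "Re z \<ge> c0 * \<bar>Im z\<bar>" "cmod z \<le> R" "\<bar>Im z\<bar> \<le> Y * (cmod z)\<^sup>2"
    "2 * \<epsilon> * Re z \<le> (cmod z)\<^sup>2"
  shows "z \<in> trap \<epsilon> c0 R Y"
proof -
  have "Re z \<le> (1 / (2 * \<epsilon>)) * (cmod z)\<^sup>2" using assms(1,7) by (simp add: field_simps)
  moreover have "- Re z \<le> \<bar>c0\<bar> * Y * (cmod z)\<^sup>2"
  proof -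
    have "- Re z \<le> - c0 * \<bar>Im z\<bar>" using assms(4) by simp
    also have "\<dots> \<le> \<bar>c0\<bar> * \<bar>Im z\<bar>" by (intro mult_right_mono) auto
    also have "\<dots> \<le> \<bar>c0\<bar> * (Y * (cmod z)\<^sup>2)" using assms(6) by (intro mult_left_mono) auto
    finally show ?thesis by (simp add: mult.assoc)
  qed
  moreover have "\<bar>c0\<bar> * Y * (cmod z)\<^sup>2 \<ge> 0" "(1 / (2 * \<epsilon>)) * (cmod z)\<^sup>2 \<ge> 0"
    using assms(1,2) by auto
  ultimately have "\<bar>Re z\<bar> \<le> (1 / (2 * \<epsilon>)) * (cmod z)\<^sup>2 + \<bar>c0\<bar> * Y * (cmod z)\<^sup>2" by linarith
  then have "cmod z \<le> ((Y + 1 / (2 * \<epsilon>) + \<bar>c0\<bar> * Y) * cmod z) * cmod z"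
    using cmod_le[of z] assms(6) by (simp add: algebra_simps power2_eq_square)
  then have "1 * cmod z \<le> ((Y + 1 / (2 * \<epsilon>) + \<bar>c0\<bar> * Y) * cmod z) * cmod z" by simp
  then have "1 \<le> (Y + 1 / (2 * \<epsilon>) + \<bar>c0\<bar> * Y) * cmod z"
    using assms(3) by (subst (asm) mult_le_cancel_right_pos) auto
  then show ?thesis using assms by (simp add: trap_def)
qed

lemma compact_trap: "compact (trap \<epsilon> c0 R Y)"
proof -
  have "bounded (trap \<epsilon> c0 R Y)"
    by (rule boundedI[of _ R]) (simp add: trap_def)
  moreover have "closed (trap \<epsilon> c0 R Y)"
    unfolding trap_def by (intro closed_Collect_conj closed_Collect_le continuous_intros)
  ultimately show ?thesis by (simp add: compact_eq_bounded_closed)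
qed

lemma trap_slit: "z \<in> trap \<epsilon> c0 R Y \<Longrightarrow> z \<in> slit"
  unfolding trap_def slit_iff by (cases "Re z = 0") (auto simp: cmod_def)

text \<open>The sector clause persists since the cotangent increases, the radius clause since the
  lower row dominates, and the disc clause is \<open>out\<close>. In the clause with Y both sides
  scale by |den|^2 for j0, while for the other maps b \<ge> 1 bounds the numerator from
  below.\<close>

lemma trap_mob:
  assumes \<epsilon>: "\<epsilon> > 0" and j: "j \<in> J" and z: "z \<in> trap \<epsilon> c0 R Y" "Im z \<noteq> 0"
    and R: "R\<^sup>2 \<ge> 2 / (1 - sqrt (c0\<^sup>2 / (1 + c0\<^sup>2)))" "R \<ge> 0"
    and Y: "Y \<ge> R / (1 - sqrt (c0\<^sup>2 / (1 + c0\<^sup>2)))"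
    and out: "mob j z \<notin> ball (of_real \<epsilon>) \<epsilon>"
  shows "mob j z \<in> trap \<epsilon> c0 R Y"
proof (rule trapI)
  define \<mu> where "\<mu> = sqrt (c0\<^sup>2 / (1 + c0\<^sup>2))"
  have "1 + c0\<^sup>2 > 0" by (simp add: add_pos_nonneg)
  then have \<mu>: "0 \<le> \<mu>" "\<mu> < 1" unfolding \<mu>_def by (auto intro!: real_sqrt_lt_1_iff[THEN iffD2])
  have sl: "z \<in> slit" using z by (simp add: slit_iff)
  have dpos: "(cmod (den j z))\<^sup>2 > 0" using den_nz[OF j sl] by simp
  have lower: "Re z \<ge> - (\<mu> * cmod z)" unfolding \<mu>_def
    by (rule cone_lower_bound) (use z in \<open>simp add: trap_def\<close>)
  have zR: "cmod z \<le> R" "\<bar>Im z\<bar> \<le> Y * (cmod z)\<^sup>2" "Re z \<ge> c0 * \<bar>Im z\<bar>" using z by (auto simp: trap_def)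
  show "Y \<ge> 0" using Y \<mu> R(2) unfolding \<mu>_def[symmetric] by (smt (verit) divide_nonneg_pos)
  show "mob j z \<noteq> 0" using mob_slit[OF j sl] slit_nonzero by blast
  note cot = cot_mob_increases[OF j z(2)]
  have "c0 \<le> Re z / \<bar>Im z\<bar>" using zR(3) z(2) by (simp add: pos_le_divide_eq)
  then have "c0 \<le> Re (mob j z) / \<bar>Im (mob j z)\<bar>" using cot(2) by linarith
  then show "Re (mob j z) \<ge> c0 * \<bar>Im (mob j z)\<bar>" using cot(1) by (simp add: pos_le_divide_eq)
  show "2 * \<epsilon> * Re (mob j z) \<le> (cmod (mob j z))\<^sup>2"
    using out unfolding mem_tangent_ball[OF \<epsilon>] by simp
  show "cmod (mob j z) \<le> R"
  proof -
    have "(cmod (num j z))\<^sup>2 \<le> 2 * ((a j)\<^sup>2 * (cmod z)\<^sup>2 + (b j)\<^sup>2)"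
      unfolding num_def using ge0 j by (intro affine_upper_bound) auto
    also have "\<dots> \<le> 2 * ((c j)\<^sup>2 * (cmod z)\<^sup>2 + (d j)\<^sup>2)"
      using ge0 le j by (intro mult_left_mono add_mono mult_right_mono power_mono) auto
    also have "\<dots> = (2 / (1 - \<mu>)) * ((1 - \<mu>) * ((c j)\<^sup>2 * (cmod z)\<^sup>2 + (d j)\<^sup>2))" using \<mu> by simp
    also have "\<dots> \<le> (2 / (1 - \<mu>)) * (cmod (den j z))\<^sup>2"
      unfolding den_def using \<mu> gt0[of j] j lower
      by (intro mult_left_mono affine_lower_bound) auto
    also have "\<dots> \<le> R\<^sup>2 * (cmod (den j z))\<^sup>2" using R(1) by (intro mult_right_mono) (auto simp: \<mu>_def)
    finally have "(cmod (mob j z))\<^sup>2 \<le> R\<^sup>2" unfolding cmod_mob using dpos by (simp add: pos_divide_le_eq)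
    then show ?thesis using R(2) by (rule power2_le_imp_le)
  qed
  have "\<bar>Im z\<bar> \<le> Y * (cmod (num j z))\<^sup>2"
  proof (cases "j = j0")
    case True
    then show ?thesis using zR(2) by (simp add: num_def special)
  next
    case False
    have "(1 - \<mu>) * 1 \<le> (1 - \<mu>) * ((a j)\<^sup>2 * (cmod z)\<^sup>2 + (b j)\<^sup>2)"
      using generic(1)[OF j False] \<mu> by (intro mult_left_mono) (auto intro: add_increasing)
    also have "\<dots> \<le> (cmod (num j z))\<^sup>2"
      unfolding num_def using ge0 j lower \<mu> by (intro affine_lower_bound) auto
    finally have *: "1 - \<mu> \<le> (cmod (num j z))\<^sup>2" by simp
    have "\<bar>Im z\<bar> \<le> R" using abs_Im_le_cmod[of z] zR(1) by linarith
    also have "\<dots> = (R / (1 - \<mu>)) * (1 - \<mu>)" using \<mu> by simp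
    also have "\<dots> \<le> Y * (cmod (num j z))\<^sup>2"
      using * Y \<mu> \<open>Y \<ge> 0\<close> by (intro mult_mono) (auto simp: \<mu>_def)
    finally show ?thesis .
  qed
  then have "\<bar>Im z\<bar> / (cmod (den j z))\<^sup>2 \<le> Y * (cmod (num j z))\<^sup>2 / (cmod (den j z))\<^sup>2"
    using dpos by (intro divide_right_mono) auto
  then show "\<bar>Im (mob j z)\<bar> \<le> Y * (cmod (mob j z))\<^sup>2"
    unfolding abs_Im_mob[OF j] cmod_mob by simp
qed (fact \<epsilon>)

text \<open>If a point were missed, the uncovered points of a suitable trap would form a nonempty
  compact set, on which Re / |Im| attains its maximum. By \<open>pullback\<close> some map sends the
  maximal point to an uncovered point, again in the trap, with a strictly larger quotient.\<close>

lemma slit_covered: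
  assumes \<epsilon>: "\<epsilon> > 0" and UW: "open UW" "ball (of_real \<epsilon>) \<epsilon> \<subseteq> UW"
    and real: "\<And>x. x > 0 \<Longrightarrow> of_real x \<in> UW"
    and pullback: "\<And>z. z \<in> slit \<Longrightarrow> (\<And>j. j \<in> J \<Longrightarrow> mob j z \<in> UW) \<Longrightarrow> z \<in> UW"
  shows "slit \<subseteq> UW"
proof (rule ccontr)
  assume "\<not> slit \<subseteq> UW"
  then obtain z0 where z0: "z0 \<in> slit" "z0 \<notin> UW" by blast
  have nonreal: "Im z \<noteq> 0" if "z \<in> slit" "z \<notin> UW" for z
  proof
    assume "Im z = 0"
    then have "z = of_real (Re z)" "Re z > 0" using that(1) by (auto simp: complex_eq_iff slit_iff)
    then show False using real that(2) by metis
  qed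
  have I0: "Im z0 \<noteq> 0" using nonreal z0 by blast
  define c0 where "c0 = Re z0 / \<bar>Im z0\<bar>"
  define \<mu> where "\<mu> = sqrt (c0\<^sup>2 / (1 + c0\<^sup>2))"
  \<comment> \<open>R is the smallest radius for which z0 satisfies the size constraint and
    \<open>trap_mob\<close> applies; Y is chosen in the same way, given R.\<close>
  define R where "R = max (cmod z0) (sqrt (2 / (1 - \<mu>)))"
  define Y where "Y = max (\<bar>Im z0\<bar> / (cmod z0)\<^sup>2) (R / (1 - \<mu>))"
  have "1 + c0\<^sup>2 > 0" by (simp add: add_pos_nonneg)
  then have \<mu>: "0 \<le> \<mu>" "\<mu> < 1" unfolding \<mu>_def by (auto intro!: real_sqrt_lt_1_iff[THEN iffD2])
  have R: "R \<ge> 0" "R\<^sup>2 \<ge> 2 / (1 - \<mu>)"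
  proof -
    show "R \<ge> 0" unfolding R_def by (simp add: le_max_iff_disj)
    have "(sqrt (2 / (1 - \<mu>)))\<^sup>2 \<le> R\<^sup>2" using \<mu> by (intro power_mono) (auto simp: R_def)
    then show "R\<^sup>2 \<ge> 2 / (1 - \<mu>)" using \<mu> by simp
  qed
  have Y: "Y \<ge> R / (1 - \<mu>)" "Y \<ge> 0"
    unfolding Y_def using \<mu> R by (auto simp: le_max_iff_disj)
  define K where "K = trap \<epsilon> c0 R Y - UW"
  have "compact K" unfolding K_def using compact_trap UW(1) by (simp add: compact_diff)
  have z0K: "z0 \<in> K"
  proof -
    have "z0 \<in> trap \<epsilon> c0 R Y"
    proof (rule trapI[OF \<epsilon> Y(2)])
      show "z0 \<noteq> 0" using I0 by auto
      show "Re z0 \<ge> c0 * \<bar>Im z0\<bar>" using I0 by (simp add: c0_def)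
      show "cmod z0 \<le> R" by (simp add: R_def)
      have "\<bar>Im z0\<bar> = \<bar>Im z0\<bar> / (cmod z0)\<^sup>2 * (cmod z0)\<^sup>2" using I0 by auto
      also have "\<dots> \<le> Y * (cmod z0)\<^sup>2" by (intro mult_right_mono) (auto simp: Y_def)
      finally show "\<bar>Im z0\<bar> \<le> Y * (cmod z0)\<^sup>2" .
      have "z0 \<notin> ball (of_real \<epsilon>) \<epsilon>" using UW(2) z0(2) by blast
      then show "2 * \<epsilon> * Re z0 \<le> (cmod z0)\<^sup>2" unfolding mem_tangent_ball[OF \<epsilon>] by simp
    qed
    then show ?thesis using z0 by (simp add: K_def)
  qed
  have KI: "Im z \<noteq> 0" if "z \<in> K" for z
    using that nonreal trap_slit by (auto simp: K_def)
  have cont: "continuous_on K (\<lambda>z. Re z / \<bar>Im z\<bar>)"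
    using KI by (intro continuous_intros) auto
  obtain z where z: "z \<in> K" "\<And>w. w \<in> K \<Longrightarrow> Re w / \<bar>Im w\<bar> \<le> Re z / \<bar>Im z\<bar>"
    using continuous_attains_sup[OF \<open>compact K\<close> _ cont] z0K by blast
  have zt: "z \<in> trap \<epsilon> c0 R Y" "z \<notin> UW" using z(1) by (auto simp: K_def)
  obtain j where j: "j \<in> J" "mob j z \<notin> UW" using pullback[OF trap_slit[OF zt(1)]] zt(2) by blast
  have "mob j z \<in> trap \<epsilon> c0 R Y"
    by (rule trap_mob[OF \<epsilon> j(1) zt(1) KI[OF z(1)]])
       (use R Y UW(2) j(2) in \<open>auto simp: \<mu>_def\<close>)
  then have "mob j z \<in> K" using j by (simp add: K_def)
  then show False using z(2) cot_mob_increases(2)[OF j(1) KI[OF z(1)]] by fastforce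
qed

text \<open>Start from a region V inside N that all maps send into itself, and let the domains grow
  by taking preimages: applying \<open>slw\<close> to a solution known on \<open>W n\<close> gives
  its values on \<open>W (Suc n)\<close>. The covering lemma shows that these domains exhaust the
  slit plane.\<close>

lemma extend_to_slit:
  assumes N: "open N" "vholomorphic_on \<psi> N" "of_real ` {0<..1} \<subseteq> N"
    and \<epsilon>0: "\<epsilon>0 > 0" "ball (of_real \<epsilon>0) \<epsilon>0 \<subseteq> N"
    and eq: "\<And>x. 0 < x \<Longrightarrow> x < 1 \<Longrightarrow> \<psi> (of_real x) = slw \<psi> (of_real x)"
  obtains \<Psi> where "vholomorphic_on \<Psi> slit" "\<And>z. z \<in> slit \<Longrightarrow> \<Psi> z = slw \<Psi> z"
    "\<And>x. 0 < x \<Longrightarrow> x < 1 \<Longrightarrow> \<Psi> (of_real x) = \<psi> (of_real x)"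
proof -
  have "compact (complex_of_real ` {\<epsilon>0..1})"
    by (intro compact_continuous_image continuous_intros) simp
  moreover have "complex_of_real ` {\<epsilon>0..1} \<subseteq> N" using N(3) \<epsilon>0(1) by auto
  ultimately obtain \<delta> where \<delta>: "\<delta> > 0" "(\<Union>x\<in>complex_of_real ` {\<epsilon>0..1}. ball x \<delta>) \<subseteq> N"
    using compact_subset_open_imp_ball_epsilon_subset N(1) by metis
  \<comment> \<open>The opening t of the sector is at most \<delta>, so that points with \<epsilon>0
    < Re z \<le> 1 stay within \<delta> of the interval, and at most 1, so that points closer to 0
    lie in the disc of radius \<epsilon>0.\<close>
  define t where "t = min 1 \<delta>"
  \<comment> \<open>With 2 \<epsilon> \<le> t every point of the small disc has |Im z| < t, which a
    map with b d \<ge> 1 carries into the sector.\<close>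
  define \<epsilon> where "\<epsilon> = min \<epsilon>0 (t / 2)"
  have t: "t > 0" "t \<le> 1" "t \<le> \<delta>" using \<delta> by (auto simp: t_def)
  have \<epsilon>: "\<epsilon> > 0" "\<epsilon> \<le> \<epsilon>0" "2 * \<epsilon> \<le> t" using t \<epsilon>0 by (auto simp: \<epsilon>_def)
  define C where "C = {z. Re z > 0 \<and> cmod z < 1 \<and> \<bar>Im z\<bar> < t * Re z}"
  define V where "V = C \<union> ball (of_real \<epsilon>) \<epsilon>"
  have V_Re: "Re z > 0" if "z \<in> V" for z
  proof (cases "z \<in> C")
    case False
    then have "(cmod z)\<^sup>2 < 2 * \<epsilon> * Re z" using that mem_tangent_ball[OF \<epsilon>(1)] by (simp add: V_def)
    then have "0 < 2 * \<epsilon> * Re z" using zero_le_power2 le_less_trans by blast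
    then show ?thesis using \<epsilon>(1) by (simp add: zero_less_mult_iff)
  qed (simp add: C_def)
  have V_slit: "V \<subseteq> slit" using V_Re by (auto simp: slit_iff)
  have "C \<subseteq> N"
  proof
    fix z assume z: "z \<in> C"
    show "z \<in> N"
    proof (cases "Re z \<le> \<epsilon>0")
      case True
      have "\<bar>Im z\<bar> < Re z" using z t by (auto simp: C_def intro: less_le_trans[of _ "t * Re z"])
      then have "(Im z)\<^sup>2 < (Re z)\<^sup>2" using power_strict_mono[of "\<bar>Im z\<bar>" "Re z" 2] by simp
      then have "(cmod z)\<^sup>2 < 2 * (Re z * Re z)" unfolding cmod_power2 by (simp add: power2_eq_square)
      also have "\<dots> \<le> 2 * (\<epsilon>0 * Re z)" using True z by (intro mult_left_mono mult_right_mono) (auto simp: C_def)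
      finally have "z \<in> ball (of_real \<epsilon>0) \<epsilon>0" unfolding mem_tangent_ball[OF \<epsilon>0(1)] by simp
      then show ?thesis using \<epsilon>0(2) by blast
    next
      case False
      have "Re z \<le> 1" using z abs_Re_le_cmod[of z] by (simp add: C_def)
      have "dist (of_real (Re z)) z = \<bar>Im z\<bar>" by (simp add: dist_norm cmod_def)
      also have "\<dots> < t * Re z" using z by (simp add: C_def)
      also have "\<dots> \<le> \<delta> * 1" using t \<open>Re z \<le> 1\<close> z by (intro mult_mono) (auto simp: C_def)
      finally have "z \<in> ball (of_real (Re z)) \<delta>" by simp
      moreover have "Re z \<in> {\<epsilon>0..1}" using False \<open>Re z \<le> 1\<close> by simp
      ultimately show ?thesis using \<delta>(2) by blast
    qed
  qed
  moreover have "ball (of_real \<epsilon>) \<epsilon> \<subseteq> ball (complex_of_real \<epsilon>0) \<epsilon>0"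
  proof
    fix z :: complex assume "z \<in> ball (of_real \<epsilon>) \<epsilon>"
    moreover from this have "Re z > 0" using V_Re by (simp add: V_def)
    ultimately show "z \<in> ball (of_real \<epsilon>0) \<epsilon>0"
      using \<epsilon> mem_tangent_ball[OF \<epsilon>(1)] mem_tangent_ball[OF \<epsilon>0(1)]
      by (auto elim!: less_le_trans)
  qed
  ultimately have VN: "V \<subseteq> N" using \<epsilon>0(2) by (auto simp: V_def)
  have C_open: "open C"
    unfolding C_def by (intro open_Collect_conj open_Collect_less continuous_intros)
  have V_open: "open V" unfolding V_def by (intro open_Un C_open open_ball)
  have V_mob: "mob j z \<in> V" if z: "z \<in> V" and j: "j \<in> J" for j z
  proof -
    note Rz = V_Re[OF z]
    have RC: "Re (mob j z) > 0" "cmod (mob j z) < 1" using Re_mob_pos[OF j Rz] cmod_mob_less_1[OF j Rz] by auto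
    have sl: "z \<in> slit" using Rz by (simp add: slit_iff)
    have dpos: "(cmod (den j z))\<^sup>2 > 0" using den_nz[OF j sl] by simp
    consider "z \<in> C" | "z \<in> ball (of_real \<epsilon>) \<epsilon>" "j = j0" | "z \<in> ball (of_real \<epsilon>) \<epsilon>" "j \<noteq> j0"
      using z by (auto simp: V_def)
    then show ?thesis
    proof cases
      case 1
      then have "\<bar>Im (mob j z)\<bar> < t * Re (mob j z)" using cone_mob[OF j Rz] by (simp add: C_def)
      then show ?thesis using RC by (simp add: V_def C_def)
    next
      case 2
      \<comment> \<open>In the coordinate 1 / z the disc is a half plane and this map a translation
        by \<open>\<l>\<close> to the right, so the disc is preserved.\<close>
      have "(cmod z)\<^sup>2 < 2 * \<epsilon> * Re z" using 2(1) mem_tangent_ball[OF \<epsilon>(1)] by simp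
      also have "\<dots> \<le> 2 * \<epsilon> * (\<l> * (cmod z)\<^sup>2 + Re z)" using l_pos \<epsilon>(1) by (intro mult_left_mono) auto
      finally have "(cmod z)\<^sup>2 / (cmod (den j z))\<^sup>2 < 2 * \<epsilon> * (\<l> * (cmod z)\<^sup>2 + Re z) / (cmod (den j z))\<^sup>2"
        using dpos by (intro divide_strict_right_mono)
      then have "mob j z \<in> ball (of_real \<epsilon>) \<epsilon>"
        unfolding mem_tangent_ball[OF \<epsilon>(1)] cmod_mob Re_mob 2(2) by (simp add: num_def special)
      then show ?thesis by (simp add: V_def)
    next
      case 3
      have "(cmod z)\<^sup>2 < 2 * \<epsilon> * Re z" using 3(1) mem_tangent_ball[OF \<epsilon>(1)] by simp
      also have "\<dots> \<le> 2 * \<epsilon> * cmod z" using complex_Re_le_cmod \<epsilon>(1) by (intro mult_left_mono) auto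
      finally have "cmod z * cmod z < (2 * \<epsilon>) * cmod z" by (simp add: power2_eq_square)
      then have "cmod z < 2 * \<epsilon>" by (simp add: mult_less_cancel_right)
      then have "\<bar>Im z\<bar> < t * 1" using abs_Im_le_cmod[of z] \<epsilon>(3) by linarith
      also have "\<dots> \<le> t * (a j * c j * (cmod z)\<^sup>2 + (a j * d j + b j * c j) * Re z + b j * d j)"
      proof (intro mult_left_mono)
        have "1 * 1 \<le> b j * d j" using generic[OF j 3(2)] by (intro mult_mono) auto
        moreover have "a j * c j * (cmod z)\<^sup>2 \<ge> 0" "(a j * d j + b j * c j) * Re z \<ge> 0"
          using ge0[OF j] gt0[OF j] Rz by auto
        ultimately show "1 \<le> a j * c j * (cmod z)\<^sup>2 + (a j * d j + b j * c j) * Re z + b j * d j" by linarith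
      qed (use t in auto)
      finally have "\<bar>Im z\<bar> / (cmod (den j z))\<^sup>2 < t * (a j * c j * (cmod z)\<^sup>2 + (a j * d j + b j * c j) * Re z + b j * d j) / (cmod (den j z))\<^sup>2"
        using dpos by (intro divide_strict_right_mono)
      then have "\<bar>Im (mob j z)\<bar> < t * Re (mob j z)" unfolding abs_Im_mob[OF j] Re_mob by simp
      then show ?thesis using RC by (simp add: V_def C_def)
    qed
  qed
  have \<psi>V: "vholomorphic_on \<psi> V" using N(2) VN by (rule vholomorphic_on_subset)
  have slV: "vholomorphic_on (slw \<psi>) V"
    by (rule vholomorphic_slw[OF \<psi>V]) (use V_mob V_slit den_slit in blast)
  have eqV: "\<psi> z = slw \<psi> z" if z: "z \<in> V" for z
  proof (cases "z \<in> C")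
    case True
    have "convex {z. \<bar>Im z\<bar> < t * Re z}"
    proof (rule convexI)
      fix x y :: complex and u v :: real
      assume xy: "x \<in> {z. \<bar>Im z\<bar> < t * Re z}" "y \<in> {z. \<bar>Im z\<bar> < t * Re z}"
        and uv: "0 \<le> u" "0 \<le> v" "u + v = 1"
      have "\<bar>u * Im x + v * Im y\<bar> \<le> u * \<bar>Im x\<bar> + v * \<bar>Im y\<bar>"
        using uv abs_triangle_ineq[of "u * Im x" "v * Im y"] by (simp add: abs_mult)
      also have "\<dots> < u * (t * Re x) + v * (t * Re y)"
      proof (cases "u = 0")
        case True then show ?thesis using xy uv by simp
      next
        case False
        then have "u * \<bar>Im x\<bar> < u * (t * Re x)" using xy uv by simp
        moreover have "v * \<bar>Im y\<bar> \<le> v * (t * Re y)" using xy uv by (intro mult_left_mono) auto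
        ultimately show ?thesis by linarith
      qed
      finally show "u *\<^sub>R x + v *\<^sub>R y \<in> {z. \<bar>Im z\<bar> < t * Re z}" by (simp add: algebra_simps)
    qed
    moreover have "C = {z. Re z > 0} \<inter> ball 0 1 \<inter> {z. \<bar>Im z\<bar> < t * Re z}" by (auto simp: C_def)
    ultimately have "convex C" by (auto intro!: convex_Int convex_halfspace_Re_gt)
    then have "connected C" by (rule convex_connected)
    moreover have "vholomorphic_on \<psi> C" "vholomorphic_on (slw \<psi>) C"
      using \<psi>V slV vholomorphic_on_subset by (auto simp: V_def)
    moreover have "of_real ` {0<..<1::real} \<subseteq> C" using t by (auto simp: C_def)
    ultimately show ?thesis
      using vholomorphic_identity_real[of \<psi> C "slw \<psi>" 0 1 z] C_open eq True by simp
  next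
    case False
    then have zb: "z \<in> ball (of_real \<epsilon>) \<epsilon>" using z by (simp add: V_def)
    have "of_real ` {0<..<\<epsilon>} \<subseteq> ball (complex_of_real \<epsilon>) \<epsilon>"
      by (auto simp: dist_real_def)
    moreover have "vholomorphic_on \<psi> (ball (of_real \<epsilon>) \<epsilon>)" "vholomorphic_on (slw \<psi>) (ball (of_real \<epsilon>) \<epsilon>)"
      using \<psi>V slV vholomorphic_on_subset by (auto simp: V_def)
    moreover have "\<epsilon> \<le> 1" using \<epsilon> t by linarith
    ultimately show ?thesis
      using vholomorphic_identity_real[of \<psi> "ball (of_real \<epsilon>) \<epsilon>" "slw \<psi>" 0 \<epsilon> z] eq zb \<epsilon>(1)
      by (simp add: connected_ball)
  qed
  \<comment> \<open>\<open>W n\<close> consists of the slit-plane points all of whose images under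
    n-fold compositions of the maps lie in V.\<close>
  define W where "W = rec_nat V (\<lambda>n X. {z \<in> slit. \<forall>j\<in>J. mob j z \<in> X})"
  have W0: "W 0 = V" and WS: "W (Suc n) = {z \<in> slit. \<forall>j\<in>J. mob j z \<in> W n}" for n
    by (simp_all add: W_def)
  have W_slit: "W n \<subseteq> slit" for n by (cases n) (use V_slit in \<open>auto simp: W0 WS\<close>)
  have W_open: "open (W n)" for n
  proof (induction n)
    case (Suc n)
    have "W (Suc n) = slit \<inter> (\<Inter>j\<in>J. {z \<in> slit. mob j z \<in> W n})" by (auto simp: WS)
    then show ?case using Suc open_mob_preimage fin open_slit by (auto intro!: open_Int open_INT)
  qed (simp add: W0 V_open)
  have W_mono: "W n \<subseteq> W (Suc n)" for n
  proof (induction n)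
    case 0 then show ?case using V_mob V_slit by (auto simp: W0 WS)
  next
    case (Suc n) then show ?case by (auto simp: WS[of n] WS[of "Suc n"])
  qed
  have W_mono': "W m \<subseteq> W n" if "m \<le> n" for m n
    using W_mono that by (rule lift_Suc_mono_le)
  have cover: "slit \<subseteq> (\<Union>n. W n)"
  proof (rule slit_covered[OF \<epsilon>(1)])
    show "open (\<Union>n. W n)" using W_open by blast
    show "ball (of_real \<epsilon>) \<epsilon> \<subseteq> (\<Union>n. W n)" using W0 by (auto simp: V_def)
    show "z \<in> (\<Union>n. W n)" if z: "z \<in> slit" "\<And>j. j \<in> J \<Longrightarrow> mob j z \<in> (\<Union>n. W n)" for z
    proof -
      have "\<forall>j\<in>J. \<exists>n. mob j z \<in> W n" using z(2) by blast
      then obtain n where n: "\<And>j. j \<in> J \<Longrightarrow> mob j z \<in> W (n j)" by metis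
      have "mob j z \<in> W (Max (n ` J))" if "j \<in> J" for j
        using W_mono'[of "n j" "Max (n ` J)"] n[OF that] fin that by auto
      then have "z \<in> W (Suc (Max (n ` J)))" using z(1) by (simp add: WS)
      then show ?thesis by blast
    qed
    \<comment> \<open>One application of any map sends the positive axis into the open unit
      interval, hence into the sector.\<close>
    fix x :: real assume x: "x > 0"
    have "mob j (of_real x) \<in> V" if "j \<in> J" for j
    proof -
      have "Re (mob j (of_real x)) > 0" "cmod (mob j (of_real x)) < 1"
        using Re_mob_pos cmod_mob_less_1 that x by auto
      moreover have "Im (mob j (of_real x)) = 0" by (simp add: Im_mob)
      ultimately show ?thesis using t by (simp add: V_def C_def)
    qed
    then have "of_real x \<in> W (Suc 0)" using x by (auto simp: WS W0 slit_iff)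
    then show "of_real x \<in> (\<Union>n. W n)" by blast
  qed
  define f where "f n = (slw ^^ n) \<psi>" for n
  have fV: "f n z = \<psi> z" if "z \<in> V" for n z
    using that
  proof (induction n arbitrary: z)
    case (Suc n)
    have "f (Suc n) z = slw (f n) z" by (simp add: f_def)
    also have "\<dots> = slw \<psi> z" by (rule slw_cong) (use Suc V_mob in blast)
    finally show ?case using eqV Suc by simp
  qed (simp add: f_def)
  have fW: "f (Suc n) z = f n z" if "z \<in> W n" for n z
    using that
  proof (induction n arbitrary: z)
    case (Suc n)
    have "slw (f (Suc n)) z = slw (f n) z" by (rule slw_cong) (use Suc WS in auto)
    then show ?case by (simp add: f_def)
  qed (use fV W0 in auto)
  have fhol: "vholomorphic_on (f n) (W n)" for n
  proof (induction n)
    case (Suc n)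
    have "vholomorphic_on (slw (f n)) (W (Suc n))"
      by (rule vholomorphic_slw[OF Suc]) (use den_slit WS in auto)
    then show ?case by (simp add: f_def)
  qed (use \<psi>V in \<open>simp add: f_def W0\<close>)
  \<comment> \<open>The iterates are stationary on \<open>W n\<close> from stage n on, so the first
    available stage already gives the common value.\<close>
  define \<Psi> where "\<Psi> z = f (LEAST n. z \<in> W n) z" for z
  have \<Psi>: "\<Psi> z = f n z" if z: "z \<in> W n" for z n
  proof -
    define m where "m = (LEAST n. z \<in> W n)"
    have m: "z \<in> W m" "m \<le> n" unfolding m_def using z by (auto intro: LeastI Least_le)
    have "f (m + k) z = f m z" for k
    proof (induction k)
      case (Suc k)
      have "z \<in> W (m + k)" using m(1) W_mono'[of m "m + k"] by auto
      then show ?case using fW[of z "m + k"] Suc by simp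
    qed simp
    from this[of "n - m"] show ?thesis using m by (simp add: \<Psi>_def m_def)
  qed
  show ?thesis
  proof
    show "vholomorphic_on \<Psi> slit"
    proof (rule vholomorphic_on_local[OF open_slit])
      fix z assume "z \<in> slit"
      then obtain n where n: "z \<in> W n" using cover by blast
      have "vholomorphic_on \<Psi> (W n)" using fhol[of n] vholomorphic_on_cong[of "W n" \<Psi> "f n"] \<Psi> by blast
      then show "\<exists>T. open T \<and> z \<in> T \<and> vholomorphic_on \<Psi> T" using n W_open by blast
    qed
  next
    fix z assume "z \<in> slit"
    then obtain n where n: "z \<in> W n" using cover by blast
    then have n1: "z \<in> W (Suc n)" using W_mono by blast
    then have "\<Psi> z = slw (f n) z" using \<Psi>[OF n1] by (simp add: f_def)
    also have "\<dots> = slw \<Psi> z" by (rule slw_cong) (use n1 \<Psi> WS in auto)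
    finally show "\<Psi> z = slw \<Psi> z" .
  next
    fix x :: real assume "0 < x" "x < 1"
    then have "of_real x \<in> V" using t by (simp add: V_def C_def)
    then show "\<Psi> (of_real x) = \<psi> (of_real x)" using \<Psi>[of "of_real x" 0] W0 by (simp add: f_def)
  qed
qed

end

section \<open>Solutions with a simple pole at the cusp\<close>

text \<open>Two discs with real centres meet in a convex set, which contains a real interval.\<close>

lemma glue_real_balls:
  fixes \<phi> :: "real \<Rightarrow> complex^'n"
  assumes P: "\<And>x r. (x, r) \<in> P \<Longrightarrow> 0 < x \<and> x \<le> 1 \<and> r > 0 \<and>
      (\<exists>g. vholomorphic_on g (ball (of_real x) r) \<and>
           (\<forall>y. \<bar>y - x\<bar> < r \<and> 0 < y \<and> y < 1 \<longrightarrow> g (of_real y) = \<phi> y))"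
  obtains \<psi> where "vholomorphic_on \<psi> (\<Union>(x, r)\<in>P. ball (of_real x) r)"
    "\<And>y. 0 < y \<Longrightarrow> y < 1 \<Longrightarrow> of_real y \<in> (\<Union>(x, r)\<in>P. ball (of_real x :: complex) r) \<Longrightarrow> \<psi> (of_real y) = \<phi> y"
proof -
  let ?B = "\<lambda>p :: real \<times> real. ball (complex_of_real (fst p)) (snd p)"
  have "\<forall>p\<in>P. \<exists>g. vholomorphic_on g (?B p) \<and>
      (\<forall>y. \<bar>y - fst p\<bar> < snd p \<and> 0 < y \<and> y < 1 \<longrightarrow> g (of_real y) = \<phi> y)"
    using P by fastforce
  then obtain g where g: "\<And>p. p \<in> P \<Longrightarrow> vholomorphic_on (g p) (?B p)"
    "\<And>p y. p \<in> P \<Longrightarrow> \<bar>y - fst p\<bar> < snd p \<Longrightarrow> 0 < y \<Longrightarrow> y < 1 \<Longrightarrow> g p (of_real y) = \<phi> y" by metis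
  have pos: "0 < fst p" "fst p \<le> 1" "snd p > 0" if "p \<in> P" for p
    using P[of "fst p" "snd p"] that by auto
  have cons: "g p z = g p' z" if p: "p \<in> P" "p' \<in> P" "z \<in> ?B p" "z \<in> ?B p'" for p p' z
  proof -
    \<comment> \<open>The real points common to both discs and to the unit interval. They exist
      because Re z lies in the real diameters of both discs and the centres lie in the half-open
      interval from 0 to 1.\<close>
    define lo where "lo = max (max (fst p - snd p) (fst p' - snd p')) 0"
    define hi where "hi = min (min (fst p + snd p) (fst p' + snd p')) 1"
    have R: "\<bar>Re z - fst p\<bar> < snd p" "\<bar>Re z - fst p'\<bar> < snd p'"
      using p(3,4) abs_Re_le_cmod[of "z - of_real (fst p)"] abs_Re_le_cmod[of "z - of_real (fst p')"]
      by (auto simp: dist_norm norm_minus_commute)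
    have "lo < hi" using R pos[OF p(1)] pos[OF p(2)] unfolding lo_def hi_def by auto
    show ?thesis
    proof (rule vholomorphic_identity_real[of _ "?B p \<inter> ?B p'" _ lo hi])
      show "vholomorphic_on (g p) (?B p \<inter> ?B p')" "vholomorphic_on (g p') (?B p \<inter> ?B p')"
        using g(1) p vholomorphic_on_subset by blast+
      show "connected (?B p \<inter> ?B p')" by (intro convex_connected convex_Int convex_ball)
      show "of_real ` {lo<..<hi} \<subseteq> ?B p \<inter> ?B p'"
        by (auto simp: lo_def hi_def dist_norm simp flip: of_real_diff)
      show "g p (of_real x) = g p' (of_real x)" if "lo < x" "x < hi" for x
        using that g(2)[OF p(1), of x] g(2)[OF p(2), of x] by (auto simp: lo_def hi_def)
    qed (use p \<open>lo < hi\<close> in auto)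
  qed
  define \<psi> where "\<psi> z = g (SOME p. p \<in> P \<and> z \<in> ?B p) z" for z
  have \<psi>: "\<psi> z = g p z" if "p \<in> P" "z \<in> ?B p" for p z
  proof -
    have "(SOME p. p \<in> P \<and> z \<in> ?B p) \<in> P \<and> z \<in> ?B (SOME p. p \<in> P \<and> z \<in> ?B p)"
      by (rule someI[of "\<lambda>p. p \<in> P \<and> z \<in> ?B p" p]) (use that in auto)
    then show ?thesis unfolding \<psi>_def using cons that by blast
  qed
  have U: "(\<Union>(x, r)\<in>P. ball (of_real x :: complex) r) = (\<Union>p\<in>P. ?B p)" by (simp add: case_prod_beta)
  show ?thesis
  proof (rule that[of \<psi>])
    show "vholomorphic_on \<psi> (\<Union>(x, r)\<in>P. ball (of_real x) r)"
      unfolding U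
    proof (rule vholomorphic_on_local)
      fix z assume "z \<in> (\<Union>p\<in>P. ?B p)"
      then obtain p where p: "p \<in> P" "z \<in> ?B p" by blast
      have "vholomorphic_on \<psi> (?B p)"
        using g(1)[OF p(1)] vholomorphic_on_cong[of "?B p" \<psi> "g p"] \<psi>[OF p(1)] by blast
      then show "\<exists>T. open T \<and> z \<in> T \<and> vholomorphic_on \<psi> T" using p(2) open_ball by blast
    qed auto
    fix y :: real assume y: "0 < y" "y < 1" "of_real y \<in> (\<Union>(x, r)\<in>P. ball (of_real x :: complex) r)"
    then obtain p where p: "p \<in> P" "of_real y \<in> ?B p" unfolding U by blast
    then have "\<bar>y - fst p\<bar> < snd p" by (simp add: dist_norm abs_minus_commute flip: of_real_diff)
    then show "\<psi> (of_real y) = \<phi> y" using g(2)[OF p(1)] y \<psi>[OF p] by simp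
  qed
qed

text \<open>Increments near a positive limit would push the sequence below every bound. Later L is
  the squared length of a fixed part, which is thereby excluded.\<close>

lemma bounded_increments_zero:
  fixes u :: "nat \<Rightarrow> real"
  assumes "\<And>n. \<bar>u n\<bar> \<le> B" "(\<lambda>n. u n - u (Suc n)) \<longlonglongrightarrow> L" "L \<ge> 0"
  shows "L = 0"
proof (rule ccontr)
  assume "L \<noteq> 0"
  then have L: "L > 0" using assms(3) by simp
  then have "\<forall>\<^sub>F n in sequentially. u n - u (Suc n) > L / 2"
    using order_tendstoD(1)[OF assms(2), of "L / 2"] by simp
  then obtain N where N: "\<And>n. n \<ge> N \<Longrightarrow> u n - u (Suc n) > L / 2" by (auto simp: eventually_sequentially)
  have "u N - u (N + k) \<ge> real k * (L / 2)" for k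
  proof (induction k)
    case (Suc k)
    then show ?case using N[of "N + k"] by (simp add: algebra_simps add_divide_distrib)
  qed simp
  moreover have "u N - u (N + k) \<le> 2 * B" for k using assms(1)[of N] assms(1)[of "N + k"] by linarith
  ultimately have *: "real k * (L / 2) \<le> 2 * B" for k by (meson order_trans)
  obtain k where "real k > 2 * B / (L / 2)" using reals_Archimedean2 by blast
  then show False using *[of k] L by (simp add: field_simps)
qed

context parabolic_sum
begin

text \<open>The data p and b are read off from the equation along an orbit tending to 0: the order X
  gives U c = c, the order 1 gives f(0) = (2 s - 1) l c + g, where g is the limit of the twisted
  increments of the bounded remainder. Boundedness removes the fixed part of g, so g = b - U b, and
  the uniqueness principle applies.\<close>

lemma bounded_cocycle:
  fixes \<phi> :: "real \<Rightarrow> complex^'n"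
  assumes G: "open G" "0 \<in> G" "vholomorphic_on f G"
    and s: "Re s > 0" "s \<noteq> 1/2" and \<delta>: "\<delta> > 0"
    and asy: "\<And>x. 0 < x \<Longrightarrow> x < \<delta> \<Longrightarrow> norm (\<phi> x - of_real (1 / x) *s cc) \<le> M"
    and eq: "\<And>x. 0 < x \<Longrightarrow> x < \<delta> \<Longrightarrow>
      f (of_real x) = \<phi> x - of_real (1 + \<l> * x) powr (- 2 * s) *s (U *v \<phi> (x / (1 + \<l> * x)))"
  obtains b where "admissible f ((2 * s - 1) *s cc) b"
    "\<And>x. 0 < x \<Longrightarrow> x < \<delta> \<Longrightarrow> Ks f ((2 * s - 1) *s cc) b s (of_real (1 / x)) =
       ((2 * s - 1) * of_real (1 / x) powr (- 2 * s)) *s \<phi> x"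
proof -
  define \<beta> where "\<beta> x = \<phi> x - of_real (1 / x) *s cc" for x
  \<comment> \<open>An orbit in the coordinate 1 / x, started at 2 / \<delta> so that all 1 / X n
    lie below \<delta>.\<close>
  define X where "X n = 2 / \<delta> + real n * \<l>" for n
  define v where "v n = complex_of_real (\<l> / X n)" for n
  define \<rho> where "\<rho> n = (1 + v n) powr (- 2 * s)" for n
  have Xpos: "X n > 0" "1 / X n < \<delta>" "1 / X n > 0" for n
  proof -
    have "X n \<ge> 2 / \<delta>" "2 / \<delta> > 0" using \<delta> ell_pos by (auto simp: X_def)
    then show "X n > 0" by linarith
    then show "1 / X n > 0" by simp
    then have "1 / X n \<le> \<delta> / 2" using \<open>X n \<ge> 2 / \<delta>\<close> \<delta> by (simp add: field_simps)
    then show "1 / X n < \<delta>" using \<delta> by linarith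
  qed
  have XS: "X (Suc n) = X n + \<l>" for n by (simp add: X_def algebra_simps)
  have Xinf: "filterlim X at_top sequentially" unfolding X_def using ell_pos by real_asymp
  have X0: "(\<lambda>n. complex_of_real (1 / X n)) \<longlonglongrightarrow> 0"
    using tendsto_of_real[OF tendsto_divide_0[OF tendsto_const[of 1] filterlim_at_top_imp_at_infinity[OF Xinf]], where 'a = complex] by simp
  have v0: "v \<longlonglongrightarrow> 0"
  proof -
    have "(\<lambda>n. of_real \<l> * complex_of_real (1 / X n)) \<longlonglongrightarrow> of_real \<l> * 0" by (intro tendsto_intros X0)
    then show ?thesis by (simp add: v_def[abs_def])
  qed
  have \<rho>1: "\<rho> \<longlonglongrightarrow> 1"
  proof -
    have "(\<lambda>n. (1 + v n) powr (- 2 * s)) \<longlonglongrightarrow> (1 + 0) powr (- 2 * s)"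
      by (intro tendsto_powr_complex tendsto_intros v0) auto
    then show ?thesis by (simp add: \<rho>_def[abs_def])
  qed
  have \<beta>M: "norm (\<beta> (1 / X n)) \<le> M" for n unfolding \<beta>_def using asy Xpos by blast
  have f0: "(\<lambda>n. f (of_real (1 / X n))) \<longlonglongrightarrow> f 0"
  proof (rule isCont_tendsto_compose[OF _ X0])
    show "isCont f 0" using vholomorphic_on_imp_continuous_on[OF G(3)] G(1,2)
      by (simp add: continuous_on_eq_continuous_at)
  qed
  \<comment> \<open>The equation at the n-th orbit point, with the polar part c X separated from the
    bounded part \<beta>.\<close>
  have E: "f (of_real (1 / X n)) = of_real (X n) *s cc - (of_real (X n) * (1 + v n) * \<rho> n) *s (U *v cc)
      + (\<beta> (1 / X n) - \<rho> n *s (U *v \<beta> (1 / X (Suc n))))" for n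
  proof -
    have 1: "(1 / X n) / (1 + \<l> * (1 / X n)) = 1 / X (Suc n)"
      unfolding XS using Xpos(1)[of n] ell_pos by (simp add: field_simps)
    have 2: "\<phi> (1 / X m) = of_real (X m) *s cc + \<beta> (1 / X m)" for m by (simp add: \<beta>_def)
    have 3: "complex_of_real (1 + \<l> * (1 / X n)) = 1 + v n" by (simp add: v_def)
    have 4: "complex_of_real (X (Suc n)) = of_real (X n) * (1 + v n)"
      unfolding XS v_def using Xpos(1)[of n] by (simp add: field_simps)
    have "f (of_real (1 / X n)) = \<phi> (1 / X n) - \<rho> n *s (U *v \<phi> (1 / X (Suc n)))"
      using eq[OF Xpos(3)[of n] Xpos(2)[of n]] unfolding 1 3 \<rho>_def[symmetric] .
    then show ?thesis
      unfolding 2 4 matrix_vector_right_distrib matrix_vector_mult_smult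
      by (simp add: vec_eq_iff algebra_simps)
  qed
  have bd0: "(\<lambda>n. z n *s w n) \<longlonglongrightarrow> 0" if "z \<longlonglongrightarrow> 0" "\<And>n. norm (w n) \<le> M" for z and w :: "nat \<Rightarrow> complex^'n"
  proof (rule tendsto_norm_zero_cancel, rule tendsto_sandwich[OF _ _ tendsto_const])
    show "\<forall>\<^sub>F n in sequentially. norm (z n *s w n) \<le> cmod (z n) * M"
      using that(2) by (intro always_eventually allI) (simp add: mult_left_mono)
    show "(\<lambda>n. cmod (z n) * M) \<longlonglongrightarrow> 0" by (intro tendsto_mult_left_zero tendsto_norm_zero that(1))
  qed auto
  \<comment> \<open>Dividing by X n and passing to the limit leaves only the polar terms.\<close>
  have Ucc: "U *v cc = cc"
  proof -
    have L1: "(\<lambda>n. of_real (1 / X n) *s f (of_real (1 / X n))) \<longlonglongrightarrow> 0 *s f 0"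
      by (intro tendsto_intros X0 f0)
    have L2: "of_real (1 / X n) *s f (of_real (1 / X n)) = cc - ((1 + v n) * \<rho> n) *s (U *v cc)
       + (of_real (1 / X n) *s \<beta> (1 / X n) - (of_real (1 / X n) * \<rho> n) *s (U *v \<beta> (1 / X (Suc n))))" for n
      unfolding E using Xpos(1)[of n] by (simp add: vec_eq_iff algebra_simps)
    have L3: "(\<lambda>n. cc - ((1 + v n) * \<rho> n) *s (U *v cc)
       + (of_real (1 / X n) *s \<beta> (1 / X n) - (of_real (1 / X n) * \<rho> n) *s (U *v \<beta> (1 / X (Suc n)))))
       \<longlonglongrightarrow> cc - ((1 + 0) * 1) *s (U *v cc) + (0 - 0)"
    proof (intro tendsto_intros v0 \<rho>1 bd0 X0 \<beta>M)
      show "(\<lambda>n. of_real (1 / X n) * \<rho> n) \<longlonglongrightarrow> 0" using tendsto_mult[OF X0 \<rho>1] by simp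
      show "norm (U *v \<beta> (1 / X (Suc n))) \<le> M" for n using \<beta>M isometry by simp
    qed
    show ?thesis using LIMSEQ_unique[OF L1[unfolded L2] L3] by simp
  qed
  obtain C where C: "C > 0" "\<And>\<alpha> v. cmod \<alpha> \<le> cmod (1 - 2 * s) \<Longrightarrow> cmod v \<le> 1/2 \<Longrightarrow>
       cmod ((1 + v) powr \<alpha> - 1 - \<alpha> * v) \<le> C * (cmod v)\<^sup>2"
    using powr_binomial_bounds[of "cmod (1 - 2 * s)"] by (metis norm_ge_zero)
  \<comment> \<open>The first-order term of the binomial expansion of X (1 + v)^(1 - 2 s) survives
    as a constant because X v = l; the second-order bound controls the rest.\<close>
  have lim1: "(\<lambda>n. of_real (X n) * (1 + v n) * \<rho> n - of_real (X n)) \<longlonglongrightarrow> (1 - 2 * s) * of_real \<l>"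
  proof (rule LIM_zero_cancel, rule tendsto_norm_zero_cancel, rule tendsto_sandwich[OF _ _ tendsto_const])
    have "\<forall>\<^sub>F n in sequentially. cmod (v n) < 1/2"
      using order_tendstoD(2)[OF tendsto_norm_zero[OF v0], of "1/2"] by simp
    then show "\<forall>\<^sub>F n in sequentially. cmod (of_real (X n) * (1 + v n) * \<rho> n - of_real (X n) - (1 - 2 * s) * of_real \<l>)
        \<le> C * \<l>\<^sup>2 * (1 / X n)"
    proof eventually_elim
      case (elim n)
      have nz: "1 + v n \<noteq> 0"
      proof
        assume "1 + v n = 0"
        then have "v n = - 1" by (simp add: add_eq_0_iff)
        then show False using elim by simp
      qed
      have gen: "x * y * r - x - t * l = x * (P - 1 - t * u)" if "y * r = P" "x * u = l"
        for x y r t l P u :: complex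
        unfolding that[symmetric] by (simp add: algebra_simps)
      have "(1 + v n) * \<rho> n = (1 + v n) powr (1 - 2 * s)"
        using powr_add[of "1 + v n" 1 "- 2 * s"] nz by (simp add: \<rho>_def powr_to_1)
      moreover have "of_real (X n) * v n = of_real \<l>" using Xpos(1)[of n] by (simp add: v_def)
      ultimately have "of_real (X n) * (1 + v n) * \<rho> n - of_real (X n) - (1 - 2 * s) * of_real \<l> =
         of_real (X n) * ((1 + v n) powr (1 - 2 * s) - 1 - (1 - 2 * s) * v n)"
        by (rule gen)
      then have "cmod (of_real (X n) * (1 + v n) * \<rho> n - of_real (X n) - (1 - 2 * s) * of_real \<l>)
        \<le> X n * (C * (cmod (v n))\<^sup>2)"
        using C(2)[of "1 - 2 * s" "v n"] elim Xpos(1)[of n] by (simp add: norm_mult mult_left_mono)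
      also have "\<dots> = C * \<l>\<^sup>2 * (1 / X n)"
        using Xpos(1)[of n] ell_pos by (simp add: v_def norm_divide power2_eq_square field_simps)
      finally show ?case .
    qed
    have "(\<lambda>n. C * \<l>\<^sup>2 * (1 / X n)) \<longlonglongrightarrow> C * \<l>\<^sup>2 * 0"
      by (intro tendsto_intros tendsto_divide_0[OF tendsto_const filterlim_at_top_imp_at_infinity[OF Xinf]])
    then show "(\<lambda>n. C * \<l>\<^sup>2 * (1 / X n)) \<longlonglongrightarrow> 0" by simp
  qed auto
  define g where "g = f 0 - ((2 * s - 1) * of_real \<l>) *s cc"
  have g: "(\<lambda>n. \<beta> (1 / X n) - U *v \<beta> (1 / X (Suc n))) \<longlonglongrightarrow> g"
  proof -
    have L1: "(\<lambda>n. f (of_real (1 / X n)) + (of_real (X n) * (1 + v n) * \<rho> n - of_real (X n)) *s cc + (\<rho> n - 1) *s (U *v \<beta> (1 / X (Suc n))))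
       \<longlonglongrightarrow> f 0 + ((1 - 2 * s) * of_real \<l>) *s cc + 0"
    proof (intro tendsto_intros f0 lim1 bd0)
      show "(\<lambda>n. \<rho> n - 1) \<longlonglongrightarrow> 0" using \<rho>1 by (simp add: LIM_zero)
      show "norm (U *v \<beta> (1 / X (Suc n))) \<le> M" for n using \<beta>M isometry by simp
    qed
    have L2: "f (of_real (1 / X n)) + (of_real (X n) * (1 + v n) * \<rho> n - of_real (X n)) *s cc
        + (\<rho> n - 1) *s (U *v \<beta> (1 / X (Suc n))) = \<beta> (1 / X n) - U *v \<beta> (1 / X (Suc n))" for n
      unfolding E Ucc by (simp add: vec_eq_iff algebra_simps)
    have L3: "f 0 + ((1 - 2 * s) * of_real \<l>) *s cc + 0 = g"
      by (simp add: g_def vec_eq_iff algebra_simps)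
    show ?thesis using L1 unfolding L2 L3 .
  qed
  obtain p b where pb: "U *v p = p" "g = p + (b - U *v b)" "\<And>x. inner p (U *v x) = inner p x"
    using fixed_decomposition by metis
  \<comment> \<open>Pairing with the vector p, which satisfies
    \<open>inner p (U *v x) = inner p x\<close>, turns the twisted increments into ordinary
    increments of a bounded real sequence.\<close>
  have "(norm p)\<^sup>2 = 0"
  proof (rule bounded_increments_zero)
    show "\<bar>inner p (\<beta> (1 / X n))\<bar> \<le> norm p * M" for n
      using Cauchy_Schwarz_ineq2[of p "\<beta> (1 / X n)"] \<beta>M[of n] by (meson mult_left_mono norm_ge_zero order_trans)
    have "(\<lambda>n. inner p (\<beta> (1 / X n) - U *v \<beta> (1 / X (Suc n)))) \<longlonglongrightarrow> inner p g"
      by (intro tendsto_intros g)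
    moreover have "inner p g = (norm p)\<^sup>2"
      unfolding pb(2) by (simp add: inner_add_right inner_diff_right pb(3) power2_norm_eq_inner)
    ultimately show "(\<lambda>n. inner p (\<beta> (1 / X n)) - inner p (\<beta> (1 / X (Suc n)))) \<longlonglongrightarrow> (norm p)\<^sup>2"
      by (simp add: inner_diff_right pb(3))
  qed simp
  then have "p = 0" by simp
  then have gb: "g = b - U *v b" using pb by simp
  define p0 where "p0 = (2 * s - 1) *s cc"
  have adm: "admissible f p0 b"
  proof -
    have "f 0 = \<l> *\<^sub>R p0 + (b - U *v b)"
      using gb unfolding g_def p0_def by (simp add: vec_eq_iff scaleR_conv_of_real[where 'a=complex] algebra_simps)
    moreover have "U *v p0 = p0" unfolding p0_def matrix_vector_mult_smult Ucc ..
    ultimately show ?thesis unfolding admissible_def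
      using vholomorphic_linear_bound[OF G] by blast
  qed
  have nz: "2 * s - 1 \<noteq> 0" using s(2) by (auto simp: field_simps)
  have "Ks f p0 b s (of_real (1 / x)) = ((2 * s - 1) * of_real (1 / x) powr (- 2 * s)) *s \<phi> x"
    if x: "0 < x" "x < \<delta>" for x
  proof -
    \<comment> \<open>The real function is read at a complex argument through the real part; only
      real orbit points occur.\<close>
    define \<Phi> where "\<Phi> z = ((2 * s - 1) * z powr (- 2 * s)) *s \<phi> (Re (1 / z))" for z
    define y where "y n = 1 / x + real n * \<l>" for n
    have y: "y n > 0" "1 / y n < \<delta>" "1 / y n > 0" for n
    proof -
      have "y n \<ge> 1 / x" "1 / x > 0" using x ell_pos by (auto simp: y_def)
      then show "y n > 0" by linarith
      then show "1 / y n > 0" by simp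
      then have "1 / y n \<le> x" using \<open>y n \<ge> 1 / x\<close> x by (simp add: field_simps)
      then show "1 / y n < \<delta>" using x by linarith
    qed
    have yc: "of_real (1 / x) + of_real (real n * \<l>) = complex_of_real (y n)" for n by (simp add: y_def)
    have \<Phi>y: "\<Phi> (of_real (y n)) = ((2 * s - 1) * of_real (y n) powr (- 2 * s)) *s \<phi> (1 / y n)" for n
      unfolding \<Phi>_def by (simp add: Re_divide power2_eq_square)
    have "Ks f p0 b s (of_real (1 / x)) = \<Phi> (of_real (1 / x))"
    proof (rule Ks_eqI[OF adm s(1)])
      show "complex_of_real (1 / x) \<in> slit" using x by (simp add: slit_iff)
    next
      fix n
      have yS: "y (Suc n) = y n + \<l>" by (simp add: y_def algebra_simps)
      have 1: "(1 / y n) / (1 + \<l> * (1 / y n)) = 1 / y (Suc n)"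
        unfolding yS using y(1)[of n] ell_pos by (simp add: field_simps)
      have "complex_of_real (y (Suc n)) powr (- 2 * s) = of_real (y n) powr (- 2 * s) * (1 + of_real \<l> / of_real (y n)) powr (- 2 * s)"
        unfolding yS of_real_add using y(1)[of n] ell_pos by (intro powr_add_slit) (auto simp: slit_iff)
      moreover have "complex_of_real (1 + \<l> * (1 / y n)) = 1 + of_real \<l> / of_real (y n)" by simp
      ultimately have 2: "complex_of_real (y (Suc n)) powr (- 2 * s) = of_real (y n) powr (- 2 * s) * of_real (1 + \<l> * (1 / y n)) powr (- 2 * s)"
        by simp
      have F: "f (1 / of_real (y n)) = \<phi> (1 / y n) - of_real (1 + \<l> * (1 / y n)) powr (- 2 * s) *s (U *v \<phi> (1 / y (Suc n)))"
        using eq[OF y(3)[of n] y(2)[of n]] unfolding 1 by simp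
      show "\<Phi> (of_real (1 / x) + of_real (real n * \<l>)) - U *v \<Phi> (of_real (1 / x) + of_real (real (Suc n) * \<l>)) =
         ((2 * s - 1) * (of_real (1 / x) + of_real (real n * \<l>)) powr (- 2 * s)) *s f (1 / (of_real (1 / x) + of_real (real n * \<l>)))"
        unfolding yc \<Phi>y 2 F matrix_vector_mult_smult by (simp add: vec_eq_iff algebra_simps)
    next
      have lim: "(\<lambda>n. cmod (of_real (y n) powr (- 2 * s)) * (cmod (2 * s - 1) * (norm b + M))) \<longlonglongrightarrow> 0"
        unfolding yc[symmetric] using s(1) by (intro tendsto_mult_left_zero norm_powr_orbit) simp
      have bound: "norm (hs p0 b s (of_real (y n)) - \<Phi> (of_real (y n))) \<le>
          cmod (of_real (y n) powr (- 2 * s)) * (cmod (2 * s - 1) * (norm b + M))" for n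
      proof -
        have "hs p0 b s (of_real (y n)) - \<Phi> (of_real (y n)) =
            of_real (y n) powr (- 2 * s) *s ((2 * s - 1) *s (b - \<beta> (1 / y n)))"
          unfolding hs_def \<Phi>y p0_def \<beta>_def by (simp add: vec_eq_iff algebra_simps)
        moreover have "norm (b - \<beta> (1 / y n)) \<le> norm b + M"
          using norm_triangle_ineq4[of b "\<beta> (1 / y n)"] asy[OF y(3,2)] unfolding \<beta>_def by (meson add_left_mono order_trans)
        ultimately show ?thesis
          by (simp only: norm_vector_smult) (intro mult_left_mono norm_ge_zero)
      qed
      show "(\<lambda>n. norm (hs p0 b s (of_real (1 / x) + of_real (real n * \<l>)) - \<Phi> (of_real (1 / x) + of_real (real n * \<l>)))) \<longlonglongrightarrow> 0"
        unfolding yc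
        by (rule tendsto_sandwich[OF always_eventually always_eventually tendsto_const lim])
           (use bound norm_ge_zero in blast)+
    qed
    also have "\<dots> = ((2 * s - 1) * of_real (1 / x) powr (- 2 * s)) *s \<phi> x"
      using \<Phi>y[of 0] by (simp add: y_def)
    finally show ?thesis .
  qed
  then show ?thesis using that[of b] adm unfolding p0_def by blast
qed

end

locale slow_cocycle = slow_system J j0 a b c d A \<l> s + parabolic_sum \<l> "A j0"
  for J :: "'j set" and j0 :: 'j and a b c d :: "'j \<Rightarrow> real" and A :: "'j \<Rightarrow> complex^'n^'n"
    and \<l> :: real and s :: complex +
  assumes s_pos: "Re s > 0" and s_half: "s \<noteq> 1/2"
begin

section \<open>The slow equation on the unit interval and its part that is regular at the
  cusp\<close>

definition mobr :: "'j \<Rightarrow> real \<Rightarrow> real" where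
  "mobr j x = (a j * x + b j) / (c j * x + d j)"

definition slwr :: "(real \<Rightarrow> complex^'n) \<Rightarrow> real \<Rightarrow> complex^'n" where
  "slwr \<phi> x = (\<Sum>j\<in>J. of_real (c j * x + d j) powr (- 2 * s) *s (A j *v \<phi> (mobr j x)))"

text \<open>The slow operator without its parabolic term. On solutions it equals
  \<open>(1 - \<alpha>(g_{-1})) \<phi>\<close> and is the future component f_{-1}.\<close>

definition rest :: "(complex \<Rightarrow> complex^'n) \<Rightarrow> complex \<Rightarrow> complex^'n" where
  "rest \<psi> z = (\<Sum>j\<in>J - {j0}. opr j \<psi> z)"

text \<open>The point z itself is not confined to the slit plane: 0 has to belong to this set, and
  so may points to the left of 0.\<close>

definition pullback_dom :: "complex set \<Rightarrow> complex set" where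
  "pullback_dom D = {z. \<forall>j\<in>J - {j0}. den j z \<in> slit \<and> mob j z \<in> D}"

lemma two_s_nz: "2 * s - 1 \<noteq> 0"
  using s_half by (auto simp: field_simps)

lemma mob_of_real: "mob j (of_real x) = of_real (mobr j x)"
  by (simp add: mob_def num_def den_def mobr_def)

lemma den_of_real: "den j (of_real x) = of_real (c j * x + d j)"
  by (simp add: den_def)

lemma mobr_unit:
  assumes "j \<in> J" "0 < x"
  shows "0 < mobr j x" "mobr j x < 1"
  using Re_mob_pos[OF assms(1), of "of_real x"] cmod_mob_less_1[OF assms(1), of "of_real x"] assms(2)
  by (auto simp: mob_of_real)

lemma mobr_0:
  assumes "j \<in> J" "j \<noteq> j0"
  shows "0 < mobr j 0" "mobr j 0 \<le> 1"
  using generic[OF assms] le(2)[OF assms(1)] by (auto simp: mobr_def)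

lemma slw_of_real:
  assumes "\<And>j. j \<in> J \<Longrightarrow> \<psi> (of_real (mobr j x)) = \<phi> (mobr j x)"
  shows "slw \<psi> (of_real x) = slwr \<phi> x"
  unfolding slw_def slwr_def opr_def mob_of_real den_of_real using assms by (intro sum.cong) auto

lemma slw_split: "slw \<psi> z = opr j0 \<psi> z + rest \<psi> z"
  unfolding slw_def rest_def using fin j0 by (rule sum.remove)

lemma opr_j0: "opr j0 \<psi> z = (of_real \<l> * z + 1) powr (- 2 * s) *s (A j0 *v \<psi> (z / (of_real \<l> * z + 1)))"
  by (simp add: opr_def mob_def num_def den_def special)

lemma rest_of_real:
  assumes \<psi>: "\<And>x. 0 < x \<Longrightarrow> x < 1 \<Longrightarrow> \<psi> (of_real x) = \<phi> x" and x: "0 < x" "x < 1"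
    and eq: "\<phi> x = slwr \<phi> x"
  shows "rest \<psi> (of_real x) = \<phi> x - of_real (1 + \<l> * x) powr (- 2 * s) *s (A j0 *v \<phi> (x / (1 + \<l> * x)))"
proof -
  have 1: "\<psi> (of_real (mobr j x)) = \<phi> (mobr j x)" if "j \<in> J" for j
    using \<psi> mobr_unit[OF that x(1)] by blast
  have "slw \<psi> (of_real x) = \<phi> x" unfolding eq by (rule slw_of_real[where \<psi> = \<psi> and \<phi> = \<phi> and x = x, OF 1])
  moreover have "opr j0 \<psi> (of_real x) = of_real (1 + \<l> * x) powr (- 2 * s) *s (A j0 *v \<phi> (x / (1 + \<l> * x)))"
    using 1[OF j0] unfolding opr_def mob_of_real den_of_real by (simp add: mobr_def special add.commute)
  ultimately show ?thesis using slw_split[of \<psi> "of_real x"] by (simp add: algebra_simps)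
qed

lemma open_pullback_dom:
  assumes "open D"
  shows "open (pullback_dom D)"
proof -
  have "open {z. den j z \<in> slit \<and> mob j z \<in> D}" for j
  proof -
    have "open (den j -` slit)"
      unfolding den_def by (intro open_vimage open_slit continuous_intros)
    moreover have "continuous_on (den j -` slit) (mob j)"
      unfolding mob_def[abs_def] num_def den_def by (intro continuous_intros) (auto dest: slit_nonzero)
    ultimately have "open (den j -` slit \<inter> mob j -` D)"
      using continuous_open_preimage assms by blast
    then show ?thesis by (simp add: vimage_def Int_def)
  qed
  moreover have "pullback_dom D = (\<Inter>j\<in>J - {j0}. {z. den j z \<in> slit \<and> mob j z \<in> D})"
    by (auto simp: pullback_dom_def)
  ultimately show ?thesis using fin by (auto intro!: open_INT)
qed

lemma vholomorphic_rest:
  "vholomorphic_on \<psi> D \<Longrightarrow> vholomorphic_on (rest \<psi>) (pullback_dom D)"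
  unfolding rest_def[abs_def]
  by (intro vholomorphic_on_sum vholomorphic_opr) (auto simp: pullback_dom_def)

lemma zero_in_pullback_dom:
  assumes "of_real ` {0<..1} \<subseteq> D"
  shows "0 \<in> pullback_dom D"
  unfolding pullback_dom_def
proof safe
  fix j assume j: "j \<in> J" "j \<noteq> j0"
  show "den j 0 \<in> slit" using gt0(2)[OF j(1)] by (simp add: den_def slit_iff)
  show "mob j 0 \<in> D" using assms mobr_0[OF j] mob_of_real[of j 0] by (auto simp: image_subset_iff)
qed

lemma slit_pullback_dom: "slit \<subseteq> pullback_dom slit"
  using den_slit mob_slit by (auto simp: pullback_dom_def)

lemma connected_slit: "connected slit"
proof -
  have "starlike slit"
    unfolding starlike_def
  proof (intro bexI[of _ 1] ballI subsetI)
    fix x z :: complex assume x: "x \<in> slit" "z \<in> closed_segment 1 x"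
    then obtain u where u: "0 \<le> u" "u \<le> 1" "z = (1 - u) *\<^sub>R 1 + u *\<^sub>R x" by (auto simp: in_segment)
    show "z \<in> slit"
    proof (cases "u = 0")
      case False
      then have "Im x \<noteq> 0 \<Longrightarrow> Im z \<noteq> 0" using u by simp
      moreover have "Re x > 0 \<Longrightarrow> Re z > 0" using u False by (simp add: add_nonneg_pos)
      ultimately show ?thesis using x(1) by (auto simp: slit_iff)
    qed (use u in \<open>simp add: slit_iff\<close>)
  qed (simp add: slit_iff)
  then show ?thesis by (rule starlike_imp_connected)
qed

text \<open>
  The solution is extended in three steps: to a neighbourhood of \<open>1\<close> by the slow equation, then to
  a disc tangent to the imaginary axis at \<open>0\<close> by the regularised sum, and finally to the slit plane.
\<close>

lemma continuation:
  fixes \<phi> :: "real \<Rightarrow> complex^'n"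
  assumes an: "real_analytic_on \<phi> {0<..<1}"
    and eq: "\<And>x. 0 < x \<Longrightarrow> x < 1 \<Longrightarrow> \<phi> x = slwr \<phi> x"
    and \<delta>: "\<delta> > 0"
    and asy: "\<And>x. 0 < x \<Longrightarrow> x < \<delta> \<Longrightarrow> norm (\<phi> x - of_real (1 / x) *s cc) \<le> M"
  obtains \<Psi> p0 b0 where "vholomorphic_on \<Psi> slit" "\<And>z. z \<in> slit \<Longrightarrow> \<Psi> z = slw \<Psi> z"
    "\<And>x. 0 < x \<Longrightarrow> x < 1 \<Longrightarrow> \<Psi> (of_real x) = \<phi> x"
    "admissible (rest \<Psi>) p0 b0"
    "\<And>\<xi>. \<xi> \<in> slit \<Longrightarrow> Ks (rest \<Psi>) p0 b0 s \<xi> = ((2 * s - 1) * \<xi> powr (- 2 * s)) *s \<Psi> (1 / \<xi>)"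
proof -
  \<comment> \<open>Discs centred in the half-open interval from 0 to 1 on which some holomorphic
    function extends \<phi>. Their union N is where \<phi> is known so far, and finding a new disc
    enlarges what is known about N.\<close>
  define good where "good x r \<longleftrightarrow> 0 < x \<and> x \<le> 1 \<and> r > 0 \<and>
      (\<exists>g. vholomorphic_on g (ball (of_real x) r) \<and>
           (\<forall>y. \<bar>y - x\<bar> < r \<and> 0 < y \<and> y < 1 \<longrightarrow> g (of_real y) = \<phi> y))" for x r :: real
  define P where "P = {(x, r). good x r}"
  define N where "N = (\<Union>(x, r)\<in>P. ball (complex_of_real x) r)"
  have N_open: "open N" unfolding N_def by auto
  have P: "(x, r) \<in> P \<Longrightarrow> 0 < x \<and> x \<le> 1 \<and> r > 0 \<and>
      (\<exists>g. vholomorphic_on g (ball (of_real x) r) \<and>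
           (\<forall>y. \<bar>y - x\<bar> < r \<and> 0 < y \<and> y < 1 \<longrightarrow> g (of_real y) = \<phi> y))" for x r
    unfolding P_def good_def by blast
  obtain \<psi> where \<psi>: "vholomorphic_on \<psi> N"
    "\<And>y. 0 < y \<Longrightarrow> y < 1 \<Longrightarrow> of_real y \<in> N \<Longrightarrow> \<psi> (of_real y) = \<phi> y"
  proof (rule glue_real_balls[OF P])
    fix \<psi> assume "vholomorphic_on \<psi> (\<Union>(x, r)\<in>P. ball (of_real x) r)"
      "\<And>y. 0 < y \<Longrightarrow> y < 1 \<Longrightarrow> of_real y \<in> (\<Union>(x, r)\<in>P. ball (of_real x :: complex) r) \<Longrightarrow> \<psi> (of_real y) = \<phi> y"
    then show thesis unfolding N_def[symmetric] by (rule that)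
  qed
  have good_N: "ball (of_real x) r \<subseteq> N" if "good x r" for x r
    using that unfolding N_def P_def by blast
  have N_unit: "of_real x \<in> N" if "0 < x" "x < 1" for x
  proof -
    have "x \<in> {0<..<1}" using that by simp
    then obtain r g where "r > 0" "vholomorphic_on g (ball (of_real x) r)"
      "\<And>y. \<bar>y - x\<bar> < r \<Longrightarrow> \<phi> y = g (of_real y)"
      by (rule real_analytic_onD[OF an]) (rule that)
    then have "good x r" unfolding good_def using that by auto
    then show ?thesis using good_N \<open>r > 0\<close> by (meson centre_in_ball subsetD)
  qed
  have \<psi>\<phi>: "\<psi> (of_real y) = \<phi> y" if "0 < y" "y < 1" for y using \<psi>(2) N_unit that by blast
  have slw\<phi>: "slw \<psi> (of_real y) = \<phi> y" if "0 < y" "y < 1" for y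
    unfolding eq[OF that] by (rule slw_of_real) (use \<psi>\<phi> mobr_unit that in blast)
  have N_1: "1 \<in> N"
  proof -
    \<comment> \<open>All images of 1 lie in the open unit interval, so \<open>slw \<psi>\<close> is
      holomorphic near 1 and agrees with \<phi> to the left of 1. This is needed at 0, because 1 may
      itself be an image of 0.\<close>
    define N1 where "N1 = (\<Inter>j\<in>J. {z \<in> slit. mob j z \<in> N}) \<inter> slit"
    have "open N1" unfolding N1_def using fin open_mob_preimage[OF N_open] open_slit by (auto intro!: open_Int open_INT)
    moreover have "1 \<in> N1"
    proof -
      have "mob j 1 \<in> N" if "j \<in> J" for j
        using N_unit mobr_unit[OF that, of 1] mob_of_real[of j 1] by auto
      then show ?thesis by (auto simp: N1_def slit_iff)
    qed
    ultimately obtain r where r: "r > 0" "ball 1 r \<subseteq> N1" by (rule openE)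
    have "vholomorphic_on (slw \<psi>) (ball 1 r)"
      by (rule vholomorphic_slw[OF \<psi>(1)]) (use r(2) den_slit in \<open>auto simp: N1_def\<close>)
    then have "good 1 r" unfolding good_def using r slw\<phi> by (auto intro!: exI[of _ "slw \<psi>"])
    then show ?thesis using good_N[of 1 r] r(1) by auto
  qed
  have N_real: "of_real ` {0<..1} \<subseteq> N"
    using N_unit N_1 by (auto simp: order_le_less)
  define G where "G = pullback_dom N"
  have G: "open G" "0 \<in> G" "vholomorphic_on (rest \<psi>) G"
    unfolding G_def using open_pullback_dom[OF N_open] zero_in_pullback_dom[OF N_real] vholomorphic_rest[OF \<psi>(1)] by auto
  define \<delta>' where "\<delta>' = min \<delta> 1"
  have \<delta>': "\<delta>' > 0" and \<delta>'1: "\<delta>' \<le> 1" using \<delta> by (simp_all add: \<delta>'_def)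
  obtain b0 where b0: "admissible (rest \<psi>) ((2 * s - 1) *s cc) b0"
    "\<And>x. 0 < x \<Longrightarrow> x < \<delta>' \<Longrightarrow> Ks (rest \<psi>) ((2 * s - 1) *s cc) b0 s (of_real (1 / x)) =
       ((2 * s - 1) * of_real (1 / x) powr (- 2 * s)) *s \<phi> x"
  proof (rule bounded_cocycle[OF G s_pos s_half \<delta>', of \<phi> cc M])
    show "norm (\<phi> x - of_real (1 / x) *s cc) \<le> M" if "0 < x" "x < \<delta>'" for x
      using asy that by (simp add: \<delta>'_def)
    show "rest \<psi> (of_real x) = \<phi> x - of_real (1 + \<l> * x) powr (- 2 * s) *s (A j0 *v \<phi> (x / (1 + \<l> * x)))"
      if "0 < x" "x < \<delta>'" for x
      using rest_of_real[of \<psi> \<phi> x] \<psi>\<phi> eq that by (simp add: \<delta>'_def)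
  qed blast
  define p0 where "p0 = (2 * s - 1) *s cc"
  note adm = b0(1)[folded p0_def] and Kb = b0(2)[folded p0_def]
  have K_hol: "vholomorphic_on (Ks (rest \<psi>) p0 b0 s) (orbit_domain G)"
    by (rule Ks_holomorphic[OF adm s_pos G])
  obtain r where r: "r > 0" "ball 0 r \<subseteq> G" using G(1,2) by (rule openE)
  \<comment> \<open>With 2 \<epsilon> \<le> r the whole orbit of the disc, from n = 0 on, lies in
    the ball of radius r inside G; with 2 \<epsilon> \<le> \<delta>' its real diameter lies where
    \<open>Kb\<close> holds.\<close>
  define \<epsilon> where "\<epsilon> = min (\<delta>' / 2) (r / 2)"
  have \<epsilon>: "\<epsilon> > 0" "\<epsilon> \<le> 1" "2 * \<epsilon> \<le> \<delta>'" "2 * \<epsilon> \<le> r" using r \<delta>' by (auto simp: \<epsilon>_def \<delta>'_def)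
  have tangent: "Re (1 / z) > 1 / (2 * \<epsilon>)" if z: "z \<in> ball (of_real \<epsilon>) \<epsilon>" for z
  proof -
    have 1: "(cmod z)\<^sup>2 < 2 * \<epsilon> * Re z" using z mem_tangent_ball[OF \<epsilon>(1)] by simp
    then have "(cmod z)\<^sup>2 > 0" using \<epsilon>(1) by (cases "z = 0") auto
    then have "1 / (2 * \<epsilon>) < Re z / (cmod z)\<^sup>2" using 1 \<epsilon>(1) by (simp add: field_simps)
    moreover have "Re (1 / z) = Re z / (cmod z)\<^sup>2" by (simp add: Re_divide cmod_power2)
    ultimately show ?thesis by simp
  qed
  have "good \<epsilon> \<epsilon>"
    unfolding good_def
  proof (intro conjI exI)
    let ?g = "\<lambda>z. ((1 / z) powr (2 * s) / (2 * s - 1)) *s Ks (rest \<psi>) p0 b0 s (1 / z)"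
    have sl: "1 / z \<in> slit" if "z \<in> ball (of_real \<epsilon>) \<epsilon>" for z
      using tangent[OF that] \<epsilon>(1) by (simp add: slit_iff) (smt (verit) divide_nonneg_pos zero_less_divide_1_iff)
    have nz: "z \<noteq> 0" if "z \<in> ball (complex_of_real \<epsilon>) \<epsilon>" for z
      using sl[OF that] by (auto simp: slit_iff)
    have dom: "1 / z \<in> orbit_domain G" if z: "z \<in> ball (of_real \<epsilon>) \<epsilon>" for z
      unfolding orbit_domain_def
    proof (safe, fact sl[OF z])
      fix n
      have "1 / (2 * \<epsilon>) < Re (1 / z) + real n * \<l>" using tangent[OF z] ell_pos by (smt (verit) mult_nonneg_nonneg of_nat_0_le_iff)
      also have "\<dots> = Re (1 / z + of_real (real n * \<l>))" by simp
      also have "\<dots> \<le> cmod (1 / z + of_real (real n * \<l>))" by (rule complex_Re_le_cmod)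
      finally have *: "1 / (2 * \<epsilon>) < cmod (1 / z + of_real (real n * \<l>))" .
      moreover have "1 / (2 * \<epsilon>) > 0" using \<epsilon>(1) by simp
      ultimately have "cmod (1 / z + of_real (real n * \<l>)) > 0" by linarith
      then have "cmod (1 / (1 / z + of_real (real n * \<l>))) < 2 * \<epsilon>"
        using * \<epsilon>(1) unfolding norm_divide norm_one by (simp add: field_simps)
      then show "1 / (1 / z + of_real (real n * \<l>)) \<in> G" using r(2) \<epsilon>(4) by (auto simp: subset_iff)
    qed
    have "vholomorphic_on (\<lambda>z. Ks (rest \<psi>) p0 b0 s (1 / z)) (ball (of_real \<epsilon>) \<epsilon>)"
      by (rule vholomorphic_on_compose[OF K_hol]) (use dom nz in \<open>auto intro!: holomorphic_intros\<close>)
    moreover have "(\<lambda>z. (1 / z) powr (2 * s) / (2 * s - 1)) holomorphic_on ball (of_real \<epsilon>) \<epsilon>"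
      using nz slit_not_nonpos[OF sl] two_s_nz by (intro holomorphic_intros) auto
    ultimately show "vholomorphic_on ?g (ball (of_real \<epsilon>) \<epsilon>)" by (intro vholomorphic_intros)
    show "\<forall>y. \<bar>y - \<epsilon>\<bar> < \<epsilon> \<and> 0 < y \<and> y < 1 \<longrightarrow> ?g (of_real y) = \<phi> y"
    proof (intro allI impI, elim conjE)
      fix y assume y: "\<bar>y - \<epsilon>\<bar> < \<epsilon>" "0 < y" "y < 1"
      then have "Ks (rest \<psi>) p0 b0 s (of_real (1 / y)) = ((2 * s - 1) * of_real (1 / y) powr (- 2 * s)) *s \<phi> y"
        using \<epsilon>(3) by (intro Kb) auto
      moreover have "of_real (1 / y) powr (2 * s) * of_real (1 / y) powr (- 2 * s) = (1 :: complex)"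
        using y(2) powr_add[of "complex_of_real (1 / y)" "2 * s" "- 2 * s"] by simp
      ultimately show "?g (of_real y) = \<phi> y"
        using two_s_nz by (simp add: vec_eq_iff mult.assoc[symmetric])
    qed
  qed (use \<epsilon> in auto)
  then have "ball (of_real \<epsilon>) \<epsilon> \<subseteq> N" by (rule good_N)
  then obtain \<Psi> where \<Psi>: "vholomorphic_on \<Psi> slit" "\<And>z. z \<in> slit \<Longrightarrow> \<Psi> z = slw \<Psi> z"
    "\<And>x. 0 < x \<Longrightarrow> x < 1 \<Longrightarrow> \<Psi> (of_real x) = \<psi> (of_real x)"
    using extend_to_slit[OF N_open \<psi>(1) N_real \<epsilon>(1)] slw\<phi> \<psi>\<phi> by auto
  have \<Psi>\<phi>: "\<Psi> (of_real x) = \<phi> x" if "0 < x" "x < 1" for x using \<Psi>(3) \<psi>\<phi> that by simp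
  \<comment> \<open>The cocycle is formed anew from \<Psi>, as \<open>rest \<psi>\<close> is known
    on G only. The data p0 and b0 carry over because the two versions agree at 0, by the identity
    theorem on a disc about 0.\<close>
  define H where "H = pullback_dom slit"
  have slit_real: "of_real ` {0<..1::real} \<subseteq> slit" by (auto simp: slit_iff)
  have H: "open H" "0 \<in> H" "vholomorphic_on (rest \<Psi>) H"
    unfolding H_def using open_pullback_dom[OF open_slit] zero_in_pullback_dom[OF slit_real] vholomorphic_rest[OF \<Psi>(1)] by auto
  have rest_eq: "rest \<Psi> (of_real x) = rest \<psi> (of_real x)" if "0 < x" "x < 1" for x
    using rest_of_real[of \<Psi> \<phi> x] rest_of_real[of \<psi> \<phi> x] \<Psi>\<phi> \<psi>\<phi> eq that by simp
  have rest0: "rest \<Psi> 0 = rest \<psi> 0"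
  proof -
    obtain e where e: "e > 0" "ball 0 e \<subseteq> G \<inter> H" using openE[OF open_Int[OF G(1) H(1)], of 0] G(2) H(2) by auto
    show ?thesis
    proof (rule vholomorphic_identity_real[of _ "ball 0 e" _ 0 "min e 1"])
      show "vholomorphic_on (rest \<Psi>) (ball 0 e)" "vholomorphic_on (rest \<psi>) (ball 0 e)"
        using vholomorphic_on_subset[OF H(3)] vholomorphic_on_subset[OF G(3)] e(2) by auto
    qed (use e(1) rest_eq in auto)
  qed
  have adm\<Psi>: "admissible (rest \<Psi>) p0 b0"
    using adm rest0 vholomorphic_linear_bound[OF H] unfolding admissible_def by simp
  have K\<Psi>: "Ks (rest \<Psi>) p0 b0 s \<xi> = ((2 * s - 1) * \<xi> powr (- 2 * s)) *s \<Psi> (1 / \<xi>)" if "\<xi> \<in> slit" for \<xi>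
  \<comment> \<open>Both sides are holomorphic on the slit plane, so it suffices to compare them at
    large real points, whose orbits 1 / (X + n l) stay in the interval below \<delta>'.\<close>
  proof (rule vholomorphic_identity_real[of "Ks (rest \<Psi>) p0 b0 s" slit
        "\<lambda>\<xi>. ((2 * s - 1) * \<xi> powr (- 2 * s)) *s \<Psi> (1 / \<xi>)" "2 / \<delta>'" "2 / \<delta>' + 1"])
    have "slit \<subseteq> orbit_domain H"
      unfolding orbit_domain_def
    proof safe
      fix \<eta> n assume \<eta>: "\<eta> \<in> slit"
      have "1 / (\<eta> + of_real (real n * \<l>)) \<in> slit" using ell_pos by (intro slit_inverse slit_add \<eta>) auto
      then show "1 / (\<eta> + of_real (real n * \<l>)) \<in> H" unfolding H_def using slit_pullback_dom by blast
    qed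
    then show "vholomorphic_on (Ks (rest \<Psi>) p0 b0 s) slit"
      using Ks_holomorphic[OF adm\<Psi> s_pos H] vholomorphic_on_subset by blast
    have "vholomorphic_on (\<lambda>\<xi>. \<Psi> (1 / \<xi>)) slit"
      by (rule vholomorphic_on_compose[OF \<Psi>(1)]) (auto intro!: holomorphic_intros slit_inverse dest: slit_nonzero)
    moreover have "(\<lambda>\<xi>. (2 * s - 1) * \<xi> powr (- 2 * s)) holomorphic_on slit"
      by (intro holomorphic_intros) (auto dest: slit_not_nonpos)
    ultimately show "vholomorphic_on (\<lambda>\<xi>. ((2 * s - 1) * \<xi> powr (- 2 * s)) *s \<Psi> (1 / \<xi>)) slit"
      by (intro vholomorphic_intros)
    show "open slit" "connected slit" by (fact open_slit connected_slit)+
    have pos: "2 / \<delta>' > 0" using \<delta>' by simp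
    show "of_real ` {2 / \<delta>'<..<2 / \<delta>' + 1} \<subseteq> slit"
    proof safe
      fix t assume "t \<in> {2 / \<delta>'<..<2 / \<delta>' + 1}"
      then have "t > 2 / \<delta>'" by simp
      then have "t > 0" using pos by linarith
      then show "complex_of_real t \<in> slit" by (simp add: slit_iff)
    qed
    fix X assume X: "2 / \<delta>' < X" "X < 2 / \<delta>' + 1"
    then have Xp: "X > 0" using pos by linarith
    then have X1: "1 / X < \<delta>'" "0 < 1 / X" using X(1) \<delta>' by (auto simp: field_simps)
    have "Ks (rest \<Psi>) p0 b0 s (of_real X) = Ks (rest \<psi>) p0 b0 s (of_real X)"
    proof -
      have "Rs (rest \<Psi>) p0 b0 s (of_real X + of_real (real n * \<l>)) = Rs (rest \<psi>) p0 b0 s (of_real X + of_real (real n * \<l>))" for n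
      proof -
        have "X + real n * \<l> \<ge> X" using ell_pos by simp
        then have "1 / (X + real n * \<l>) \<le> 1 / X" "0 < 1 / (X + real n * \<l>)" using Xp by (auto intro!: divide_left_mono)
        then have "rest \<Psi> (of_real (1 / (X + real n * \<l>))) = rest \<psi> (of_real (1 / (X + real n * \<l>)))"
          using X1(1) \<delta>'1 by (intro rest_eq) linarith+
        then show ?thesis unfolding Rs_def by simp
      qed
      then show ?thesis unfolding Ks_def by simp
    qed
    also have "\<dots> = ((2 * s - 1) * of_real X powr (- 2 * s)) *s \<phi> (1 / X)" using Kb[OF X1(2,1)] by simp
    also have "\<phi> (1 / X) = \<Psi> (of_real (1 / X))" using \<Psi>\<phi>[of "1 / X"] X1 by (simp add: \<delta>'_def)
    finally show "Ks (rest \<Psi>) p0 b0 s (of_real X) = ((2 * s - 1) * of_real X powr (- 2 * s)) *s \<Psi> (1 / of_real X)" by simp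
  qed (use that in auto)
  show ?thesis by (rule that[OF \<Psi>(1,2) \<Psi>\<phi> adm\<Psi> K\<Psi>])
qed

end

section \<open>Smooth functions, the spaces of holomorphic functions, and linear isomorphisms\<close>

text \<open>A canonical choice for the family of derivatives whose existence
  \<open>smooth_on_open\<close> asserts; being determined by the function, it lets local families be
  patched together.\<close>

definition iter_deriv :: "nat \<Rightarrow> (real \<Rightarrow> complex^'n) \<Rightarrow> real \<Rightarrow> complex^'n" where
  "iter_deriv n = ((\<lambda>f x. vector_derivative f (at x)) ^^ n)"

lemma iter_deriv_eqI:
  assumes I: "open I" and D0: "\<And>x. x \<in> I \<Longrightarrow> D 0 x = f x"
    and D: "\<And>n x. x \<in> I \<Longrightarrow> (D n has_vector_derivative D (Suc n) x) (at x)"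
    and x: "x \<in> I"
  shows "iter_deriv n f x = D n x"
  using x
proof (induction n arbitrary: x)
  case (Suc n)
  have "(iter_deriv n f has_vector_derivative D (Suc n) x) (at x)"
    by (rule has_vector_derivative_transform_within_open[OF D[OF Suc.prems] I Suc.prems]) (simp add: Suc.IH)
  then show ?case by (simp add: iter_deriv_def vector_derivative_at)
qed (simp add: iter_deriv_def D0)

lemma smooth_on_open_local:
  assumes "\<And>x. x \<in> I \<Longrightarrow> \<exists>V g. open V \<and> x \<in> V \<and> smooth_on_open g V \<and> (\<forall>y\<in>V. f y = g y)"
  shows "smooth_on_open f I"
  unfolding smooth_on_open_def
proof (intro exI conjI allI ballI)
  fix x n assume "x \<in> I"
  then obtain V g where V: "open V" "x \<in> V" "smooth_on_open g V" "\<forall>y\<in>V. f y = g y" using assms by blast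
  obtain D where D: "\<And>x. x \<in> V \<Longrightarrow> D 0 x = g x"
    "\<And>n x. x \<in> V \<Longrightarrow> (D n has_vector_derivative D (Suc n) x) (at x)"
    using V(3) unfolding smooth_on_open_def by blast
  have Df: "D 0 x = f x" if "x \<in> V" for x using D(1) V(4) that by simp
  have it: "iter_deriv n f y = D n y" if "y \<in> V" for n y
    by (rule iter_deriv_eqI[where I = V, OF V(1) Df D(2) that])
  show "(iter_deriv n f has_vector_derivative iter_deriv (Suc n) f x) (at x)"
    unfolding it[OF V(2)]
    by (rule has_vector_derivative_transform_within_open[OF D(2)[OF V(2)] V(1,2)]) (simp add: it)
qed (simp add: iter_deriv_def)

lemma smooth_on_open_subset: "smooth_on_open f I \<Longrightarrow> K \<subseteq> I \<Longrightarrow> smooth_on_open f K"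
  unfolding smooth_on_open_def by (meson subsetD)

lemma smooth_on_open_add:
  assumes "smooth_on_open f I" "smooth_on_open g I"
  shows "smooth_on_open (\<lambda>x. f x + g x) I"
proof -
  obtain D E where "\<And>x. x \<in> I \<Longrightarrow> D 0 x = f x" "\<And>n x. x \<in> I \<Longrightarrow> (D n has_vector_derivative D (Suc n) x) (at x)"
    "\<And>x. x \<in> I \<Longrightarrow> E 0 x = g x" "\<And>n x. x \<in> I \<Longrightarrow> (E n has_vector_derivative E (Suc n) x) (at x)"
    using assms unfolding smooth_on_open_def by blast
  then show ?thesis
    unfolding smooth_on_open_def by (intro exI[of _ "\<lambda>n x. D n x + E n x"]) (auto intro: has_vector_derivative_add)
qed

lemma bounded_linear_vector_smult: "bounded_linear (\<lambda>v :: complex^'n. c *s v)"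
proof (rule bounded_linear_intro[where K = "cmod c"])
  show "c *s (r *\<^sub>R x) = r *\<^sub>R (c *s x)" for r and x :: "complex^'n"
    by (simp add: vec_eq_iff)
qed (simp_all add: vec.scale_right_distrib mult.commute)

lemma smooth_on_open_smult:
  assumes "smooth_on_open f I"
  shows "smooth_on_open (\<lambda>x. c *s f x) I"
proof -
  obtain D where "\<And>x. x \<in> I \<Longrightarrow> D 0 x = f x" "\<And>n x. x \<in> I \<Longrightarrow> (D n has_vector_derivative D (Suc n) x) (at x)"
    using assms unfolding smooth_on_open_def by blast
  then show ?thesis
    unfolding smooth_on_open_def
    by (intro exI[of _ "\<lambda>n x. c *s D n x"])
       (auto intro: bounded_linear.has_vector_derivative[OF bounded_linear_vector_smult])
qed

lemma has_vector_derivative_vec: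
  fixes f :: "real \<Rightarrow> complex^'n"
  assumes "\<And>i. ((\<lambda>x. f x $ i) has_vector_derivative f' $ i) (at x)"
  shows "(f has_vector_derivative f') (at x)"
proof -
  have bl: "bounded_linear (\<lambda>c. c *s axis i (1::complex))" for i :: 'n
  proof (rule bounded_linear_intro[where K = 1])
    show "(r *\<^sub>R c) *s axis i (1::complex) = r *\<^sub>R (c *s axis i 1)" for r c by (simp add: vec_eq_iff)
    show "norm (c *s axis i (1::complex)) \<le> norm c * 1" for c by simp
  qed (simp add: vec.scale_left_distrib)
  have sum: "v = (\<Sum>i\<in>UNIV. v $ i *s axis i 1)" for v :: "complex^'n"
    by (simp add: vec_eq_iff sum_component axis_def if_distrib sum.delta cong: if_cong)
  have "((\<lambda>x. \<Sum>i\<in>UNIV. f x $ i *s axis i 1) has_vector_derivative (\<Sum>i\<in>UNIV. f' $ i *s axis i 1)) (at x)"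
    by (intro has_vector_derivative_sum bounded_linear.has_vector_derivative[OF bl] assms)
  then show ?thesis by (simp only: sum[symmetric])
qed

lemma vholomorphic_imp_smooth:
  assumes g: "vholomorphic_on g S" "open S" and I: "of_real ` I \<subseteq> S"
  shows "smooth_on_open (\<lambda>x. g (of_real x)) I"
  unfolding smooth_on_open_def
proof (intro exI[of _ "\<lambda>n x. \<chi> i. (deriv ^^ n) (\<lambda>z. g z $ i) (of_real x)"] conjI allI ballI)
  fix n x assume x: "x \<in> I"
  show "((\<lambda>x. \<chi> i. (deriv ^^ n) (\<lambda>z. g z $ i) (of_real x)) has_vector_derivative
     (\<chi> i. (deriv ^^ Suc n) (\<lambda>z. g z $ i) (of_real x))) (at x)"
  proof (rule has_vector_derivative_vec)
    fix i
    have "(deriv ^^ n) (\<lambda>z. g z $ i) holomorphic_on S"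
      by (rule holomorphic_higher_deriv[OF vholomorphic_onD[OF g(1)] g(2)])
    then have "((deriv ^^ n) (\<lambda>z. g z $ i) has_field_derivative deriv ((deriv ^^ n) (\<lambda>z. g z $ i)) (of_real x)) (at (of_real x))"
      by (rule holomorphic_derivI[OF _ g(2)]) (use I x in auto)
    from has_vector_derivative_real_field[OF this]
    show "((\<lambda>x. (\<chi> i. (deriv ^^ n) (\<lambda>z. g z $ i) (of_real x)) $ i) has_vector_derivative
       (\<chi> i. (deriv ^^ Suc n) (\<lambda>z. g z $ i) (of_real x)) $ i) (at x)" by simp
  qed
qed (simp add: vec_eq_iff)

text \<open>Identity theorem inside E, continuity on its closure, and the value 0 elsewhere. The
  alternative \<open>E = {}\<close> is the absent component for q = 3.\<close>

lemma B_space_unique: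
  assumes "f \<in> B_space E" "g \<in> B_space E" "open E" "connected E" and ab: "of_real ` {a<..<b} \<subseteq> E" "a < b \<or> E = {}"
    and eq: "\<And>x. x \<in> {a<..<b} \<Longrightarrow> f (of_real x) = g (of_real x)"
  shows "f = g"
proof
  fix z
  have E: "f z = g z" if "z \<in> E" for z
    using vholomorphic_identity_real[of f E g a b z] assms that by (auto simp: B_space_def)
  show "f z = g z"
  proof (cases "z \<in> closure E")
    case True
    have "continuous_on (closure E) (\<lambda>z. f z - g z)"
      using assms(1,2) by (intro continuous_intros) (auto simp: B_space_def)
    from continuous_constant_on_closure[OF this, of 0 z] show ?thesis using E True by simp
  next
    case False
    then show ?thesis using assms(1,2) by (simp add: B_space_def)
  qed
qed

lemma B_space_add: "f \<in> B_space E \<Longrightarrow> g \<in> B_space E \<Longrightarrow> f + g \<in> B_space E"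
  by (auto simp: B_space_def plus_fun_def intro!: continuous_intros vholomorphic_on_add)

lemma B_space_scale: "f \<in> B_space E \<Longrightarrow> fun_scale c f \<in> B_space E"
  by (auto simp: B_space_def fun_scale_def intro!: continuous_intros vholomorphic_on_smult)

lemma B_space_restrict:
  assumes "open G" "closure E \<subseteq> G" "vholomorphic_on g G"
  shows "(\<lambda>z. if z \<in> closure E then g z else 0) \<in> B_space E"
proof -
  have "continuous_on (closure E) g"
    using vholomorphic_on_imp_continuous_on[OF assms(3)] assms(2) continuous_on_subset by blast
  then have "continuous_on (closure E) (\<lambda>z. if z \<in> closure E then g z else 0)"
    by (rule continuous_on_eq) simp
  moreover have "E \<subseteq> G" using assms(2) closure_subset by blast
  then have "vholomorphic_on g E" using assms(3) vholomorphic_on_subset by blast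
  then have "vholomorphic_on (\<lambda>z. if z \<in> closure E then g z else 0) E"
    by (subst vholomorphic_on_cong[where g = g]) (use closure_subset in auto)
  ultimately show ?thesis by (simp add: B_space_def)
qed

lemma module_fun_scale: "module (fun_scale :: complex \<Rightarrow> ('a \<Rightarrow> complex^'n) \<Rightarrow> _)"
  by unfold_locales (auto simp: fun_scale_def fun_eq_iff plus_fun_def vec_eq_iff algebra_simps)

lemma module_pair_scale: "module (pair_scale :: complex \<Rightarrow> ('a \<Rightarrow> complex^'n) \<times> ('b \<Rightarrow> complex^'n) \<Rightarrow> _)"
  by unfold_locales (auto simp: pair_scale_def fun_scale_def fun_eq_iff plus_fun_def vec_eq_iff algebra_simps prod_eq_iff)

text \<open>A linear surjection with a left inverse is bijective, and the left inverse is then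
  linear too. Used once for the large spaces and once, with the same two maps, for the spaces with
  the smoothness condition.\<close>

lemma linear_iso_pair:
  assumes scA: "module scA" and scB: "module scB"
    and A: "module.subspace scA A"
    and add: "\<And>x y. x \<in> A \<Longrightarrow> y \<in> A \<Longrightarrow> \<Psi> (x + y) = \<Psi> x + \<Psi> y"
    and scale: "\<And>c x. x \<in> A \<Longrightarrow> \<Psi> (scA c x) = scB c (\<Psi> x)"
    and onto: "\<Psi> ` A = B" and inv: "\<And>x. x \<in> A \<Longrightarrow> \<Phi> (\<Psi> x) = x"
  shows "linear_iso_on scA scB A B \<Psi>" "linear_iso_on scB scA B A \<Phi>"
proof -
  note sA = module.subspace_def[OF scA] and sB = module.subspace_def[OF scB]
  have A0: "0 \<in> A" "\<And>x y. x \<in> A \<Longrightarrow> y \<in> A \<Longrightarrow> x + y \<in> A" "\<And>c x. x \<in> A \<Longrightarrow> scA c x \<in> A"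
    using A unfolding sA by auto
  have "\<Psi> 0 = \<Psi> 0 + \<Psi> 0" using add[OF A0(1) A0(1)] by simp
  then have "\<Psi> 0 = 0" by simp
  then have B0: "0 \<in> B" using onto A0(1) by (metis imageI)
  have subB: "module.subspace scB B"
    unfolding sB
  proof (intro conjI ballI allI)
    fix x y assume "x \<in> B" "y \<in> B"
    then obtain x' y' where "x' \<in> A" "y' \<in> A" "x = \<Psi> x'" "y = \<Psi> y'" using onto by auto
    then show "x + y \<in> B" using add A0(2) onto by (metis imageI)
  next
    fix c x assume "x \<in> B"
    then obtain x' where "x' \<in> A" "x = \<Psi> x'" using onto by auto
    then show "scB c x \<in> B" using scale A0(3) onto by (metis imageI)
  qed (rule B0)
  have bij: "bij_betw \<Psi> A B" unfolding bij_betw_def using onto inv by (auto intro: inj_on_inverseI)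
  have bij': "bij_betw \<Phi> B A"
    by (rule bij_betw_byWitness[where f' = \<Psi>]) (use onto inv in auto)
  show "linear_iso_on scA scB A B \<Psi>"
    unfolding linear_iso_on_def using A subB add scale bij by blast
  have "\<Phi> (x + y) = \<Phi> x + \<Phi> y" if xy: "x \<in> B" "y \<in> B" for x y
  proof -
    obtain x' y' where *: "x' \<in> A" "y' \<in> A" "x = \<Psi> x'" "y = \<Psi> y'" using onto xy by auto
    then have "\<Phi> (x + y) = \<Phi> (\<Psi> (x' + y'))" using add by simp
    then show ?thesis using * inv A0(2) by simp
  qed
  moreover have "\<Phi> (scB c x) = scA c (\<Phi> x)" if x: "x \<in> B" for c x
  proof -
    obtain x' where *: "x' \<in> A" "x = \<Psi> x'" using onto x by auto
    then have "\<Phi> (scB c x) = \<Phi> (\<Psi> (scA c x'))" using scale by simp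
    then show ?thesis using * inv A0(3) by simp
  qed
  ultimately show "linear_iso_on scB scA B A \<Phi>"
    unfolding linear_iso_on_def using A subB bij' by blast
qed

section \<open>Linear operations on real-analytic functions, and their continuity\<close>

lemma real_analytic_on_add:
  assumes "real_analytic_on f I" "real_analytic_on g I"
  shows "real_analytic_on (\<lambda>x. f x + g x) I"
  unfolding real_analytic_on_def
proof
  fix x assume x: "x \<in> I"
  obtain a r b r' where "r > 0" "\<forall>y. \<bar>y - x\<bar> < r \<longrightarrow> (\<lambda>n. (y - x) ^ n *\<^sub>R a n) sums f y"
    "r' > 0" "\<forall>y. \<bar>y - x\<bar> < r' \<longrightarrow> (\<lambda>n. (y - x) ^ n *\<^sub>R b n) sums g y"
    using bspec[OF assms(1)[unfolded real_analytic_on_def] x] bspec[OF assms(2)[unfolded real_analytic_on_def] x]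
    by (elim exE conjE) (rule that)
  then show "\<exists>a r. r > 0 \<and> (\<forall>y. \<bar>y - x\<bar> < r \<longrightarrow> (\<lambda>n. (y - x) ^ n *\<^sub>R a n) sums (f y + g y))"
    by (intro exI[of _ "\<lambda>n. a n + b n"] exI[of _ "min r r'"]) (auto simp: scaleR_add_right intro: sums_add)
qed

lemma real_analytic_on_smult:
  assumes "real_analytic_on f I"
  shows "real_analytic_on (\<lambda>x. c *s f x) I"
  unfolding real_analytic_on_def
proof
  fix x assume x: "x \<in> I"
  obtain a r where ar: "r > 0 \<and> (\<forall>y. \<bar>y - x\<bar> < r \<longrightarrow> (\<lambda>n. (y - x) ^ n *\<^sub>R a n) sums f y)"
    using bspec[OF assms[unfolded real_analytic_on_def] x] by (elim exE)
  then have r: "r > 0" "\<And>y. \<bar>y - x\<bar> < r \<Longrightarrow> (\<lambda>n. (y - x) ^ n *\<^sub>R a n) sums f y" by auto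
  have "\<forall>y. \<bar>y - x\<bar> < r \<longrightarrow> (\<lambda>n. (y - x) ^ n *\<^sub>R (c *s a n)) sums (c *s f y)"
  proof (intro allI impI)
    fix y assume that: "\<bar>y - x\<bar> < r"
    have "(y - x) ^ n *\<^sub>R (c *s a n) = c *s ((y - x) ^ n *\<^sub>R a n)" for n
      by (simp add: vec_eq_iff)
    then show "(\<lambda>n. (y - x) ^ n *\<^sub>R (c *s a n)) sums (c *s f y)" using bounded_linear.sums[OF bounded_linear_vector_smult[of c] r(2)[OF that]] by simp
  qed
  then show "\<exists>a r. r > 0 \<and> (\<forall>y. \<bar>y - x\<bar> < r \<longrightarrow> (\<lambda>n. (y - x) ^ n *\<^sub>R a n) sums (c *s f y))"
    using r(1) by (intro exI[of _ "\<lambda>n. c *s a n"] exI[of _ r]) simp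
qed

lemma C_omega_add: "\<phi> \<in> C_omega \<Longrightarrow> \<phi>' \<in> C_omega \<Longrightarrow> \<phi> + \<phi>' \<in> C_omega"
  by (auto simp: C_omega_def plus_fun_def intro: real_analytic_on_add)

lemma C_omega_scale: "\<phi> \<in> C_omega \<Longrightarrow> fun_scale c \<phi> \<in> C_omega"
  by (auto simp: C_omega_def fun_scale_def intro: real_analytic_on_smult)

lemma C_omega_zero: "0 \<in> C_omega"
proof -
  have "real_analytic_on (\<lambda>x. 0 *s (0 :: complex^'n)) I" for I
    unfolding real_analytic_on_def by (intro ballI exI[of _ "\<lambda>_. 0"] exI[of _ 1]) auto
  then show ?thesis by (simp add: C_omega_def zero_fun_def)
qed

lemma real_analytic_imp_continuous:
  assumes "real_analytic_on \<phi> I" "x \<in> I"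
  shows "isCont \<phi> x"
proof -
  obtain r g where rg: "r > 0" "vholomorphic_on g (ball (of_real x) r)" "\<And>y. \<bar>y - x\<bar> < r \<Longrightarrow> \<phi> y = g (of_real y)"
    using assms by (rule real_analytic_onD) (rule that)
  have "continuous_on (ball x r) (\<lambda>y. g (of_real y))"
    by (rule continuous_on_compose2[OF vholomorphic_on_imp_continuous_on[OF rg(2)]])
       (auto intro!: continuous_intros simp: dist_of_real)
  then have "continuous_on (ball x r) \<phi>"
    by (rule continuous_on_eq) (use rg(3) in \<open>auto simp: dist_real_def abs_minus_commute\<close>)
  then show ?thesis using rg(1) by (simp add: continuous_on_eq_continuous_at)
qed

section \<open>The transfer operators\<close>

text \<open>Lets the sign \<sigma> be absorbed into the matrices, so that both halves of the slow
  operator become one sum over a common index set.\<close>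

definition smat :: "complex \<Rightarrow> complex^'n^'n \<Rightarrow> complex^'n^'n" where
  "smat k A = (\<chi> i j. k * A $ i $ j)"

lemma smat_mult: "smat k A *v v = k *s (A *v v)"
  by (simp add: smat_def matrix_vector_mult_def vec_eq_iff sum_distrib_left mult.assoc)

locale hecke =
  fixes q :: nat and \<rho> :: "(real^2^2) set \<Rightarrow> complex^'n^'n" and s \<sigma> :: complex
  assumes q3: "q \<ge> 3" and q_odd: "odd q" and hom: "\<rho> \<in> hom (Gamma_tilde q) unitary_group"
    and s_pos: "Re s > 0" and s_half: "s \<noteq> 1/2"
begin

abbreviation \<l> where "\<l> \<equiv> ell q"
abbreviation U where "U \<equiv> \<rho> (g_elt q (-1))"

text \<open>The index \<open>(k, True)\<close> stands for the element \<open>g_elt q (- k)\<close>, and \<open>(k, False)\<close> for its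
  product with \<open>Q_elt\<close>.\<close>

definition JJ :: "(nat \<times> bool) set" where "JJ = {1..m_of q} \<times> UNIV"

definition ca :: "nat \<times> bool \<Rightarrow> real" where "ca j = (if snd j then sn q (fst j) else sn q (fst j - 1))"
definition cb :: "nat \<times> bool \<Rightarrow> real" where "cb j = (if snd j then sn q (fst j - 1) else sn q (fst j))"
definition cc :: "nat \<times> bool \<Rightarrow> real" where "cc j = (if snd j then sn q (Suc (fst j)) else sn q (fst j))"
definition cd :: "nat \<times> bool \<Rightarrow> real" where "cd j = (if snd j then sn q (fst j) else sn q (Suc (fst j)))"

definition elt :: "nat \<times> bool \<Rightarrow> (real^2^2) set" where
  "elt j = (if snd j then g_elt q (- int (fst j)) else Qg_elt q (- int (fst j)))"

definition cA :: "nat \<times> bool \<Rightarrow> complex^'n^'n" where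
  "cA j = (if snd j then \<rho> (elt j) else smat \<sigma> (\<rho> (elt j)))"

definition jg :: "nat \<times> bool" where "jg = (1, True)"
definition jQ :: "nat \<times> bool" where "jQ = (1, False)"

lemma JJ_cases:
  assumes "j \<in> JJ"
  obtains k where "fst j = Suc k" "k < m_of q"
  using assms unfolding JJ_def by (cases "fst j") auto

lemma inv_elt:
  assumes "j \<in> JJ"
  shows "inv\<^bsub>PGL2\<^esub> (elt j) = pgl (ca j) (cb j) (cc j) (cd j)"
proof -
  obtain k where k: "fst j = Suc k" "k < m_of q" using assms by (rule JJ_cases)
  show ?thesis
    using inv_g[OF q3 q_odd, of k] inv_Qg[OF q3 q_odd, of k]
    by (cases "snd j") (simp_all only: elt_def ca_def cb_def cc_def cd_def k diff_Suc_1 if_True if_False)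
qed

text \<open>With u, v, w three consecutive values of \<open>sn\<close>, all claims but the last two
  reduce to 0 \<le> u < v \<le> w, v \<ge> 1 and v^2 - u w = 1.\<close>

lemma coeff:
  assumes "j \<in> JJ"
  shows "ca j \<ge> 0" "cb j \<ge> 0" "cc j > 0" "cd j > 0" "ca j \<le> cc j" "cb j \<le> cd j"
    "ca j + cb j < cc j + cd j" "\<bar>ca j * cd j - cb j * cc j\<bar> = 1"
    "j \<noteq> jg \<Longrightarrow> cb j \<ge> 1" "j \<noteq> jg \<Longrightarrow> cd j \<ge> 1"
proof -
  obtain k where k: "fst j = Suc k" "k < m_of q" using assms by (rule JJ_cases)
  define u v w where "u = sn q k" and "v = sn q (Suc k)" and "w = sn q (Suc (Suc k))"
  have uvw: "u \<ge> 0" "v \<ge> 1" "w \<ge> 1" "u < v" "v \<le> w" "v * v - u * w = 1"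
    unfolding u_def v_def w_def
    using k sn_nonneg[OF q3 q_odd, of k] sn_ge_1[OF q3 q_odd, of "Suc k"] sn_ge_1[OF q3 q_odd, of "Suc (Suc k)"]
      sn_strict[OF q3 q_odd, of k] sn_mono[OF q3 q_odd, of "Suc k"] sn_det[OF q3 q_odd, of k] by simp_all
  have c: "ca j = (if snd j then v else u)" "cb j = (if snd j then u else v)"
    "cc j = (if snd j then w else v)" "cd j = (if snd j then v else w)"
    by (simp_all add: ca_def cb_def cc_def cd_def k u_def v_def w_def)
  show "ca j \<ge> 0" "cb j \<ge> 0" "cc j > 0" "cd j > 0" "ca j \<le> cc j" "cb j \<le> cd j"
    "ca j + cb j < cc j + cd j"
    unfolding c using uvw(1-5) by (cases "snd j"; simp)+
  show "\<bar>ca j * cd j - cb j * cc j\<bar> = 1"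
    unfolding c using uvw(6) by (cases "snd j") (simp_all add: abs_minus_commute)
  \<comment> \<open>Excluding jg among the elements without Q forces k \<ge> 1, so u is not the
    value \<open>sn q 0 = 0\<close>.\<close>
  have "u \<ge> 1" if "snd j" "j \<noteq> jg"
  proof -
    have "k \<ge> 1" using k that by (cases j) (auto simp: jg_def)
    then show ?thesis unfolding u_def using k by (intro sn_ge_1[OF q3 q_odd]) auto
  qed
  then show "j \<noteq> jg \<Longrightarrow> cb j \<ge> 1" "j \<noteq> jg \<Longrightarrow> cd j \<ge> 1"
    unfolding c using uvw(2,3) by (cases "snd j"; simp)+
qed

lemma jg_coeff: "ca jg = 1" "cb jg = 0" "cc jg = ell q" "cd jg = 1"
  using sn_1[OF q3 q_odd] sn_0[OF q3 q_odd] sn_2[OF q3 q_odd]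
  by (simp_all add: ca_def cb_def cc_def cd_def jg_def numeral_2_eq_2)

lemma jQ_coeff: "ca jQ = 0" "cb jQ = 1" "cc jQ = 1" "cd jQ = ell q"
  using sn_1[OF q3 q_odd] sn_0[OF q3 q_odd] sn_2[OF q3 q_odd]
  by (simp_all add: ca_def cb_def cc_def cd_def jQ_def numeral_2_eq_2)

lemma jg_in: "jg \<in> JJ" and jQ_in: "jQ \<in> JJ"
  using m_pos[OF q3 q_odd] by (simp_all add: JJ_def jg_def jQ_def)

lemma cA_U: "cA jg = U"
  by (simp add: cA_def elt_def jg_def)

lemma cA_jQ: "cA jQ = smat \<sigma> (\<rho> Q_elt ** U)"
  using rho_Qg[OF q3 q_odd hom] by (simp add: cA_def elt_def jQ_def)

sublocale slow_cocycle JJ jg ca cb cc cd cA "ell q" s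
proof -
  have "finite JJ" by (simp add: JJ_def)
  moreover have "ell q > 0" using ell_ge_1[OF q3 q_odd] by linarith
  moreover have "norm (cA jg *v v) = norm v" for v
    unfolding cA_U by (rule rho_isometry[OF q3 q_odd hom in_Gamma_tilde(1)[OF q3 q_odd hom]])
  ultimately show "slow_cocycle JJ jg ca cb cc cd cA (ell q) s"
    using coeff jg_coeff jg_in s_pos s_half by unfold_locales auto
qed

section \<open>The slow operators as an instance of the abstract system\<close>

lemma alpha_elt:
  assumes "j \<in> JJ"
  shows "alpha \<rho> s (elt j) f z = den j z powr (- 2 * s) *s (\<rho> (elt j) *v f (mob j z))"
  unfolding alpha_pgl[OF inv_elt[OF assms] disjI1[OF coeff(3)[OF assms]] coeff(8)[OF assms]]
  by (simp add: den_def mob_def num_def)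

lemma alpha_real_elt:
  assumes "j \<in> JJ" "x > 0"
  shows "alpha_real \<rho> s (elt j) f x = of_real (cc j * x + cd j) powr (- 2 * s) *s (\<rho> (elt j) *v f (mobr j x))"
proof -
  have "cc j * x + cd j > 0" using coeff[OF assms(1)] assms(2) by (intro add_pos_pos) auto
  then show ?thesis
    unfolding alpha_real_pgl[OF inv_elt[OF assms(1)] disjI1[OF coeff(3)[OF assms(1)]] coeff(8)[OF assms(1)]]
    by (simp add: alpha_real_pgl[OF inv_elt[OF assms(1)] disjI1[OF coeff(3)[OF assms(1)]] coeff(8)[OF assms(1)]] mobr_def)
qed

lemma acts_into_elt:
  assumes "j \<in> JJ"
  shows "acts_into (elt j) A B \<longleftrightarrow> (\<forall>z\<in>A. den j z \<in> slit \<and> mob j z \<in> B)"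
  unfolding acts_into_pgl[OF inv_elt[OF assms] disjI1[OF coeff(3)[OF assms]]]
  by (simp add: den_def mob_def num_def)

lemma sum_JJ:
  fixes X :: "nat \<times> bool \<Rightarrow> 'a :: comm_monoid_add"
  assumes "finite K"
  shows "(\<Sum>k\<in>K. X (k, True) + X (k, False)) = (\<Sum>j\<in>K \<times> UNIV. X j)"
proof -
  have "(\<Sum>j\<in>K \<times> UNIV. X j) = (\<Sum>k\<in>K. \<Sum>t\<in>UNIV. X (k, t))" by (simp add: sum.cartesian_product)
  then show ?thesis by (simp add: UNIV_bool add.commute)
qed

lemma opr_True: "k \<in> {1..m_of q} \<Longrightarrow> opr (k, True) \<psi> z = alpha \<rho> s (g_elt q (- int k)) \<psi> z"
  using alpha_elt[of "(k, True)"] by (simp add: opr_def JJ_def elt_def cA_def)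

lemma opr_False: "k \<in> {1..m_of q} \<Longrightarrow> opr (k, False) \<psi> z = \<sigma> *s alpha \<rho> s (Qg_elt q (- int k)) \<psi> z"
  using alpha_elt[of "(k, False)"] by (simp add: opr_def JJ_def elt_def cA_def smat_mult vec_eq_iff)

lemma slow_eq: "slow q \<rho> s \<sigma> \<psi> z = slw \<psi> z"
proof -
  have "slow q \<rho> s \<sigma> \<psi> z = (\<Sum>k\<in>{1..m_of q}. opr (k, True) \<psi> z + opr (k, False) \<psi> z)"
    unfolding slow_def by (intro sum.cong refl) (simp only: opr_True opr_False)
  also have "\<dots> = (\<Sum>j\<in>JJ. opr j \<psi> z)" unfolding JJ_def by (rule sum_JJ) simp
  finally show ?thesis unfolding slw_def .
qed

lemma slow_real_eq:
  assumes "x > 0"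
  shows "slow_real q \<rho> s \<sigma> \<phi> x = slwr \<phi> x"
proof -
  let ?X = "\<lambda>j. of_real (cc j * x + cd j) powr (- 2 * s) *s (cA j *v \<phi> (mobr j x))"
  have "slow_real q \<rho> s \<sigma> \<phi> x = (\<Sum>k\<in>{1..m_of q}. ?X (k, True) + ?X (k, False))"
    unfolding slow_real_def
  proof (intro sum.cong refl)
    fix k assume k: "k \<in> {1..m_of q}"
    then have J: "(k, True) \<in> JJ" "(k, False) \<in> JJ" by (auto simp: JJ_def)
    show "alpha_real \<rho> s (g_elt q (- int k)) \<phi> x + \<sigma> *s alpha_real \<rho> s (Qg_elt q (- int k)) \<phi> x = ?X (k, True) + ?X (k, False)"
      using alpha_real_elt[OF J(1) assms, of \<phi>] alpha_real_elt[OF J(2) assms, of \<phi>]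
      by (simp add: elt_def cA_def smat_mult vec_eq_iff)
  qed
  also have "\<dots> = (\<Sum>j\<in>JJ. ?X j)" unfolding JJ_def by (rule sum_JJ) simp
  finally show ?thesis unfolding slwr_def .
qed

text \<open>The terms with k \<ge> 2, common to both rows of the fast equation.\<close>

definition main :: "(complex \<Rightarrow> complex^'n) \<Rightarrow> complex \<Rightarrow> complex^'n" where
  "main f z = fast_0 q \<rho> s f z + \<sigma> *s Q_fast_0 q \<rho> s f z"

lemma main_eq: "main f z = (\<Sum>j\<in>{2..m_of q} \<times> UNIV. opr j f z)"
proof -
  have "main f z = (\<Sum>k\<in>{2..m_of q}. opr (k, True) f z + opr (k, False) f z)"
    unfolding main_def fast_0_def Q_fast_0_def sum.distrib
    by (simp add: opr_True opr_False vec.scale_sum_right del: vector_smult_assoc)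
  also have "\<dots> = (\<Sum>j\<in>{2..m_of q} \<times> UNIV. opr j f z)" by (rule sum_JJ) simp
  finally show ?thesis .
qed

lemma JJ_split: "JJ - {jg} = insert jQ ({2..m_of q} \<times> UNIV)"
proof -
  have "m_of q \<ge> 1" by (rule m_pos[OF q3 q_odd])
  then show ?thesis unfolding JJ_def jg_def jQ_def by (auto simp: numeral_2_eq_2 Suc_le_eq)
qed

text \<open>The shape of the second row of the fast equation: \<open>Q_fast_m1\<close>, applied to
  f_{-1}, will turn out to be the term of jQ up to the factor \<sigma>.\<close>

lemma rest_eq_main: "rest f z = opr jQ f z + main f z"
  unfolding rest_def JJ_split main_eq by (subst sum.insert) (auto simp: jQ_def)

text \<open>The maps with k \<ge> 2 send the unit interval into D_0, so \<open>main\<close>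
  evaluates a solution only where it is f_0.\<close>

lemma mobr_ge_2:
  assumes j: "j \<in> {2..m_of q} \<times> UNIV" and x: "0 < x" "x < 1"
  shows "j \<in> JJ" "1 / \<l> < mobr j x" "mobr j x < 1"
proof -
  show J: "j \<in> JJ" using j by (auto simp: JJ_def)
  show "mobr j x < 1" using mobr_unit[OF J x(1)] by simp
  obtain k where k: "fst j = Suc k" "k < m_of q" using J by (rule JJ_cases)
  then have k1: "k \<ge> 1" using j by auto
  obtain i where i: "k = Suc i" using k1 by (cases k) auto
  have l: "\<l> > 0" using l_pos .
  \<comment> \<open>By the recursion l times a value of \<open>sn\<close> is the sum of its two
    neighbours, hence at least the next one.\<close>
  have A: "\<l> * sn q k \<ge> sn q (Suc k)" using sn_rec[OF q3 q_odd, of i] sn_nonneg[OF q3 q_odd, of i] k i by simp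
  have B: "\<l> * sn q (Suc k) > sn q (Suc (Suc k))" using sn_rec[OF q3 q_odd, of k] sn_ge_1[OF q3 q_odd, of k] k k1 by simp
  have "cc j * x + cd j < \<l> * (ca j * x + cb j)"
  proof (cases "snd j")
    case True
    have "\<l> * (ca j * x + cb j) = (\<l> * sn q (Suc k)) * x + \<l> * sn q k" using k True by (simp add: ca_def cb_def algebra_simps)
    moreover have "sn q (Suc (Suc k)) * x < (\<l> * sn q (Suc k)) * x" using B x(1) by (intro mult_strict_right_mono)
    ultimately show ?thesis using k True A by (simp add: cc_def cd_def)
  next
    case False
    have "\<l> * (ca j * x + cb j) = (\<l> * sn q k) * x + \<l> * sn q (Suc k)" using k False by (simp add: ca_def cb_def algebra_simps)
    moreover have "sn q (Suc k) * x \<le> (\<l> * sn q k) * x" using A x(1) by (intro mult_right_mono) auto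
    ultimately show ?thesis using k False B by (simp add: cc_def cd_def)
  qed
  moreover have "cc j * x + cd j > 0" using coeff[OF J] x(1) by (intro add_pos_pos) auto
  ultimately show "1 / \<l> < mobr j x" unfolding mobr_def using l by (simp add: field_simps)
qed

text \<open>The counterpart of \<open>mobr_ge_2\<close>: the two maps with k = 1 send the positive
  axis into D_{-1}.\<close>

lemma mobr_1:
  assumes "x > 0"
  shows "mobr jg x = x / (\<l> * x + 1)" "mobr jQ x = 1 / (x + \<l>)"
    "0 < x / (\<l> * x + 1)" "x / (\<l> * x + 1) < 1 / \<l>" "0 < 1 / (x + \<l>)" "1 / (x + \<l>) < 1 / \<l>"
proof -
  have l: "\<l> > 0" using l_pos .
  show "mobr jg x = x / (\<l> * x + 1)" by (simp only: mobr_def special) simp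
  show "mobr jQ x = 1 / (x + \<l>)"
    by (simp add: mobr_def jQ_coeff)
  have "\<l> * x > 0" using l assms by simp
  then have pos: "\<l> * x + 1 > 0" by linarith
  then show "0 < x / (\<l> * x + 1)" using assms by simp
  show "x / (\<l> * x + 1) < 1 / \<l>" using pos l by (simp add: pos_divide_less_eq distrib_left)
  show "0 < 1 / (x + \<l>)" "1 / (x + \<l>) < 1 / \<l>" using l assms by (auto simp: field_simps)
qed

lemma opr_1_False: "opr jQ f z = \<sigma> *s ((z + of_real \<l>) powr (- 2 * s) *s (\<rho> Q_elt *v (U *v f (1 / (z + of_real \<l>)))))"
proof -
  have "den jQ z = z + of_real \<l>" "mob jQ z = 1 / (z + of_real \<l>)"
    by (simp_all add: den_def mob_def num_def jQ_coeff)
  then show ?thesis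
    by (simp only: opr_def smat_mult cA_jQ matrix_vector_mul_assoc[symmetric])
       (simp add: vec_eq_iff)
qed

text \<open>In the coordinate 1 / z the terms of the series are those of \<open>Ks\<close> up to the
  weight. As the series starts with n = 1, \<open>Ks\<close> is taken one translation step further
  and a matrix U stands in front.\<close>

lemma fast_m1_eq:
  assumes adm: "admissible f p b" and z: "z \<in> slit"
  shows "fast_m1 q \<rho> s f z = (1 / (2 * s - 1)) *s ((1 / z) powr (2 * s) *s (U *v Ks f p b s (1 / z + of_real \<l>)))"
  unfolding fast_m1_def
proof (rule mero_continuation_eq[OF _ _ s_pos s_half])
  define \<xi> where "\<xi> = 1 / z"
  have \<xi>: "\<xi> \<in> slit" "\<xi> + of_real \<l> \<in> slit" unfolding \<xi>_def using slit_inverse[OF z] slit_add l_pos by auto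
  have z0: "z \<noteq> 0" "\<xi> \<noteq> 0" "1 / \<xi> = z" using slit_nonzero z \<xi> by (auto simp: \<xi>_def)
  show "vholomorphic_on (\<lambda>w. (1 / z) powr (2 * w) *s (U *v Ks f p b w (1 / z + of_real \<l>))) {w. Re w > 0}"
    using Ks_holomorphic_exponent[OF adm \<xi>(2)] z0 unfolding \<xi>_def
    by (intro vholomorphic_intros holomorphic_intros) auto
  fix w assume w: "Re w > 1/2"
  have "(\<lambda>n. matpow U n *v ((\<xi> + of_real \<l> + of_real (real n * \<l>)) powr (- 2 * w) *s
        f (1 / (\<xi> + of_real \<l> + of_real (real n * \<l>))))) sums ((1 / (2 * w - 1)) *s Ks f p b w (\<xi> + of_real \<l>))"
    using Ks_sums[OF adm w \<xi>(2)] unfolding cA_U .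
  from bounded_linear.sums[OF bounded_linear_vector_smult[of "\<xi> powr (2 * w)"] bounded_linear.sums[OF bounded_linear_matrix_vector_complex[of U] this]]
  have S: "(\<lambda>n. \<xi> powr (2 * w) *s (U *v (matpow U n *v ((\<xi> + of_real \<l> + of_real (real n * \<l>)) powr (- 2 * w) *s
        f (1 / (\<xi> + of_real \<l> + of_real (real n * \<l>)))))))
     sums (\<xi> powr (2 * w) *s (U *v ((1 / (2 * w - 1)) *s Ks f p b w (\<xi> + of_real \<l>))))" .
  have E: "alpha \<rho> w (g_pow q (Suc n)) f z = \<xi> powr (2 * w) *s (U *v (matpow U n *v ((\<xi> + of_real \<l> + of_real (real n * \<l>)) powr (- 2 * w) *s
        f (1 / (\<xi> + of_real \<l> + of_real (real n * \<l>))))))" for n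
  proof -
    define t where "t = real (Suc n) * \<l>"
    have t: "t > 0" using l_pos by (simp add: t_def)
    have X: "\<xi> + of_real \<l> + of_real (real n * \<l>) = \<xi> + of_real t" by (simp add: t_def algebra_simps)
    have "\<xi> + of_real t \<noteq> 0" using slit_add[OF \<xi>(1), of t] t slit_nonzero by auto
    have "(\<xi> + of_real t) powr (- 2 * w) = \<xi> powr (- 2 * w) * (1 + of_real t / \<xi>) powr (- 2 * w)"
      using powr_add_slit[OF \<xi>(1)] t by simp
    moreover have "1 + of_real t / \<xi> = of_real t * z + 1" by (simp add: \<xi>_def)
    moreover have "\<xi> powr (2 * w) * \<xi> powr (- 2 * w) = 1" using z0 by (simp flip: powr_add)
    ultimately have pw: "\<xi> powr (2 * w) * (\<xi> + of_real t) powr (- 2 * w) = (of_real t * z + 1) powr (- 2 * w)"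
      by (simp flip: mult.assoc)
    have mb: "(of_real 1 * z + of_real 0) / (of_real t * z + of_real 1) = 1 / (\<xi> + of_real t)"
      using z0 by (simp add: \<xi>_def field_simps)
    have "alpha \<rho> w (g_pow q (Suc n)) f z = (of_real t * z + 1) powr (- 2 * w) *s (matpow U (Suc n) *v f (1 / (\<xi> + of_real t)))"
      using alpha_pgl[OF inv_g_pow[OF q3 q_odd, of "Suc n"], of \<rho> w f z] t
      unfolding rho_g_pow[OF q3 q_odd hom] t_def[symmetric] mb by simp
    then show ?thesis unfolding X pw[symmetric] matrix_vector_mult_smult
      by (simp add: matrix_vector_mul_assoc vec_eq_iff)
  qed
  show "(\<Sum>n. alpha \<rho> w (g_pow q (Suc n)) f z) = (1 / (2 * w - 1)) *s ((1 / z) powr (2 * w) *s (U *v Ks f p b w (1 / z + of_real \<l>)))"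
    unfolding E using sums_unique[OF S, symmetric] unfolding \<xi>_def
    by (simp only: matrix_vector_mult_smult vector_smult_assoc mult.commute)
qed

text \<open>After composition with Q the translated coordinate is z itself, so no weight appears and
  only \<open>z + of_real \<l>\<close> has to avoid the slit. This is why the operator makes sense
  at 0.\<close>

lemma Q_fast_m1_eq:
  assumes adm: "admissible f p b" and z: "z + of_real \<l> \<in> slit"
  shows "Q_fast_m1 q \<rho> s f z = (1 / (2 * s - 1)) *s (\<rho> Q_elt *v (U *v Ks f p b s (z + of_real \<l>)))"
  unfolding Q_fast_m1_def
proof (rule mero_continuation_eq[OF _ _ s_pos s_half])
  show "vholomorphic_on (\<lambda>w. \<rho> Q_elt *v (U *v Ks f p b w (z + of_real \<l>))) {w. Re w > 0}"
    by (intro vholomorphic_intros Ks_holomorphic_exponent[OF adm z])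
  fix w assume w: "Re w > 1/2"
  have "(\<lambda>n. matpow U n *v ((z + of_real \<l> + of_real (real n * \<l>)) powr (- 2 * w) *s
        f (1 / (z + of_real \<l> + of_real (real n * \<l>))))) sums ((1 / (2 * w - 1)) *s Ks f p b w (z + of_real \<l>))"
    using Ks_sums[OF adm w z] unfolding cA_U .
  from bounded_linear.sums[OF bounded_linear_matrix_vector_complex[of "\<rho> Q_elt"] bounded_linear.sums[OF bounded_linear_matrix_vector_complex[of U] this]]
  have S: "(\<lambda>n. \<rho> Q_elt *v (U *v (matpow U n *v ((z + of_real \<l> + of_real (real n * \<l>)) powr (- 2 * w) *s
        f (1 / (z + of_real \<l> + of_real (real n * \<l>)))))))
     sums (\<rho> Q_elt *v (U *v ((1 / (2 * w - 1)) *s Ks f p b w (z + of_real \<l>))))" .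
  have E: "alpha \<rho> w (Qg_pow q (Suc n)) f z = \<rho> Q_elt *v (U *v (matpow U n *v ((z + of_real \<l> + of_real (real n * \<l>)) powr (- 2 * w) *s
        f (1 / (z + of_real \<l> + of_real (real n * \<l>))))))" for n
  proof -
    have X: "z + of_real \<l> + of_real (real n * \<l>) = z + of_real (real (Suc n) * \<l>)" by (simp add: algebra_simps)
    have "alpha \<rho> w (Qg_pow q (Suc n)) f z = (z + of_real (real (Suc n) * \<l>)) powr (- 2 * w) *s
        ((\<rho> Q_elt ** matpow U (Suc n)) *v f (1 / (z + of_real (real (Suc n) * \<l>))))"
      using alpha_pgl[OF inv_Qg_pow[OF q3 q_odd, of "Suc n"], of \<rho> w f z]
      unfolding rho_Qg_pow[OF q3 q_odd hom] by simp
    then show ?thesis unfolding X matrix_vector_mult_smult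
      by (simp only: matrix_vector_mul_assoc[symmetric] matpow.simps)
  qed
  show "(\<Sum>n. alpha \<rho> w (Qg_pow q (Suc n)) f z) = (1 / (2 * w - 1)) *s (\<rho> Q_elt *v (U *v Ks f p b w (z + of_real \<l>)))"
    unfolding E sums_unique[OF S, symmetric] by (simp only: matrix_vector_mult_smult)
qed

end

context parabolic_sum
begin

lemma Ks_cong:
  assumes "\<And>n. f (1 / (\<eta> + of_real (real n * \<l>))) = g (1 / (\<eta> + of_real (real n * \<l>)))"
  shows "Ks f p b w \<eta> = Ks g p b w \<eta>"
  unfolding Ks_def Rs_def using assms by simp

lemma admissible_cong:
  assumes "open G" "0 \<in> G" "\<And>z. z \<in> G \<Longrightarrow> f z = g z" "admissible f p b"
  shows "admissible g p b"
proof -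
  obtain e where e: "e > 0" "ball 0 e \<subseteq> G" using assms(1,2) by (rule openE)
  obtain C r where r: "r > 0" "\<forall>v. cmod v < r \<longrightarrow> norm (f v - f 0) \<le> C * cmod v"
    using assms(4) unfolding admissible_def by blast
  have "f v = g v" if "cmod v < e" for v using assms(3) e(2) that by (auto simp: subset_iff)
  then have "\<forall>v. cmod v < min r e \<longrightarrow> norm (g v - g 0) \<le> C * cmod v" using r(2) e(1) by (metis min_less_iff_conj norm_zero)
  moreover have "min r e > 0" using r e by simp
  ultimately have "\<exists>C r. r > 0 \<and> (\<forall>v. cmod v < r \<longrightarrow> norm (g v - g 0) \<le> C * cmod v)" by blast
  then show ?thesis using assms(2,3,4) unfolding admissible_def by simp
qed

end

text \<open>The automorphy factor of the parabolic powers is a coboundary in the coordinate 1 / z: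
  it is the quotient of the weights at the two points.\<close>

lemma powr_inverse_coordinate:
  assumes "z \<in> slit" "t \<ge> 0"
  shows "(1 / z) powr (2 * w) * (1 / z + of_real t) powr (- 2 * w) = (of_real t * z + 1) powr (- 2 * w)"
proof -
  have z: "1 / z \<in> slit" "1 / z \<noteq> 0" "z \<noteq> 0" using slit_inverse slit_nonzero assms by auto
  have "(1 / z + of_real t) powr (- 2 * w) = (1 / z) powr (- 2 * w) * (of_real t * z + 1) powr (- 2 * w)"
    using powr_add_slit[OF z(1) assms(2)] by (simp add: add.commute)
  moreover have "(1 / z) powr (2 * w) * (1 / z) powr (- 2 * w) = 1" using z by (simp flip: powr_add)
  ultimately show ?thesis by (simp flip: mult.assoc)
qed

text \<open>Where the denominator vanishes both sides are 0 by the convention for division.\<close>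

lemma inverse_coordinate: "z \<noteq> 0 \<Longrightarrow> z / (of_real t * z + 1) = 1 / (1 / z + of_real t)" for z :: complex
  by (cases "of_real t * z + 1 = 0") (auto simp: field_simps)

lemma inverse_shift_bounds:
  fixes x t :: real
  assumes "x > 0" "t \<ge> 0"
  shows "0 \<le> 1 / (1 / x + t)" "1 / (1 / x + t) \<le> x"
proof -
  have "1 / (1 / x + t) \<le> 1 / (1 / x)" using assms by (intro frac_le) auto
  then show "1 / (1 / x + t) \<le> x" by simp
qed (use assms in simp)

definition polar_at_0 :: "(real \<Rightarrow> complex^'n) \<Rightarrow> bool" where
  "polar_at_0 \<phi> \<longleftrightarrow> (\<exists>c M \<delta>. \<delta> > 0 \<and> (\<forall>x. 0 < x \<and> x < \<delta> \<longrightarrow> norm (\<phi> x - of_real (1 / x) *s c) \<le> M))"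

lemma polar_at_0_iff:
  "(\<exists>c. (\<lambda>x. norm (\<phi> x - (1 / x) *\<^sub>R c)) \<in> O[at_right 0](\<lambda>_. 1)) \<longleftrightarrow> polar_at_0 \<phi>"
proof
  assume "\<exists>c. (\<lambda>x. norm (\<phi> x - (1 / x) *\<^sub>R c)) \<in> O[at_right 0](\<lambda>_. 1)"
  then obtain c M where "\<forall>\<^sub>F x in at_right 0. norm (norm (\<phi> x - (1 / x) *\<^sub>R c)) \<le> M * norm (1 :: real)"
    by (auto elim: landau_o.bigE)
  then obtain \<delta> where "\<delta> > 0" "\<And>x. 0 < x \<Longrightarrow> x < \<delta> \<Longrightarrow> norm (\<phi> x - (1 / x) *\<^sub>R c) \<le> M"
    by (auto simp: eventually_at_right_field)
  then show "polar_at_0 \<phi>" unfolding polar_at_0_def vector_smult_of_real by blast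
next
  assume "polar_at_0 \<phi>"
  then obtain c M \<delta> where d: "\<delta> > 0" "\<And>x. 0 < x \<Longrightarrow> x < \<delta> \<Longrightarrow> norm (\<phi> x - (1 / x) *\<^sub>R c) \<le> M"
    unfolding polar_at_0_def vector_smult_of_real by blast
  have "(\<lambda>x. norm (\<phi> x - (1 / x) *\<^sub>R c)) \<in> O[at_right 0](\<lambda>_. 1)"
    by (rule bigoI[of _ M]) (use d in \<open>auto simp: eventually_at_right_field intro!: exI[of _ \<delta>]\<close>)
  then show "\<exists>c. (\<lambda>x. norm (\<phi> x - (1 / x) *\<^sub>R c)) \<in> O[at_right 0](\<lambda>_. 1)" by blast
qed

context hecke
begin

lemma elt_jg: "elt jg = g_elt q (-1)"
  by (simp add: elt_def jg_def)

lemma alpha_real_g: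
  assumes "x > 0"
  shows "alpha_real \<rho> s (g_elt q (-1)) \<phi> x = of_real (\<l> * x + 1) powr (- 2 * s) *s (U *v \<phi> (x / (\<l> * x + 1)))"
  using alpha_real_elt[OF jg_in assms, of \<phi>] unfolding elt_jg mobr_1[OF assms] jg_coeff .

lemma l_ge_1: "\<l> \<ge> 1"
  using ell_ge_1[OF q3 q_odd] .

lemma one_over_l: "0 < 1 / \<l>" "1 / \<l> \<le> 1"
  using l_ge_1 by auto

lemma SEF_iff: "\<phi> \<in> SEF q \<rho> s \<sigma> \<longleftrightarrow> \<phi> \<in> C_omega \<and> (\<forall>x. 0 < x \<and> x < 1 \<longrightarrow> \<phi> x = slwr \<phi> x)"
  unfolding SEF_def using slow_real_eq[of _ \<phi>] by auto

lemma SEF_continuation: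
  assumes "\<phi> \<in> SEF q \<rho> s \<sigma>" "polar_at_0 \<phi>"
  obtains \<Psi> p b where "vholomorphic_on \<Psi> slit" "\<And>z. z \<in> slit \<Longrightarrow> \<Psi> z = slw \<Psi> z"
    "\<And>x. 0 < x \<Longrightarrow> x < 1 \<Longrightarrow> \<Psi> (of_real x) = \<phi> x" "admissible (rest \<Psi>) p b"
    "\<And>\<xi>. \<xi> \<in> slit \<Longrightarrow> Ks (rest \<Psi>) p b s \<xi> = ((2 * s - 1) * \<xi> powr (- 2 * s)) *s \<Psi> (1 / \<xi>)"
proof -
  have an: "real_analytic_on \<phi> {0<..<1}" and eq: "\<And>x. 0 < x \<Longrightarrow> x < 1 \<Longrightarrow> \<phi> x = slwr \<phi> x"
    using assms(1) unfolding SEF_iff C_omega_def by auto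
  obtain c M \<delta> where d: "\<delta> > 0" "\<And>x. 0 < x \<Longrightarrow> x < \<delta> \<Longrightarrow> norm (\<phi> x - of_real (1 / x) *s c) \<le> M"
    using assms(2) unfolding polar_at_0_def by blast
  show ?thesis by (rule continuation[OF an eq d]) (assumption | rule that)+
qed

text \<open>The holomorphic extension demanded by \<open>SEF_hol\<close> comes for free: the
  asymptotics extend \<phi> to the slit plane, which is rounded at 0 and mapped into itself.\<close>

lemma SEF_as_eq: "SEF_as q \<rho> s \<sigma> = {\<phi> \<in> SEF q \<rho> s \<sigma>. polar_at_0 \<phi>}"
proof (intro Set.set_eqI iffI)
  fix \<phi> assume "\<phi> \<in> {\<phi> \<in> SEF q \<rho> s \<sigma>. polar_at_0 \<phi>}"
  then have \<phi>: "\<phi> \<in> SEF q \<rho> s \<sigma>" "polar_at_0 \<phi>" by auto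
  obtain \<Psi> p b where \<Psi>: "vholomorphic_on \<Psi> slit" "\<And>z. z \<in> slit \<Longrightarrow> \<Psi> z = slw \<Psi> z"
    "\<And>x. 0 < x \<Longrightarrow> x < 1 \<Longrightarrow> \<Psi> (of_real x) = \<phi> x" "admissible (rest \<Psi>) p b"
    "\<And>\<xi>. \<xi> \<in> slit \<Longrightarrow> Ks (rest \<Psi>) p b s \<xi> = ((2 * s - 1) * \<xi> powr (- 2 * s)) *s \<Psi> (1 / \<xi>)"
    by (rule SEF_continuation[OF \<phi>]) (rule that)
  have "ball (of_real 1) 1 \<subseteq> slit"
  proof
    fix z :: complex assume z: "z \<in> ball (of_real 1) 1"
    have "cmod (z - 1) < 1" using z by (simp add: dist_norm norm_minus_commute)
    then have "\<bar>Re z - 1\<bar> < 1" using abs_Re_le_cmod[of "z - 1"] by simp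
    then show "z \<in> slit" by (auto simp: slit_iff)
  qed
  then have "rounded_at_0 slit" unfolding rounded_at_0_def by (metis zero_less_one)
  moreover have "\<forall>k\<in>{1..m_of q}. acts_into (g_elt q (- int k)) slit slit \<and> acts_into (Qg_elt q (- int k)) slit slit"
  proof (intro ballI)
    fix k assume "k \<in> {1..m_of q}"
    then have J: "(k, True) \<in> JJ" "(k, False) \<in> JJ" by (auto simp: JJ_def)
    then have "acts_into (elt (k, True)) slit slit" "acts_into (elt (k, False)) slit slit"
      by (simp_all add: acts_into_elt den_slit mob_slit)
    then show "acts_into (g_elt q (- int k)) slit slit \<and> acts_into (Qg_elt q (- int k)) slit slit"
      by (simp add: elt_def)
  qed
  moreover have "of_real ` {0<..<1::real} \<subseteq> slit" by (auto simp: slit_iff)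
  ultimately have "\<phi> \<in> SEF_hol q \<rho> s \<sigma>"
    unfolding SEF_hol_def mem_Collect_eq using \<phi>(1) \<Psi>(1-3) open_slit
    by (intro conjI exI[of _ slit] exI[of _ \<Psi>]) (auto simp: slow_eq)
  then show "\<phi> \<in> SEF_as q \<rho> s \<sigma>" unfolding SEF_as_def using \<phi>(2) polar_at_0_iff by blast
next
  fix \<phi> assume "\<phi> \<in> SEF_as q \<rho> s \<sigma>"
  then show "\<phi> \<in> {\<phi> \<in> SEF q \<rho> s \<sigma>. polar_at_0 \<phi>}"
    unfolding SEF_as_def SEF_hol_def mem_Collect_eq polar_at_0_iff by blast
qed

end

section \<open>Fast eigenfunctions from slow ones, and back\<close>

locale hecke_nbhds = hecke q \<rho> s \<sigma>
  for q :: nat and \<rho> :: "(real^2^2) set \<Rightarrow> complex^'n^'n" and s \<sigma> :: complex +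
  fixes E0 Em1 :: "complex set"
  assumes nbhds: "fast_nbhds q E0 Em1"
begin

lemma nb: "open E0" "connected E0" "of_real ` closure (D_0 q) \<subseteq> E0" "q = 3 \<Longrightarrow> E0 = {}" "0 \<notin> closure E0"
  "open Em1" "connected Em1" "of_real ` closure (D_m1 q) \<subseteq> Em1"
  using nbhds unfolding fast_nbhds_def by blast+

lemma main_maps:
  assumes "j \<in> {2..m_of q} \<times> UNIV" "z \<in> closure E0 \<or> z \<in> closure Em1"
  shows "den j z \<in> slit" "mob j z \<in> E0"
proof -
  obtain k t where j: "j = (k, t)" "k \<in> {2..m_of q}" using assms(1) by auto
  then have J: "j \<in> JJ" by (auto simp: JJ_def)
  have "acts_into (g_elt q (- int k)) (closure E0) E0 \<and> acts_into (Qg_elt q (- int k)) (closure E0) E0 \<and>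
    acts_into (g_elt q (- int k)) (closure Em1) E0 \<and> acts_into (Qg_elt q (- int k)) (closure Em1) E0"
    using nbhds j(2) unfolding fast_nbhds_def by blast
  then have "acts_into (elt j) (closure E0) E0" "acts_into (elt j) (closure Em1) E0"
    by (auto simp: elt_def j(1))
  then show "den j z \<in> slit" "mob j z \<in> E0" using assms(2) by (auto simp: acts_into_elt[OF J])
qed

lemma power_maps:
  assumes "n \<ge> 1"
  shows "z \<in> closure E0 \<Longrightarrow> of_real (real n * \<l>) * z + 1 \<in> slit"
    "z \<in> closure E0 \<Longrightarrow> z / (of_real (real n * \<l>) * z + 1) \<in> Em1"
    "z \<in> closure E0 \<or> z \<in> closure Em1 \<Longrightarrow> z + of_real (real n * \<l>) \<in> slit"
    "z \<in> closure E0 \<or> z \<in> closure Em1 \<Longrightarrow> 1 / (z + of_real (real n * \<l>)) \<in> Em1"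
proof -
  have acts: "acts_into (g_pow q n) (closure E0) Em1" "acts_into (Qg_pow q n) (closure E0) Em1"
    "acts_into (Qg_pow q n) (closure Em1) Em1"
    using nbhds assms unfolding fast_nbhds_def by blast+
  have c: "real n * ell q > 0 \<or> real n * ell q = 0 \<and> (1::real) > 0" "(1::real) > 0 \<or> (1::real) = 0 \<and> real n * ell q > 0"
    by auto (use assms l_pos in auto)
  note A = acts_into_pgl[OF inv_g_pow[OF q3 q_odd] c(1)] and B = acts_into_pgl[OF inv_Qg_pow[OF q3 q_odd] c(2)]
  show "z \<in> closure E0 \<Longrightarrow> of_real (real n * \<l>) * z + 1 \<in> slit"
    "z \<in> closure E0 \<Longrightarrow> z / (of_real (real n * \<l>) * z + 1) \<in> Em1"
    using acts(1) unfolding A by auto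
  show "z \<in> closure E0 \<or> z \<in> closure Em1 \<Longrightarrow> z + of_real (real n * \<l>) \<in> slit"
    "z \<in> closure E0 \<or> z \<in> closure Em1 \<Longrightarrow> 1 / (z + of_real (real n * \<l>)) \<in> Em1"
    using acts(2,3) unfolding B by auto
qed

text \<open>At a negative real z the denominator n l z + 1 becomes nonpositive for large n, contrary
  to admissibility; 0 is excluded by assumption. So an extension to the slit plane suffices for f_0,
  whatever the shape of E0.\<close>

lemma closure_E0_slit: "closure E0 \<subseteq> slit"
proof
  fix z assume z: "z \<in> closure E0"
  show "z \<in> slit"
  proof (rule ccontr)
    assume "z \<notin> slit"
    then have z0: "Im z = 0" "Re z \<le> 0" by (auto simp: slit_iff)
    have "z \<noteq> 0" using z nb(5) by blast
    then have "Re z < 0" using z0 by (auto simp: complex_eq_iff)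
    define D where "D = \<l> * (- Re z)"
    have pos: "D > 0" unfolding D_def using l_pos \<open>Re z < 0\<close> by (simp add: mult_pos_neg)
    obtain n where n: "real n > 1 / D" using reals_Archimedean2 by blast
    have "1 / D > 0" using pos by simp
    then have "n \<ge> 1" using n by (cases n) auto
    have "real n * D > 1" using n pos by (simp add: pos_divide_less_eq)
    then have "real n * (\<l> * (- Re z)) > 1" by (simp only: D_def)
    then have "Re (of_real (real n * \<l>) * z + 1) \<le> 0" by (simp add: algebra_simps)
    moreover have "Im (of_real (real n * \<l>) * z + 1) = 0" using z0 by simp
    ultimately have "of_real (real n * \<l>) * z + 1 \<notin> slit" by (simp add: slit_iff)
    then show False using power_maps(1)[OF \<open>n \<ge> 1\<close> z] by blast
  qed
qed

lemma inverse_maps: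
  assumes "z \<in> closure E0"
  shows "1 / (1 / z + of_real (real (Suc n) * \<l>)) \<in> Em1"
  using power_maps(2)[of "Suc n" z] inverse_coordinate[of z "real (Suc n) * \<l>"] assms nb(5) by (metis le_add1 plus_1_eq_Suc)

text \<open>Em1 contains 0 and hence points to its left, where the extended solution itself is not
  defined. Its \<open>rest\<close> is, and this is why f_{-1} is taken to be \<open>rest\<close> of
  the extension.\<close>

lemma closure_Em1_pullback: "closure Em1 \<subseteq> pullback_dom slit"
proof
  fix z assume z: "z \<in> closure Em1"
  show "z \<in> pullback_dom slit"
    unfolding pullback_dom_def JJ_split mem_Collect_eq
  proof (intro ballI)
    fix j assume "j \<in> insert jQ ({2..m_of q} \<times> UNIV)"
    then consider "j = jQ" | "j \<in> {2..m_of q} \<times> UNIV" by blast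
    then show "den j z \<in> slit \<and> mob j z \<in> slit"
    proof cases
      case 1
      have "z + of_real \<l> \<in> slit" using power_maps(3)[of 1 z] z by simp
      then show ?thesis unfolding 1 using slit_inverse by (simp add: den_def mob_def num_def jQ_coeff)
    next
      case 2
      then show ?thesis using main_maps[OF 2] z closure_E0_slit closure_subset by blast
    qed
  qed
qed

lemma D_m1_closure: "0 \<le> x \<Longrightarrow> x \<le> 1 / \<l> \<Longrightarrow> of_real x \<in> Em1"
  using nb(8) one_over_l unfolding D_m1_def by (auto simp: closure_greaterThanLessThan)

lemma D_0_closure: "q \<noteq> 3 \<Longrightarrow> 1 / \<l> \<le> x \<Longrightarrow> x \<le> 1 \<Longrightarrow> of_real x \<in> E0"
  using nb(3) ell_gt_1[OF q3 q_odd] unfolding D_0_def by (auto simp: closure_greaterThanLessThan)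

lemma zero_Em1: "0 \<in> Em1"
  using D_m1_closure[of 0] one_over_l by simp

text \<open>The prescription of the inverse map in the theorem, kept as a relation: it is linear
  and, by \<open>rel_unique\<close>, determines the pair.\<close>

definition rel :: "(complex \<Rightarrow> complex^'n) \<Rightarrow> (complex \<Rightarrow> complex^'n) \<Rightarrow> (real \<Rightarrow> complex^'n) \<Rightarrow> bool" where
  "rel f0 f1 \<phi> \<longleftrightarrow> f0 \<in> B_space E0 \<and> f1 \<in> B_space Em1 \<and> (\<forall>x\<in>D_0 q. f0 (of_real x) = \<phi> x) \<and>
     (\<forall>x\<in>D_m1 q. f1 (of_real x) = \<phi> x - alpha_real \<rho> s (g_elt q (-1)) \<phi> x)"

lemma FEF_iff: "(f0, f1) \<in> FEF q E0 Em1 \<rho> s \<sigma> \<longleftrightarrow> f0 \<in> B_space E0 \<and> f1 \<in> B_space Em1 \<and>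
     (\<forall>z\<in>closure E0. f0 z = main f0 z + (fast_m1 q \<rho> s f1 z + \<sigma> *s Q_fast_m1 q \<rho> s f1 z)) \<and>
     (\<forall>z\<in>closure Em1. f1 z = main f0 z + \<sigma> *s Q_fast_m1 q \<rho> s f1 z)"
  unfolding FEF_def main_def by auto

text \<open>Take the extension \<Psi> for f_0 and \<open>rest \<Psi>\<close> for f_{-1}. Since
  \<open>Ks\<close> of f_{-1} is the weighted \<Psi>, \<open>fast_m1\<close> and
  \<open>Q_fast_m1\<close> reproduce the terms of g_{-1} and Q g_{-1}, and the two rows become the
  slow equation with and without its parabolic term.\<close>

lemma to_FEF:
  assumes "\<phi> \<in> SEF q \<rho> s \<sigma>" "polar_at_0 \<phi>"
  shows "\<exists>f0 f1. (f0, f1) \<in> FEF q E0 Em1 \<rho> s \<sigma> \<and> rel f0 f1 \<phi> \<and>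
     (\<forall>x\<in>D_m1 q. \<phi> x = f1 (of_real x) + fast_m1 q \<rho> s f1 (of_real x))"
proof -
  obtain \<Psi> p b where \<Psi>: "vholomorphic_on \<Psi> slit" "\<And>z. z \<in> slit \<Longrightarrow> \<Psi> z = slw \<Psi> z"
    "\<And>x. 0 < x \<Longrightarrow> x < 1 \<Longrightarrow> \<Psi> (of_real x) = \<phi> x" "admissible (rest \<Psi>) p b"
    "\<And>\<xi>. \<xi> \<in> slit \<Longrightarrow> Ks (rest \<Psi>) p b s \<xi> = ((2 * s - 1) * \<xi> powr (- 2 * s)) *s \<Psi> (1 / \<xi>)"
    by (rule SEF_continuation[OF assms]) (rule that)
  define f0 where "f0 = (\<lambda>z. if z \<in> closure E0 then \<Psi> z else 0)"
  define f1 where "f1 = (\<lambda>z. if z \<in> closure Em1 then rest \<Psi> z else 0)"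
  have B: "f0 \<in> B_space E0" "f1 \<in> B_space Em1"
    unfolding f0_def f1_def
    using B_space_restrict[OF open_slit closure_E0_slit \<Psi>(1)]
      B_space_restrict[OF open_pullback_dom[OF open_slit] closure_Em1_pullback vholomorphic_rest[OF \<Psi>(1)]] by auto
  have adm: "admissible f1 p b"
    by (rule admissible_cong[OF nb(6) zero_Em1 _ \<Psi>(4)]) (use closure_subset in \<open>auto simp: f1_def\<close>)
  have f1K: "Ks f1 p b s \<eta> = ((2 * s - 1) * \<eta> powr (- 2 * s)) *s \<Psi> (1 / \<eta>)"
    if "\<eta> \<in> slit" "\<And>n. 1 / (\<eta> + of_real (real n * \<l>)) \<in> closure Em1" for \<eta>
  proof -
    have "Ks f1 p b s \<eta> = Ks (rest \<Psi>) p b s \<eta>"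
      by (rule Ks_cong) (use that(2) in \<open>simp add: f1_def\<close>)
    then show ?thesis using \<Psi>(5)[OF that(1)] by simp
  qed
  have fast: "fast_m1 q \<rho> s f1 z = opr jg \<Psi> z"
    if z: "z \<in> slit" "\<And>n. 1 / (1 / z + of_real (real (Suc n) * \<l>)) \<in> closure Em1" for z
  proof -
    have X: "1 / z + of_real \<l> + of_real (real n * \<l>) = 1 / z + of_real (real (Suc n) * \<l>)" for n
      by (simp add: algebra_simps)
    have \<eta>: "1 / z + of_real \<l> \<in> slit" using slit_inverse[OF z(1)] slit_add l_pos by simp
    have K: "Ks f1 p b s (1 / z + of_real \<l>) = ((2 * s - 1) * (1 / z + of_real \<l>) powr (- 2 * s)) *s \<Psi> (1 / (1 / z + of_real \<l>))"
      by (rule f1K[OF \<eta>]) (simp only: X z(2))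
    have "opr jg \<Psi> z = ((1 / z) powr (2 * s) * (1 / z + of_real \<l>) powr (- 2 * s)) *s (U *v \<Psi> (1 / (1 / z + of_real \<l>)))"
      unfolding opr_j0 cA_U inverse_coordinate[OF slit_nonzero[OF z(1)]] powr_inverse_coordinate[OF z(1) less_imp_le[OF l_pos]] ..
    then show ?thesis unfolding fast_m1_eq[OF adm z(1)] K matrix_vector_mult_smult using two_s_nz
      by (simp add: vec_eq_iff)
  qed
  have Qfast: "\<sigma> *s Q_fast_m1 q \<rho> s f1 z = opr jQ \<Psi> z" if z: "z \<in> closure E0 \<or> z \<in> closure Em1" for z
  proof -
    have X: "z + of_real \<l> + of_real (real n * \<l>) = z + of_real (real (Suc n) * \<l>)" for n
      by (simp add: algebra_simps)
    have \<eta>: "z + of_real \<l> \<in> slit" using power_maps(3)[of 1 z] z by simp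
    have K: "Ks f1 p b s (z + of_real \<l>) = ((2 * s - 1) * (z + of_real \<l>) powr (- 2 * s)) *s \<Psi> (1 / (z + of_real \<l>))"
    proof (rule f1K[OF \<eta>])
      fix n show "1 / (z + of_real \<l> + of_real (real n * \<l>)) \<in> closure Em1"
        unfolding X using power_maps(4)[of "Suc n" z] z closure_subset by auto
    qed
    show ?thesis unfolding Q_fast_m1_eq[OF adm \<eta>] K opr_1_False matrix_vector_mult_smult using two_s_nz
      by (simp add: vec_eq_iff)
  qed
  have main: "main f0 z = main \<Psi> z" if z: "z \<in> closure E0 \<or> z \<in> closure Em1" for z
    unfolding main_eq
  proof (intro sum.cong refl opr_cong)
    fix j assume "j \<in> {2..m_of q} \<times> (UNIV :: bool set)"
    then have "mob j z \<in> E0" using main_maps(2) z by blast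
    then show "f0 (mob j z) = \<Psi> (mob j z)" using closure_subset by (auto simp: f0_def)
  qed
  have eq0: "f0 z = main f0 z + (fast_m1 q \<rho> s f1 z + \<sigma> *s Q_fast_m1 q \<rho> s f1 z)" if z: "z \<in> closure E0" for z
  proof -
    have sl: "z \<in> slit" using closure_E0_slit z by blast
    have "f0 z = slw \<Psi> z" using z \<Psi>(2)[OF sl] by (simp add: f0_def)
    also have "\<dots> = opr jg \<Psi> z + (opr jQ \<Psi> z + main \<Psi> z)" unfolding slw_split rest_eq_main ..
    also have "opr jg \<Psi> z = fast_m1 q \<rho> s f1 z"
      by (rule fast[OF sl, symmetric]) (use inverse_maps[OF z] closure_subset in blast)
    finally show ?thesis using Qfast main z by simp
  qed
  have eq1: "f1 z = main f0 z + \<sigma> *s Q_fast_m1 q \<rho> s f1 z" if z: "z \<in> closure Em1" for z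
    using z Qfast main rest_eq_main[of \<Psi> z] by (simp add: f1_def)
  have Dm: "0 < x \<and> x < 1 \<and> of_real x \<in> closure Em1" if "x \<in> D_m1 q" for x
  proof -
    have x: "0 < x" "x < 1 / \<l>" using that by (auto simp: D_m1_def)
    then have "x < 1" using one_over_l(2) by linarith
    then show ?thesis using D_m1_closure[of x] x closure_subset by auto
  qed
  have r: "rel f0 f1 \<phi>"
    unfolding rel_def
  proof (intro conjI B ballI)
    fix x assume x: "x \<in> D_0 q"
    then have "q \<noteq> 3" using ell_3[OF q3 q_odd] by (auto simp: D_0_def)
    then have "of_real x \<in> E0" using D_0_closure x by (auto simp: D_0_def)
    moreover have "0 < x" "x < 1" using x one_over_l(1) unfolding D_0_def greaterThanLessThan_iff by linarith+
    ultimately show "f0 (of_real x) = \<phi> x" using \<Psi>(3) closure_subset by (auto simp: f0_def)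
  next
    fix x assume x: "x \<in> D_m1 q"
    then have "f1 (of_real x) = rest \<Psi> (of_real x)" using Dm by (simp add: f1_def)
    also have "\<dots> = \<phi> x - of_real (1 + \<l> * x) powr (- 2 * s) *s (cA jg *v \<phi> (x / (1 + \<l> * x)))"
      using Dm[OF x] assms(1) \<Psi>(3) by (intro rest_of_real) (auto simp: SEF_iff)
    finally show "f1 (of_real x) = \<phi> x - alpha_real \<rho> s (g_elt q (-1)) \<phi> x"
      using alpha_real_g[of x \<phi>] Dm[OF x] by (simp add: cA_U add.commute)
  qed
  have "\<phi> x = f1 (of_real x) + fast_m1 q \<rho> s f1 (of_real x)" if x: "x \<in> D_m1 q" for x
  proof -
    have x': "0 < x" "x < 1" "of_real x \<in> closure Em1" "x < 1 / \<l>" using Dm[OF x] x by (auto simp: D_m1_def)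
    then have sl: "complex_of_real x \<in> slit" by (simp add: slit_iff)
    have "fast_m1 q \<rho> s f1 (of_real x) = opr jg \<Psi> (of_real x)"
    proof (rule fast[OF sl])
      fix n
      note bounds = inverse_shift_bounds[OF x'(1), of "real (Suc n) * \<l>"]
      have "complex_of_real (1 / (1 / x + real (Suc n) * \<l>)) \<in> Em1"
        using bounds x'(4) l_pos by (intro D_m1_closure) auto
      then show "1 / (1 / complex_of_real x + of_real (real (Suc n) * \<l>)) \<in> closure Em1"
        using closure_subset by auto
    qed
    moreover have "f1 (of_real x) = rest \<Psi> (of_real x)" using x' by (simp add: f1_def)
    moreover have "\<phi> x = slw \<Psi> (of_real x)" using \<Psi>(2)[OF sl] \<Psi>(3) x' by simp
    ultimately show ?thesis by (simp add: slw_split)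
  qed
  then show ?thesis using r B eq0 eq1 unfolding FEF_iff by blast
qed

text \<open>At 1 / l the value comes from f_0. For q = 3 one has 1 / l = 1 and the second branch is
  empty.\<close>

definition glued :: "(complex \<Rightarrow> complex^'n) \<Rightarrow> (complex \<Rightarrow> complex^'n) \<Rightarrow> real \<Rightarrow> complex^'n" where
  "glued f0 f1 x = (if 0 < x \<and> x < 1 / \<l> then f1 (of_real x) + fast_m1 q \<rho> s f1 (of_real x)
     else if 1 / \<l> \<le> x \<and> x < 1 then f0 (of_real x) else 0)"

lemma glued_D_m1: "x \<in> D_m1 q \<Longrightarrow> glued f0 f1 x = f1 (of_real x) + fast_m1 q \<rho> s f1 (of_real x)"
  by (simp add: glued_def D_m1_def)

lemma glued_D_0: "x \<in> D_0 q \<Longrightarrow> glued f0 f1 x = f0 (of_real x)"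
  by (simp add: glued_def D_0_def)

text \<open>The regularised sum W of f_{-1} solves the twisted difference equation, so that on
  D_{-1} the function is W(1 / x). The rows then give the slow equation on either interval, and
  \<open>Ks_real_asymptotics\<close> gives the behaviour at 0.\<close>

lemma from_FEF:
  assumes F: "(f0, f1) \<in> FEF q E0 Em1 \<rho> s \<sigma>"
  shows "glued f0 f1 \<in> SEF q \<rho> s \<sigma>" "polar_at_0 (glued f0 f1)" "rel f0 f1 (glued f0 f1)"
proof -
  define \<phi> where "\<phi> = glued f0 f1"
  have B: "f0 \<in> B_space E0" "f1 \<in> B_space Em1"
    and eq0: "\<And>z. z \<in> closure E0 \<Longrightarrow> f0 z = main f0 z + (fast_m1 q \<rho> s f1 z + \<sigma> *s Q_fast_m1 q \<rho> s f1 z)"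
    and eq1: "\<And>z. z \<in> closure Em1 \<Longrightarrow> f1 z = main f0 z + \<sigma> *s Q_fast_m1 q \<rho> s f1 z"
    using F unfolding FEF_iff by blast+
  have hol1: "vholomorphic_on f1 Em1" and hol0: "vholomorphic_on f0 E0" using B by (auto simp: B_space_def)
  obtain p b where adm: "admissible f1 p b" using admissible_exists[OF nb(6) zero_Em1 hol1] by blast
  \<comment> \<open>\<open>Ks\<close> with the weight and the factor 2 s - 1 removed, i.e. the sum
    (1 + L_{-1}) f_{-1} in the coordinate 1 / z.\<close>
  define W where "W \<eta> = (1 / (2 * s - 1)) *s (\<eta> powr (2 * s) *s Ks f1 p b s \<eta>)" for \<eta>
  have KW: "Ks f1 p b s \<eta> = (2 * s - 1) *s (\<eta> powr (- 2 * s) *s W \<eta>)" if "\<eta> \<in> slit" for \<eta>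
  proof -
    have "\<eta> powr (- 2 * s) * \<eta> powr (2 * s) = 1" using slit_nonzero[OF that] by (simp flip: powr_add)
    then show ?thesis unfolding W_def using two_s_nz by (simp add: vec_eq_iff mult.assoc[symmetric])
  qed
  have F1: "f1 z + fast_m1 q \<rho> s f1 z = W (1 / z)" if z: "z \<in> slit" for z
  proof -
    have i: "1 / z \<in> slit" by (rule slit_inverse[OF z])
    have EE: "(1 / z) powr (2 * s) * (1 / z) powr (- 2 * s) = 1" using slit_nonzero[OF i] by (simp flip: powr_add)
    have kt: "(1 / (2 * s - 1)) * (2 * s - 1) = 1" using two_s_nz by simp
    have gen: "k * (E * (t * E' * v + u)) = v + k * (E * u)" if "E * E' = 1" "k * t = 1" for k E t E' u v :: complex
    proof -
      have "k * (E * (t * E' * v + u)) = (k * t) * (E * E') * v + k * (E * u)" by (simp add: algebra_simps)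
      then show ?thesis using that by simp
    qed
    show ?thesis unfolding W_def Ks_shift[OF adm s_pos i] fast_m1_eq[OF adm z]
      unfolding cA_U vec_eq_iff vector_add_component vector_smult_component gen[OF EE kt] by simp
  qed
  have F2: "fast_m1 q \<rho> s f1 z = (of_real \<l> * z + 1) powr (- 2 * s) *s (U *v W (1 / z + of_real \<l>))" if z: "z \<in> slit" for z
  proof -
    have i: "1 / z + of_real \<l> \<in> slit" using slit_inverse[OF z] slit_add l_pos by simp
    show ?thesis unfolding fast_m1_eq[OF adm z] KW[OF i] powr_inverse_coordinate[OF z less_imp_le[OF l_pos], symmetric]
        matrix_vector_mult_smult using two_s_nz by (simp add: vec_eq_iff)
  qed
  have F3: "Q_fast_m1 q \<rho> s f1 z = (z + of_real \<l>) powr (- 2 * s) *s (\<rho> Q_elt *v (U *v W (z + of_real \<l>)))"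
    if z: "z + of_real \<l> \<in> slit" for z
    unfolding Q_fast_m1_eq[OF adm z] KW[OF z] matrix_vector_mult_smult using two_s_nz by (simp add: vec_eq_iff)
  have \<phi>W: "\<phi> x = W (of_real (1 / x))" if "0 < x" "x < 1 / \<l>" for x
    unfolding \<phi>_def glued_def using F1[of "of_real x"] that by (simp add: slit_iff)
  have fast_real: "fast_m1 q \<rho> s f1 (of_real x) = of_real (\<l> * x + 1) powr (- 2 * s) *s (U *v \<phi> (x / (\<l> * x + 1)))"
    if x: "0 < x" for x
  proof -
    have "1 / (x / (\<l> * x + 1)) = 1 / x + \<l>" using x by (simp add: field_simps)
    then have "\<phi> (x / (\<l> * x + 1)) = W (1 / of_real x + of_real \<l>)"
      using \<phi>W[OF mobr_1(3,4)[OF x]] by simp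
    then show ?thesis using F2[of "of_real x"] x by (simp add: slit_iff)
  qed
  have Qfast_real: "Q_fast_m1 q \<rho> s f1 (of_real x) = (of_real x + of_real \<l>) powr (- 2 * s) *s (\<rho> Q_elt *v (U *v \<phi> (1 / (x + \<l>))))"
    if x: "0 < x" for x
    using F3[of "of_real x"] \<phi>W[OF mobr_1(5,6)[OF x]] x l_pos by (simp add: slit_iff)
  have \<phi>0: "\<phi> x = f0 (of_real x)" if "1 / \<l> \<le> x" "x < 1" for x
    unfolding \<phi>_def glued_def using that by simp
  have main_real: "main f0 (of_real x) = (\<Sum>j\<in>{2..m_of q} \<times> UNIV. of_real (cc j * x + cd j) powr (- 2 * s) *s (cA j *v \<phi> (mobr j x)))"
    if x: "0 < x" "x < 1" for x
    unfolding main_eq opr_def mob_of_real den_of_real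
    by (intro sum.cong refl) (use \<phi>0 mobr_ge_2(2,3)[OF _ x] in \<open>simp add: less_imp_le\<close>)
  have slow: "slwr \<phi> x = main f0 (of_real x) + (fast_m1 q \<rho> s f1 (of_real x) + \<sigma> *s Q_fast_m1 q \<rho> s f1 (of_real x))"
    if x: "0 < x" "x < 1" for x
  proof -
    let ?X = "\<lambda>j. of_real (cc j * x + cd j) powr (- 2 * s) *s (cA j *v \<phi> (mobr j x))"
    have "slwr \<phi> x = ?X jg + (?X jQ + (\<Sum>j\<in>{2..m_of q} \<times> UNIV. ?X j))"
    proof -
      have "slwr \<phi> x = ?X jg + (\<Sum>j\<in>JJ - {jg}. ?X j)" unfolding slwr_def by (rule sum.remove[OF fin jg_in])
      also have "(\<Sum>j\<in>JJ - {jg}. ?X j) = ?X jQ + (\<Sum>j\<in>{2..m_of q} \<times> UNIV. ?X j)"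
        unfolding JJ_split by (subst sum.insert) (auto simp: jQ_def)
      finally show ?thesis .
    qed
    moreover have "?X jg = fast_m1 q \<rho> s f1 (of_real x)"
      unfolding fast_real[OF x(1)] mobr_1[OF x(1)] jg_coeff cA_U ..
    moreover have "?X jQ = \<sigma> *s Q_fast_m1 q \<rho> s f1 (of_real x)"
      unfolding Qfast_real[OF x(1)] mobr_1[OF x(1)] jQ_coeff cA_jQ
      by (simp only: smat_mult matrix_vector_mul_assoc[symmetric]) (simp add: vec_eq_iff)
    ultimately show ?thesis unfolding main_real[OF x] by simp
  qed
  \<comment> \<open>Subtracting the rows shows that the two definitions of \<phi> agree where the
    domains overlap; this makes \<phi> analytic across 1 / l.\<close>
  have near: "f0 z = f1 z + fast_m1 q \<rho> s f1 z" if "z \<in> closure E0" "z \<in> closure Em1" for z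
    using eq0[OF that(1)] eq1[OF that(2)] by simp
  have E0_real: "of_real x \<in> E0" if "1 / \<l> \<le> x" "x < 1" for x
  proof -
    have "q \<noteq> 3" using that ell_3[OF q3 q_odd] by auto
    then show ?thesis using D_0_closure that by simp
  qed
  have se: "\<phi> x = slwr \<phi> x" if x: "0 < x" "x < 1" for x
  proof (cases "x < 1 / \<l>")
    case True
    then have "of_real x \<in> closure Em1" using D_m1_closure[of x] x closure_subset by auto
    then show ?thesis using eq1[of "of_real x"] True x unfolding slow[OF x] by (simp add: \<phi>_def glued_def)
  next
    case False
    then have "of_real x \<in> closure E0" using E0_real[of x] x closure_subset by auto
    then show ?thesis using eq0[of "of_real x"] False x unfolding slow[OF x] by (simp add: \<phi>0)
  qed
  have an: "real_analytic_on \<phi> {0<..<1}"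
  proof (rule real_analytic_onI)
    fix x :: real assume "x \<in> {0<..<1}"
    then have x: "0 < x" "x < 1" by auto
    show "\<exists>r g. r > 0 \<and> vholomorphic_on g (ball (of_real x) r) \<and> (\<forall>y. \<bar>y - x\<bar> < r \<longrightarrow> \<phi> y = g (of_real y))"
    proof (cases "x < 1 / \<l>")
      case True
      define S where "S = slit \<inter> (\<lambda>z. 1 / z) -` orbit_domain Em1"
      have "continuous_on slit (\<lambda>z. 1 / z)" by (intro continuous_intros) (auto dest: slit_nonzero)
      then have "open S" unfolding S_def
        by (rule continuous_open_preimage[OF _ open_slit open_orbit_domain[OF nb(6) zero_Em1]])
      moreover have "of_real x \<in> S"
      proof -
        have "1 / (1 / complex_of_real x + of_real (real n * \<l>)) \<in> Em1" for n
        proof -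
          note bounds = inverse_shift_bounds[OF x(1), of "real n * \<l>"]
          have "complex_of_real (1 / (1 / x + real n * \<l>)) \<in> Em1"
            using bounds True l_pos by (intro D_m1_closure) auto
          then show ?thesis by simp
        qed
        then show ?thesis using x by (simp add: S_def orbit_domain_def slit_iff)
      qed
      ultimately obtain r where r: "r > 0" "ball (of_real x) r \<subseteq> S" by (rule openE)
      define r' where "r' = min r (min x (1 / \<l> - x))"
      have "vholomorphic_on (\<lambda>z. W (1 / z)) S"
      proof -
        have "vholomorphic_on (\<lambda>z. Ks f1 p b s (1 / z)) S"
          by (rule vholomorphic_on_compose[OF Ks_holomorphic[OF adm s_pos nb(6) zero_Em1 hol1]])
             (auto simp: S_def intro!: holomorphic_intros dest: slit_nonzero)
        moreover have "(\<lambda>z. (1 / z) powr (2 * s)) holomorphic_on S"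
          using slit_nonzero slit_not_nonpos[OF slit_inverse] by (intro holomorphic_intros) (auto simp: S_def)
        ultimately show ?thesis unfolding W_def by (intro vholomorphic_on_smult holomorphic_on_const)
      qed
      then have "vholomorphic_on (\<lambda>z. W (1 / z)) (ball (of_real x) r')"
        by (rule vholomorphic_on_subset) (use r(2) in \<open>auto simp: r'_def\<close>)
      moreover have "\<phi> y = W (1 / of_real y)" if "\<bar>y - x\<bar> < r'" for y
        using \<phi>W[of y] that by (simp add: r'_def abs_less_iff)
      moreover have "r' > 0" using r x True by (simp add: r'_def)
      ultimately show ?thesis by (intro exI[of _ r'] exI[of _ "\<lambda>z. W (1 / z)"]) auto
    next
      case False
      have xE: "of_real x \<in> E0" using E0_real x False by simp
      obtain r where r: "r > 0" "ball (complex_of_real x) r \<subseteq> E0" by (rule openE[OF nb(1) xE])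
      define r' where "r' = min r (min x (1 - x))"
      have "vholomorphic_on f0 (ball (of_real x) r')"
        by (rule vholomorphic_on_subset[OF hol0]) (use r(2) in \<open>auto simp: r'_def\<close>)
      moreover have "\<phi> y = f0 (of_real y)" if y: "\<bar>y - x\<bar> < r'" for y
      proof -
        have y01: "0 < y" "y < 1" using y by (auto simp: r'_def abs_less_iff)
        show ?thesis
        proof (cases "y < 1 / \<l>")
          case True
          have "complex_of_real y \<in> ball (of_real x) r" using y by (simp add: r'_def dist_real_def abs_minus_commute)
          then have "of_real y \<in> closure E0" using r(2) closure_subset by blast
          moreover have "of_real y \<in> closure Em1" using D_m1_closure[of y] True y01 closure_subset by auto
          ultimately show ?thesis using near[of "of_real y"] True y01 by (simp add: \<phi>_def glued_def)
        qed (use \<phi>0 y01 in auto)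
      qed
      moreover have "r' > 0" using r x by (simp add: r'_def)
      ultimately show ?thesis by (intro exI[of _ r'] exI[of _ f0]) auto
    qed
  qed
  have "\<phi> x = 0" if "x \<notin> {0<..<1}" for x
  proof (cases "0 < x")
    case True
    with that have "\<not> x < 1" "\<not> x < 1 / \<l>" using one_over_l unfolding greaterThanLessThan_iff by linarith+
    then show ?thesis unfolding \<phi>_def glued_def by (simp only: simp_thms if_False)
  next
    case False
    then have "\<not> 1 / \<l> \<le> x" using one_over_l(1) by linarith
    with False show ?thesis unfolding \<phi>_def glued_def by (simp only: simp_thms if_False)
  qed
  then have C: "\<phi> \<in> C_omega" unfolding C_omega_def using an by blast
  then show "glued f0 f1 \<in> SEF q \<rho> s \<sigma>" using se unfolding SEF_iff \<phi>_def by blast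
  obtain C0 B0 where CB: "B0 > 0" "\<And>x. x \<ge> B0 \<Longrightarrow> norm (Ks f1 p b s (of_real x) - hs p b s (of_real x)) \<le> C0 * x powr (- 2 * Re s)"
    using Ks_real_asymptotics[OF adm s_pos] by blast
  show "polar_at_0 (glued f0 f1)"
    unfolding polar_at_0_def \<phi>_def[symmetric]
  proof (intro exI conjI allI impI)
    show "min (1 / B0) (1 / \<l>) > 0" using CB(1) l_pos by simp
    fix x assume "0 < x \<and> x < min (1 / B0) (1 / \<l>)"
    then have x: "0 < x" "x < 1 / B0" "x < 1 / \<l>" by auto
    then have X: "1 / x \<ge> B0" "1 / x > 0" using CB(1) by (auto simp: field_simps)
    define X where "X = 1 / x"
    have XX: "complex_of_real X powr (2 * s) * of_real X powr (- 2 * s) = 1"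
      using x(1) by (simp add: X_def flip: powr_add)
    \<comment> \<open>The coefficient of 1 / x is p / (2 s - 1); the bounded remainder consists of b
      and the tail of \<open>Ks\<close>.\<close>
    have "\<phi> x - of_real (1 / x) *s ((1 / (2 * s - 1)) *s p) =
        b + (1 / (2 * s - 1)) *s (of_real X powr (2 * s) *s (Ks f1 p b s (of_real X) - hs p b s (of_real X)))"
    proof -
      have h: "of_real X powr (2 * s) *s hs p b s (of_real X) = of_real X *s p + (2 * s - 1) *s b"
        using XX unfolding hs_def by (simp add: vec_eq_iff flip: mult.assoc)
      have "\<phi> x = (1 / (2 * s - 1)) *s (of_real X powr (2 * s) *s (Ks f1 p b s (of_real X) - hs p b s (of_real X)))
          + (1 / (2 * s - 1)) *s (of_real X powr (2 * s) *s hs p b s (of_real X))"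
        unfolding \<phi>W[OF x(1,3)] W_def X_def by (simp add: vec_eq_iff algebra_simps)
      also have "(1 / (2 * s - 1)) *s (of_real X powr (2 * s) *s hs p b s (of_real X)) =
          of_real (1 / x) *s ((1 / (2 * s - 1)) *s p) + b"
        unfolding h vector_add_ldistrib vector_smult_assoc using two_s_nz by (simp add: X_def)
      finally show ?thesis by (simp add: algebra_simps)
    qed
    also have "norm \<dots> \<le> norm b + norm ((1 / (2 * s - 1)) *s (of_real X powr (2 * s) *s (Ks f1 p b s (of_real X) - hs p b s (of_real X))))"
      by (rule norm_triangle_ineq)
    also have "norm ((1 / (2 * s - 1)) *s (of_real X powr (2 * s) *s (Ks f1 p b s (of_real X) - hs p b s (of_real X))))
        = cmod (1 / (2 * s - 1)) * (X powr (2 * Re s) * norm (Ks f1 p b s (of_real X) - hs p b s (of_real X)))"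
      using X(2) unfolding norm_vector_smult X_def[symmetric] by (simp add: norm_powr_real_powr)
    also have "\<dots> \<le> cmod (1 / (2 * s - 1)) * (X powr (2 * Re s) * (C0 * X powr (- 2 * Re s)))"
      using CB(2)[OF X(1)] by (intro mult_left_mono) (auto simp: X_def)
    also have "X powr (2 * Re s) * (C0 * X powr (- 2 * Re s)) = C0"
      using X(2) by (simp add: X_def powr_minus)
    finally show "norm (\<phi> x - of_real (1 / x) *s ((1 / (2 * s - 1)) *s p)) \<le> norm b + cmod (1 / (2 * s - 1)) * C0" by simp
  qed
  show "rel f0 f1 (glued f0 f1)"
    unfolding rel_def \<phi>_def[symmetric]
  proof (intro conjI B ballI)
    fix x assume "x \<in> D_0 q" then show "f0 (of_real x) = \<phi> x" by (simp add: \<phi>_def glued_D_0)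
  next
    fix x assume x: "x \<in> D_m1 q"
    then have "x > 0" by (simp add: D_m1_def)
    then show "f1 (of_real x) = \<phi> x - alpha_real \<rho> s (g_elt q (-1)) \<phi> x"
      unfolding alpha_real_g[OF \<open>x > 0\<close>] fast_real[OF \<open>x > 0\<close>, symmetric] using x by (simp add: \<phi>_def glued_D_m1)
  qed
qed

end

section \<open>Linear structure of the spaces of slow eigenfunctions\<close>

context hecke
begin

lemma slwr_add: "slwr (\<phi> + \<phi>') x = slwr \<phi> x + slwr \<phi>' x"
  unfolding slwr_def by (simp add: plus_fun_def matrix_vector_right_distrib vec.scale_right_distrib sum.distrib)

lemma slwr_scale: "slwr (fun_scale k \<phi>) x = k *s slwr \<phi> x"
  unfolding slwr_def fun_scale_def vec.scale_sum_right matrix_vector_mult_smult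
  by (intro sum.cong refl) (simp add: vec_eq_iff)

lemma slwr_zero: "slwr 0 x = 0"
  unfolding slwr_def by (simp add: zero_fun_def)

lemma subspace_SEF: "module.subspace fun_scale (SEF q \<rho> s \<sigma>)"
  unfolding module.subspace_def[OF module_fun_scale]
proof (intro conjI ballI allI)
  show "0 \<in> SEF q \<rho> s \<sigma>" unfolding SEF_iff using C_omega_zero by (simp add: slwr_zero)
next
  fix \<phi> \<phi>' assume "\<phi> \<in> SEF q \<rho> s \<sigma>" "\<phi>' \<in> SEF q \<rho> s \<sigma>"
  then show "\<phi> + \<phi>' \<in> SEF q \<rho> s \<sigma>" unfolding SEF_iff by (simp add: slwr_add C_omega_add del: plus_fun_apply) simp
next
  fix k \<phi> assume "\<phi> \<in> SEF q \<rho> s \<sigma>"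
  then show "fun_scale k \<phi> \<in> SEF q \<rho> s \<sigma>"
    using C_omega_scale[of \<phi> k] unfolding SEF_iff slwr_scale fun_scale_def[symmetric] by (simp add: fun_scale_def)
qed

lemma subspace_SEF_as: "module.subspace fun_scale (SEF_as q \<rho> s \<sigma>)"
  unfolding module.subspace_def[OF module_fun_scale] SEF_as_eq
proof (intro conjI ballI allI)
  note sub = subspace_SEF[unfolded module.subspace_def[OF module_fun_scale]]
  have "polar_at_0 (0 :: real \<Rightarrow> complex^'n)"
    unfolding polar_at_0_def by (intro exI[of _ 0] exI[of _ 1]) (simp add: exI[of _ 0])
  then show "0 \<in> {\<phi> \<in> SEF q \<rho> s \<sigma>. polar_at_0 \<phi>}" using sub by simp
  fix \<phi> assume \<phi>: "\<phi> \<in> {\<phi> \<in> SEF q \<rho> s \<sigma>. polar_at_0 \<phi>}"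
  then obtain c M \<delta> where 1: "\<delta> > 0" "\<And>x. 0 < x \<Longrightarrow> x < \<delta> \<Longrightarrow> norm (\<phi> x - of_real (1 / x) *s c) \<le> M"
    unfolding polar_at_0_def by blast
  { fix \<phi>' assume \<phi>': "\<phi>' \<in> {\<phi> \<in> SEF q \<rho> s \<sigma>. polar_at_0 \<phi>}"
    then obtain c' M' \<delta>' where 2: "\<delta>' > 0" "\<And>x. 0 < x \<Longrightarrow> x < \<delta>' \<Longrightarrow> norm (\<phi>' x - of_real (1 / x) *s c') \<le> M'"
      unfolding polar_at_0_def by blast
    have "polar_at_0 (\<phi> + \<phi>')" unfolding polar_at_0_def
    proof (intro exI conjI allI impI)
      show "min \<delta> \<delta>' > 0" using 1 2 by simp
      fix x assume x: "0 < x \<and> x < min \<delta> \<delta>'"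
      have eq: "(\<phi> + \<phi>') x - of_real (1 / x) *s (c + c') = (\<phi> x - of_real (1 / x) *s c) + (\<phi>' x - of_real (1 / x) *s c')"
        by (simp add: vec_eq_iff algebra_simps)
      show "norm ((\<phi> + \<phi>') x - of_real (1 / x) *s (c + c')) \<le> M + M'"
        unfolding eq using x by (intro norm_triangle_mono 1(2) 2(2)) auto
    qed
    then show "\<phi> + \<phi>' \<in> {\<phi> \<in> SEF q \<rho> s \<sigma>. polar_at_0 \<phi>}" using \<phi> \<phi>' sub by simp
  next
    fix k
    have "polar_at_0 (fun_scale k \<phi>)" unfolding polar_at_0_def
    proof (intro exI conjI allI impI)
      show "\<delta> > 0" by (fact 1)
      fix x assume x: "0 < x \<and> x < \<delta>"
      have "fun_scale k \<phi> x - of_real (1 / x) *s (k *s c) = k *s (\<phi> x - of_real (1 / x) *s c)"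
        by (simp add: fun_scale_def vec_eq_iff algebra_simps)
      then show "norm (fun_scale k \<phi> x - of_real (1 / x) *s (k *s c)) \<le> cmod k * M"
        using 1(2)[of x] x by (simp only: norm_vector_smult) (intro mult_left_mono, auto)
    qed
    then show "fun_scale k \<phi> \<in> {\<phi> \<in> SEF q \<rho> s \<sigma>. polar_at_0 \<phi>}" using \<phi> sub by simp
  }
qed

lemma alpha_real_J: "alpha_real \<rho> s J_elt \<phi> x = \<rho> J_elt *v \<phi> (- x)"
  using alpha_real_pgl[OF inv_J[OF q3 q_odd], of x \<rho> s \<phi>] by simp

lemma alpha_J: "alpha \<rho> s J_elt f z = \<rho> J_elt *v f (- z)"
  using alpha_pgl[OF inv_J[OF q3 q_odd], of \<rho> s f z] by simp

text \<open>A smooth extension is bounded near 0, so the asymptotic condition holds with c = 0, and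
  by \<open>SEF_as_eq\<close> nothing else is required.\<close>

lemma SEF_dec_subset: "SEF_dec q \<rho> s \<sigma> \<subseteq> SEF_as q \<rho> s \<sigma>"
proof
  fix \<phi> assume "\<phi> \<in> SEF_dec q \<rho> s \<sigma>"
  then obtain F where \<phi>: "\<phi> \<in> SEF q \<rho> s \<sigma>" and F: "smooth_on_open F {- (1 / ell q)<..<1 / ell q}"
    "\<And>x. x \<in> {0<..<1 / ell q} \<Longrightarrow> F x = \<phi> x" unfolding SEF_dec_def by blast
  obtain D where D: "\<And>x. x \<in> {- (1 / ell q)<..<1 / ell q} \<Longrightarrow> D 0 x = F x"
    "\<And>n x. x \<in> {- (1 / ell q)<..<1 / ell q} \<Longrightarrow> (D n has_vector_derivative D (Suc n) x) (at x)"
    using F(1) unfolding smooth_on_open_def by blast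
  have "isCont (D 0) 0" using has_vector_derivative_continuous[OF D(2)[of 0 0]] one_over_l by simp
  then obtain d where d: "d > 0" "\<forall>x. dist x 0 < d \<longrightarrow> dist (D 0 x) (D 0 0) < 1"
    unfolding continuous_at_eps_delta using zero_less_one by blast
  have "polar_at_0 \<phi>" unfolding polar_at_0_def
  proof (intro exI conjI allI impI)
    show "min d (1 / \<l>) > 0" using d one_over_l by simp
    fix x assume x: "0 < x \<and> x < min d (1 / \<l>)"
    then have "\<phi> x = D 0 x" using D(1)[of x] F(2)[of x] by simp
    moreover have "dist (D 0 x) (D 0 0) < 1" using d(2) x by (simp add: dist_real_def)
    ultimately have "norm (\<phi> x) \<le> norm (D 0 0) + 1"
      using norm_triangle_sub[of "\<phi> x" "D 0 0"] by (simp add: dist_norm)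
    then show "norm (\<phi> x - of_real (1 / x) *s 0) \<le> norm (D 0 0) + 1" by simp
  qed
  then show "\<phi> \<in> SEF_as q \<rho> s \<sigma>" unfolding SEF_as_eq using \<phi> by simp
qed

lemma subspace_SEF_dec: "module.subspace fun_scale (SEF_dec q \<rho> s \<sigma>)"
  unfolding module.subspace_def[OF module_fun_scale]
proof (intro conjI ballI allI)
  note sub = subspace_SEF[unfolded module.subspace_def[OF module_fun_scale]]
  let ?I = "{- (1 / ell q)<..<1 / ell q}"
  have "smooth_on_open (\<lambda>x. 0 :: complex^'n) ?I"
    unfolding smooth_on_open_def by (intro exI[of _ "\<lambda>_ _. 0"]) auto
  then show "0 \<in> SEF_dec q \<rho> s \<sigma>" unfolding SEF_dec_def mem_Collect_eq using sub
    by (intro conjI exI[of _ "\<lambda>_. 0"]) (auto simp: alpha_real_J)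
next
  note sub = subspace_SEF[unfolded module.subspace_def[OF module_fun_scale]]
  fix \<phi> \<phi>' assume "\<phi> \<in> SEF_dec q \<rho> s \<sigma>" "\<phi>' \<in> SEF_dec q \<rho> s \<sigma>"
  then obtain F F' where \<phi>: "\<phi> \<in> SEF q \<rho> s \<sigma>" "\<phi>' \<in> SEF q \<rho> s \<sigma>" and
    F: "smooth_on_open F {- (1 / ell q)<..<1 / ell q}" "\<forall>x\<in>{0<..<1 / ell q}. F x = \<phi> x"
      "\<forall>x\<in>{- (1 / ell q)<..<0}. F x = - \<sigma> *s alpha_real \<rho> s J_elt \<phi> x" and
    F': "smooth_on_open F' {- (1 / ell q)<..<1 / ell q}" "\<forall>x\<in>{0<..<1 / ell q}. F' x = \<phi>' x"
      "\<forall>x\<in>{- (1 / ell q)<..<0}. F' x = - \<sigma> *s alpha_real \<rho> s J_elt \<phi>' x"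
    unfolding SEF_dec_def mem_Collect_eq by (elim conjE exE)
  show "\<phi> + \<phi>' \<in> SEF_dec q \<rho> s \<sigma>" unfolding SEF_dec_def mem_Collect_eq
    using sub \<phi> F F' smooth_on_open_add[OF F(1) F'(1)]
    by (intro conjI exI[of _ "\<lambda>x. F x + F' x"])
       (auto simp: alpha_real_J matrix_vector_right_distrib vec.scale_right_distrib)
next
  note sub = subspace_SEF[unfolded module.subspace_def[OF module_fun_scale]]
  fix k \<phi> assume "\<phi> \<in> SEF_dec q \<rho> s \<sigma>"
  then obtain F where \<phi>: "\<phi> \<in> SEF q \<rho> s \<sigma>" and
    F: "smooth_on_open F {- (1 / ell q)<..<1 / ell q}" "\<forall>x\<in>{0<..<1 / ell q}. F x = \<phi> x"
      "\<forall>x\<in>{- (1 / ell q)<..<0}. F x = - \<sigma> *s alpha_real \<rho> s J_elt \<phi> x"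
    unfolding SEF_dec_def mem_Collect_eq by (elim conjE exE)
  show "fun_scale k \<phi> \<in> SEF_dec q \<rho> s \<sigma>" unfolding SEF_dec_def mem_Collect_eq
    using sub \<phi> F smooth_on_open_smult[OF F(1), of k]
    by (intro conjI exI[of _ "\<lambda>x. k *s F x"])
       (auto simp: alpha_real_J fun_scale_def matrix_vector_mult_smult mult.commute)
qed

end

section \<open>The two mutually inverse isomorphisms\<close>

context hecke_nbhds
begin

text \<open>Within the unit interval D_{-1} and D_0 miss at most the point 1 / l, where continuity
  decides.\<close>

lemma C_omega_unique:
  assumes "\<phi> \<in> C_omega" "\<phi>' \<in> C_omega"
    and m1: "\<And>x. x \<in> D_m1 q \<Longrightarrow> \<phi> x = \<phi>' x" and D0: "\<And>x. x \<in> D_0 q \<Longrightarrow> \<phi> x = \<phi>' x"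
  shows "\<phi> = \<phi>'"
proof
  fix x
  consider "x \<in> D_m1 q" | "x \<in> D_0 q" | "x = 1 / \<l>" "x < 1" | "x \<notin> {0<..<1}"
    unfolding D_m1_def D_0_def using one_over_l by (auto simp: not_less) force
  then show "\<phi> x = \<phi>' x"
  proof cases
    case 3
    have x01: "x \<in> {0<..<1}" using 3 one_over_l by simp
    have c: "isCont \<phi> x" "isCont \<phi>' x"
      using assms(1,2) real_analytic_imp_continuous[OF _ x01] by (auto simp: C_omega_def)
    then have "(\<phi> \<longlongrightarrow> \<phi> x) (at_left x)" "(\<phi>' \<longlongrightarrow> \<phi>' x) (at_left x)"
      using filterlim_at_split by (auto simp: isCont_def filterlim_at_split)
    moreover have "\<forall>\<^sub>F y in at_left x. \<phi> y = \<phi>' y"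
      using eventually_at_left_real[of 0 x] x01 by (auto elim!: eventually_mono intro!: m1 simp: D_m1_def 3)
    ultimately have "(\<phi>' \<longlongrightarrow> \<phi> x) (at_left x)" "(\<phi>' \<longlongrightarrow> \<phi>' x) (at_left x)"
      using tendsto_cong by blast+
    then show ?thesis by (intro tendsto_unique[of "at_left x"]) auto
  next
    case 4
    then show ?thesis using assms(1,2) by (simp add: C_omega_def)
  qed (use m1 D0 in auto)
qed

lemma rel_unique:
  assumes "rel f0 f1 \<phi>" "rel f0' f1' \<phi>"
  shows "f0 = f0'" "f1 = f1'"
proof -
  show "f1 = f1'"
  proof (rule B_space_unique[of _ Em1 _ 0 "1 / \<l>"])
    show "of_real ` {0<..<1 / \<l>} \<subseteq> Em1" using D_m1_closure by auto
  qed (use assms nb one_over_l in \<open>auto simp: rel_def D_m1_def\<close>)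
  show "f0 = f0'"
  proof (rule B_space_unique[of _ E0 _ "1 / \<l>" 1])
    show "of_real ` {1 / \<l><..<1} \<subseteq> E0"
    proof safe
      fix x assume x: "x \<in> {1 / \<l><..<1}"
      then have "q \<noteq> 3" using ell_3[OF q3 q_odd] by auto
      then show "complex_of_real x \<in> E0" using D_0_closure x by auto
    qed
    show "1 / \<l> < 1 \<or> E0 = {}" using nb(4) ell_gt_1[OF q3 q_odd] by (cases "q = 3") auto
  qed (use assms nb in \<open>auto simp: rel_def D_0_def\<close>)
qed

lemma rel_add: "rel f0 f1 \<phi> \<Longrightarrow> rel g0 g1 \<psi> \<Longrightarrow> rel (f0 + g0) (f1 + g1) (\<phi> + \<psi>)"
  unfolding rel_def using B_space_add
  by (auto simp: alpha_real_g D_m1_def matrix_vector_right_distrib vec.scale_right_distrib)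

lemma rel_scale: "rel f0 f1 \<phi> \<Longrightarrow> rel (fun_scale k f0) (fun_scale k f1) (fun_scale k \<phi>)"
  unfolding rel_def using B_space_scale[of f0 E0 k] B_space_scale[of f1 Em1 k]
  by (auto simp: alpha_real_g D_m1_def fun_scale_def matrix_vector_mult_smult vec.scale_right_diff_distrib mult.commute)

definition PsiM :: "(real \<Rightarrow> complex^'n) \<Rightarrow> (complex \<Rightarrow> complex^'n) \<times> (complex \<Rightarrow> complex^'n)" where
  "PsiM \<phi> = (SOME f. rel (fst f) (snd f) \<phi>)"

definition PhiM :: "(complex \<Rightarrow> complex^'n) \<times> (complex \<Rightarrow> complex^'n) \<Rightarrow> real \<Rightarrow> complex^'n" where
  "PhiM f = glued (fst f) (snd f)"

lemma PsiM_eqI: "rel f0 f1 \<phi> \<Longrightarrow> PsiM \<phi> = (f0, f1)"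
proof -
  assume r: "rel f0 f1 \<phi>"
  have "rel (fst (PsiM \<phi>)) (snd (PsiM \<phi>)) \<phi>"
    unfolding PsiM_def by (rule someI[of "\<lambda>f. rel (fst f) (snd f) \<phi>" "(f0, f1)"]) (simp add: r)
  then show ?thesis using rel_unique[OF _ r] by (metis prod.collapse)
qed

lemma PsiM_props:
  assumes "\<phi> \<in> SEF_as q \<rho> s \<sigma>"
  shows "rel (fst (PsiM \<phi>)) (snd (PsiM \<phi>)) \<phi>" "PsiM \<phi> \<in> FEF q E0 Em1 \<rho> s \<sigma>" "PhiM (PsiM \<phi>) = \<phi>"
    "\<And>x. x \<in> D_m1 q \<Longrightarrow> \<phi> x = snd (PsiM \<phi>) (of_real x) + fast_m1 q \<rho> s (snd (PsiM \<phi>)) (of_real x)"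
proof -
  have \<phi>: "\<phi> \<in> SEF q \<rho> s \<sigma>" "polar_at_0 \<phi>" using assms SEF_as_eq by auto
  obtain f0 f1 where f: "(f0, f1) \<in> FEF q E0 Em1 \<rho> s \<sigma>" "rel f0 f1 \<phi>"
    "\<And>x. x \<in> D_m1 q \<Longrightarrow> \<phi> x = f1 (of_real x) + fast_m1 q \<rho> s f1 (of_real x)"
    using to_FEF[OF \<phi>] by blast
  have P: "PsiM \<phi> = (f0, f1)" by (rule PsiM_eqI[OF f(2)])
  show "rel (fst (PsiM \<phi>)) (snd (PsiM \<phi>)) \<phi>" "PsiM \<phi> \<in> FEF q E0 Em1 \<rho> s \<sigma>"
    using P f by auto
  show "\<phi> x = snd (PsiM \<phi>) (of_real x) + fast_m1 q \<rho> s (snd (PsiM \<phi>)) (of_real x)" if "x \<in> D_m1 q" for x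
    using f(3)[OF that] P by simp
  have "glued f0 f1 = \<phi>"
  proof (rule C_omega_unique)
    show "glued f0 f1 \<in> C_omega" using from_FEF(1)[OF f(1)] by (simp add: SEF_iff)
    show "\<phi> \<in> C_omega" using \<phi>(1) by (simp add: SEF_iff)
  qed (use f in \<open>auto simp: glued_D_m1 glued_D_0 rel_def\<close>)
  then show "PhiM (PsiM \<phi>) = \<phi>" using P by (simp add: PhiM_def)
qed

lemma PhiM_props:
  assumes "f \<in> FEF q E0 Em1 \<rho> s \<sigma>"
  shows "PhiM f \<in> SEF_as q \<rho> s \<sigma>" "PsiM (PhiM f) = f"
proof -
  obtain f0 f1 where f: "f = (f0, f1)" by (cases f)
  note fr = from_FEF[OF assms[unfolded f]]
  show "PhiM f \<in> SEF_as q \<rho> s \<sigma>" unfolding SEF_as_eq using fr f by (simp add: PhiM_def)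
  show "PsiM (PhiM f) = f" using PsiM_eqI[OF fr(3)] f by (simp add: PhiM_def)
qed

lemma PsiM_add: "\<phi> \<in> SEF_as q \<rho> s \<sigma> \<Longrightarrow> \<psi> \<in> SEF_as q \<rho> s \<sigma> \<Longrightarrow> PsiM (\<phi> + \<psi>) = PsiM \<phi> + PsiM \<psi>"
  using PsiM_eqI[OF rel_add[OF PsiM_props(1) PsiM_props(1)]] by (simp add: plus_prod_def)

lemma PsiM_scale: "\<phi> \<in> SEF_as q \<rho> s \<sigma> \<Longrightarrow> PsiM (fun_scale k \<phi>) = pair_scale k (PsiM \<phi>)"
  using PsiM_eqI[OF rel_scale[OF PsiM_props(1)]] by (simp add: pair_scale_def)

lemma PsiM_image: "PsiM ` SEF_as q \<rho> s \<sigma> = FEF q E0 Em1 \<rho> s \<sigma>"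
proof
  show "FEF q E0 Em1 \<rho> s \<sigma> \<subseteq> PsiM ` SEF_as q \<rho> s \<sigma>"
  proof
    fix f assume "f \<in> FEF q E0 Em1 \<rho> s \<sigma>"
    then show "f \<in> PsiM ` SEF_as q \<rho> s \<sigma>" using PhiM_props by (metis imageI)
  qed
qed (use PsiM_props in auto)

lemma FEF_dec_iff:
  "(f0, f1) \<in> FEF_dec q E0 Em1 \<rho> s \<sigma> \<longleftrightarrow> (f0, f1) \<in> FEF q E0 Em1 \<rho> s \<sigma> \<and>
    (\<exists>F \<epsilon>. \<epsilon> > 0 \<and> smooth_on_open F {-\<epsilon><..<\<epsilon>} \<and>
       (\<forall>x\<in>{0<..<\<epsilon>}. F x = f1 (of_real x) + fast_m1 q \<rho> s f1 (of_real x)) \<and>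
       (\<forall>x\<in>{-\<epsilon><..<0}. F x = - \<sigma> *s (\<rho> J_elt *v (f1 (of_real (- x)) + fast_m1 q \<rho> s f1 (of_real (- x))))))"
  unfolding FEF_dec_def by (simp add: alpha_J)

lemma PsiM_dec:
  assumes "\<phi> \<in> SEF_dec q \<rho> s \<sigma>"
  shows "PsiM \<phi> \<in> FEF_dec q E0 Em1 \<rho> s \<sigma>"
proof -
  have as: "\<phi> \<in> SEF_as q \<rho> s \<sigma>" using SEF_dec_subset assms by blast
  obtain f0 f1 where P: "PsiM \<phi> = (f0, f1)" by (cases "PsiM \<phi>")
  note props = PsiM_props[OF as, unfolded P fst_conv snd_conv]
  obtain F where F: "smooth_on_open F {- (1 / ell q)<..<1 / ell q}" "\<forall>x\<in>{0<..<1 / ell q}. F x = \<phi> x"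
      "\<forall>x\<in>{- (1 / ell q)<..<0}. F x = - \<sigma> *s alpha_real \<rho> s J_elt \<phi> x"
    using assms unfolding SEF_dec_def mem_Collect_eq by (elim conjE exE)
  show ?thesis unfolding P FEF_dec_iff
  proof (intro conjI exI[of _ F] exI[of _ "1 / ell q"] ballI)
    show "(f0, f1) \<in> FEF q E0 Em1 \<rho> s \<sigma>" by (rule props)
    show "F x = f1 (of_real x) + fast_m1 q \<rho> s f1 (of_real x)" if "x \<in> {0<..<1 / ell q}" for x
      using F(2) props(4)[of x] that by (simp add: D_m1_def)
    show "F x = - \<sigma> *s (\<rho> J_elt *v (f1 (of_real (- x)) + fast_m1 q \<rho> s f1 (of_real (- x))))"
      if x: "x \<in> {- (1 / ell q)<..<0}" for x
    proof -
      have "- x \<in> D_m1 q" using x by (auto simp: D_m1_def)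
      then show ?thesis using F(3) x props(4)[of "- x"] by (simp add: alpha_real_J)
    qed
  qed (use F one_over_l in auto)
qed

text \<open>\<open>FEF_dec\<close> gives smoothness on some neighbourhood of 0 only, whereas
  \<open>SEF_dec\<close> asks for it on the full interval. Away from 0 it follows from the
  holomorphic extension of \<phi> to the slit plane and, on the left, from its reflection.\<close>

lemma PhiM_dec:
  assumes "f \<in> FEF_dec q E0 Em1 \<rho> s \<sigma>"
  shows "PhiM f \<in> SEF_dec q \<rho> s \<sigma>"
proof -
  obtain f0 f1 where f: "f = (f0, f1)" by (cases f)
  obtain F \<epsilon> where F0: "(f0, f1) \<in> FEF q E0 Em1 \<rho> s \<sigma>" and F: "\<epsilon> > 0" "smooth_on_open F {-\<epsilon><..<\<epsilon>}"
      "\<forall>x\<in>{0<..<\<epsilon>}. F x = f1 (of_real x) + fast_m1 q \<rho> s f1 (of_real x)"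
      "\<forall>x\<in>{-\<epsilon><..<0}. F x = - \<sigma> *s (\<rho> J_elt *v (f1 (of_real (- x)) + fast_m1 q \<rho> s f1 (of_real (- x))))"
    using assms unfolding f FEF_dec_iff by (elim conjE exE)
  define \<phi> where "\<phi> = PhiM f"
  have as: "\<phi> \<in> SEF_as q \<rho> s \<sigma>" unfolding \<phi>_def f by (rule PhiM_props[OF F0])
  then have \<phi>: "\<phi> \<in> SEF q \<rho> s \<sigma>" "polar_at_0 \<phi>" using SEF_as_eq by auto
  have \<phi>f: "\<phi> x = f1 (of_real x) + fast_m1 q \<rho> s f1 (of_real x)" if "0 < x" "x < 1 / \<l>" for x
    using that by (simp add: \<phi>_def f PhiM_def glued_def)
  obtain \<Psi> p b where \<Psi>: "vholomorphic_on \<Psi> slit" "\<And>z. z \<in> slit \<Longrightarrow> \<Psi> z = slw \<Psi> z"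
    "\<And>x. 0 < x \<Longrightarrow> x < 1 \<Longrightarrow> \<Psi> (of_real x) = \<phi> x" "admissible (rest \<Psi>) p b"
    "\<And>\<xi>. \<xi> \<in> slit \<Longrightarrow> Ks (rest \<Psi>) p b s \<xi> = ((2 * s - 1) * \<xi> powr (- 2 * s)) *s \<Psi> (1 / \<xi>)"
    by (rule SEF_continuation[OF \<phi>]) (rule that)
  define e where "e = min \<epsilon> (1 / \<l>)"
  have e: "e > 0" "e \<le> \<epsilon>" "e \<le> 1 / \<l>" using F(1) one_over_l by (auto simp: e_def)
  \<comment> \<open>Near 0, including 0 itself, the smooth function F is kept; elsewhere \<phi> and
    its reflected version take over, with which F agrees off 0.\<close>
  define G where "G x = (if \<bar>x\<bar> < e then F x else if x > 0 then \<phi> x else - \<sigma> *s (\<rho> J_elt *v \<phi> (- x)))" for x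
  have Gpos: "G x = \<phi> x" if "0 < x" "x < 1 / \<l>" for x
    using that F(3) \<phi>f e by (auto simp: G_def)
  have Gneg: "G x = - \<sigma> *s (\<rho> J_elt *v \<phi> (- x))" if "- (1 / \<l>) < x" "x < 0" for x
    using that F(4) \<phi>f[of "- x"] e by (auto simp: G_def)
  have sm_pos: "smooth_on_open (\<lambda>x. \<Psi> (of_real x)) {0<..<1}"
    by (rule vholomorphic_imp_smooth[OF \<Psi>(1) open_slit]) (auto simp: slit_iff)
  have sm_neg: "smooth_on_open (\<lambda>x. - \<sigma> *s (\<rho> J_elt *v \<Psi> (- of_real x))) {-1<..<0}"
  proof (rule vholomorphic_imp_smooth)
    show "open (uminus -` slit)" by (intro open_vimage open_slit continuous_intros)
    show "vholomorphic_on (\<lambda>z. - \<sigma> *s (\<rho> J_elt *v \<Psi> (- z))) (uminus -` slit)"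
      by (intro vholomorphic_on_smult vholomorphic_on_matrix vholomorphic_on_compose[OF \<Psi>(1)] holomorphic_intros) auto
  qed (auto simp: slit_iff)
  have "smooth_on_open G {- (1 / ell q)<..<1 / ell q}"
  proof (rule smooth_on_open_local)
    fix x assume x: "x \<in> {- (1 / ell q)<..<1 / ell q}"
    consider "\<bar>x\<bar> < e" | "x > 0" | "x < 0" using e(1) by linarith
    then show "\<exists>V g. open V \<and> x \<in> V \<and> smooth_on_open g V \<and> (\<forall>y\<in>V. G y = g y)"
    proof cases
      case 1
      have "smooth_on_open F {-e<..<e}" by (rule smooth_on_open_subset[OF F(2)]) (use e in auto)
      then show ?thesis using 1
        by (intro exI[of _ "{-e<..<e}"] exI[of _ F]) (auto simp: G_def abs_less_iff)
    next
      case 2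
      have "smooth_on_open (\<lambda>x. \<Psi> (of_real x)) {0<..<1 / \<l>}"
        by (rule smooth_on_open_subset[OF sm_pos])
          (use one_over_l(2) in \<open>unfold greaterThanLessThan_subseteq_greaterThanLessThan, linarith\<close>)
      moreover have "G y = \<Psi> (of_real y)" if y: "y \<in> {0<..<1 / \<l>}" for y
      proof -
        have "y < 1" using y one_over_l(2) unfolding greaterThanLessThan_iff by linarith
        then show ?thesis using Gpos[of y] \<Psi>(3)[of y] y by simp
      qed
      ultimately show ?thesis using 2 x
        by (intro exI[of _ "{0<..<1 / \<l>}"] exI[of _ "\<lambda>x. \<Psi> (of_real x)"]) auto
    next
      case 3
      have "smooth_on_open (\<lambda>x. - \<sigma> *s (\<rho> J_elt *v \<Psi> (- of_real x))) {- (1 / \<l>)<..<0}"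
        by (rule smooth_on_open_subset[OF sm_neg])
          (use one_over_l(2) in \<open>unfold greaterThanLessThan_subseteq_greaterThanLessThan, linarith\<close>)
      moreover have "G y = - \<sigma> *s (\<rho> J_elt *v \<Psi> (- of_real y))" if y: "y \<in> {- (1 / \<l>)<..<0}" for y
      proof -
        have "0 < - y" "- y < 1" using y one_over_l(2) unfolding greaterThanLessThan_iff by linarith+
        then show ?thesis using Gneg[of y] \<Psi>(3)[of "- y"] y by simp
      qed
      ultimately show ?thesis using 3 x
        by (intro exI[of _ "{- (1 / \<l>)<..<0}"] exI[of _ "\<lambda>x. - \<sigma> *s (\<rho> J_elt *v \<Psi> (- of_real x))"]) auto
    qed
  qed
  then have "\<phi> \<in> SEF_dec q \<rho> s \<sigma>" unfolding SEF_dec_def mem_Collect_eq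
    using \<phi>(1) Gpos Gneg by (intro conjI exI[of _ G]) (auto simp: alpha_real_J)
  then show ?thesis by (simp add: \<phi>_def)
qed

lemma PsiM_image_dec: "PsiM ` SEF_dec q \<rho> s \<sigma> = FEF_dec q E0 Em1 \<rho> s \<sigma>"
proof
  show "FEF_dec q E0 Em1 \<rho> s \<sigma> \<subseteq> PsiM ` SEF_dec q \<rho> s \<sigma>"
  proof
    fix f assume f: "f \<in> FEF_dec q E0 Em1 \<rho> s \<sigma>"
    then have "f \<in> FEF q E0 Em1 \<rho> s \<sigma>" by (auto simp: FEF_dec_def)
    then show "f \<in> PsiM ` SEF_dec q \<rho> s \<sigma>" using PhiM_props(2) PhiM_dec[OF f] by (metis imageI)
  qed
qed (use PsiM_dec in auto)

lemmas isos = linear_iso_pair[OF module_fun_scale module_pair_scale subspace_SEF_as PsiM_add PsiM_scale PsiM_image PsiM_props(3)]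

lemmas isos_dec = linear_iso_pair[OF module_fun_scale module_pair_scale subspace_SEF_dec
  PsiM_add[OF subsetD[OF SEF_dec_subset] subsetD[OF SEF_dec_subset]] PsiM_scale[OF subsetD[OF SEF_dec_subset]]
  PsiM_image_dec PsiM_props(3)[OF subsetD[OF SEF_dec_subset]]]

text \<open>Membership in \<open>C_omega\<close> settles the values that the two formulas leave
  open: those at 1 / l and outside the unit interval.\<close>

lemma PhiM_iff:
  assumes F: "(f0, f1) \<in> FEF q E0 Em1 \<rho> s \<sigma>"
  shows "\<phi> = PhiM (f0, f1) \<longleftrightarrow> \<phi> \<in> C_omega \<and> (\<forall>x \<in> D_0 q. \<phi> x = f0 (of_real x)) \<and>
          (\<forall>x \<in> D_m1 q. \<phi> x = f1 (of_real x) + fast_m1 q \<rho> s f1 (of_real x))"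
proof -
  have C: "glued f0 f1 \<in> C_omega" using from_FEF(1)[OF F] by (simp add: SEF_iff)
  then show ?thesis
    using C_omega_unique[OF _ C, of \<phi>] by (auto simp: PhiM_def glued_D_0 glued_D_m1)
qed

lemma PsiM_iff:
  assumes "\<phi> \<in> SEF_as q \<rho> s \<sigma>"
  shows "(f0, f1) = PsiM \<phi> \<longleftrightarrow> rel f0 f1 \<phi>"
  using PsiM_eqI[of f0 f1 \<phi>] PsiM_props(1)[OF assms] by (metis fst_conv snd_conv)

end

theorem theorem3p5:
  fixes q :: nat and s \<sigma> :: complex
    and \<rho> :: "(real^2^2) set \<Rightarrow> complex^'n^'n"
    and E0 Em1 :: "complex set"
  assumes "q \<ge> 3" and "odd q"
    and "\<rho> \<in> hom (Gamma_tilde q) unitary_group"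
    and "Re s > 0" and "s \<noteq> 1/2"
    and "\<sigma> = 1 \<or> \<sigma> = -1"
    and "fast_nbhds q E0 Em1"
  shows "\<exists>\<Phi> \<Psi>.
    linear_iso_on pair_scale fun_scale (FEF q E0 Em1 \<rho> s \<sigma>) (SEF_as q \<rho> s \<sigma>) \<Phi> \<and>
    linear_iso_on fun_scale pair_scale (SEF_as q \<rho> s \<sigma>) (FEF q E0 Em1 \<rho> s \<sigma>) \<Psi> \<and>
    (\<forall>f \<in> FEF q E0 Em1 \<rho> s \<sigma>. \<Psi> (\<Phi> f) = f) \<and>
    (\<forall>\<phi> \<in> SEF_as q \<rho> s \<sigma>. \<Phi> (\<Psi> \<phi>) = \<phi>) \<and>
    (\<forall>f0 fm1 \<phi>. (f0, fm1) \<in> FEF q E0 Em1 \<rho> s \<sigma> \<longrightarrow>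
       (\<phi> = \<Phi> (f0, fm1) \<longleftrightarrow> \<phi> \<in> C_omega \<and>
          (\<forall>x \<in> D_0 q. \<phi> x = f0 (of_real x)) \<and>
          (\<forall>x \<in> D_m1 q. \<phi> x = fm1 (of_real x) + fast_m1 q \<rho> s fm1 (of_real x)))) \<and>
    (\<forall>\<phi> f0 fm1. \<phi> \<in> SEF_as q \<rho> s \<sigma> \<longrightarrow>
       ((f0, fm1) = \<Psi> \<phi> \<longleftrightarrow> f0 \<in> B_space E0 \<and> fm1 \<in> B_space Em1 \<and>
          (\<forall>x \<in> D_0 q. f0 (of_real x) = \<phi> x) \<and>
          (\<forall>x \<in> D_m1 q. fm1 (of_real x) = \<phi> x - alpha_real \<rho> s (g_elt q (-1)) \<phi> x))) \<and>
    linear_iso_on pair_scale fun_scale (FEF_dec q E0 Em1 \<rho> s \<sigma>) (SEF_dec q \<rho> s \<sigma>) \<Phi> \<and>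
    linear_iso_on fun_scale pair_scale (SEF_dec q \<rho> s \<sigma>) (FEF_dec q E0 Em1 \<rho> s \<sigma>) \<Psi>"
proof -
  interpret hecke_nbhds q \<rho> s \<sigma> E0 Em1
    using assms by unfold_locales
  show ?thesis
    by (intro exI[of _ PhiM] exI[of _ PsiM] conjI ballI allI impI isos isos_dec PhiM_props(2) PsiM_props(3)
        PhiM_iff PsiM_iff[unfolded rel_def])
qed

end
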